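(* There is an $(\mathcal{H}^F,d_{\mathcal{H}^F})$-valued random variable $\bar{\mathcal{W}}^F$ whose distribution is uniquely determined by the following properties (that is, a random variable with these properties exists, and any two such random variables have the same distribution). (a) Almost surely the paths of $\bar{\mathcal{W}}^F$ are noncrossing (although they may touch, including coalescing and bifurcating). (b$_1$) From any deterministic point $(x,t)\in\mathbb{R}^2$, there is almost surely a unique path $W_{x,t}^F$ in $\bar{\mathcal{W}}^F$ passing through $x$ at time $t$. (b$_2$) For any deterministic $n$ and $\{(x_1,t_1),\ldots,(x_n,t_n)\}\subset\mathbb{R}^2$, the joint distribution of the semipaths $\{W_{x_j,t_j}^F(t),\ t\ge t_j,\ j=1,\ldots,n\}$ is that of coalescing Brownian motions (with unit diffusion constant).
   Context: Put $\Phi(x,t)=\tanh(x)/(1+|t|)$ for $(x,t)\in[-\infty,\infty]^2$ (so $\Phi(x,\pm\infty)=0$). $\Pi^F$ is the set of functions $f:[-\infty,\infty]\to[-\infty,\infty]$ such that $t\mapsto\Phi(f(t),t)$ is continuous (functions differing only at $t=\pm\infty$ are identified), with metric $d^F(f_1,f_2)=\sup_{-\infty\le t\le\infty}|\Phi(f_1(t),t)-\Phi(f_2(t),t)|$; elements are identified with their space-time paths $\{(f(s),s)\}$. $\mathcal{H}^F$ is the set of compact subsets of $(\Pi^F,d^F)$, with the induced Hausdorff metric $d_{\mathcal{H}^F}$ and its Borel $\sigma$-algebra. Two paths $f,g$ cross if there are times $s,t$ with $f(s)>g(s)$ and $f(t)<g(t)$; a collection is noncrossing if no two of its paths cross. Coalescing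 Brownian motions started at $(x_1,t_1),\ldots,(x_n,t_n)$ are Brownian motions, the $j$-th starting from $x_j$ at time $t_j$, evolving independently until two of them meet, after which those two coincide forever. *)

theory Defs
  imports "HOL-Probability.Probability"
begin

definition tanh_ereal :: "ereal \<Rightarrow> real" where
  "tanh_ereal x = (case x of ereal r \<Rightarrow> tanh r | PInfty \<Rightarrow> 1 | MInfty \<Rightarrow> -1)"

definition \<Phi> :: "ereal \<Rightarrow> ereal \<Rightarrow> real" where
  "\<Phi> x t = (case t of ereal s \<Rightarrow> tanh_ereal x / (1 + \<bar>s\<bar>) | PInfty \<Rightarrow> 0 | MInfty \<Rightarrow> 0)"

lemma tanh_ereal_simps [simp]:
  "tanh_ereal (ereal r) = tanh r" "tanh_ereal \<infinity> = 1" "tanh_ereal (-\<infinity>) = -1"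
  unfolding tanh_ereal_def by simp_all

lemma \<Phi>_simps [simp]:
  "\<Phi> x (ereal s) = tanh_ereal x / (1 + \<bar>s\<bar>)" "\<Phi> x \<infinity> = 0" "\<Phi> x (-\<infinity>) = 0"
  unfolding \<Phi>_def by simp_all

definition is_path :: "(ereal \<Rightarrow> ereal) \<Rightarrow> bool" where
  "is_path f \<longleftrightarrow> continuous_on UNIV (\<lambda>t. \<Phi> (f t) t)"

definition path_eq :: "(ereal \<Rightarrow> ereal) \<Rightarrow> (ereal \<Rightarrow> ereal) \<Rightarrow> bool" where
  "path_eq f g \<longleftrightarrow> is_path f \<and> is_path g \<and> (\<forall>t. \<bar>t\<bar> \<noteq> \<infinity> \<longrightarrow> f t = g t)"

lemma is_path_zero: "is_path (\<lambda>_. 0)"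
proof -
  have "tanh_ereal 0 = 0"
    using tanh_ereal_simps(1)[of 0] by (simp flip: zero_ereal_def)
  then have "\<Phi> 0 t = 0" for t
    by (cases t) auto
  then show ?thesis by (simp add: is_path_def)
qed

quotient_type fpath = "ereal \<Rightarrow> ereal" / partial: path_eq
proof (rule part_equivpI)
  show "\<exists>f. path_eq f f"
    using is_path_zero by (auto simp: path_eq_def)
  show "symp path_eq"
    by (auto simp: symp_def path_eq_def)
  show "transp path_eq"
    by (auto simp: transp_def path_eq_def)
qed

text \<open>The position of a path is well defined at finite times only.\<close>

lift_definition at_time :: "fpath \<Rightarrow> real \<Rightarrow> ereal" is "\<lambda>f t. f (ereal t)"
  by (auto simp: path_eq_def)

lemma \<Phi>_cong: "path_eq f g \<Longrightarrow> \<Phi> (f t) t = \<Phi> (g t) t"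
  by (cases t) (auto simp: path_eq_def)

lemma abs_tanh_ereal_le: "\<bar>tanh_ereal x\<bar> \<le> 1"
proof (cases x)
  case (real r)
  then show ?thesis
    using tanh_real_lt_1[of r] tanh_real_gt_neg1[of r] by (simp add: abs_le_iff)
qed auto

lemma abs_\<Phi>_le: "\<bar>\<Phi> x t\<bar> \<le> 1"
  using abs_tanh_ereal_le[of x] by (cases t) (auto simp: abs_divide divide_le_eq_1)

lemma abs_\<Phi>_diff_le: "\<bar>\<Phi> x t - \<Phi> y t\<bar> \<le> 2"
  using abs_\<Phi>_le[of x t] abs_\<Phi>_le[of y t] by linarith

lemma bdd_above_\<Phi>_diff: "bdd_above (range (\<lambda>t. \<bar>\<Phi> (f t) t - \<Phi> (g t) t\<bar>))"
  using abs_\<Phi>_diff_le by (auto intro!: bdd_aboveI[where M = 2])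

lemma tanh_ereal_inject: "tanh_ereal x = tanh_ereal y \<longleftrightarrow> x = y"
proof -
  have "tanh r \<noteq> 1" "tanh r \<noteq> -1" "1 \<noteq> tanh r" "-1 \<noteq> tanh r" for r :: real
    using tanh_real_lt_1[of r] tanh_real_gt_neg1[of r] by auto
  then show ?thesis by (cases x; cases y) auto
qed

lemma \<Phi>_inject: "\<Phi> x (ereal t) = \<Phi> y (ereal t) \<longleftrightarrow> x = y"
proof -
  have "1 + \<bar>t\<bar> \<noteq> 0" by linarith
  then show ?thesis by (simp add: tanh_ereal_inject)
qed

instantiation fpath :: metric_space
begin

lift_definition dist_fpath :: "fpath \<Rightarrow> fpath \<Rightarrow> real"
  is "\<lambda>f g. SUP t. \<bar>\<Phi> (f t) t - \<Phi> (g t) t\<bar>"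
  using \<Phi>_cong by (metis (mono_tags, lifting))

definition uniformity_fpath :: "(fpath \<times> fpath) filter" where
  "uniformity_fpath = (INF e\<in>{0<..}. principal {(x, y). dist x y < e})"

definition open_fpath :: "fpath set \<Rightarrow> bool" where
  "open_fpath U \<longleftrightarrow> (\<forall>x\<in>U. \<forall>\<^sub>F (x', y) in uniformity. x' = x \<longrightarrow> y \<in> U)"

instance
proof
  show "uniformity = (INF e\<in>{0<..}. principal {(x :: fpath, y). dist x y < e})"
    by (rule uniformity_fpath_def)
  show "open U = (\<forall>x\<in>U. \<forall>\<^sub>F (x', y) in uniformity. x' = x \<longrightarrow> y \<in> U)" for U :: "fpath set"
    by (rule open_fpath_def)
  show "dist x y = 0 \<longleftrightarrow> x = y" for x y :: fpath
  proof (transfer, safe)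
    fix f g assume p: "path_eq f f" "path_eq g g"
      and 0: "(SUP t. \<bar>\<Phi> (f t) t - \<Phi> (g t) t\<bar>) = 0"
    have "\<bar>\<Phi> (f t) t - \<Phi> (g t) t\<bar> \<le> 0" for t
      unfolding 0[symmetric] by (rule cSUP_upper[OF UNIV_I bdd_above_\<Phi>_diff])
    then have eq: "\<Phi> (f t) t = \<Phi> (g t) t" for t
      by (metis abs_le_zero_iff right_minus_eq)
    have "f t = g t" if "\<bar>t\<bar> \<noteq> \<infinity>" for t
      using that eq[of t] \<Phi>_inject by (cases t) (auto simp del: \<Phi>_simps)
    with p show "path_eq f g"
      by (auto simp: path_eq_def)
  next
    fix f g assume "path_eq f g"
    then show "(SUP t. \<bar>\<Phi> (f t) t - \<Phi> (g t) t\<bar>) = 0"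
      by (simp add: \<Phi>_cong)
  qed
  show "dist x y \<le> dist x z + dist y z" for x y z :: fpath
  proof transfer
    fix f g h :: "ereal \<Rightarrow> ereal"
    show "(SUP t. \<bar>\<Phi> (f t) t - \<Phi> (g t) t\<bar>)
      \<le> (SUP t. \<bar>\<Phi> (f t) t - \<Phi> (h t) t\<bar>) + (SUP t. \<bar>\<Phi> (g t) t - \<Phi> (h t) t\<bar>)"
    proof (rule cSUP_least, simp)
      fix t
      have "\<bar>\<Phi> (f t) t - \<Phi> (h t) t\<bar> \<le> (SUP t. \<bar>\<Phi> (f t) t - \<Phi> (h t) t\<bar>)"
        "\<bar>\<Phi> (g t) t - \<Phi> (h t) t\<bar> \<le> (SUP t. \<bar>\<Phi> (g t) t - \<Phi> (h t) t\<bar>)"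
        by (rule cSUP_upper[OF UNIV_I bdd_above_\<Phi>_diff])+
      then show "\<bar>\<Phi> (f t) t - \<Phi> (g t) t\<bar> \<le> (SUP t. \<bar>\<Phi> (f t) t - \<Phi> (h t) t\<bar>)
          + (SUP t. \<bar>\<Phi> (g t) t - \<Phi> (h t) t\<bar>)"
        by linarith
    qed
  qed
qed

end

lemma dist_fpath_le: "dist (x :: fpath) y \<le> 2"
  by transfer (rule cSUP_least, auto intro: abs_\<Phi>_diff_le)

typedef compact_paths = "{K :: fpath set. compact K}"
  morphisms paths_of Abs_compact_paths
  by (rule exI[of _ "{}"]) simp

setup_lifting type_definition_compact_paths

text \<open>The distance of the empty set to any other compact set is put equal to 2, a bound for the
  diameter of the path space; so the empty set is an isolated point.\<close>

definition hausdorff_dist :: "fpath set \<Rightarrow> fpath set \<Rightarrow> real" where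
  "hausdorff_dist A B =
    (if A = {} \<and> B = {} then 0
     else if A = {} \<or> B = {} then 2
     else max (SUP f\<in>A. INF g\<in>B. dist f g) (SUP g\<in>B. INF f\<in>A. dist f g))"

lemma hausdorff_dist_le_iff:
  assumes "A \<noteq> {}" "B \<noteq> {}"
  shows "hausdorff_dist A B \<le> r \<longleftrightarrow> (\<forall>f\<in>A. infdist f B \<le> r) \<and> (\<forall>g\<in>B. infdist g A \<le> r)"
proof -
  have le2: "infdist x S \<le> 2" for x :: fpath and S
    by (cases "S = {}") (auto simp: infdist_def intro: cINF_lower2 dist_fpath_le bdd_belowI2[where m = 0])
  have *: "(SUP f\<in>S. infdist f T) \<le> r \<longleftrightarrow> (\<forall>f\<in>S. infdist f T \<le> r)"
    if "S \<noteq> {}" for S T :: "fpath set"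
    using that le2 by (intro cSUP_le_iff bdd_aboveI2[where M = 2]) auto
  have "hausdorff_dist A B = max (SUP f\<in>A. infdist f B) (SUP g\<in>B. infdist g A)"
    using assms by (simp add: hausdorff_dist_def infdist_def dist_commute)
  then show ?thesis using assms by (simp add: *)
qed

lemma infdist_le_hausdorff_dist:
  assumes "f \<in> A" "B \<noteq> {}"
  shows "infdist f B \<le> hausdorff_dist A B" "infdist f B \<le> hausdorff_dist B A"
  using assms hausdorff_dist_le_iff[of A B "hausdorff_dist A B"]
    hausdorff_dist_le_iff[of B A "hausdorff_dist B A"] by auto

lemma hausdorff_dist_nonneg: "0 \<le> hausdorff_dist A B"
proof (cases "A = {} \<or> B = {}")
  case False
  then obtain f where "f \<in> A" by auto
  then show ?thesis
    using False infdist_le_hausdorff_dist(1)[of f A B] infdist_nonneg[of f B] by auto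
qed (auto simp: hausdorff_dist_def)

lemma hausdorff_dist_le_2: "hausdorff_dist A B \<le> 2"
proof (cases "A = {} \<or> B = {}")
  case False
  have "infdist x S \<le> 2" if "S \<noteq> {}" for x :: fpath and S
    using that infdist_le2[OF _ dist_fpath_le] by auto
  then show ?thesis using False by (simp add: hausdorff_dist_le_iff)
qed (auto simp: hausdorff_dist_def)

lemma infdist_triangle_hausdorff:
  assumes "C \<noteq> {}" "f \<in> A" "B \<noteq> {}"
  shows "infdist f B \<le> hausdorff_dist A C + hausdorff_dist B C"
proof -
  have "infdist f B - hausdorff_dist B C \<le> dist f h" if "h \<in> C" for h
    using infdist_triangle[of f B h] infdist_le_hausdorff_dist(2)[OF that assms(3)] by linarith
  then have "infdist f B - hausdorff_dist B C \<le> infdist f C"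
    unfolding infdist_notempty[OF assms(1)] by (rule cINF_greatest[OF assms(1)])
  also have "\<dots> \<le> hausdorff_dist A C"
    using infdist_le_hausdorff_dist(1)[OF assms(2,1)] .
  finally show ?thesis by simp
qed

instantiation compact_paths :: metric_space
begin

lift_definition dist_compact_paths :: "compact_paths \<Rightarrow> compact_paths \<Rightarrow> real"
  is hausdorff_dist .

definition uniformity_compact_paths :: "(compact_paths \<times> compact_paths) filter" where
  "uniformity_compact_paths = (INF e\<in>{0<..}. principal {(x, y). dist x y < e})"

definition open_compact_paths :: "compact_paths set \<Rightarrow> bool" where
  "open_compact_paths U \<longleftrightarrow> (\<forall>x\<in>U. \<forall>\<^sub>F (x', y) in uniformity. x' = x \<longrightarrow> y \<in> U)"

instance
proof
  show "uniformity = (INF e\<in>{0<..}. principal {(x :: compact_paths, y). dist x y < e})"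
    by (rule uniformity_compact_paths_def)
  show "open U = (\<forall>x\<in>U. \<forall>\<^sub>F (x', y) in uniformity. x' = x \<longrightarrow> y \<in> U)"
    for U :: "compact_paths set"
    by (rule open_compact_paths_def)
  show "dist x y = 0 \<longleftrightarrow> x = y" for x y :: compact_paths
  proof transfer
    fix A B :: "fpath set"
    assume c: "compact A" "compact B"
    show "hausdorff_dist A B = 0 \<longleftrightarrow> A = B"
    proof (cases "A = {} \<or> B = {}")
      case False
      have "hausdorff_dist A B = 0 \<longleftrightarrow> hausdorff_dist A B \<le> 0"
        using hausdorff_dist_nonneg[of A B] by auto
      also have "\<dots> \<longleftrightarrow> (\<forall>f\<in>A. infdist f B = 0) \<and> (\<forall>g\<in>B. infdist g A = 0)"
        using False by (simp add: hausdorff_dist_le_iff order_antisym_conv[OF infdist_nonneg])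
      also have "\<dots> \<longleftrightarrow> (\<forall>f\<in>A. f \<in> B) \<and> (\<forall>g\<in>B. g \<in> A)"
        using False c by (simp add: in_closed_iff_infdist_zero compact_imp_closed)
      finally show ?thesis by auto
    qed (auto simp: hausdorff_dist_def)
  qed
  show "dist x y \<le> dist x z + dist y z" for x y z :: compact_paths
  proof transfer
    fix A B C :: "fpath set"
    assume c: "compact A" "compact B" "compact C"
    show "hausdorff_dist A B \<le> hausdorff_dist A C + hausdorff_dist B C"
    proof (cases "A = {} \<or> B = {} \<or> C = {}")
      case True
      then show ?thesis
        using hausdorff_dist_nonneg[of A C] hausdorff_dist_nonneg[of B C]
          hausdorff_dist_le_2[of A B]
        by (auto simp: hausdorff_dist_def[of "{}"] hausdorff_dist_def[of _ "{}"]
            split: if_splits)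
    next
      case False
      then show ?thesis
        using infdist_triangle_hausdorff[of C _ A B] infdist_triangle_hausdorff[of C _ B A]
        by (simp add: hausdorff_dist_le_iff add.commute)
    qed
  qed
qed

end

definition brownian_motion_from ::
  "'a measure \<Rightarrow> real \<Rightarrow> real \<Rightarrow> (real \<Rightarrow> 'a \<Rightarrow> real) \<Rightarrow> bool" where
  "brownian_motion_from M x t\<^sub>0 B \<longleftrightarrow>
     prob_space M
   \<and> (\<forall>t\<ge>t\<^sub>0. B t \<in> borel_measurable M)
   \<and> (\<forall>\<omega>\<in>space M. B t\<^sub>0 \<omega> = x \<and> continuous_on {t\<^sub>0..} (\<lambda>t. B t \<omega>))
   \<and> (\<forall>s t. t\<^sub>0 \<le> s \<and> s < t \<longrightarrow>
        distributed M lborel (\<lambda>\<omega>. B t \<omega> - B s \<omega>) (normal_density 0 (sqrt (t - s))))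
   \<and> (\<forall>(k::nat) u. t\<^sub>0 \<le> u 0 \<and> (\<forall>i<k. u i \<le> u (Suc i)) \<longrightarrow>
        prob_space.indep_vars M (\<lambda>_. borel) (\<lambda>i \<omega>. B (u (Suc i)) \<omega> - B (u i) \<omega>) {..<k})"

definition independent_brownian_motions ::
  "'a measure \<Rightarrow> nat \<Rightarrow> (nat \<Rightarrow> real) \<Rightarrow> (nat \<Rightarrow> real) \<Rightarrow> (nat \<Rightarrow> real \<Rightarrow> 'a \<Rightarrow> real) \<Rightarrow> bool" where
  "independent_brownian_motions M n x t B \<longleftrightarrow>
     prob_space M
   \<and> (\<forall>j<n. brownian_motion_from M (x j) (t j) (B j))
   \<and> prob_space.indep_vars M (\<lambda>j. Pi\<^sub>M {t j..} (\<lambda>_. borel))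
       (\<lambda>j \<omega>. \<lambda>s\<in>{t j..}. B j s \<omega>) {..<n}"

definition met_by :: "(nat \<Rightarrow> real) \<Rightarrow> (nat \<Rightarrow> real \<Rightarrow> real) \<Rightarrow> nat \<Rightarrow> nat \<Rightarrow> real \<Rightarrow> bool" where
  "met_by t y i j s \<longleftrightarrow> (\<exists>u. t i \<le> u \<and> t j \<le> u \<and> u \<le> s \<and> y i u = y j u)"

text \<open>Each \<open>Y j\<close> is driven by its own Brownian motion \<open>B j\<close>, the \<open>B j\<close> being independent, until it
  meets some \<open>Y i\<close> with \<open>i < j\<close>; from then on \<open>Y i\<close> and \<open>Y j\<close> coincide. After a meeting the common path is driven
  by the Brownian motion of the smallest index involved; by the strong Markov property the joint law
  does not depend on this convention. Given the \<open>B j\<close>, the conditions determine \<open>Y j\<close> on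
  \<open>[t j, \<infinity>)\<close>, by induction on \<open>j\<close>.\<close>

definition coalescing_brownian_motions ::
  "'a measure \<Rightarrow> nat \<Rightarrow> (nat \<Rightarrow> real) \<Rightarrow> (nat \<Rightarrow> real) \<Rightarrow> (nat \<Rightarrow> real \<Rightarrow> 'a \<Rightarrow> real) \<Rightarrow> bool" where
  "coalescing_brownian_motions M n x t Y \<longleftrightarrow>
     (\<exists>B. independent_brownian_motions M n x t B \<and>
       (\<forall>\<omega>\<in>space M. \<forall>j<n.
          Y j (t j) \<omega> = x j
        \<and> continuous_on {t j..} (\<lambda>s. Y j s \<omega>)
        \<and> (\<forall>s\<ge>t j. (\<forall>i<j. \<not> met_by t (\<lambda>i u. Y i u \<omega>) i j s) \<longrightarrow> Y j s \<omega> = B j s \<omega>)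
        \<and> (\<forall>i<j. \<forall>s\<ge>t j. met_by t (\<lambda>i u. Y i u \<omega>) i j s \<longrightarrow> Y j s \<omega> = Y i s \<omega>)))"

definition semipath_law ::
  "'a measure \<Rightarrow> nat \<Rightarrow> (nat \<Rightarrow> real) \<Rightarrow> (nat \<Rightarrow> real \<Rightarrow> 'a \<Rightarrow> ereal) \<Rightarrow> (nat \<times> real \<Rightarrow> ereal) measure"
  where
  "semipath_law M n t Y =
     distr M (Pi\<^sub>M (SIGMA j:{..<n}. {t j..}) (\<lambda>_. borel))
       (\<lambda>\<omega>. \<lambda>(j, s)\<in>(SIGMA j:{..<n}. {t j..}). Y j s \<omega>)"

text \<open>The sample space on which the coalescing Brownian motions live is immaterial, but its type has
  to be fixed; \<open>nat \<Rightarrow> real \<Rightarrow> real\<close> is that of sequences of paths.\<close>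

definition is_coalescing_brownian_law ::
  "nat \<Rightarrow> (nat \<Rightarrow> real) \<Rightarrow> (nat \<Rightarrow> real) \<Rightarrow> (nat \<times> real \<Rightarrow> ereal) measure \<Rightarrow> bool" where
  "is_coalescing_brownian_law n x t L \<longleftrightarrow>
     (\<exists>(M :: (nat \<Rightarrow> real \<Rightarrow> real) measure) Y.
        coalescing_brownian_motions M n x t Y \<and>
        L = semipath_law M n t (\<lambda>j s \<omega>. ereal (Y j s \<omega>)))"

definition cross :: "fpath \<Rightarrow> fpath \<Rightarrow> bool" where
  "cross f g \<longleftrightarrow> (\<exists>s t. at_time f s > at_time g s \<and> at_time f t < at_time g t)"

definition noncrossing :: "fpath set \<Rightarrow> bool" where
  "noncrossing K \<longleftrightarrow> (\<forall>f\<in>K. \<forall>g\<in>K. \<not> cross f g)"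

definition passes :: "fpath \<Rightarrow> real \<Rightarrow> real \<Rightarrow> bool" where
  "passes f x t \<longleftrightarrow> at_time f t = ereal x"

text \<open>The explicit constant fallback matters: \<open>THE\<close> alone may pick different values for different
  sets \<open>K\<close> without a unique path, and \<open>K \<mapsto> path_through K x t\<close> could not be shown measurable.\<close>

definition path_through :: "fpath set \<Rightarrow> real \<Rightarrow> real \<Rightarrow> fpath" where
  "path_through K x t =
     (if \<exists>!f. f \<in> K \<and> passes f x t then THE f. f \<in> K \<and> passes f x t else undefined)"

definition full_brownian_web :: "'a measure \<Rightarrow> ('a \<Rightarrow> compact_paths) \<Rightarrow> bool" where
  "full_brownian_web M W \<longleftrightarrow>
     prob_space M
   \<and> W \<in> borel_measurable M
   \<and> (AE \<omega> in M. noncrossing (paths_of (W \<omega>)))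
   \<and> (\<forall>x t. AE \<omega> in M. \<exists>!f. f \<in> paths_of (W \<omega>) \<and> passes f x t)
   \<and> (\<forall>n x t. is_coalescing_brownian_law n x t
        (semipath_law M n t (\<lambda>j s \<omega>. at_time (path_through (paths_of (W \<omega>)) (x j) (t j)) s)))"

end

theory Submission
 imports Defs "HOL-Complex_Analysis.Great_Picard"
begin

text \<open>Coalescing Brownian motions are obtained by glueing each path to those of smaller index at the
 first meeting. Interchanging the two driving motions at a meeting time shows that the law does not
 depend on the order of priority; hence subfamilies are consistent, and one sequence of coalescing
 Brownian motions can be started from all rational points of space-time. Almost surely this skeleton
 is locally finite after any positive time. The web consists of all paths that cross no path of the
 skeleton. Almost surely it is also the closure of the countable set of web paths through the rational points,
 and it is compact. A web in the sense of (a), (b) lies between these two sets, so it is almost surely a measurable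
 function of its own skeleton, whose law is prescribed.\<close>

text \<open>\<open>semipath_law\<close> takes laws of maps that no hypothesis declares measurable,
  and this shapes both halves of the proof. For uniqueness, the prescribed law is a probability
  measure, and this alone forces the semipaths through rational points to be measurable. For
  existence, the web lives on the largest sigma-algebra that the construction makes measurable over
  the completed Wiener space, so that almost sure identities suffice.

  All probability enters through two estimates. Fourth moments of Gaussian variables control
  fluctuations. The interchange of two motions, applied to their gap, gives the reflection
  principle: two motions at distance \<open>a\<close> have not met after time \<open>h\<close> with
  probability at most \<open>a / sqrt h\<close>. That this bound is linear in \<open>a\<close> makes
  the expected number of distinct images telescope. The rest is deterministic: \<open>good\<close>
  collects countably many conditions at rational points, and compactness and the equality of the two
  descriptions of the web follow from it without further randomness.\<close>

type_synonym paths = "nat \<Rightarrow> real \<Rightarrow> real"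

section \<open>The standard Gaussian measure and its invariance under rotation\<close>

definition stdn :: "real measure" where
 "stdn = density lborel std_normal_density"

lemma sets_stdn [simp, measurable_cong]: "sets stdn = sets borel"
 by (simp add: stdn_def)

lemma space_stdn [simp]: "space stdn = UNIV"
 by (simp add: stdn_def)

lemma prob_space_stdn: "prob_space stdn"
 unfolding stdn_def by (rule prob_space_normal_density) simp

text \<open>The product density depends only on the sum of the squares. The first argument is
  \<open>(u + v) / sqrt 2\<close>, written in the shape that the substitutions in
  \<open>stdn_pair_rotate\<close> produce.\<close>

lemma std_normal_density_rotate:
 "std_normal_density (sqrt 2 * u - (u - v) / sqrt 2) * std_normal_density ((u - v) / sqrt 2)
  = std_normal_density u * std_normal_density v"
proof -
 have 1: "sqrt 2 * u - (u - v) / sqrt 2 = (u + v) / sqrt 2"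
  by (simp add: field_simps)
 have "- ((u + v) / sqrt 2)\<^sup>2 / 2 + - ((u - v) / sqrt 2)\<^sup>2 / 2 = - u\<^sup>2 / 2 + - v\<^sup>2 / 2"
  by (simp add: power_divide power2_eq_square field_simps)
 then show ?thesis
  unfolding 1 std_normal_density_def by (simp add: mult_exp_exp)
qed

lemma nn_integral_stdn_pair:
 assumes [measurable]: "F \<in> borel_measurable (borel \<Otimes>\<^sub>M borel)"
 shows "(\<integral>\<^sup>+z. F z \<partial>(stdn \<Otimes>\<^sub>M stdn)) =
  (\<integral>\<^sup>+x. \<integral>\<^sup>+y. ennreal (std_normal_density x * std_normal_density y) * F (x, y) \<partial>lborel \<partial>lborel)"
proof -
 interpret prob_space stdn by (rule prob_space_stdn)
 have "(\<integral>\<^sup>+z. F z \<partial>(stdn \<Otimes>\<^sub>M stdn)) = (\<integral>\<^sup>+x. \<integral>\<^sup>+y. F (x, y) \<partial>stdn \<partial>stdn)"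
  by (rule nn_integral_fst[symmetric]) simp
 also have "\<dots> = (\<integral>\<^sup>+x. std_normal_density x * (\<integral>\<^sup>+y. std_normal_density y * F (x, y) \<partial>lborel) \<partial>lborel)"
  unfolding stdn_def by (simp add: nn_integral_density)
 also have "\<dots> = (\<integral>\<^sup>+x. \<integral>\<^sup>+y. ennreal (std_normal_density x * std_normal_density y) * F (x, y) \<partial>lborel \<partial>lborel)"
  by (simp add: nn_integral_cmult[symmetric] ennreal_mult mult.assoc)
 finally show ?thesis .
qed

text \<open>The plane is rotated one coordinate at a time: with Fubini exchanges in between,
  \<open>x = - y + sqrt 2 * u\<close> and then \<open>y = (u - v) / sqrt 2\<close> are substituted.
  The Jacobians \<open>sqrt 2\<close> and \<open>1 / sqrt 2\<close> cancel.\<close>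

lemma stdn_pair_rotate:
 "distr (stdn \<Otimes>\<^sub>M stdn) (borel \<Otimes>\<^sub>M borel) (\<lambda>(x, y). ((x + y) / sqrt 2, (x - y) / sqrt 2))
  = stdn \<Otimes>\<^sub>M stdn" (is "distr ?P ?B ?r = ?P")
proof (rule measure_eqI)
 show "sets (distr ?P ?B ?r) = sets ?P"
  by (simp cong: sets_pair_measure_cong)
 fix A assume "A \<in> sets (distr ?P ?B ?r)"
 then have A[measurable]: "A \<in> sets ?B" by simp
 define F :: "real \<times> real \<Rightarrow> ennreal" where "F = indicator A"
 have [measurable]: "F \<in> borel_measurable ?B" unfolding F_def by simp
 let ?g = "\<lambda>x y. std_normal_density x * std_normal_density y"
 have "emeasure (distr ?P ?B ?r) A = (\<integral>\<^sup>+z. F z \<partial>distr ?P ?B ?r)"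
  unfolding F_def by simp
 also have "\<dots> = (\<integral>\<^sup>+z. F (?r z) \<partial>?P)"
  by (subst nn_integral_distr) auto
 also have "\<dots> = (\<integral>\<^sup>+x. \<integral>\<^sup>+y. ennreal (?g x y) * F ((x + y) / sqrt 2, (x - y) / sqrt 2) \<partial>lborel \<partial>lborel)"
  by (subst nn_integral_stdn_pair) auto
 also have "\<dots> = (\<integral>\<^sup>+y. \<integral>\<^sup>+x. ennreal (?g x y) * F ((x + y) / sqrt 2, (x - y) / sqrt 2) \<partial>lborel \<partial>lborel)"
  by (rule lborel_pair.Fubini'[symmetric]) simp
 also have "\<dots> = (\<integral>\<^sup>+y. ennreal (sqrt 2) * (\<integral>\<^sup>+u. ennreal (?g (- y + sqrt 2 * u) y) *
   F ((- y + sqrt 2 * u + y) / sqrt 2, (- y + sqrt 2 * u - y) / sqrt 2) \<partial>lborel) \<partial>lborel)"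
 proof (rule nn_integral_cong)
  fix y :: real
  show "(\<integral>\<^sup>+x. ennreal (?g x y) * F ((x + y) / sqrt 2, (x - y) / sqrt 2) \<partial>lborel) =
   ennreal (sqrt 2) * (\<integral>\<^sup>+u. ennreal (?g (- y + sqrt 2 * u) y) *
   F ((- y + sqrt 2 * u + y) / sqrt 2, (- y + sqrt 2 * u - y) / sqrt 2) \<partial>lborel)"
   by (subst nn_integral_real_affine[where c = "sqrt 2" and t = "- y"]) auto
 qed
 also have "\<dots> = ennreal (sqrt 2) * (\<integral>\<^sup>+y. \<integral>\<^sup>+u. ennreal (?g (- y + sqrt 2 * u) y) *
   F (u, u - sqrt 2 * y) \<partial>lborel \<partial>lborel)"
 proof -
  have "(- y + sqrt 2 * u + y) / sqrt 2 = u" "(- y + sqrt 2 * u - y) / sqrt 2 = u - sqrt 2 * y" for u y :: real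
   by (simp_all add: field_simps)
  then show ?thesis
   by (subst nn_integral_cmult[symmetric]) auto
 qed
 also have "\<dots> = ennreal (sqrt 2) * (\<integral>\<^sup>+u. \<integral>\<^sup>+y. ennreal (?g (- y + sqrt 2 * u) y) *
   F (u, u - sqrt 2 * y) \<partial>lborel \<partial>lborel)"
  by (subst lborel_pair.Fubini') auto
 also have "\<dots> = ennreal (sqrt 2) * (\<integral>\<^sup>+u. ennreal (1 / sqrt 2) * (\<integral>\<^sup>+v.
   ennreal (?g (- (u / sqrt 2 + (- 1 / sqrt 2) * v) + sqrt 2 * u) (u / sqrt 2 + (- 1 / sqrt 2) * v)) *
   F (u, u - sqrt 2 * (u / sqrt 2 + (- 1 / sqrt 2) * v)) \<partial>lborel) \<partial>lborel)"
 proof (intro arg_cong2[where f = "(*)"] refl nn_integral_cong)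
  fix u :: real
  show "(\<integral>\<^sup>+y. ennreal (?g (- y + sqrt 2 * u) y) * F (u, u - sqrt 2 * y) \<partial>lborel) =
   ennreal (1 / sqrt 2) * (\<integral>\<^sup>+v.
   ennreal (?g (- (u / sqrt 2 + (- 1 / sqrt 2) * v) + sqrt 2 * u) (u / sqrt 2 + (- 1 / sqrt 2) * v)) *
   F (u, u - sqrt 2 * (u / sqrt 2 + (- 1 / sqrt 2) * v)) \<partial>lborel)"
   by (subst nn_integral_real_affine[where c = "- 1 / sqrt 2" and t = "u / sqrt 2"]) auto
 qed
 also have "\<dots> = ennreal (sqrt 2) * (\<integral>\<^sup>+u. ennreal (1 / sqrt 2) * (\<integral>\<^sup>+v. ennreal (?g u v) * F (u, v) \<partial>lborel) \<partial>lborel)"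
 proof -
  have 1: "u / sqrt 2 + (- 1 / sqrt 2) * v = (u - v) / sqrt 2"
   "u - sqrt 2 * ((u - v) / sqrt 2) = v" for u v :: real
   by (simp_all add: field_simps)
  have 2: "- ((u - v) / sqrt 2) + sqrt 2 * u = sqrt 2 * u - (u - v) / sqrt 2" for u v :: real
   by simp
  show ?thesis unfolding 1 2 std_normal_density_rotate ..
 qed
 also have "\<dots> = (\<integral>\<^sup>+u. \<integral>\<^sup>+v. ennreal (?g u v) * F (u, v) \<partial>lborel \<partial>lborel)"
  by (subst nn_integral_cmult) (auto simp: mult.assoc[symmetric] ennreal_mult[symmetric])
 also have "\<dots> = (\<integral>\<^sup>+z. F z \<partial>?P)"
  by (subst nn_integral_stdn_pair) auto
 also have "\<dots> = emeasure ?P A"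
  unfolding F_def by (simp cong: sets_pair_measure_cong)
 finally show "emeasure (distr ?P ?B ?r) A = emeasure ?P A" .
qed

section \<open>Independent Gaussian families and the refinement step\<close>

abbreviation gaussians :: "('i \<Rightarrow> real) measure" where
 "gaussians \<equiv> PiM UNIV (\<lambda>_. stdn)"

lemma prod_lessThan_double:
 fixes h :: "nat \<Rightarrow> 'a :: comm_monoid_mult"
 shows "(\<Prod>k<2 * n. h k) = (\<Prod>k<n. h (2 * k) * h (2 * k + 1))"
 by (induction n) (simp_all add: mult.assoc)

lemma distr_gaussians_pair:
 assumes "i \<noteq> j"
 shows "distr gaussians (borel \<Otimes>\<^sub>M borel) (\<lambda>v. (v i, v j)) = stdn \<Otimes>\<^sub>M stdn"
proof (rule pair_measure_eqI[symmetric])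
 interpret prob_space stdn by (rule prob_space_stdn)
 interpret P: product_prob_space "\<lambda>_. stdn" UNIV ..
 show "sigma_finite_measure stdn" "sigma_finite_measure stdn" ..
 show "sets (stdn \<Otimes>\<^sub>M stdn) = sets (distr gaussians (borel \<Otimes>\<^sub>M borel) (\<lambda>v. (v i, v j)))"
  by (simp cong: sets_pair_measure_cong)
 fix A B assume AB: "A \<in> sets stdn" "B \<in> sets stdn"
 have "emeasure (distr gaussians (borel \<Otimes>\<^sub>M borel) (\<lambda>v. (v i, v j))) (A \<times> B) =
  emeasure gaussians {v \<in> space gaussians. \<forall>l\<in>{i, j}. v l \<in> (if l = i then A else B)}"
  using AB assms by (subst emeasure_distr) (auto intro!: arg_cong2[where f = emeasure] simp: space_PiM)
 also have "\<dots> = emeasure stdn A * emeasure stdn B"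
  using AB assms by (subst P.emeasure_PiM_Collect) auto
 finally show "emeasure stdn A * emeasure stdn B =
  emeasure (distr gaussians (borel \<Otimes>\<^sub>M borel) (\<lambda>v. (v i, v j))) (A \<times> B)" by simp
qed

lemma indep_vars_gaussians:
 "prob_space.indep_vars gaussians (\<lambda>_. borel) (\<lambda>j v. v j) UNIV"
proof -
 interpret prob_space stdn by (rule prob_space_stdn)
 interpret P: product_prob_space "\<lambda>_. stdn" UNIV ..
 have 1: "distr gaussians borel (\<lambda>x. x i) = stdn" for i
 proof -
  have "distr gaussians borel (\<lambda>x. x i) = distr gaussians stdn (\<lambda>x. x i)"
   by (rule distr_cong) auto
  then show ?thesis by (simp add: P.PiM_component)
 qed
 have 2: "distr gaussians (PiM UNIV (\<lambda>_. borel)) (\<lambda>x. x) = gaussians"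
  by (rule distr_id2) (auto intro!: sets_PiM_cong)
 show ?thesis
  by (subst P.indep_vars_iff_distr_eq_PiM) (auto simp: 1 2 restrict_UNIV)
qed

text \<open>Row \<open>0\<close> holds the normalised increments over the dyadic intervals of one level, rows \<open>1, 2, \<dots>\<close>
 the innovations that are still unused.  One step halves the intervals.\<close>

definition levy_step :: "(nat \<times> nat \<Rightarrow> real) \<Rightarrow> nat \<times> nat \<Rightarrow> real" where
 "levy_step v = (\<lambda>(i, k). if i = 0
  then (if even k then v (0, k div 2) + v (1, k div 2) else v (0, k div 2) - v (1, k div 2)) / sqrt 2
  else v (i + 1, k))"

lemma measurable_levy_step [measurable]: "levy_step \<in> gaussians \<rightarrow>\<^sub>M gaussians"
proof -
 have 1: "(\<lambda>v. levy_step v j) \<in> borel_measurable gaussians" for j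
  by (cases j) (simp add: levy_step_def)
 have "(\<lambda>v. \<lambda>j\<in>UNIV. levy_step v j) \<in> gaussians \<rightarrow>\<^sub>M gaussians"
  by (rule measurable_restrict) (simp add: 1 measurable_cong_sets[OF refl sets_stdn])
 then show ?thesis by (simp add: restrict_UNIV)
qed

text \<open>The coordinates fall into disjoint, hence independent, blocks: the pairs in rows 0 and
  1, which are rotated by \<open>stdn_pair_rotate\<close>, and the single entries of the later rows,
  which only move up by one row.\<close>

lemma distr_levy_step: "distr gaussians gaussians levy_step = gaussians"
proof -
 interpret prob_space stdn by (rule prob_space_stdn)
 interpret P: product_prob_space "\<lambda>_. stdn" "UNIV :: (nat \<times> nat) set" ..
 let ?S = "measure stdn"
 \<comment> \<open>\<open>Inl k\<close> stands for the pair in column \<open>k\<close> of rows 0 and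
   1, \<open>Inr (i, k)\<close> for a single later entry. Single entries are padded with 0 in
   \<open>U\<close>, so that all blocks take values in the plane.\<close>
 define K :: "nat + nat \<times> nat \<Rightarrow> (nat \<times> nat) set" where
  "K = (\<lambda>l. case l of Inl k \<Rightarrow> {(0, k), (1, k)} | Inr (i, k) \<Rightarrow> {(i + 2, k)})"
 define U :: "nat + nat \<times> nat \<Rightarrow> (nat \<times> nat \<Rightarrow> real) \<Rightarrow> real \<times> real" where
  "U = (\<lambda>l v. case l of Inl k \<Rightarrow> (v (0, k), v (1, k)) | Inr (i, k) \<Rightarrow> (v (i + 2, k), 0))"
 have "P.indep_vars (\<lambda>l. PiM (K l) (\<lambda>_. borel)) (\<lambda>l w. restrict (\<lambda>i. w i) (K l)) UNIV"
  by (rule P.indep_vars_restrict[OF indep_vars_gaussians])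
   (auto simp: K_def disjoint_family_on_def split: sum.splits prod.splits)
 then have "P.indep_vars (\<lambda>_. borel \<Otimes>\<^sub>M borel) (\<lambda>l w. U l (restrict (\<lambda>i. w i) (K l))) UNIV"
  by (rule P.indep_vars_compose2)
   (auto simp: K_def U_def split: sum.splits prod.splits intro!: measurable_Pair measurable_component_singleton)
 also have "(\<lambda>l w. U l (restrict (\<lambda>i. w i) (K l))) = U"
  by (auto simp: fun_eq_iff U_def K_def split: sum.splits)
 finally have ind: "P.indep_vars (\<lambda>_. borel \<Otimes>\<^sub>M borel) U UNIV" .
 show ?thesis
 proof (rule P.PiM_eq)
  fix J :: "(nat \<times> nat) set" and F assume J: "finite J" and F: "\<And>j. j \<in> J \<Longrightarrow> F j \<in> sets stdn"
  define G where "G j = (if j \<in> J then F j else UNIV)" for j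
  have G [measurable]: "G j \<in> sets borel" for j
   using F by (auto simp: G_def)
  obtain n where n: "\<And>i k. (i, k) \<in> J \<Longrightarrow> i \<le> n \<and> k < n" "n > 0"
  proof
   fix i k assume "(i, k) \<in> J"
   then have "i \<le> Max (fst ` J)" "k \<le> Max (snd ` J)"
    using J by (auto intro!: Max_ge rev_image_eqI)
   then show "i \<le> Suc (Max (fst ` J) + Max (snd ` J)) \<and> k < Suc (Max (fst ` J) + Max (snd ` J))"
    by simp
  qed simp
  define J' where "J' = Pair 0 ` {..<2 * n} \<union> (\<lambda>(i, k). (i + 1, k)) ` ({..<n} \<times> {..<n})"
  have JJ': "J \<subseteq> J'"
  proof
   fix j assume "j \<in> J"
   with n show "j \<in> J'"
    by (cases j; cases "fst j") (force simp: J'_def)+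
  qed
  have [simp]: "finite J'" by (auto simp: J'_def)
  define L where "L = (Inl ` {..<n} :: (nat + nat \<times> nat) set) \<union> Inr ` ({..<n} \<times> {..<n})"
  define A where "A l = (case l of
    Inl k \<Rightarrow> (\<lambda>(x, y). ((x + y) / sqrt 2, (x - y) / sqrt 2)) -` (G (0, 2 * k) \<times> G (0, 2 * k + 1)) \<inter> space (borel \<Otimes>\<^sub>M borel)
   | Inr (i, k) \<Rightarrow> G (i + 1, k) \<times> UNIV)" for l :: "nat + nat \<times> nat"
  have A [measurable]: "A l \<in> sets (borel \<Otimes>\<^sub>M borel)" for l
   unfolding A_def by (auto split: sum.splits prod.splits)
  have E: "levy_step -` prod_emb UNIV (\<lambda>_. stdn) J (Pi\<^sub>E J F) \<inter> space gaussians =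
   (\<Inter>l\<in>L. U l -` A l \<inter> space gaussians)" (is "?E = ?R")
  proof -
   have all_double: "(\<forall>k<2 * n. Q k) \<longleftrightarrow> (\<forall>k<n. Q (2 * k) \<and> Q (2 * k + 1))" for Q :: "nat \<Rightarrow> bool"
   proof safe
    fix k assume Q: "\<forall>k<n. Q (2 * k) \<and> Q (2 * k + 1)" and "k < 2 * n"
    then show "Q k" by (cases "even k") (auto elim!: evenE oddE)
   qed auto
   have "v \<in> ?E \<longleftrightarrow> (\<forall>j\<in>J'. levy_step v j \<in> G j)" for v
    using JJ' by (auto simp: prod_emb_def space_PiM G_def PiE_iff restrict_def extensional_def)
   also have "\<dots> v \<longleftrightarrow> (\<forall>k<2 * n. levy_step v (0, k) \<in> G (0, k)) \<and>
     (\<forall>i<n. \<forall>k<n. v (i + 2, k) \<in> G (i + 1, k))" for v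
    by (auto simp: J'_def ball_Un levy_step_def)
   also have "\<dots> v \<longleftrightarrow> (\<forall>k<n. levy_step v (0, 2 * k) \<in> G (0, 2 * k) \<and> levy_step v (0, 2 * k + 1) \<in> G (0, 2 * k + 1)) \<and>
     (\<forall>i<n. \<forall>k<n. v (i + 2, k) \<in> G (i + 1, k))" for v
    by (simp only: all_double[of "\<lambda>k. levy_step v (0, k) \<in> G (0, k)"])
   also have "\<dots> v \<longleftrightarrow> v \<in> ?R" for v
    using n(2) by (auto simp: L_def ball_Un U_def A_def levy_step_def space_PiM space_pair_measure)
   finally show ?thesis by blast
  qed
  have SG: "?S (G j) = (if j \<in> J then ?S (F j) else 1)" for j
   using prob_space by (simp add: G_def)
  have pA: "P.prob (U l -` A l \<inter> space gaussians) = measure (distr gaussians (borel \<Otimes>\<^sub>M borel) (U l)) (A l)" for l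
   using ind by (subst measure_distr) (auto simp: P.indep_vars_def)
  have pInl: "P.prob (U (Inl k) -` A (Inl k) \<inter> space gaussians) = ?S (G (0, 2 * k)) * ?S (G (0, 2 * k + 1))" for k
  proof -
   have "measure (distr gaussians (borel \<Otimes>\<^sub>M borel) (U (Inl k))) (A (Inl k)) = measure (stdn \<Otimes>\<^sub>M stdn) (A (Inl k))"
    unfolding U_def by (simp add: distr_gaussians_pair)
   also have "\<dots> = measure (distr (stdn \<Otimes>\<^sub>M stdn) (borel \<Otimes>\<^sub>M borel) (\<lambda>(x, y). ((x + y) / sqrt 2, (x - y) / sqrt 2)))
     (G (0, 2 * k) \<times> G (0, 2 * k + 1))"
    by (subst measure_distr) (auto simp: A_def space_pair_measure)
   also have "\<dots> = ?S (G (0, 2 * k)) * ?S (G (0, 2 * k + 1))"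
    unfolding stdn_pair_rotate by (simp add: measure_def emeasure_pair_measure_Times enn2real_mult)
   finally show ?thesis by (simp add: pA)
  qed
  have pInr: "P.prob (U (Inr (i, k)) -` A (Inr (i, k)) \<inter> space gaussians) = ?S (G (i + 1, k))" for i k
  proof -
   have "P.prob (U (Inr (i, k)) -` A (Inr (i, k)) \<inter> space gaussians) = P.prob {v \<in> space gaussians. v (i + 2, k) \<in> G (i + 1, k)}"
    by (auto simp: U_def A_def intro!: arg_cong[where f = P.prob])
   also have "\<dots> = ?S (G (i + 1, k))"
    unfolding measure_def by (subst P.emeasure_PiM_Collect_single) auto
   finally show ?thesis .
  qed
  have "emeasure (distr gaussians gaussians levy_step) (prod_emb UNIV (\<lambda>_. stdn) J (Pi\<^sub>E J F)) =
   P.prob (\<Inter>l\<in>L. U l -` A l \<inter> space gaussians)"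
   using J F by (subst emeasure_distr) (auto simp: E P.emeasure_eq_measure)
  also have "P.prob (\<Inter>l\<in>L. U l -` A l \<inter> space gaussians) = (\<Prod>l\<in>L. P.prob (U l -` A l \<inter> space gaussians))"
   using n(2) A by (intro P.indep_varsD[OF ind]) (auto simp: L_def)
  also have "\<dots> = (\<Prod>k<n. ?S (G (0, 2 * k)) * ?S (G (0, 2 * k + 1))) * (\<Prod>(i, k)\<in>{..<n} \<times> {..<n}. ?S (G (i + 1, k)))"
   unfolding L_def using pInl pInr
   by (subst prod.union_disjoint) (auto simp: prod.reindex case_prod_beta intro!: arg_cong2[where f = "(*)"] prod.cong)
  also have "\<dots> = (\<Prod>j\<in>J'. ?S (G j))"
   unfolding J'_def using prod_lessThan_double[of "\<lambda>k. ?S (G (0, k))" n]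
   by (subst prod.union_disjoint) (auto simp: prod.reindex inj_on_def case_prod_beta)
  also have "\<dots> = (\<Prod>j\<in>J. ?S (F j))"
   using JJ' by (intro prod.mono_neutral_cong_right) (auto simp: SG)
  finally show "emeasure (distr gaussians gaussians levy_step) (prod_emb UNIV (\<lambda>_. stdn) J (Pi\<^sub>E J F)) =
    (\<Prod>j\<in>J. emeasure stdn (F j))"
   by (simp add: emeasure_eq_measure prod_ennreal)
 qed simp
qed

text \<open>Uniqueness of a measure whose events are generated by real-valued functions \<open>h i\<close>.  The
 generation is expressed by minimality: any measure space on which all \<open>h i\<close> are measurable has
 at least the events of \<open>P\<close>.\<close>

lemma measure_eqI_half_lines:
 fixes P Q :: "'a measure" and h :: "'i \<Rightarrow> 'a \<Rightarrow> real"
 assumes P: "prob_space P" and Q: "prob_space Q" and PQ: "sets P = sets Q"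
  and h: "\<And>i. i \<in> I \<Longrightarrow> h i \<in> borel_measurable P"
  and gen: "\<And>N. space N = space P \<Longrightarrow> (\<And>i. i \<in> I \<Longrightarrow> h i \<in> borel_measurable N) \<Longrightarrow> sets P \<subseteq> sets N"
  and eq: "\<And>J a. finite J \<Longrightarrow> J \<subseteq> I \<Longrightarrow>
   measure P {x \<in> space P. \<forall>i\<in>J. h i x \<le> a i} = measure Q {x \<in> space P. \<forall>i\<in>J. h i x \<le> a i}"
 shows "P = Q"
proof -
 interpret P: prob_space P by fact
 interpret Q: prob_space Q by fact
 define E where "E = {{x \<in> space P. \<forall>i\<in>J. h i x \<le> a i} | J a. finite J \<and> J \<subseteq> I}"
 have E_sets: "E \<subseteq> sets P"
 proof -
  have "{x \<in> space P. \<forall>i\<in>J. h i x \<le> a i} \<in> sets P" if J: "finite J" "J \<subseteq> I" for J a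
  proof (rule sets.sets_Collect_finite_All[OF _ J(1)])
   fix i assume "i \<in> J"
   then have [measurable]: "h i \<in> borel_measurable P" using h J by auto
   show "{x \<in> space P. h i x \<le> a i} \<in> sets P" by measurable
  qed
  then show ?thesis by (auto simp: E_def)
 qed
 have E_Pow: "E \<subseteq> Pow (space P)" by (auto simp: E_def)
 have "sets P \<subseteq> sets (sigma (space P) E)"
 proof (rule gen)
  fix i assume i: "i \<in> I"
  show "h i \<in> borel_measurable (sigma (space P) E)"
   unfolding borel_measurable_iff_le
  proof
   fix a
   have "{x \<in> space P. \<forall>j\<in>{i}. h j x \<le> a} \<in> E"
    unfolding E_def using i by (intro CollectI exI[of _ "{i}"] exI[of _ "\<lambda>_. a"]) auto
   then show "{w \<in> space (sigma (space P) E). h i w \<le> a} \<in> sets (sigma (space P) E)"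
    using E_Pow by (auto simp: space_measure_of)
  qed
 qed (use E_Pow in \<open>simp add: space_measure_of\<close>)
 then have gen': "sets P = sigma_sets (space P) E"
  using E_Pow sets.sigma_sets_subset[OF E_sets] by auto
 show ?thesis
 proof (rule measure_eqI_generator_eq[where A = "\<lambda>_. space P"])
  show "Int_stable E"
  proof (rule Int_stableI)
   fix A B assume "A \<in> E" "B \<in> E"
   then obtain J a K b where *: "A = {x \<in> space P. \<forall>i\<in>J. h i x \<le> a i}" "B = {x \<in> space P. \<forall>i\<in>K. h i x \<le> b i}"
    "finite J" "finite K" "J \<subseteq> I" "K \<subseteq> I"
    unfolding E_def by blast
   let ?c = "\<lambda>i. if i \<in> J then if i \<in> K then min (a i) (b i) else a i else b i"
   have "A \<inter> B = {x \<in> space P. \<forall>i\<in>J \<union> K. h i x \<le> ?c i}"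
    unfolding * by (auto split: if_splits)
   then show "A \<inter> B \<in> E"
    unfolding E_def using * by (intro CollectI exI[of _ "J \<union> K"] exI[of _ ?c]) auto
  qed
  show "emeasure P X = emeasure Q X" if "X \<in> E" for X
   using that eq by (auto simp: E_def P.emeasure_eq_measure Q.emeasure_eq_measure)
  have "{x \<in> space P. \<forall>i\<in>{}. h i x \<le> 0} \<in> E"
   unfolding E_def by (intro CollectI exI[of _ "{}"] exI[of _ "\<lambda>_. 0"]) auto
  then show "range (\<lambda>_ :: nat. space P) \<subseteq> E" by auto
 qed (use E_Pow gen' PQ in auto)
qed

lemma measure_eqI_marginals:
 fixes P Q :: "'a measure" and h :: "'i \<Rightarrow> 'a \<Rightarrow> real"
 assumes P: "prob_space P" and Q: "prob_space Q" and PQ: "sets P = sets Q"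
  and h: "\<And>i. i \<in> I \<Longrightarrow> h i \<in> borel_measurable P"
  and gen: "\<And>N. space N = space P \<Longrightarrow> (\<And>i. i \<in> I \<Longrightarrow> h i \<in> borel_measurable N) \<Longrightarrow> sets P \<subseteq> sets N"
  and eq: "\<And>J. finite J \<Longrightarrow> J \<subseteq> I \<Longrightarrow>
   distr P (PiM J (\<lambda>_. borel)) (\<lambda>x. \<lambda>i\<in>J. h i x) = distr Q (PiM J (\<lambda>_. borel)) (\<lambda>x. \<lambda>i\<in>J. h i x)"
 shows "P = Q"
proof (rule measure_eqI_half_lines[OF P Q PQ h gen])
 fix J and a :: "'i \<Rightarrow> real" assume J: "finite J" "J \<subseteq> I"
 have sp: "space P = space Q" by (rule sets_eq_imp_space_eq[OF PQ])
 have hQ: "h i \<in> borel_measurable Q" if "i \<in> I" for i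
  using h[OF that] measurable_cong_sets[OF PQ refl] by auto
 let ?A = "{y \<in> space (PiM J (\<lambda>_. borel)). \<forall>i\<in>J. y i \<le> a i}"
 have A: "?A \<in> sets (PiM J (\<lambda>_. borel))"
  by (rule sets.sets_Collect_finite_All[OF _ J(1)]) simp
 have *: "measure (distr M (PiM J (\<lambda>_. borel)) (\<lambda>x. \<lambda>i\<in>J. h i x)) ?A = measure M {x \<in> space M. \<forall>i\<in>J. h i x \<le> a i}"
  if m: "\<forall>i\<in>J. h i \<in> borel_measurable M" for M
 proof -
  have "(\<lambda>x. \<lambda>i\<in>J. h i x) \<in> M \<rightarrow>\<^sub>M PiM J (\<lambda>_. borel)"
   using m by (intro measurable_restrict) auto
  then show ?thesis
   using A by (subst measure_distr) (auto intro!: arg_cong[where f = "measure M"] simp: space_PiM)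
 qed
 have "\<forall>i\<in>J. h i \<in> borel_measurable P" "\<forall>i\<in>J. h i \<in> borel_measurable Q"
  using h hQ J by auto
 from *[OF this(1)] *[OF this(2)]
 show "measure P {x \<in> space P. \<forall>i\<in>J. h i x \<le> a i} = measure Q {x \<in> space P. \<forall>i\<in>J. h i x \<le> a i}"
  by (simp add: sp eq[OF J])
qed

text \<open>Supplies the generation hypothesis of \<open>measure_eqI_half_lines\<close> for product
  spaces: the identity map out of \<open>N\<close> is measurable, so every event is its own
  preimage.\<close>

lemma sets_PiM_borel_le:
 fixes N :: "('i \<Rightarrow> real) measure"
 assumes "space N = space (PiM I (\<lambda>_. borel))" "\<And>i. i \<in> I \<Longrightarrow> (\<lambda>x. x i) \<in> borel_measurable N"
 shows "sets (PiM I (\<lambda>_. borel)) \<subseteq> sets N"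
proof
 have m: "(\<lambda>x :: 'i \<Rightarrow> real. x) \<in> N \<rightarrow>\<^sub>M PiM I (\<lambda>_. borel)"
  using assms by (intro measurable_PiM_single') (auto simp: space_PiM)
 fix A :: "('i \<Rightarrow> real) set" assume A: "A \<in> sets (PiM I (\<lambda>_. borel))"
 from measurable_sets[OF m this] sets.sets_into_space[OF A] show "A \<in> sets N"
  by (simp add: assms Int_absorb2)
qed

text \<open>Products of continuous ramps are used as test functions. Dominated convergence first
  removes the index \<open>m\<close> with the ramps fixed; only then are the ramps sharpened to
  indicators of half lines.\<close>

lemma distr_eq_limit:
 fixes X :: "nat \<Rightarrow> 'i \<Rightarrow> 'a \<Rightarrow> real" and Z :: "nat \<Rightarrow> 'i \<Rightarrow> 'b \<Rightarrow> real"
 assumes M: "prob_space M" "prob_space N"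
  and X [measurable]: "\<And>m i. i \<in> I \<Longrightarrow> X m i \<in> borel_measurable M" "\<And>i. i \<in> I \<Longrightarrow> X' i \<in> borel_measurable M"
  and Z [measurable]: "\<And>m i. i \<in> I \<Longrightarrow> Z m i \<in> borel_measurable N" "\<And>i. i \<in> I \<Longrightarrow> Z' i \<in> borel_measurable N"
  and XZ: "\<And>m. distr M (PiM I (\<lambda>_. borel)) (\<lambda>v. \<lambda>i\<in>I. X m i v) = distr N (PiM I (\<lambda>_. borel)) (\<lambda>v. \<lambda>i\<in>I. Z m i v)"
  and lim: "\<And>i. i \<in> I \<Longrightarrow> AE v in M. (\<lambda>m. X m i v) \<longlonglongrightarrow> X' i v"
   "\<And>i. i \<in> I \<Longrightarrow> AE v in N. (\<lambda>m. Z m i v) \<longlonglongrightarrow> Z' i v"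
 shows "distr M (PiM I (\<lambda>_. borel)) (\<lambda>v. \<lambda>i\<in>I. X' i v) = distr N (PiM I (\<lambda>_. borel)) (\<lambda>v. \<lambda>i\<in>I. Z' i v)"
  (is "?P = ?Q")
proof (rule measure_eqI_half_lines[where I = I and h = "\<lambda>i x. x i"])
 interpret M: prob_space M by fact
 interpret N: prob_space N by fact
 let ?B = "PiM I (\<lambda>_. borel) :: ('i \<Rightarrow> real) measure"
 have mX: "(\<lambda>v. \<lambda>i\<in>I. X m i v) \<in> M \<rightarrow>\<^sub>M ?B" "(\<lambda>v. \<lambda>i\<in>I. X' i v) \<in> M \<rightarrow>\<^sub>M ?B" for m
  by (rule measurable_restrict; simp add: X)+
 have mZ: "(\<lambda>v. \<lambda>i\<in>I. Z m i v) \<in> N \<rightarrow>\<^sub>M ?B" "(\<lambda>v. \<lambda>i\<in>I. Z' i v) \<in> N \<rightarrow>\<^sub>M ?B" for m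
  by (rule measurable_restrict; simp add: Z)+
 show "prob_space ?P" "prob_space ?Q"
  using mX mZ by (auto intro: M.prob_space_distr N.prob_space_distr)
 show "sets ?P \<subseteq> sets L" if "space L = space ?P" "\<And>i. i \<in> I \<Longrightarrow> (\<lambda>x. x i) \<in> borel_measurable L" for L
  using sets_PiM_borel_le[of L I] that by simp
 fix J and a :: "'i \<Rightarrow> real" assume J: "finite J" "J \<subseteq> I"
 \<comment> \<open>For positive \<open>k\<close>, a ramp that falls from 1 to 0 between
   \<open>b\<close> and \<open>b + 1 / k\<close>.\<close>
 define g where "g k b x = max 0 (min 1 (1 - real k * (x - b)))" for k :: nat and b x :: real
 have g_cont: "isCont (g k b) x" for k b x
  unfolding g_def by (intro continuous_intros)
 have g_bd: "0 \<le> g k b x" "g k b x \<le> 1" for k b x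
  by (auto simp: g_def)
 have [measurable]: "g k b \<in> borel_measurable borel" for k b
  unfolding g_def by measurable
 have g_lim: "(\<lambda>k. g k b x) \<longlonglongrightarrow> (if x \<le> b then 1 else 0)" for b x
 proof (cases "x \<le> b")
  case True
  then have "g k b x = 1" for k by (simp add: g_def mult_nonneg_nonpos)
  with True show ?thesis by simp
 next
  case False
  then obtain k0 :: nat where k0: "1 < real k0 * (x - b)"
   using reals_Archimedean3[of "x - b"] by auto
  have "\<forall>\<^sub>F k in sequentially. g k b x = 0"
   using eventually_ge_at_top[of k0]
  proof eventually_elim
   case (elim k)
   have "real k0 * (x - b) \<le> real k * (x - b)"
    using elim False by (intro mult_right_mono) auto
   with k0 show ?case by (simp add: g_def)
  qed
  with False show ?thesis by (simp add: tendsto_eventually)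
 qed
 define G where "G k y = (\<Prod>i\<in>J. g k (a i) (y i))" for k and y :: "'i \<Rightarrow> real"
 have G_meas: "G k \<in> borel_measurable ?B" for k
  unfolding G_def using J by (intro borel_measurable_prod) auto
 have G_bd: "norm (G k y) \<le> 1" for k y
  unfolding G_def using g_bd by (auto intro!: prod_le_1 simp: prod_nonneg)
 have G_restr: "G k (\<lambda>i\<in>I. y i) = G k y" for k y
  unfolding G_def using J by (intro prod.cong) auto
 have int_eq: "(\<integral>v. G k (\<lambda>i. X m i v) \<partial>M) = (\<integral>v. G k (\<lambda>i. Z m i v) \<partial>N)" for k m
 proof -
  have "(\<integral>v. G k (\<lambda>i. X m i v) \<partial>M) = (\<integral>y. G k y \<partial>distr M ?B (\<lambda>v. \<lambda>i\<in>I. X m i v))"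
   by (subst integral_distr[OF mX(1) G_meas]) (simp add: G_restr)
  also have "\<dots> = (\<integral>v. G k (\<lambda>i. Z m i v) \<partial>N)"
   unfolding XZ by (subst integral_distr[OF mZ(1) G_meas]) (simp add: G_restr)
  finally show ?thesis .
 qed
 have lim_m: "(\<lambda>m. \<integral>v. G k (\<lambda>i. V m i v) \<partial>L) \<longlonglongrightarrow> (\<integral>v. G k (\<lambda>i. V' i v) \<partial>L)"
  if L: "prob_space L" and V: "\<And>m i. i \<in> I \<Longrightarrow> V m i \<in> borel_measurable L" "\<And>i. i \<in> I \<Longrightarrow> V' i \<in> borel_measurable L"
   and lim: "\<And>i. i \<in> I \<Longrightarrow> AE v in L. (\<lambda>m. V m i v) \<longlonglongrightarrow> V' i v"
  for k and L :: "'c measure" and V V'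
 proof -
  interpret L: prob_space L by fact
  show ?thesis
  proof (rule integral_dominated_convergence[where w = "\<lambda>_. 1"])
   have [measurable]: "V m i \<in> borel_measurable L" "V' i \<in> borel_measurable L" if "i \<in> J" for m i
    using V that J by auto
   show "(\<lambda>v. G k (\<lambda>i. V' i v)) \<in> borel_measurable L" "\<And>m. (\<lambda>v. G k (\<lambda>i. V m i v)) \<in> borel_measurable L"
    unfolding G_def by measurable
   have "AE v in L. \<forall>i\<in>J. (\<lambda>m. V m i v) \<longlonglongrightarrow> V' i v"
    using J lim by (intro AE_finite_allI) auto
   then show "AE v in L. (\<lambda>m. G k (\<lambda>i. V m i v)) \<longlonglongrightarrow> G k (\<lambda>i. V' i v)"
    unfolding G_def by eventually_elim (intro tendsto_prod isCont_tendsto_compose[OF g_cont], auto)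
  qed (use G_bd in auto)
 qed
 have int_eq': "(\<integral>v. G k (\<lambda>i. X' i v) \<partial>M) = (\<integral>v. G k (\<lambda>i. Z' i v) \<partial>N)" for k
 proof (rule LIMSEQ_unique)
  show "(\<lambda>m. \<integral>v. G k (\<lambda>i. X m i v) \<partial>M) \<longlonglongrightarrow> (\<integral>v. G k (\<lambda>i. X' i v) \<partial>M)"
   by (rule lim_m[OF M(1) X lim(1)])
  show "(\<lambda>m. \<integral>v. G k (\<lambda>i. X m i v) \<partial>M) \<longlonglongrightarrow> (\<integral>v. G k (\<lambda>i. Z' i v) \<partial>N)"
   unfolding int_eq by (rule lim_m[OF M(2) Z lim(2)])
 qed
 have lim_k: "(\<lambda>k. \<integral>v. G k (\<lambda>i. V' i v) \<partial>L) \<longlonglongrightarrow> measure L {v \<in> space L. \<forall>i\<in>J. V' i v \<le> a i}"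
  if L: "prob_space L" and V: "\<And>i. i \<in> I \<Longrightarrow> V' i \<in> borel_measurable L"
  for L :: "'c measure" and V'
 proof -
  interpret L: prob_space L by fact
  have [measurable]: "V' i \<in> borel_measurable L" if "i \<in> J" for i
   using V that J by auto
  have S: "{v \<in> space L. \<forall>i\<in>J. V' i v \<le> a i} \<in> sets L"
   by (rule sets.sets_Collect_finite_All[OF _ J(1)]) simp
  have "(\<lambda>k. \<integral>v. G k (\<lambda>i. V' i v) \<partial>L) \<longlonglongrightarrow> (\<integral>v. indicator {v \<in> space L. \<forall>i\<in>J. V' i v \<le> a i} v \<partial>L)"
  proof (rule integral_dominated_convergence[where w = "\<lambda>_. 1"])
   show "\<And>k. (\<lambda>v. G k (\<lambda>i. V' i v)) \<in> borel_measurable L"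
    unfolding G_def by measurable
   show "AE v in L. (\<lambda>k. G k (\<lambda>i. V' i v)) \<longlonglongrightarrow> indicator {v \<in> space L. \<forall>i\<in>J. V' i v \<le> a i} v"
   proof (rule AE_I2)
    fix v assume "v \<in> space L"
    have "(\<lambda>k. G k (\<lambda>i. V' i v)) \<longlonglongrightarrow> (\<Prod>i\<in>J. if V' i v \<le> a i then 1 else 0)"
     unfolding G_def by (intro tendsto_prod g_lim)
    also have "(\<Prod>i\<in>J. if V' i v \<le> a i then 1 else 0) = (indicator {v \<in> space L. \<forall>i\<in>J. V' i v \<le> a i} v :: real)"
     using \<open>v \<in> space L\<close> J(1) by (auto simp: indicator_def intro!: prod.neutral)
    finally show "(\<lambda>k. G k (\<lambda>i. V' i v)) \<longlonglongrightarrow> indicator {v \<in> space L. \<forall>i\<in>J. V' i v \<le> a i} v" .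
   qed
  qed (use G_bd S in auto)
  with S show ?thesis by simp
 qed
 have "measure M {v \<in> space M. \<forall>i\<in>J. X' i v \<le> a i} = measure N {v \<in> space N. \<forall>i\<in>J. Z' i v \<le> a i}"
 proof (rule LIMSEQ_unique)
  show "(\<lambda>k. \<integral>v. G k (\<lambda>i. X' i v) \<partial>M) \<longlonglongrightarrow> measure M {v \<in> space M. \<forall>i\<in>J. X' i v \<le> a i}"
   by (rule lim_k[OF M(1) X(2)])
  show "(\<lambda>k. \<integral>v. G k (\<lambda>i. X' i v) \<partial>M) \<longlonglongrightarrow> measure N {v \<in> space N. \<forall>i\<in>J. Z' i v \<le> a i}"
   unfolding int_eq' by (rule lim_k[OF M(2) Z(2)])
 qed
 moreover have "{y \<in> space ?B. \<forall>i\<in>J. y i \<le> a i} \<in> sets ?B"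
 proof (rule sets.sets_Collect_finite_All[OF _ J(1)])
  fix i assume "i \<in> J"
  then have [measurable]: "(\<lambda>y. y i) \<in> borel_measurable ?B" using J by auto
  show "{y \<in> space ?B. y i \<le> a i} \<in> sets ?B" by measurable
 qed
 then have "measure ?P {y \<in> space ?B. \<forall>i\<in>J. y i \<le> a i} = measure M {v \<in> space M. \<forall>i\<in>J. X' i v \<le> a i}"
  "measure ?Q {y \<in> space ?B. \<forall>i\<in>J. y i \<le> a i} = measure N {v \<in> space N. \<forall>i\<in>J. Z' i v \<le> a i}"
  using mX mZ J by (auto simp: measure_distr space_PiM intro!: arg_cong2[where f = measure])
 ultimately show "measure ?P {x \<in> space ?P. \<forall>i\<in>J. x i \<le> a i} = measure ?Q {x \<in> space ?P. \<forall>i\<in>J. x i \<le> a i}"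
  by simp
qed (auto simp: X Z)

section \<open>Finite families of independent Gaussian variables\<close>

lemma distr_indep_PiM:
 assumes M: "prob_space M" and I: "finite I" and ind: "prob_space.indep_vars M (\<lambda>_. N) X I"
 shows "distr M (PiM I (\<lambda>_. N)) (\<lambda>w. \<lambda>i\<in>I. X i w) = PiM I (\<lambda>i. distr M N (X i))"
proof -
 interpret prob_space M by fact
 have X: "X i \<in> M \<rightarrow>\<^sub>M N" if "i \<in> I" for i
  using ind that by (auto simp: indep_vars_def)
 show ?thesis
 proof (cases "I = {}")
  case True
  let ?D = "distr M (PiM {} (\<lambda>_. N)) (\<lambda>w. \<lambda>i\<in>{}. X i w)" and ?P = "PiM {} (\<lambda>i. distr M N (X i))"
  have D: "prob_space ?D"
   by (rule prob_space_distr, rule measurable_restrict) simp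
  have P: "prob_space ?P" by (rule prob_space_PiM) simp
  have "?D = ?P"
  proof (rule measure_eqI)
   fix A assume "A \<in> sets ?D"
   then have "A = {} \<or> A = space ?D \<and> A = space ?P" by (auto simp: sets_PiM_empty space_PiM)
   then show "emeasure ?D A = emeasure ?P A"
    using prob_space.emeasure_space_1[OF D] prob_space.emeasure_space_1[OF P] by auto
  qed (simp add: sets_PiM_empty)
  with True show ?thesis by simp
 next
  case False
  with ind X show ?thesis by (simp add: indep_vars_iff_distr_eq_PiM')
 qed
qed

text \<open>A point mass for \<open>s = 0\<close>, where \<^const>\<open>normal_density\<close> would be useless.\<close>

definition gauss :: "real \<Rightarrow> real measure" where
 "gauss s = distr stdn borel (\<lambda>x. s * x)"

lemma sets_gauss [simp, measurable_cong]: "sets (gauss s) = sets borel"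
 by (simp add: gauss_def)

lemma space_gauss [simp]: "space (gauss s) = UNIV"
 by (simp add: gauss_def)

lemma prob_space_gauss: "prob_space (gauss s)"
 unfolding gauss_def by (rule prob_space.prob_space_distr[OF prob_space_stdn]) simp

lemma gauss_eq_density:
 assumes "0 < s"
 shows "gauss s = density lborel (normal_density 0 s)"
proof -
 interpret prob_space stdn by (rule prob_space_stdn)
 have "distributed stdn lborel (\<lambda>x. x) std_normal_density"
  unfolding distributed_def by (auto simp: stdn_def distr_id2)
 from normal_density_affine[OF this, of s 0] assms
 have "distr stdn lborel (\<lambda>x. s * x) = density lborel (normal_density 0 s)"
  by (auto simp: distributed_def)
 moreover have "distr stdn lborel (\<lambda>x. s * x) = gauss s"
  unfolding gauss_def by (rule distr_cong) auto
 ultimately show ?thesis by simp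
qed

lemma distributed_normal_iff_gauss:
 assumes "0 < s"
 shows "distributed M lborel X (normal_density 0 s) \<longleftrightarrow> X \<in> borel_measurable M \<and> distr M borel X = gauss s"
proof -
 have "distr M borel X = distr M lborel X"
  by (rule distr_cong) auto
 with assms show ?thesis by (auto simp: distributed_def gauss_eq_density)
qed

lemma distr_gaussians_gauss:
 "distr gaussians borel (\<lambda>v. s * v i) = gauss s"
proof -
 interpret prob_space stdn by (rule prob_space_stdn)
 interpret P: product_prob_space "\<lambda>_. stdn" UNIV ..
 have "distr gaussians borel (\<lambda>v. s * v i) = distr (distr gaussians stdn (\<lambda>v. v i)) borel (\<lambda>x. s * x)"
  by (subst distr_distr) (auto simp: comp_def)
 then show ?thesis by (simp add: P.PiM_component gauss_def)
qed

text \<open>Markov's inequality for the fourth power; the fourth moment of the standard normal law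
  is 3. Second moments would be too weak for the union bound over dyadic intervals in
  \<open>AE_levy_good\<close>.\<close>

lemma gauss_tail: "0 < c \<Longrightarrow> measure (gauss s) {x. c \<le> \<bar>x\<bar>} \<le> 3 * s ^ 4 / c ^ 4"
proof -
 interpret S: prob_space stdn by (rule prob_space_stdn)
 interpret G: prob_space "gauss s" by (rule prob_space_gauss)
 assume c: "0 < c"
 have hbi: "has_bochner_integral lborel (\<lambda>x. std_normal_density x * x ^ 4) 3"
  using std_normal_moment_even[of 2] by (simp add: fact_numeral)
 have int: "integrable stdn (\<lambda>x. x ^ 4)" and val: "(\<integral>x. x ^ 4 \<partial>stdn) = 3"
  using hbi unfolding stdn_def
  by (auto simp: integrable_density integral_density has_bochner_integral_iff)
 have int': "integrable stdn (\<lambda>x. (s * x) ^ 4)" and val': "(\<integral>x. (s * x) ^ 4 \<partial>stdn) = 3 * s ^ 4"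
  using int val by (auto simp: power_mult_distrib)
 have "measure (gauss s) {x. c \<le> \<bar>x\<bar>} = measure stdn {x \<in> space stdn. c ^ 4 \<le> (s * x) ^ 4}"
 proof -
  have "c ^ 4 \<le> y ^ 4 \<longleftrightarrow> c \<le> \<bar>y\<bar>" for y :: real
  proof -
   have "y ^ 4 = \<bar>y\<bar> ^ 4" by simp
   then show ?thesis using c by (simp only: power_mono_iff abs_ge_zero order_less_imp_le zero_less_numeral)
  qed
  then show ?thesis
   unfolding gauss_def by (subst measure_distr) (auto intro!: arg_cong[where f = "measure stdn"])
 qed
 also have "\<dots> \<le> (\<integral>x. (s * x) ^ 4 \<partial>stdn) / c ^ 4"
  using c by (intro integral_Markov_inequality_measure[OF int', where A = "{}"]) auto
 finally show ?thesis by (simp add: val')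
qed

subsection \<open>L\'evy's construction of Brownian motion\<close>

lemma measurable_levy_step_pow [measurable]: "(levy_step ^^ m) \<in> gaussians \<rightarrow>\<^sub>M gaussians"
 by (induction m) (auto simp: id_def intro!: measurable_comp)

lemma distr_levy_step_pow: "distr gaussians gaussians (levy_step ^^ m) = gaussians"
proof (induction m)
 case (Suc m)
 have "distr gaussians gaussians (levy_step ^^ Suc m) = distr (distr gaussians gaussians (levy_step ^^ m)) gaussians levy_step"
  by (subst distr_distr) auto
 then show ?case by (simp only: Suc distr_levy_step)
qed (simp add: distr_id2 id_def)

text \<open>The Brownian increment over the interval from \<open>k / 2 ^ m\<close> to
  \<open>(k + 1) / 2 ^ m\<close>; the factor is the standard deviation belonging to the length
  \<open>1 / 2 ^ m\<close>.\<close>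

definition dyinc :: "(nat \<times> nat \<Rightarrow> real) \<Rightarrow> nat \<Rightarrow> nat \<Rightarrow> real" where
 "dyinc v m k = (1 / sqrt 2) ^ m * (levy_step ^^ m) v (0, k)"

definition dysum :: "(nat \<times> nat \<Rightarrow> real) \<Rightarrow> nat \<Rightarrow> nat \<Rightarrow> real" where
 "dysum v m n = (\<Sum>k<n. dyinc v m k)"

lemma measurable_dyinc [measurable]: "(\<lambda>v. dyinc v m k) \<in> borel_measurable gaussians"
proof -
 have "(\<lambda>v. (levy_step ^^ m) v (0, k)) \<in> borel_measurable gaussians"
  using measurable_compose[OF measurable_levy_step_pow, of "\<lambda>v. v (0, k)" borel] by simp
 then show ?thesis unfolding dyinc_def by simp
qed

lemma measurable_dysum [measurable]: "(\<lambda>v. dysum v m n) \<in> borel_measurable gaussians"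
 unfolding dysum_def by simp

text \<open>The innovation enters the two halves with opposite signs and cancels, so a refinement
  does not move the points of coarser levels.\<close>

lemma dyinc_split: "dyinc v (Suc m) (2 * k) + dyinc v (Suc m) (Suc (2 * k)) = dyinc v m k"
proof -
 have *: "x / (sqrt 2 * sqrt 2 ^ m) = x / sqrt 2 ^ m / sqrt 2" for x :: real
  by simp
 show ?thesis
  by (simp add: dyinc_def levy_step_def field_simps)
qed

lemma dysum_double: "dysum v (Suc m) (2 * n) = dysum v m n"
 by (induction n) (simp_all add: dysum_def dyinc_split)

text \<open>With fourth moments, any ratio strictly between \<open>2 powr (- 1 / 4)\<close> and 1
  makes the failure probabilities summable over the levels.\<close>

definition levy_ratio :: real where
 "levy_ratio = 9 / 10"

lemma levy_ratio: "0 < levy_ratio" "levy_ratio < 1" "0 \<le> levy_ratio" "levy_ratio \<le> 1"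
 by (simp_all add: levy_ratio_def)

definition levy_good :: "(nat \<times> nat \<Rightarrow> real) \<Rightarrow> bool" where
 "levy_good v \<longleftrightarrow> (\<forall>N :: nat. \<exists>m0. \<forall>m\<ge>m0. \<forall>k<N * 2 ^ m. \<bar>dyinc v m k\<bar> \<le> levy_ratio ^ m)"

lemma measurable_levy_good [measurable]: "Measurable.pred gaussians levy_good"
 unfolding levy_good_def by measurable

text \<open>Borel-Cantelli over the levels. A single increment fails with probability at most
  \<open>3 * (25 / 64) ^ m\<close>, since \<open>(1 / 4) / (9 / 10) ^ 4 < 25 / 64\<close>. There are
  \<open>N * 2 ^ m\<close> of them up to time \<open>N\<close>, and twice \<open>25 / 64\<close> is
  \<open>25 / 32 < 1\<close>.\<close>

lemma AE_levy_good: "AE v in gaussians. levy_good v"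
proof -
 interpret prob_space stdn by (rule prob_space_stdn)
 interpret P: product_prob_space "\<lambda>_. stdn" "UNIV :: (nat \<times> nat) set" ..
 have tail: "P.prob {v \<in> space gaussians. levy_ratio ^ m < \<bar>dyinc v m k\<bar>} \<le> 3 * (25 / 64) ^ m" for m k
 proof -
  have "P.prob {v \<in> space gaussians. levy_ratio ^ m < \<bar>dyinc v m k\<bar>} \<le>
    P.prob {v \<in> space gaussians. levy_ratio ^ m \<le> \<bar>dyinc v m k\<bar>}"
   by (intro P.finite_measure_mono) auto
  also have "{v \<in> space gaussians. levy_ratio ^ m \<le> \<bar>dyinc v m k\<bar>} =
    (\<lambda>v. (1 / sqrt 2) ^ m * (levy_step ^^ m) v (0, k)) -` {x. levy_ratio ^ m \<le> \<bar>x\<bar>} \<inter> space gaussians"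
   by (auto simp: dyinc_def)
  also have "P.prob \<dots> = measure (distr gaussians borel (\<lambda>v. (1 / sqrt 2) ^ m * (levy_step ^^ m) v (0, k))) {x. levy_ratio ^ m \<le> \<bar>x\<bar>}"
   using measurable_dyinc[of m k] by (subst measure_distr) (auto simp: dyinc_def)
  also have "distr gaussians borel (\<lambda>v. (1 / sqrt 2) ^ m * (levy_step ^^ m) v (0, k)) = gauss ((1 / sqrt 2) ^ m)"
   (is "?D = _")
  proof -
   have "?D = distr (distr gaussians gaussians (levy_step ^^ m)) borel (\<lambda>v. (1 / sqrt 2) ^ m * v (0, k))"
    by (subst distr_distr) (auto simp: comp_def)
   then show ?thesis by (simp only: distr_levy_step_pow distr_gaussians_gauss)
  qed
  also have "measure (gauss ((1 / sqrt 2) ^ m)) {x. levy_ratio ^ m \<le> \<bar>x\<bar>} \<le> 3 * ((1 / sqrt 2) ^ m) ^ 4 / (levy_ratio ^ m) ^ 4"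
   by (rule gauss_tail) (simp add: levy_ratio)
  also have "((1 / sqrt 2) ^ m) ^ 4 = ((1 / sqrt 2) ^ 4) ^ m"
   by (simp only: power_mult[symmetric] mult.commute)
  also have "(1 / sqrt 2) ^ 4 = (1 / 4 :: real)"
   by (simp add: power_divide power4_eq_xxxx)
  also have "(levy_ratio ^ m) ^ 4 = (levy_ratio ^ 4) ^ m"
   by (simp only: power_mult[symmetric] mult.commute)
  also have "3 * (1 / 4) ^ m / (levy_ratio ^ 4) ^ m = 3 * ((1 / 4) / levy_ratio ^ 4) ^ m"
   by (simp only: power_divide times_divide_eq_right)
  also have "\<dots> \<le> 3 * (25 / 64) ^ m"
   by (intro mult_left_mono power_mono) (auto simp: levy_ratio_def power_divide)
  finally show ?thesis .
 qed
 have "AE v in gaussians. \<exists>m0. \<forall>m\<ge>m0. \<forall>k<N * 2 ^ m. \<bar>dyinc v m k\<bar> \<le> levy_ratio ^ m" for N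
 proof -
  define A where "A m = {v \<in> space gaussians. \<exists>k<N * 2 ^ m. levy_ratio ^ m < \<bar>dyinc v m k\<bar>}" for m
  have A: "A m \<in> sets gaussians" for m
   unfolding A_def by measurable
  have "P.prob (A m) \<le> (\<Sum>k<N * 2 ^ m. P.prob {v \<in> space gaussians. levy_ratio ^ m < \<bar>dyinc v m k\<bar>})" for m
  proof -
   have "A m = (\<Union>k<N * 2 ^ m. {v \<in> space gaussians. levy_ratio ^ m < \<bar>dyinc v m k\<bar>})"
    by (auto simp: A_def)
   then show ?thesis
    by (simp only:) (intro P.finite_measure_subadditive_finite, auto)
  qed
  also have "\<dots> m \<le> (\<Sum>k<N * 2 ^ m. 3 * (25 / 64) ^ m)" for m
   by (intro sum_mono tail)
  also have "\<dots> m = 3 * real N * (25 / 32) ^ m" for m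
   by (simp add: power_divide field_simps) (simp add: power_mult_distrib[symmetric])
  finally have bd: "P.prob (A m) \<le> 3 * real N * (25 / 32) ^ m" for m .
  have "summable (\<lambda>m. P.prob (A m))"
   by (rule summable_comparison_test[where g = "\<lambda>m. 3 * real N * (25 / 32) ^ m"])
    (use bd in \<open>auto intro!: exI[of _ 0] summable_mult summable_geometric\<close>)
  then have "AE v in gaussians. \<forall>\<^sub>F m in sequentially. v \<in> space gaussians - A m"
   using A by (intro borel_cantelli_AE1) (auto simp: P.emeasure_eq_measure)
  then show ?thesis
  proof eventually_elim
   case (elim v)
   then obtain M where M: "\<And>m. M \<le> m \<Longrightarrow> v \<notin> A m \<and> v \<in> space gaussians"
    by (auto simp: eventually_sequentially)
   have "\<bar>dyinc v m k\<bar> \<le> levy_ratio ^ m" if "M \<le> m" "k < N * 2 ^ m" for m k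
    using M[OF that(1)] that(2) unfolding A_def by (metis (mono_tags, lifting) mem_Collect_eq not_less)
   then show ?case by blast
  qed
 qed
 then show ?thesis
  unfolding levy_good_def by (subst AE_all_countable) auto
qed

definition levy_approx :: "(nat \<times> nat \<Rightarrow> real) \<Rightarrow> real \<Rightarrow> nat \<Rightarrow> real" where
 "levy_approx v t m = dysum v m (nat \<lfloor>2 ^ m * t\<rfloor>)"

lemma measurable_levy_approx [measurable]: "(\<lambda>v. levy_approx v t m) \<in> borel_measurable gaussians"
 unfolding levy_approx_def by simp

text \<open>The value 0 off the good set makes every path continuous, not only almost every one;
  this allows the law to be carried by a space of continuous paths.\<close>

definition levy_bm :: "(nat \<times> nat \<Rightarrow> real) \<Rightarrow> real \<Rightarrow> real" where
 "levy_bm v t = (if levy_good v then lim (\<lambda>m. levy_approx v t m) else 0)"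

lemma measurable_levy_bm [measurable]: "(\<lambda>v. levy_bm v t) \<in> borel_measurable gaussians"
 unfolding levy_bm_def by measurable

lemma nat_floor_dyadic_nonpos: "t \<le> 0 \<Longrightarrow> nat \<lfloor>2 ^ m * t\<rfloor> = 0" for t :: real
proof -
 assume "t \<le> 0"
 then have "2 ^ m * t \<le> 0" by (intro mult_nonneg_nonpos) auto
 then show ?thesis by simp
qed

lemma levy_bm_nonpos: "t \<le> 0 \<Longrightarrow> levy_bm v t = 0"
 by (simp add: levy_bm_def levy_approx_def dysum_def nat_floor_dyadic_nonpos)

text \<open>When the level is raised, the number of complete dyadic intervals before
  \<open>t\<close> doubles or doubles plus one, so the approximation changes by at most one
  increment of the finer level.\<close>

lemma dysum_floor_Suc:
 fixes t :: real
 shows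
 "\<bar>levy_approx v t (Suc m) - levy_approx v t m\<bar> \<le> \<bar>dyinc v (Suc m) (2 * nat \<lfloor>2 ^ m * t\<rfloor>)\<bar>"
proof (cases "t < 0")
 case True
 then have "nat \<lfloor>2 ^ m * t\<rfloor> = 0" for m
  by (simp add: nat_floor_dyadic_nonpos)
 then show ?thesis by (simp add: levy_approx_def dysum_def del: power_Suc)
next
 case False
 define K where "K = \<lfloor>2 ^ m * t\<rfloor>"
 have "0 \<le> K" using False by (simp add: K_def)
 have "\<lfloor>2 ^ Suc m * t\<rfloor> = 2 * K \<or> \<lfloor>2 ^ Suc m * t\<rfloor> = 2 * K + 1"
  unfolding K_def power_Suc mult.assoc by linarith
 then have "nat \<lfloor>2 ^ Suc m * t\<rfloor> = 2 * nat K \<or> nat \<lfloor>2 ^ Suc m * t\<rfloor> = Suc (2 * nat K)"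
  using \<open>0 \<le> K\<close> by auto
 moreover have "dysum v (Suc m) (Suc (2 * nat K)) = dysum v (Suc m) (2 * nat K) + dyinc v (Suc m) (2 * nat K)"
  by (simp add: dysum_def)
 ultimately show ?thesis
  by (auto simp: levy_approx_def K_def[symmetric] dysum_double simp del: power_Suc)
qed

text \<open>The geometric series is summed by telescoping: for the ratio 9/10,
  \<open>levy_ratio ^ n = 10 * (levy_ratio ^ n - levy_ratio ^ Suc n)\<close>.\<close>

lemma dysum_cauchy:
 fixes t :: real
 assumes m0: "\<forall>m\<ge>m0. \<forall>k<N * 2 ^ m. \<bar>dyinc v m k\<bar> \<le> levy_ratio ^ m" and t: "t < real N" and m: "m0 \<le> m" "m \<le> n"
 shows "\<bar>levy_approx v t n - levy_approx v t m\<bar> \<le> 10 * (levy_ratio ^ m - levy_ratio ^ n)"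
 using m(2)
proof (induction n rule: dec_induct)
 case (step n)
 have "2 ^ n * t < real (N * 2 ^ n)" using t by (simp add: mult.commute)
 then have "2 * nat \<lfloor>2 ^ n * t\<rfloor> < N * 2 ^ Suc n \<or> nat \<lfloor>2 ^ n * t\<rfloor> = 0"
 proof -
  assume "2 ^ n * t < real (N * 2 ^ n)"
  then have "\<lfloor>2 ^ n * t\<rfloor> < int (N * 2 ^ n)" by (simp add: floor_less_iff)
  then show ?thesis by (auto simp: nat_less_iff)
 qed
 then consider "2 * nat \<lfloor>2 ^ n * t\<rfloor> < N * 2 ^ Suc n" | "N = 0" by (cases "N = 0") auto
 then have "\<bar>levy_approx v t (Suc n) - levy_approx v t n\<bar> \<le> levy_ratio ^ Suc n"
 proof cases
  case 1
  then have "\<bar>dyinc v (Suc n) (2 * nat \<lfloor>2 ^ n * t\<rfloor>)\<bar> \<le> levy_ratio ^ Suc n"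
   using m0 m(1) step.hyps by (meson le_Suc_eq le_trans)
  with dysum_floor_Suc[where v = v and m = n and t = t] show ?thesis by linarith
 next
  case 2
  then have "nat \<lfloor>2 ^ n * t\<rfloor> = 0" for n
   using t by (simp add: nat_floor_dyadic_nonpos)
  then show ?thesis using levy_ratio by (simp add: levy_approx_def dysum_def del: power_Suc)
 qed
 moreover have "levy_ratio ^ Suc n \<le> 10 * (levy_ratio ^ n - levy_ratio ^ Suc n)"
 proof -
  have "levy_ratio ^ Suc n \<le> levy_ratio ^ n"
   using levy_ratio by (intro power_decreasing) auto
  moreover have "10 * (p - levy_ratio * p) = p" for p
   by (simp add: levy_ratio_def)
  from this[of "levy_ratio ^ n"] have "10 * (levy_ratio ^ n - levy_ratio ^ Suc n) = levy_ratio ^ n"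
   by (simp only: power_Suc)
  ultimately show ?thesis by linarith
 qed
 ultimately show ?case using step.IH unfolding right_diff_distrib by linarith
qed simp

lemma levy_bm_limit:
 assumes "levy_good v"
 shows "(levy_approx v t) \<longlonglongrightarrow> levy_bm v t"
proof -
 obtain N :: nat where N: "t < real N" using reals_Archimedean2 by blast
 from assms obtain m0 where m0: "\<forall>m\<ge>m0. \<forall>k<N * 2 ^ m. \<bar>dyinc v m k\<bar> \<le> levy_ratio ^ m"
  unfolding levy_good_def by blast
 have "Cauchy (levy_approx v t)"
 proof (rule metric_CauchyI)
  fix e :: real assume "0 < e"
  then obtain m1 where m1: "levy_ratio ^ m1 < e / 20"
   using real_arch_pow_inv[of "e / 20" levy_ratio] levy_ratio by auto
  define M where "M = max m0 m1"
  have M0: "m0 \<le> M" by (simp add: M_def)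
  have M: "levy_ratio ^ M \<le> levy_ratio ^ m1"
   by (rule power_decreasing) (auto simp: M_def levy_ratio)
  have near: "\<bar>levy_approx v t n - levy_approx v t M\<bar> < e / 2" if "M \<le> n" for n
  proof -
   have "0 \<le> levy_ratio ^ n" using levy_ratio by simp
   with dysum_cauchy[OF m0 N M0 that] M m1 show ?thesis
    unfolding right_diff_distrib by linarith
  qed
  show "\<exists>M. \<forall>m\<ge>M. \<forall>n\<ge>M. dist (levy_approx v t m) (levy_approx v t n) < e"
  proof (intro exI allI impI)
   fix m n assume "M \<le> m" "M \<le> n"
   with near[of m] near[of n] show "dist (levy_approx v t m) (levy_approx v t n) < e"
    unfolding dist_real_def by linarith
  qed
 qed
 then show ?thesis
  using assms by (simp add: levy_bm_def Cauchy_convergent_iff convergent_LIMSEQ_iff)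
qed

text \<open>21 = 10 + 1 + 10: the error of the level \<open>m\<close> approximation at both times,
  and at most one increment of level \<open>m\<close> between them.\<close>

lemma levy_bm_modulus:
 assumes m0: "\<forall>m\<ge>m0. \<forall>k<N * 2 ^ m. \<bar>dyinc v m k\<bar> \<le> levy_ratio ^ m" and good: "levy_good v"
  and m: "m0 \<le> m" and st: "s \<le> t" "t < real N" "t - s \<le> 1 / 2 ^ m"
 shows "\<bar>levy_bm v t - levy_bm v s\<bar> \<le> 21 * levy_ratio ^ m"
proof -
 have lim: "\<bar>levy_bm v r - levy_approx v r m\<bar> \<le> 10 * levy_ratio ^ m" if "r < real N" for r
 proof (rule LIMSEQ_le_const2[OF tendsto_rabs[OF tendsto_diff[OF levy_bm_limit[OF good] tendsto_const]]])
  have "\<bar>levy_approx v r n - levy_approx v r m\<bar> \<le> 10 * levy_ratio ^ m" if n: "m \<le> n" for n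
  proof -
   have "0 \<le> levy_ratio ^ n" using levy_ratio by simp
   with dysum_cauchy[OF m0 \<open>r < real N\<close> m n] show ?thesis unfolding right_diff_distrib by linarith
  qed
  then show "\<exists>n0. \<forall>n\<ge>n0. \<bar>levy_approx v r n - levy_approx v r m\<bar> \<le> 10 * levy_ratio ^ m"
   by blast
 qed
 have "\<bar>levy_approx v t m - levy_approx v s m\<bar> \<le> levy_ratio ^ m"
 proof -
  have le: "2 ^ m * s \<le> 2 ^ m * t" "2 ^ m * t \<le> 2 ^ m * s + 1"
   using st by (auto simp: field_simps)
  then have "\<lfloor>2 ^ m * t\<rfloor> = \<lfloor>2 ^ m * s\<rfloor> \<or> \<lfloor>2 ^ m * t\<rfloor> = \<lfloor>2 ^ m * s\<rfloor> + 1"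
   by linarith
  moreover have nat_cases: "L = K \<or> L = K + 1 \<Longrightarrow> nat L = nat K \<or> nat L = Suc (nat K) \<and> 0 \<le> K" for K L :: int
   by auto
  ultimately consider "nat \<lfloor>2 ^ m * t\<rfloor> = nat \<lfloor>2 ^ m * s\<rfloor>" | "nat \<lfloor>2 ^ m * t\<rfloor> = Suc (nat \<lfloor>2 ^ m * s\<rfloor>)" "0 \<le> \<lfloor>2 ^ m * s\<rfloor>"
   using nat_cases by blast
  then show ?thesis
  proof cases
   case 2
   have "2 ^ m * s < real (N * 2 ^ m)" using st by (simp add: mult.commute)
   then have "\<lfloor>2 ^ m * s\<rfloor> < int (N * 2 ^ m)" by (simp add: floor_less_iff)
   then have "nat \<lfloor>2 ^ m * s\<rfloor> < N * 2 ^ m" using 2 by linarith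
   with m0 m have "\<bar>dyinc v m (nat \<lfloor>2 ^ m * s\<rfloor>)\<bar> \<le> levy_ratio ^ m" by blast
   with 2 show ?thesis by (simp add: levy_approx_def dysum_def)
  qed (use levy_ratio in \<open>simp add: levy_approx_def\<close>)
 qed
 with lim[of s] lim[of t] st show ?thesis by linarith
qed

lemma continuous_levy_bm: "continuous_on UNIV (levy_bm v)"
proof (cases "levy_good v")
 case True
 show ?thesis
  unfolding continuous_on_iff
 proof (intro ballI allI impI)
  fix t e :: real assume "0 < e"
  obtain N :: nat where N: "t + 1 < real N" using reals_Archimedean2 by blast
  from True obtain m0 where m0: "\<forall>m\<ge>m0. \<forall>k<N * 2 ^ m. \<bar>dyinc v m k\<bar> \<le> levy_ratio ^ m"
   unfolding levy_good_def by blast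
  obtain m1 where m1: "levy_ratio ^ m1 < e / 21"
   using real_arch_pow_inv[of "e / 21" levy_ratio] \<open>0 < e\<close> levy_ratio by auto
  define M where "M = max m0 m1"
  have M0: "m0 \<le> M" by (simp add: M_def)
  have M: "levy_ratio ^ M \<le> levy_ratio ^ m1"
   by (rule power_decreasing) (auto simp: M_def levy_ratio)
  have M1: "(1 :: real) / 2 ^ M \<le> 1" by simp
  show "\<exists>d>0. \<forall>s\<in>UNIV. dist s t < d \<longrightarrow> dist (levy_bm v s) (levy_bm v t) < e"
  proof (intro exI conjI ballI impI)
   fix s assume "dist s t < 1 / 2 ^ M"
   then have st: "\<bar>s - t\<bar> < 1 / 2 ^ M" by (simp add: dist_real_def)
   have "\<bar>levy_bm v (max s t) - levy_bm v (min s t)\<bar> \<le> 21 * levy_ratio ^ M"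
   proof (rule levy_bm_modulus[OF m0 True])
    show "max s t < real N" "max s t - min s t \<le> 1 / 2 ^ M"
     using st N M1 by linarith+
   qed (use M0 in auto)
   moreover have "\<bar>levy_bm v (max s t) - levy_bm v (min s t)\<bar> = dist (levy_bm v s) (levy_bm v t)"
    by (cases "s \<le> t") (auto simp: dist_real_def)
   ultimately show "dist (levy_bm v s) (levy_bm v t) < e"
    using M m1 by linarith
  qed simp
 qed
qed (simp add: levy_bm_def)

lemma distr_gaussians_scale:
 fixes I :: "'i set"
 assumes "finite I"
 shows "distr gaussians (PiM I (\<lambda>_. borel)) (\<lambda>w. \<lambda>i\<in>I. s i * w i) = PiM I (\<lambda>i. gauss (s i))"
proof -
 interpret prob_space stdn by (rule prob_space_stdn)
 interpret P: product_prob_space "\<lambda>_. stdn" "UNIV :: 'i set" ..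
 have "P.indep_vars (\<lambda>_. borel) (\<lambda>i w. s i * w i) I"
  by (rule P.indep_vars_compose2[OF P.indep_vars_subset[OF indep_vars_gaussians]]) auto
 from distr_indep_PiM[OF P.prob_space_axioms assms this] show ?thesis
  by (simp add: distr_gaussians_gauss)
qed

lemma distr_gaussians_sum:
 fixes L :: "'i set"
 assumes "finite L"
 shows "distr gaussians borel (\<lambda>w. c * (\<Sum>l\<in>L. w l)) = gauss (\<bar>c\<bar> * sqrt (card L))"
proof (cases "L = {} \<or> c = 0")
 case True
 interpret prob_space stdn by (rule prob_space_stdn)
 interpret P: product_prob_space "\<lambda>_. stdn" "UNIV :: 'i set" ..
 have "distr gaussians borel (\<lambda>w :: 'i \<Rightarrow> real. 0 * w undefined) = gauss 0"
  by (rule distr_gaussians_gauss)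
 with True show ?thesis by auto
next
 case False
 interpret prob_space stdn by (rule prob_space_stdn)
 interpret P: product_prob_space "\<lambda>_. stdn" "UNIV :: 'i set" ..
 have ind: "P.indep_vars (\<lambda>_. borel) (\<lambda>l w. w l) L"
  by (rule P.indep_vars_subset[OF indep_vars_gaussians]) simp
 have 1: "distributed gaussians lborel (\<lambda>w. w l) std_normal_density" for l :: 'i
  using distributed_normal_iff_gauss[of 1 gaussians "\<lambda>w. w l"] distr_gaussians_gauss[of 1 l] by simp
 have "distributed gaussians lborel (\<lambda>w. \<Sum>l\<in>L. w l) (normal_density (\<Sum>l\<in>L. 0) (sqrt (\<Sum>l\<in>L. 1\<^sup>2)))"
  by (rule P.sum_indep_normal) (use assms False ind 1 in auto)
 then have "distributed gaussians lborel (\<lambda>w. 0 + c * (\<Sum>l\<in>L. w l)) (normal_density (0 + c * 0) (\<bar>c\<bar> * sqrt (card L)))"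
  using False assms by (intro P.normal_density_affine) (auto simp: card_gt_0_iff)
 then show ?thesis
  using False assms distributed_normal_iff_gauss[of "\<bar>c\<bar> * sqrt (card L)" gaussians "\<lambda>w. c * (\<Sum>l\<in>L. w l)"]
  by (simp add: card_gt_0_iff)
qed

lemma dyadic_floor_limit:
 assumes "0 \<le> u"
 shows "(\<lambda>m. real (nat \<lfloor>2 ^ m * u\<rfloor>) / 2 ^ m) \<longlonglongrightarrow> u"
proof (rule tendsto_sandwich)
 have "(\<lambda>m. u - (1 / 2) ^ m) \<longlonglongrightarrow> u - 0"
  by (intro tendsto_intros LIMSEQ_realpow_zero) auto
 then show "(\<lambda>m. u - (1 / 2) ^ m) \<longlonglongrightarrow> u" by simp
 have *: "real (nat \<lfloor>2 ^ m * u\<rfloor>) = real_of_int \<lfloor>2 ^ m * u\<rfloor>" for m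
  using assms by simp
 show "\<forall>\<^sub>F m in sequentially. u - (1 / 2) ^ m \<le> real (nat \<lfloor>2 ^ m * u\<rfloor>) / 2 ^ m"
 proof (rule always_eventually, rule allI)
  fix m :: nat
  have "2 ^ m * u - 1 \<le> real_of_int \<lfloor>2 ^ m * u\<rfloor>" by linarith
  then show "u - (1 / 2) ^ m \<le> real (nat \<lfloor>2 ^ m * u\<rfloor>) / 2 ^ m"
   unfolding * using divide_right_mono[of "2 ^ m * u - 1" "real_of_int \<lfloor>2 ^ m * u\<rfloor>" "2 ^ m"]
   by (simp add: power_one_over diff_divide_distrib)
 qed
 show "\<forall>\<^sub>F m in sequentially. real (nat \<lfloor>2 ^ m * u\<rfloor>) / 2 ^ m \<le> u"
  unfolding * by (simp add: field_simps)
qed simp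

text \<open>At each finite level the increments are sums over disjoint blocks of row 0, and
  \<open>levy_step ^^ m\<close> preserves the law, so they are independent Gaussians. Writing these
  as scaled coordinates \<open>r m i * w i\<close> turns the passage to the limit into an
  application of \<open>distr_eq_limit\<close> on both sides.\<close>

lemma levy_bm_increments:
 assumes u0: "0 \<le> u 0" and u: "\<And>i. i < k \<Longrightarrow> u i \<le> u (Suc i)"
 shows "distr gaussians (PiM {..<k} (\<lambda>_. borel)) (\<lambda>v. \<lambda>i\<in>{..<k}. levy_bm v (u (Suc i)) - levy_bm v (u i))
  = PiM {..<k} (\<lambda>i. gauss (sqrt (u (Suc i) - u i)))"
proof -
 interpret prob_space stdn by (rule prob_space_stdn)
 interpret P: product_prob_space "\<lambda>_. stdn" "UNIV :: (nat \<times> nat) set" ..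
 interpret N: product_prob_space "\<lambda>_. stdn" "UNIV :: nat set" ..
 define K where "K m i = nat \<lfloor>2 ^ m * u i\<rfloor>" for m i
 have u_mono: "u i \<le> u j" if "i \<le> j" "j \<le> k" for i j
  using that(1,2) by (induction j rule: dec_induct) (use u in \<open>auto intro: order_trans\<close>)
 have u_nonneg: "0 \<le> u i" if "i \<le> k" for i
  using u_mono[of 0 i] that u0 by simp
 have K_mono: "K m i \<le> K m j" if "i \<le> j" "j \<le> k" for m i j
  unfolding K_def using u_mono[OF that] by (intro nat_mono floor_mono mult_left_mono) auto
 define Y where "Y m i w = (1 / sqrt 2) ^ m * (\<Sum>l\<in>Pair 0 ` {K m i..<K m (Suc i)}. w l)" for m i and w :: "nat \<times> nat \<Rightarrow> real"
 define r where "r m i = sqrt (real (K m (Suc i)) / 2 ^ m - real (K m i) / 2 ^ m)" for m i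
 have Y_gauss: "distr gaussians borel (Y m i) = gauss (r m i)" if "i < k" for m i
 proof -
  have "\<bar>(1 / sqrt 2) ^ m\<bar> * sqrt (card (Pair (0::nat) ` {K m i..<K m (Suc i)})) = r m i"
   using K_mono[of i "Suc i" m] that
   by (simp add: r_def card_image inj_on_def real_sqrt_divide real_sqrt_power power_divide flip: diff_divide_distrib)
  then show ?thesis
   unfolding Y_def by (subst distr_gaussians_sum) auto
 qed
 have Y_indep: "P.indep_vars (\<lambda>_. borel) (Y m) {..<k}" for m
 proof -
  have disj: "disjoint_family_on (\<lambda>i. Pair (0::nat) ` {K m i..<K m (Suc i)}) {..<k}"
   unfolding disjoint_family_on_def
  proof (intro ballI impI)
   fix i j assume "i \<in> {..<k}" "j \<in> {..<k}" "i \<noteq> j"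
   then have "K m (Suc i) \<le> K m j \<or> K m (Suc j) \<le> K m i"
    using K_mono[of "Suc i" j m] K_mono[of "Suc j" i m] by (cases "i < j") auto
   then show "Pair (0::nat) ` {K m i..<K m (Suc i)} \<inter> Pair 0 ` {K m j..<K m (Suc j)} = {}"
    by auto
  qed
  have "P.indep_vars (\<lambda>i. PiM (Pair 0 ` {K m i..<K m (Suc i)}) (\<lambda>_. borel))
    (\<lambda>i w. restrict (\<lambda>l. w l) (Pair 0 ` {K m i..<K m (Suc i)})) {..<k}"
   by (rule P.indep_vars_restrict[OF indep_vars_gaussians _ disj]) simp
  then have "P.indep_vars (\<lambda>_. borel) (\<lambda>i w. Y m i (restrict (\<lambda>l. w l) (Pair 0 ` {K m i..<K m (Suc i)}))) {..<k}"
   by (rule P.indep_vars_compose2) (simp add: Y_def)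
  also have "(\<lambda>i w. Y m i (restrict (\<lambda>l. w l) (Pair 0 ` {K m i..<K m (Suc i)}))) = Y m"
   by (intro ext) (auto simp: Y_def intro!: sum.cong)
  finally show ?thesis .
 qed
 have Y_meas: "Y m i \<in> borel_measurable gaussians" for m i
  unfolding Y_def by measurable
 have X_eq: "levy_approx v (u (Suc i)) m - levy_approx v (u i) m = Y m i ((levy_step ^^ m) v)" if "i < k" for v m i
 proof -
  have "levy_approx v (u (Suc i)) m - levy_approx v (u i) m = (\<Sum>l\<in>{K m i..<K m (Suc i)}. dyinc v m l)"
   unfolding levy_approx_def dysum_def K_def[symmetric]
   using K_mono[of i "Suc i" m] that by (simp add: lessThan_atLeast0 sum_diff_nat_ivl)
  also have "\<dots> = Y m i ((levy_step ^^ m) v)"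
   by (simp add: Y_def dyinc_def sum_distrib_left sum.reindex inj_on_def)
  finally show ?thesis .
 qed
 have X_law: "distr gaussians (PiM {..<k} (\<lambda>_. borel)) (\<lambda>v. \<lambda>i\<in>{..<k}. levy_approx v (u (Suc i)) m - levy_approx v (u i) m)
   = distr gaussians (PiM {..<k} (\<lambda>_. borel)) (\<lambda>w. \<lambda>i\<in>{..<k}. r m i * w i)" for m
 proof -
  have Y_meas': "(\<lambda>w. \<lambda>i\<in>{..<k}. Y m i w) \<in> gaussians \<rightarrow>\<^sub>M PiM {..<k} (\<lambda>_. borel)"
   by (rule measurable_restrict) (rule Y_meas)
  have "distr gaussians (PiM {..<k} (\<lambda>_. borel)) (\<lambda>v. \<lambda>i\<in>{..<k}. levy_approx v (u (Suc i)) m - levy_approx v (u i) m)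
   = distr (distr gaussians gaussians (levy_step ^^ m)) (PiM {..<k} (\<lambda>_. borel)) (\<lambda>w. \<lambda>i\<in>{..<k}. Y m i w)"
   using Y_meas' by (subst distr_distr) (auto simp: X_eq comp_def intro!: distr_cong)
  also have "\<dots> = PiM {..<k} (\<lambda>i. distr gaussians borel (Y m i))"
   unfolding distr_levy_step_pow by (rule distr_indep_PiM[OF P.prob_space_axioms _ Y_indep]) simp
  also have "\<dots> = PiM {..<k} (\<lambda>i. gauss (r m i))"
   by (rule PiM_cong) (auto simp: Y_gauss)
  also have "\<dots> = distr gaussians (PiM {..<k} (\<lambda>_. borel)) (\<lambda>w. \<lambda>i\<in>{..<k}. r m i * w i)"
   by (rule distr_gaussians_scale[symmetric]) simp
  finally show ?thesis .
 qed
 have r_lim: "(\<lambda>m. r m i) \<longlonglongrightarrow> sqrt (u (Suc i) - u i)" if "i < k" for i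
  unfolding r_def K_def using u_nonneg[of i] u_nonneg[of "Suc i"] that
  by (intro tendsto_real_sqrt tendsto_diff dyadic_floor_limit) auto
 have "distr gaussians (PiM {..<k} (\<lambda>_. borel)) (\<lambda>v. \<lambda>i\<in>{..<k}. levy_bm v (u (Suc i)) - levy_bm v (u i))
  = distr gaussians (PiM {..<k} (\<lambda>_. borel)) (\<lambda>w. \<lambda>i\<in>{..<k}. sqrt (u (Suc i) - u i) * w i)"
 proof (rule distr_eq_limit[OF P.prob_space_axioms N.prob_space_axioms _ _ _ _ X_law])
  show "AE v in gaussians. (\<lambda>m. levy_approx v (u (Suc i)) m - levy_approx v (u i) m) \<longlonglongrightarrow> levy_bm v (u (Suc i)) - levy_bm v (u i)" for i
   using AE_levy_good by eventually_elim (intro tendsto_diff levy_bm_limit)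
  show "AE w in gaussians. (\<lambda>m. r m i * w i) \<longlonglongrightarrow> sqrt (u (Suc i) - u i) * w i" if "i \<in> {..<k}" for i
   using r_lim[of i] that by (auto intro!: tendsto_mult)
 qed auto
 also have "\<dots> = PiM {..<k} (\<lambda>i. gauss (sqrt (u (Suc i) - u i)))"
  by (rule distr_gaussians_scale) simp
 finally show ?thesis .
qed

subsection \<open>Wiener measure\<close>

text \<open>The trace of the product sigma-algebra is taken, because a set such as that of all
  continuous functions is not an event of the uncountable product.\<close>

definition path_space :: "(real \<Rightarrow> real) set \<Rightarrow> (real \<Rightarrow> real) measure" where
 "path_space C = restrict_space (PiM UNIV (\<lambda>_. borel)) C"

lemma space_path_space [simp]: "space (path_space C) = C"
 by (auto simp: path_space_def space_restrict_space space_PiM)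

lemma measurable_path_spaceI:
 assumes "\<And>s. (\<lambda>x. f x s) \<in> borel_measurable M" "\<And>x. x \<in> space M \<Longrightarrow> f x \<in> C"
 shows "f \<in> M \<rightarrow>\<^sub>M path_space C"
 unfolding path_space_def
 using assms by (intro measurable_restrict_space2 measurable_abs_UNIV) auto

lemma measurable_path_space_eval [measurable]: "(\<lambda>f. f s) \<in> borel_measurable (path_space C)"
 unfolding path_space_def by (intro measurable_restrict_space1) simp

text \<open>The paths live on the whole line and vanish up to time 0, so that the shifted path
  \<open>w j (s - t j)\<close> in \<open>drive\<close> is continuous at all real times, also before
  its start.\<close>

definition wiener1 :: "(real \<Rightarrow> real) measure" where
 "wiener1 = distr gaussians (path_space {f. continuous_on UNIV f \<and> (\<forall>s\<le>0. f s = 0)}) levy_bm"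

abbreviation wiener :: "paths measure" where
 "wiener \<equiv> PiM UNIV (\<lambda>_. wiener1)"

lemma measurable_levy_bm_path:
 "levy_bm \<in> gaussians \<rightarrow>\<^sub>M path_space {f. continuous_on UNIV f \<and> (\<forall>s\<le>0. f s = 0)}"
 by (rule measurable_path_spaceI) (auto simp: continuous_levy_bm levy_bm_nonpos)

lemma sets_wiener1 [measurable_cong]: "sets wiener1 = sets (path_space {f. continuous_on UNIV f \<and> (\<forall>s\<le>0. f s = 0)})"
 by (simp add: wiener1_def)

lemma space_wiener1: "space wiener1 = {f. continuous_on UNIV f \<and> (\<forall>s\<le>0. f s = 0)}"
 by (simp add: wiener1_def)

lemma prob_space_wiener1: "prob_space wiener1"
 unfolding wiener1_def
 using prob_space.prob_space_distr[OF prob_space_PiM[OF prob_space_stdn] measurable_levy_bm_path] .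

lemma prob_space_wiener: "prob_space wiener"
 by (rule prob_space_PiM) (rule prob_space_wiener1)

interpretation W: prob_space wiener
 by (rule prob_space_wiener)

lemma measurable_wiener1_eval [measurable]: "(\<lambda>f. f s) \<in> borel_measurable wiener1"
 using measurable_path_space_eval by (simp add: measurable_cong_sets[OF sets_wiener1 refl])

lemma measurable_wiener_eval [measurable]: "(\<lambda>w. w j s) \<in> borel_measurable wiener"
 using measurable_compose[OF measurable_component_singleton[of j UNIV "\<lambda>_. wiener1"] measurable_wiener1_eval] by simp

lemma space_wiener: "space wiener = {w. \<forall>j. continuous_on UNIV (w j) \<and> (\<forall>s\<le>0. w j s = 0)}"
 by (auto simp: space_PiM space_wiener1)

lemma wienerD:
 assumes "w \<in> space wiener"
 shows "continuous_on A (w j)" "s \<le> 0 \<Longrightarrow> w j s = 0"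
 using assms by (auto simp: space_wiener intro: continuous_on_subset)

lemma measurable_wienerI:
 assumes "\<And>j s. (\<lambda>x. f x j s) \<in> borel_measurable M" "\<And>x. x \<in> space M \<Longrightarrow> f x \<in> space wiener"
 shows "f \<in> M \<rightarrow>\<^sub>M wiener"
proof -
 have "(\<lambda>x. f x j) \<in> M \<rightarrow>\<^sub>M wiener1" for j
  using assms unfolding measurable_cong_sets[OF refl sets_wiener1]
  by (intro measurable_path_spaceI) (auto simp: space_wiener)
 then show ?thesis by (intro measurable_abs_UNIV) auto
qed

lemma wiener1_increments:
 assumes "0 \<le> u 0" and "\<And>i. i < k \<Longrightarrow> u i \<le> u (Suc i)"
 shows "distr wiener1 (PiM {..<k} (\<lambda>_. borel)) (\<lambda>f. \<lambda>i\<in>{..<k}. f (u (Suc i)) - f (u i))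
  = PiM {..<k} (\<lambda>i. gauss (sqrt (u (Suc i) - u i)))"
proof -
 have m: "(\<lambda>f. \<lambda>i\<in>{..<k}. f (u (Suc i)) - f (u i)) \<in> path_space C \<rightarrow>\<^sub>M PiM {..<k} (\<lambda>_. borel)" for C
  by (rule measurable_restrict) measurable
 show ?thesis
  unfolding wiener1_def
  by (subst distr_distr[OF m measurable_levy_bm_path]) (simp add: comp_def levy_bm_increments[OF assms])
qed

definition brownian_law :: "(real \<Rightarrow> real) measure \<Rightarrow> bool" where
 "brownian_law Q \<longleftrightarrow> prob_space Q \<and> sets Q = sets wiener1 \<and>
  (\<forall>u (k :: nat). 0 \<le> u 0 \<longrightarrow> (\<forall>i<k. u i \<le> u (Suc i)) \<longrightarrow>
   distr Q (PiM {..<k} (\<lambda>_. borel)) (\<lambda>f. \<lambda>i\<in>{..<k}. f (u (Suc i)) - f (u i))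
    = PiM {..<k} (\<lambda>i. gauss (sqrt (u (Suc i) - u i))))"

lemma brownian_law_wiener1: "brownian_law wiener1"
 by (simp add: brownian_law_def prob_space_wiener1 wiener1_increments)

lemma brownian_law_increments:
 assumes Q: "brownian_law Q" and u: "0 \<le> u 0" "\<And>i. i < k \<Longrightarrow> u i \<le> u (Suc i)"
 shows "distr (PiM UNIV (\<lambda>_ :: nat. Q)) (PiM ({..<n} \<times> {..<k}) (\<lambda>_. borel)) (\<lambda>w. \<lambda>(j, i)\<in>{..<n} \<times> {..<k}. w j (u (Suc i)) - w j (u i))
  = PiM ({..<n} \<times> {..<k}) (\<lambda>(j, i). gauss (sqrt (u (Suc i) - u i)))"
proof (rule product_sigma_finite.PiM_eqI)
 let ?G = "\<lambda>(j :: nat, i). gauss (sqrt (u (Suc i) - u i))"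
 let ?X = "\<lambda>w. \<lambda>(j, i)\<in>{..<n} \<times> {..<k}. w j (u (Suc i)) - w j (u i)"
 interpret G: prob_space "?G x" for x
  by (cases x) (simp add: prob_space_gauss)
 show "product_sigma_finite ?G" ..
 interpret W: prob_space Q using Q by (simp add: brownian_law_def)
 have sQ [measurable_cong]: "sets Q = sets wiener1" using Q by (simp add: brownian_law_def)
 interpret P: product_prob_space "\<lambda>_. Q" "UNIV :: nat set" ..
 interpret G': product_prob_space "\<lambda>i. gauss (sqrt (u (Suc i) - u i))" "{..<k}"
  using prob_space_gauss by (intro product_prob_spaceI)
 have sG: "sets (?G x) = sets borel" for x by (cases x) simp
 show "sets (distr (PiM UNIV (\<lambda>_. Q)) (PiM ({..<n} \<times> {..<k}) (\<lambda>_. borel)) ?X) = sets (PiM ({..<n} \<times> {..<k}) ?G)"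
  by (simp add: sG cong: sets_PiM_cong)
 have m: "?X \<in> PiM UNIV (\<lambda>_. Q) \<rightarrow>\<^sub>M PiM ({..<n} \<times> {..<k}) (\<lambda>_. borel)"
  by (rule measurable_restrict) (auto split: prod.splits)
 fix A assume A: "\<And>x. x \<in> {..<n} \<times> {..<k} \<Longrightarrow> A x \<in> sets (?G x)"
 define B where "B j = {f \<in> space Q. \<forall>i<k. f (u (Suc i)) - f (u i) \<in> A (j, i)}" for j
 have A': "A (j, i) \<in> sets borel" if "j < n" "i < k" for j i
  using A[of "(j, i)"] that by simp
 have B: "B j \<in> sets Q" if "j < n" for j
  unfolding B_def using A'[OF that] by measurable
 have "emeasure Q (B j) = (\<Prod>i<k. emeasure (?G (j, i)) (A (j, i)))" if "j < n" for j
 proof -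
  let ?h = "\<lambda>f. \<lambda>i\<in>{..<k}. f (u (Suc i)) - f (u i) :: real" and ?E = "PiE {..<k} (\<lambda>i. A (j, i))"
  have h: "?h \<in> Q \<rightarrow>\<^sub>M PiM {..<k} (\<lambda>_. borel)"
   by (rule measurable_restrict) measurable
  have E: "?E \<in> sets (PiM {..<k} (\<lambda>_. borel))"
   using A'[OF that] by (intro sets_PiM_I_finite) auto
  have "?h -` ?E \<inter> space Q = B j"
  proof (rule set_eqI)
   fix f
   show "f \<in> ?h -` ?E \<inter> space Q \<longleftrightarrow> f \<in> B j"
    unfolding B_def Int_iff vimage_eq PiE_iff mem_Collect_eq by auto
  qed
  then have "emeasure Q (B j) = emeasure (distr Q (PiM {..<k} (\<lambda>_. borel)) ?h) ?E"
   by (simp only: emeasure_distr[OF h E])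
  also have "distr Q (PiM {..<k} (\<lambda>_. borel)) ?h = PiM {..<k} (\<lambda>i. gauss (sqrt (u (Suc i) - u i)))"
   using Q u by (auto simp: brownian_law_def)
  also have "emeasure \<dots> ?E = (\<Prod>i<k. emeasure (?G (j, i)) (A (j, i)))"
   using A'[OF that] by (subst G'.emeasure_PiM) auto
  finally show ?thesis .
 qed
 then have "(\<Prod>x\<in>{..<n} \<times> {..<k}. emeasure (?G x) (A x)) = (\<Prod>j<n. emeasure Q (B j))"
  by (simp add: prod.cartesian_product case_prod_beta)
 also have "\<dots> = emeasure (PiM UNIV (\<lambda>_. Q)) {w \<in> space (PiM UNIV (\<lambda>_. Q)). \<forall>j\<in>{..<n}. w j \<in> B j}"
  using B by (intro P.emeasure_PiM_Collect[symmetric]) auto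
 also have "{w \<in> space (PiM UNIV (\<lambda>_. Q)). \<forall>j\<in>{..<n}. w j \<in> B j} = ?X -` PiE ({..<n} \<times> {..<k}) A \<inter> space (PiM UNIV (\<lambda>_. Q))"
 proof (rule set_eqI)
  fix w :: "paths"
  have "w j \<in> space Q" if "w \<in> space (PiM UNIV (\<lambda>_. Q))" for j
   using that by (simp add: space_PiM PiE_iff)
  then show "w \<in> {w \<in> space (PiM UNIV (\<lambda>_. Q)). \<forall>j\<in>{..<n}. w j \<in> B j} \<longleftrightarrow> w \<in> ?X -` PiE ({..<n} \<times> {..<k}) A \<inter> space (PiM UNIV (\<lambda>_. Q))"
   unfolding B_def Int_iff vimage_eq PiE_iff mem_Collect_eq by auto
 qed
 also have "emeasure (PiM UNIV (\<lambda>_. Q)) \<dots> = emeasure (distr (PiM UNIV (\<lambda>_. Q)) (PiM ({..<n} \<times> {..<k}) (\<lambda>_. borel)) ?X) (PiE ({..<n} \<times> {..<k}) A)"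
 proof (rule emeasure_distr[OF m, symmetric])
  show "PiE ({..<n} \<times> {..<k}) A \<in> sets (PiM ({..<n} \<times> {..<k}) (\<lambda>_. borel))"
   using A' by (intro sets_PiM_I_finite) auto
 qed
 finally show "emeasure (distr (PiM UNIV (\<lambda>_. Q)) (PiM ({..<n} \<times> {..<k}) (\<lambda>_. borel)) ?X) (PiE ({..<n} \<times> {..<k}) A)
   = (\<Prod>x\<in>{..<n} \<times> {..<k}. emeasure (?G x) (A x))" by simp
qed simp

lemma sets_wiener_le:
 assumes "space N = space wiener" "\<And>j s. (\<lambda>w. w j s) \<in> borel_measurable N"
 shows "sets wiener \<subseteq> sets N"
proof
 have m: "(\<lambda>f. f) \<in> N \<rightarrow>\<^sub>M wiener"
  using assms by (intro measurable_wienerI) auto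
 fix A assume A: "A \<in> sets wiener"
 from measurable_sets[OF m this] sets.sets_into_space[OF A] show "A \<in> sets N"
  by (simp add: assms Int_absorb2)
qed

lemma finite_times_grid:
 assumes "finite S"
 obtains u :: "nat \<Rightarrow> real" and k where "u 0 = 0" "\<And>i. u i \<le> u (Suc i)" "\<And>s. s \<in> S \<Longrightarrow> 0 \<le> s \<Longrightarrow> \<exists>l\<le>k. u l = s"
proof -
 define U where "U = insert 0 {s \<in> S. 0 \<le> s}"
 define xs where "xs = sorted_list_of_set U"
 have fin: "finite U" using assms by (simp add: U_def)
 have xs: "set xs = U" "sorted xs" "xs \<noteq> []"
  using fin by (auto simp: xs_def U_def simp del: sorted_list_of_set_insert_remove)
 define k where "k = length xs - 1"
 \<comment> \<open>The sequence stays constant after the last time, so it is monotone at all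
   indices.\<close>
 define u where "u i = xs ! min i k" for i
 have len: "min i k < length xs" for i
  using xs(3) by (cases xs) (auto simp: k_def)
 have "xs ! 0 = 0"
 proof -
  have "0 \<in> set xs" using xs(1) by (simp add: U_def)
  then obtain i where i: "i < length xs" "xs ! i = 0" by (auto simp: in_set_conv_nth)
  with sorted_nth_mono[OF xs(2), of 0 i] have "xs ! 0 \<le> 0" by simp
  moreover have "xs ! 0 \<in> U" using xs by (metis length_greater_0_conv nth_mem)
  ultimately show ?thesis by (auto simp: U_def)
 qed
 then have "u 0 = 0" by (simp add: u_def)
 moreover have "u i \<le> u (Suc i)" for i
  unfolding u_def by (rule sorted_nth_mono[OF xs(2)]) (use len in auto)
 moreover have "\<exists>l\<le>k. u l = s" if "s \<in> S" "0 \<le> s" for s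
 proof -
  have "s \<in> set xs" using xs(1) that by (simp add: U_def)
  then obtain l where "l < length xs" "xs ! l = s" by (auto simp: in_set_conv_nth)
  then show ?thesis by (intro exI[of _ l]) (auto simp: u_def k_def min_def)
 qed
 ultimately show ?thesis by (rule that)
qed

text \<open>The time \<open>c\<close> and the bound \<open>n\<^sub>0\<close> are free parameters of
  the test: increments need only be compared on grids that contain \<open>c\<close> and on at least
  \<open>n\<^sub>0\<close> motions. For \<open>distr_swap_at\<close> these are the time of the
  interchange and a bound beyond both interchanged indices.\<close>

lemma wiener_eqI:
 assumes Q: "prob_space Q" "sets Q = sets wiener"
  and c: "0 \<le> c"
  and inc: "\<And>(n :: nat) (k :: nat) l u. n\<^sub>0 \<le> n \<Longrightarrow> 0 \<le> u 0 \<Longrightarrow> (\<And>i. u i \<le> u (Suc i)) \<Longrightarrow> l \<le> k \<Longrightarrow> u l = c \<Longrightarrow>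
   distr Q (PiM ({..<n} \<times> {..<k}) (\<lambda>_. borel)) (\<lambda>w. \<lambda>(j, i)\<in>{..<n} \<times> {..<k}. w j (u (Suc i)) - w j (u i))
   = PiM ({..<n} \<times> {..<k}) (\<lambda>(j, i). gauss (sqrt (u (Suc i) - u i)))"
 shows "Q = wiener"
proof (rule measure_eqI_marginals[OF Q(1) prob_space_wiener Q(2), where I = UNIV and h = "\<lambda>(j, s) w. w j s"])
 have sp: "space Q = space wiener" by (rule sets_eq_imp_space_eq[OF Q(2)])
 show "(\<lambda>w. (\<lambda>(j, s) w. w j s) x w) \<in> borel_measurable Q" for x
  using measurable_wiener_eval by (cases x) (simp add: measurable_cong_sets[OF Q(2) refl])
 show "sets Q \<subseteq> sets N" if "space N = space Q" "\<And>x. x \<in> UNIV \<Longrightarrow> (\<lambda>(j, s) w. w j s) x \<in> borel_measurable N"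
  for N :: "paths measure"
  unfolding Q(2) using that(1) that(2)[of "(j, s)" for j s]
  by (intro sets_wiener_le) (auto simp: sp)
 fix J :: "(nat \<times> real) set" assume J: "finite J"
 obtain n where n: "\<And>j s. (j, s) \<in> J \<Longrightarrow> j < n" "n\<^sub>0 \<le> n"
 proof
  fix j s assume "(j, s) \<in> J"
  then show "j < Suc (max n\<^sub>0 (Max (fst ` J)))"
   using J by (auto simp: less_Suc_eq_le le_max_iff_disj intro!: Max_ge rev_image_eqI)
 qed simp
 have "finite (insert c (snd ` J))" using J by simp
 then obtain u k where u: "u 0 = 0" "\<And>i. u i \<le> u (Suc i)" "\<And>s. s \<in> insert c (snd ` J) \<Longrightarrow> 0 \<le> s \<Longrightarrow> \<exists>l\<le>k. u l = s"
  using finite_times_grid[of "insert c (snd ` J)"] by metis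
 obtain lc where lc: "lc \<le> k" "u lc = c" using u(3)[of c] c by auto
 define l where "l s = (if s \<le> 0 then 0 else SOME l. l \<le> k \<and> u l = s)" for s
 have l: "l s \<le> k" "u (l s) = max 0 s" if "s \<in> snd ` J" for s
 proof -
  have "l s \<le> k \<and> u (l s) = max 0 s"
  proof (cases "s \<le> 0")
   case False
   then have "\<exists>l\<le>k. u l = s" using u(3)[OF insertI2[OF that]] by simp
   from someI_ex[OF this] False show ?thesis by (simp add: l_def)
  qed (simp add: l_def u)
  then show "l s \<le> k" "u (l s) = max 0 s" by auto
 qed
 let ?B = "PiM ({..<n} \<times> {..<k}) (\<lambda>_. borel) :: (nat \<times> nat \<Rightarrow> real) measure"
 let ?X = "\<lambda>w. \<lambda>(j, i)\<in>{..<n} \<times> {..<k}. w j (u (Suc i)) - w j (u i)"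
 define \<phi> where "\<phi> y = (\<lambda>(j, s)\<in>J. \<Sum>i<l s. y (j, i))" for y :: "nat \<times> nat \<Rightarrow> real"
 have X: "?X \<in> wiener \<rightarrow>\<^sub>M ?B"
  by (rule measurable_restrict) (auto split: prod.splits)
 have \<phi>: "\<phi> \<in> ?B \<rightarrow>\<^sub>M PiM J (\<lambda>_. borel)"
  unfolding \<phi>_def
 proof (rule measurable_restrict)
  fix x assume x: "x \<in> J"
  then have "{..<l (snd x)} \<subseteq> {..<k}" "fst x < n"
   using l(1)[of "snd x"] n(1)[of "fst x" "snd x"] by auto
  then show "(\<lambda>y. case x of (j, s) \<Rightarrow> \<Sum>i<l s. y (j, i)) \<in> borel_measurable ?B"
   by (auto simp: case_prod_beta intro!: borel_measurable_sum measurable_component_singleton)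
 qed
 have repr: "(\<lambda>x\<in>J. (case x of (j, s) \<Rightarrow> \<lambda>w. w j s) w) = \<phi> (?X w)" if "w \<in> space wiener" for w
 proof (rule ext)
  fix x
  show "(\<lambda>x\<in>J. (case x of (j, s) \<Rightarrow> \<lambda>w. w j s) w) x = \<phi> (?X w) x"
  proof (cases "x \<in> J")
   case True
   obtain j s where x: "x = (j, s)" by (cases x)
   have s: "s \<in> snd ` J" using True x by force
   have "(\<Sum>i<l s. ?X w (j, i)) = (\<Sum>i<l s. w j (u (Suc i)) - w j (u i))"
    using l(1)[OF s] n(1)[of j s] True x by (intro sum.cong) auto
   also have "\<dots> = w j (max 0 s) - w j 0"
    by (subst sum_lessThan_telescope) (simp add: l[OF s] u)
   also have "\<dots> = w j s"
    using wienerD(2)[OF that] by (auto simp: max_def)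
   finally show ?thesis using True x by (simp add: \<phi>_def)
  qed (simp add: \<phi>_def)
 qed
 have main: "distr L (PiM J (\<lambda>_. borel)) (\<lambda>w. \<lambda>x\<in>J. (case x of (j, s) \<Rightarrow> \<lambda>w. w j s) w) = distr (distr L ?B ?X) (PiM J (\<lambda>_. borel)) \<phi>"
  if "sets L = sets wiener" for L
  using X \<phi> that repr sets_eq_imp_space_eq[OF that]
  by (subst distr_distr) (auto simp: comp_def measurable_cong_sets[OF that refl] intro!: distr_cong)
 show "distr Q (PiM J (\<lambda>_. borel)) (\<lambda>w. \<lambda>x\<in>J. (case x of (j, s) \<Rightarrow> \<lambda>w. w j s) w) =
   distr wiener (PiM J (\<lambda>_. borel)) (\<lambda>w. \<lambda>x\<in>J. (case x of (j, s) \<Rightarrow> \<lambda>w. w j s) w)"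
  unfolding main[OF Q(2)] main[OF refl]
  using inc[OF n(2) _ u(2) lc] brownian_law_increments[OF brownian_law_wiener1, of u k n] u by simp
qed

text \<open>\<open>wiener_eqI\<close> is applied to the countable power of \<open>Q\<close>, and the
  result is projected to one coordinate.\<close>

lemma brownian_law_unique:
 assumes "brownian_law Q"
 shows "Q = wiener1"
proof -
 have sQ: "sets Q = sets wiener1" and Q: "prob_space Q" using assms by (auto simp: brownian_law_def)
 have "PiM UNIV (\<lambda>_. Q) = wiener"
  by (rule wiener_eqI[where c = 0 and n\<^sub>0 = 0]) (use assms Q sQ in \<open>auto intro!: prob_space_PiM sets_PiM_cong brownian_law_increments\<close>)
 then have "distr (PiM UNIV (\<lambda>_ :: nat. Q)) Q (\<lambda>w. w 0) = distr wiener wiener1 (\<lambda>w. w 0)"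
  using sQ by (intro distr_cong) auto
 then show ?thesis
  using distr_PiM_component[of UNIV "\<lambda>_ :: nat. Q" 0] distr_PiM_component[of UNIV "\<lambda>_ :: nat. wiener1" 0]
  by (simp add: Q prob_space_wiener1)
qed

subsection \<open>Coalescing paths\<close>

definition glue :: "real \<Rightarrow> (real \<Rightarrow> real) \<Rightarrow> (real \<Rightarrow> real) \<Rightarrow> real \<Rightarrow> real" where
 "glue T a b s = (if \<exists>u\<in>{T..s}. a u = b u then b s else a s)"

text \<open>Glueing to one lower index after the other avoids selecting the index that is met first.
  \<open>coal_met\<close> and \<open>coal_not_met\<close> show that the result nevertheless
  satisfies the required conditions.\<close>

fun coal :: "(nat \<Rightarrow> real) \<Rightarrow> paths \<Rightarrow> paths" where
 "coal t B j = foldl (\<lambda>z i. glue (max (t i) (t j)) z (coal t B i)) (B j) [0..<j]"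

declare coal.simps [simp del]

text \<open>The path \<open>j\<close> after it has been glued to the paths \<open>i < k\<close>.\<close>

definition coal_part :: "(nat \<Rightarrow> real) \<Rightarrow> paths \<Rightarrow> nat \<Rightarrow> paths" where
 "coal_part t B j k = foldl (\<lambda>z i. glue (max (t i) (t j)) z (coal t B i)) (B j) [0..<k]"

lemma coal_part_simps [simp]:
 "coal_part t B j 0 = B j"
 "coal_part t B j (Suc k) = glue (max (t k) (t j)) (coal_part t B j k) (coal t B k)"
 by (simp_all add: coal_part_def)

lemma coal_eq_part: "coal t B j = coal_part t B j j"
 by (subst coal.simps) (simp add: coal_part_def)

text \<open>The switch takes place at the infimum of the closed set of meeting times, and there both
  paths agree.\<close>

lemma continuous_glue:
 assumes a: "continuous_on UNIV a" and b: "continuous_on UNIV b"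
 shows "continuous_on UNIV (glue T a b)"
proof (cases "\<exists>u\<ge>T. a u = b u")
 case False
 then have "glue T a b = a" by (auto simp: glue_def fun_eq_iff)
 with a show ?thesis by simp
next
 case True
 define S where "S = {u. T \<le> u \<and> a u = b u}"
 have "closed S"
 proof -
  have "S = {T..} \<inter> {u. a u = b u}" by (auto simp: S_def)
  then show ?thesis using a b by (auto intro!: closed_Int closed_Collect_eq)
 qed
 moreover have S: "S \<noteq> {}" "bdd_below S"
  using True by (auto simp: S_def intro: bdd_belowI[of _ T])
 ultimately have r: "Inf S \<in> S" by (rule closed_contains_Inf[rotated 2])
 have "glue T a b = (\<lambda>s. if s \<le> Inf S then a s else b s)"
 proof
  fix s
  have "(\<exists>u\<in>{T..s}. a u = b u) \<longleftrightarrow> Inf S \<le> s"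
  proof
   assume "\<exists>u\<in>{T..s}. a u = b u"
   then obtain u where "u \<in> S" "u \<le> s" by (auto simp: S_def)
   with cInf_lower[OF this(1) S(2)] show "Inf S \<le> s" by simp
  next
   assume "Inf S \<le> s"
   with r show "\<exists>u\<in>{T..s}. a u = b u" by (auto simp: S_def)
  qed
  with r show "glue T a b s = (if s \<le> Inf S then a s else b s)"
   by (auto simp: glue_def S_def)
 qed
 moreover have "continuous_on ({..Inf S} \<union> {Inf S..}) (\<lambda>s. if s \<le> Inf S then a s else b s)"
  using r a b by (intro continuous_on_If) (auto simp: S_def intro: continuous_on_subset)
 moreover have "{..Inf S} \<union> {Inf S..} = UNIV" by auto
 ultimately show ?thesis by simp
qed

lemma continuous_coal:
 assumes "\<And>i. i \<le> j \<Longrightarrow> continuous_on UNIV (B i)"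
 shows "continuous_on UNIV (coal t B j)"
 using assms
proof (induction j rule: less_induct)
 case (less j)
 have "continuous_on UNIV (coal_part t B j k)" if "k \<le> j" for k
  using that by (induction k) (auto intro!: continuous_glue less)
 then show ?case by (simp add: coal_eq_part)
qed

text \<open>This is adaptedness; it makes the meeting time of two coalescing paths a stopping time
  in \<open>distr_cbm_adjacent_bounded\<close>.\<close>

lemma coal_causal:
 assumes "\<And>i u. i \<le> j \<Longrightarrow> u \<le> s \<Longrightarrow> B i u = B' i u"
 shows "coal t B j s = coal t B' j s"
 using assms
proof (induction j arbitrary: s rule: less_induct)
 case (less j)
 have "coal_part t B j k v = coal_part t B' j k v" if "k \<le> j" "v \<le> s" for k v
  using that
 proof (induction k arbitrary: v)
  case (Suc k)
  have *: "coal_part t B j k u = coal_part t B' j k u" "coal t B k u = coal t B' k u" if "u \<le> v" for u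
   using Suc that less.prems by (auto intro!: less.IH)
  show ?case
   using * by (auto simp: glue_def)
 qed (use less.prems in auto)
 then show ?case by (simp add: coal_eq_part)
qed

lemma coal_before: "s < t j \<Longrightarrow> coal t B j s = B j s"
proof -
 assume s: "s < t j"
 have "coal_part t B j k s = B j s" for k
  using s by (induction k) (auto simp: glue_def)
 then show ?thesis by (simp add: coal_eq_part)
qed

lemma coal_start: "coal t B j (t j) = B j (t j)"
proof -
 have "coal_part t B j k (t j) = B j (t j)" for k
  by (induction k) (auto simp: glue_def)
 then show ?thesis by (simp add: coal_eq_part)
qed

text \<open>Two nested inductions. The inner one runs over the paths to which \<open>j\<close> has
  been glued so far: once the partial path meets one of them, it follows that path. If the next
  glueing diverts it to path \<open>k\<close>, then \<open>k\<close> itself meets \<open>i\<close>,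
  and the outer induction merges \<open>k\<close> and \<open>i\<close>.\<close>

lemma coal_met:
 assumes "i < j" "met_by t (coal t B) i j s"
 shows "coal t B j s = coal t B i s"
 using assms
proof (induction j arbitrary: i s rule: less_induct)
 case (less j)
 let ?Y = "coal t B" and ?Z = "coal_part t B j"
 have "?Z k s = ?Y i s" if "k \<le> j" "i < k" "t i \<le> u" "t j \<le> u" "u \<le> s" "?Y i u = ?Z k u" for k i u s
  using that
 proof (induction k arbitrary: i u s)
  case (Suc k)
  let ?T = "max (t k) (t j)"
  show ?case
  proof (cases "i = k")
   case True
   have "\<exists>v\<in>{?T..s}. ?Z k v = ?Y k v"
   proof (cases "\<exists>v\<in>{?T..u}. ?Z k v = ?Y k v")
    case False
    then have "?Z (Suc k) u = ?Z k u" by (simp add: glue_def)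
    then have "?Z k u = ?Y k u" using Suc.prems(6) True by metis
    with Suc.prems True show ?thesis by (intro bexI[of _ u]) auto
   qed (use Suc.prems in auto)
   then show ?thesis by (simp add: glue_def True)
  next
   case False
   with Suc.prems have i: "i < k" by simp
   \<comment> \<open>The outer induction hypothesis for the pair \<open>i < k\<close>; it applies
     because \<open>k < j\<close>.\<close>
   have kmet: "?Y k s = ?Y i s" if "t k \<le> v" "u \<le> v" "v \<le> s" "?Y k v = ?Y i v" for v
    using that Suc.prems i by (intro less.IH) (auto simp: met_by_def intro!: exI[of _ v])
   show ?thesis
   proof (cases "\<exists>v\<in>{?T..u}. ?Z k v = ?Y k v")
    case True
    then obtain v where v: "?T \<le> v" "v \<le> u" "?Z k v = ?Y k v" by auto
    then have "?Z (Suc k) u = ?Y k u" by (auto simp: glue_def)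
    with Suc.prems have "?Y k u = ?Y i u" by simp
    with kmet[of u] v Suc.prems have "?Y k s = ?Y i s" by simp
    moreover have "?Z (Suc k) s = ?Y k s"
     using v Suc.prems by (auto simp: glue_def)
    ultimately show ?thesis by simp
   next
    case False
    then have "?Z (Suc k) u = ?Z k u" by (simp add: glue_def)
    then have Zi: "?Z k v = ?Y i v" if "u \<le> v" for v
     using Suc.prems i that by (intro Suc.IH[of i u v]) auto
    show ?thesis
    proof (cases "\<exists>v\<in>{?T..s}. ?Z k v = ?Y k v")
     case True
     then obtain v where v: "?T \<le> v" "v \<le> s" "?Z k v = ?Y k v" by auto
     with False have "u < v" by force
     with v Zi[of v] kmet[of v] have "?Y k s = ?Y i s" by simp
     with v show ?thesis by (auto simp: glue_def)
    next
     case False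
     then show ?thesis using Zi[of s] Suc.prems by (simp add: glue_def)
    qed
   qed
  qed
 qed simp
 from this[of j i] less.prems show ?case
  by (auto simp: met_by_def coal_eq_part[of t B j])
qed

text \<open>A glueing that took effect up to the time \<open>s\<close> would show up as a meeting
  with the path to which it led.\<close>

lemma coal_not_met:
 assumes "t j \<le> s" "\<And>i. i < j \<Longrightarrow> \<not> met_by t (coal t B) i j s"
 shows "coal t B j s = B j s"
proof -
 let ?Y = "coal t B" and ?Z = "coal_part t B j"
 have "?Z k v = B j v"
  if "k \<le> j" "\<And>i u. i < k \<Longrightarrow> t i \<le> u \<Longrightarrow> t j \<le> u \<Longrightarrow> u \<le> v \<Longrightarrow> ?Y i u \<noteq> ?Z k u" for k v
  using that
 proof (induction k arbitrary: v)
  case (Suc k)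
  have no: "\<not> (\<exists>u\<in>{max (t k) (t j)..v}. ?Z k u = ?Y k u)"
  proof
   assume "\<exists>u\<in>{max (t k) (t j)..v}. ?Z k u = ?Y k u"
   then have "?Z (Suc k) v = ?Y k v" "t k \<le> v" "t j \<le> v" by (auto simp: glue_def)
   with Suc.prems(2)[of k v] show False by simp
  qed
  then have eq: "?Z (Suc k) u = ?Z k u" if "u \<le> v" for u
   using that by (auto simp: glue_def)
  have "?Z k v = B j v"
  proof (rule Suc.IH)
   fix i u assume "i < k" "t i \<le> u" "t j \<le> u" "u \<le> v"
   with Suc.prems(2)[of i u] eq[of u] show "?Y i u \<noteq> ?Z k u" by simp
  qed (use Suc.prems in simp)
  with eq[of v] show ?case by simp
 qed simp
 from this[of j s] show ?thesis
  using assms(2) by (auto simp: coal_eq_part[of t B j] met_by_def)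
qed

text \<open>The conditions of \<open>coalescing_brownian_motions\<close> for one sample point, with
  the starting value read off from the driver.\<close>

definition coalesces :: "nat \<Rightarrow> (nat \<Rightarrow> real) \<Rightarrow> paths \<Rightarrow> paths \<Rightarrow> bool" where
 "coalesces n t B Y \<longleftrightarrow> (\<forall>j<n. Y j (t j) = B j (t j) \<and> continuous_on {t j..} (Y j)
  \<and> (\<forall>s\<ge>t j. (\<forall>i<j. \<not> met_by t Y i j s) \<longrightarrow> Y j s = B j s)
  \<and> (\<forall>i<j. \<forall>s\<ge>t j. met_by t Y i j s \<longrightarrow> Y j s = Y i s))"

lemma met_by_mono: "met_by t y i j u \<Longrightarrow> u \<le> s \<Longrightarrow> met_by t y i j s"
 by (auto simp: met_by_def)

lemma coalesces_free:
 assumes "coalesces n t B Y" "j < n" "t j \<le> s" "\<And>i. i < j \<Longrightarrow> \<not> met_by t Y i j s"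
 shows "Y j s = B j s"
 using assms unfolding coalesces_def by blast

lemma coalesces_met:
 assumes "coalesces n t B Y" "j < n" "t j \<le> s" "i < j" "met_by t Y i j s"
 shows "Y j s = Y i s"
 using assms unfolding coalesces_def by blast

lemma coalesces_coal:
 assumes "\<And>j. j < n \<Longrightarrow> continuous_on UNIV (B j)"
 shows "coalesces n t B (coal t B)"
 unfolding coalesces_def
proof (intro allI impI conjI)
 fix j assume "j < n"
 then have "continuous_on UNIV (coal t B j)"
  using assms by (intro continuous_coal) simp
 then show "continuous_on {t j..} (coal t B j)" by (rule continuous_on_subset) simp
qed (auto simp: coal_start coal_met coal_not_met)

lemma coalesces_first_meeting:
 assumes Y: "coalesces n t B Y" and j: "j < n" and B: "continuous_on {t j..} (B j)"
  and met: "i < j" "met_by t Y i j s"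
 obtains i u where "i < j" "t i \<le> u" "t j \<le> u" "u \<le> s" "Y i u = Y j u"
  "\<And>v. t j \<le> v \<Longrightarrow> v \<le> u \<Longrightarrow> Y j v = B j v"
proof -
 define S where "S = (\<Union>i<j. {u \<in> {max (t i) (t j)..s}. Y i u = Y j u})"
 have contY: "continuous_on {t i..} (Y i)" if "i \<le> j" for i
  using Y j that by (auto simp: coalesces_def)
 have "closed S"
  unfolding S_def
 proof (intro closed_UN ballI)
  fix i assume i: "i \<in> {..<j}"
  have "{u \<in> {max (t i) (t j)..s}. Y i u = Y j u} = {u \<in> {max (t i) (t j)..s}. Y i u - Y j u = 0}"
   by auto
  moreover have "closed {u \<in> {max (t i) (t j)..s}. Y i u - Y j u = 0}"
   using i by (intro continuous_closed_preimage_constant continuous_on_diff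
     continuous_on_subset[OF contY[of i]] continuous_on_subset[OF contY[of j]]) auto
  ultimately show "closed {u \<in> {max (t i) (t j)..s}. Y i u = Y j u}" by simp
 qed simp
 moreover have S: "S \<noteq> {}" "bdd_below S"
 proof -
  from met show "S \<noteq> {}" by (auto simp: S_def met_by_def)
  show "bdd_below S" by (rule bdd_belowI[of _ "t j"]) (auto simp: S_def)
 qed
 ultimately have T: "Inf S \<in> S" by (rule closed_contains_Inf[rotated 2])
 then obtain i where i: "i < j" "t i \<le> Inf S" "t j \<le> Inf S" "Inf S \<le> s" "Y i (Inf S) = Y j (Inf S)"
  by (auto simp: S_def)
 have before: "Y j v = B j v" if v: "t j \<le> v" "v < Inf S" for v
 proof -
  have "\<not> met_by t Y k j v" if "k < j" for k
  proof
   assume "met_by t Y k j v"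
   then obtain w where w: "t k \<le> w" "t j \<le> w" "w \<le> v" "Y k w = Y j w"
    by (auto simp: met_by_def)
   then have "w \<in> S" "w \<le> v"
    using that v i by (auto simp: S_def intro!: bexI[of _ k])
   with cInf_lower[OF this(1) S(2)] v show False by simp
  qed
  then show ?thesis by (rule coalesces_free[OF Y j v(1)])
 qed
 \<comment> \<open>At the first meeting time itself the path still equals its driver, by continuity
   from the left or by the starting condition.\<close>
 have "Y j (Inf S) = B j (Inf S)"
 proof (cases "Inf S = t j")
  case True
  with Y j show ?thesis by (simp add: coalesces_def)
 next
  case False
  with i have lt: "t j < Inf S" by simp
  have "closed {v \<in> {t j..Inf S}. Y j v - B j v = 0}"
   by (intro continuous_closed_preimage_constant continuous_on_diff
     continuous_on_subset[OF contY[of j]] continuous_on_subset[OF B]) auto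
  then have "closure {t j..<Inf S} \<subseteq> {v \<in> {t j..Inf S}. Y j v - B j v = 0}"
   using before by (intro closure_minimal) auto
  then show ?thesis using lt by (simp add: closure_atLeastLessThan subset_iff)
 qed
 with before have "Y j v = B j v" if "t j \<le> v" "v \<le> Inf S" for v
  using that by (cases "v = Inf S") auto
 with i that show ?thesis by blast
qed

text \<open>Up to its first meeting, path \<open>j\<close> equals the common driver in both
  families, and the lower paths agree by induction. Hence the earlier of the two first meetings
  takes place in both families, and from then on both copies of \<open>j\<close> follow the same
  lower path.\<close>

lemma coalesces_unique:
 assumes Y: "coalesces n t B Y" and Y': "coalesces n t B' Y'"
  and B: "\<And>j. j < n \<Longrightarrow> continuous_on {t j..} (B j)" "\<And>j. j < n \<Longrightarrow> continuous_on {t j..} (B' j)"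
  and BB': "\<And>j s. j < n \<Longrightarrow> t j \<le> s \<Longrightarrow> B j s = B' j s"
  and "j < n" "t j \<le> s"
 shows "Y j s = Y' j s"
 using assms(6,7)
proof (induction j arbitrary: s rule: less_induct)
 case (less j)
 note coalY = coalesces_met[OF Y less.prems] and coalY' = coalesces_met[OF Y' less.prems]
 have freeY: "Y j u = B j u" if "\<And>i. i < j \<Longrightarrow> \<not> met_by t Y i j s" "t j \<le> u" "u \<le> s" for u
  using that met_by_mono[of t Y _ j u s] by (intro coalesces_free[OF Y less.prems(1)]) auto
 have freeY': "Y' j u = B' j u" if "\<And>i. i < j \<Longrightarrow> \<not> met_by t Y' i j s" "t j \<le> u" "u \<le> s" for u
  using that met_by_mono[of t Y' _ j u s] by (intro coalesces_free[OF Y' less.prems(1)]) auto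
 have same: "Y i u = Y' i u" if "i < j" "t i \<le> u" for i u
  using less.IH[OF that(1) _ that(2)] that less.prems(1) by simp
 consider "\<And>i. i < j \<Longrightarrow> \<not> met_by t Y i j s" "\<And>i. i < j \<Longrightarrow> \<not> met_by t Y' i j s"
  | i where "i < j" "met_by t Y i j s" "\<And>i. i < j \<Longrightarrow> \<not> met_by t Y' i j s"
  | i where "i < j" "met_by t Y' i j s" "\<And>i. i < j \<Longrightarrow> \<not> met_by t Y i j s"
  | i i' where "i < j" "met_by t Y i j s" "i' < j" "met_by t Y' i' j s"
  by blast
 then show ?case
 proof cases
  case 1
  with freeY[of s] freeY'[of s] BB'[OF less.prems] less.prems show ?thesis by simp
 next
  case 2
  from coalesces_first_meeting[OF Y less.prems(1) B(1)[OF less.prems(1)] 2(1,2)]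
  obtain i u where u: "i < j" "t i \<le> u" "t j \<le> u" "u \<le> s" "Y i u = Y j u"
   "\<And>v. t j \<le> v \<Longrightarrow> v \<le> u \<Longrightarrow> Y j v = B j v" by metis
  have "Y' i u = Y' j u"
   using u(5) u(6)[of u] u freeY'[OF 2(3), of u] same[of i u] BB'[OF less.prems(1), of u] by simp
  with u have "met_by t Y' i j s" by (auto simp: met_by_def)
  with 2(3)[OF u(1)] show ?thesis by simp
 next
  case 3
  from coalesces_first_meeting[OF Y' less.prems(1) B(2)[OF less.prems(1)] 3(1,2)]
  obtain i u where u: "i < j" "t i \<le> u" "t j \<le> u" "u \<le> s" "Y' i u = Y' j u"
   "\<And>v. t j \<le> v \<Longrightarrow> v \<le> u \<Longrightarrow> Y' j v = B' j v" by metis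
  have "Y i u = Y j u"
   using u(5) u(6)[of u] u freeY[OF 3(3), of u] same[of i u] BB'[OF less.prems(1), of u] by simp
  with u have "met_by t Y i j s" by (auto simp: met_by_def)
  with 3(3)[OF u(1)] show ?thesis by simp
 next
  case 4
  from coalesces_first_meeting[OF Y less.prems(1) B(1)[OF less.prems(1)] 4(1,2)]
  obtain i u where u: "i < j" "t i \<le> u" "t j \<le> u" "u \<le> s" "Y i u = Y j u"
   "\<And>v. t j \<le> v \<Longrightarrow> v \<le> u \<Longrightarrow> Y j v = B j v" by metis
  from coalesces_first_meeting[OF Y' less.prems(1) B(2)[OF less.prems(1)] 4(3,4)]
  obtain i' u' where u': "i' < j" "t i' \<le> u'" "t j \<le> u'" "u' \<le> s" "Y' i' u' = Y' j u'"
   "\<And>v. t j \<le> v \<Longrightarrow> v \<le> u' \<Longrightarrow> Y' j v = B' j v" by metis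
  show ?thesis
  proof (cases "u \<le> u'")
   case True
   then have "Y' i u = Y' j u"
    using u(5) u(6)[of u] u u'(6)[of u] same[of i u] BB'[OF less.prems(1), of u] by simp
   with u have "met_by t Y' i j s" "met_by t Y i j s" by (auto simp: met_by_def)
   with coalY[OF u(1)] coalY'[OF u(1)] same[of i s] u show ?thesis by simp
  next
   case False
   then have "Y i' u' = Y j u'"
    using u'(5) u'(6)[of u'] u' u(6)[of u'] same[of i' u'] BB'[OF less.prems(1), of u'] by simp
   with u' have "met_by t Y i' j s" "met_by t Y' i' j s" by (auto simp: met_by_def)
   with coalY[OF u'(1)] coalY'[OF u'(1)] same[of i' s] u' show ?thesis by simp
  qed
 qed
qed

text \<open>By the intermediate value theorem a change of order forces a meeting, after which the
  paths coincide; but at the later of the two times they are assumed different.\<close>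

lemma coal_noncross_aux:
 assumes B: "\<And>i. continuous_on UNIV (B i)" and "i < j"
  and s: "max (t i) (t j) \<le> s" "max (t i) (t j) \<le> s'"
  and c: "coal t B i s < coal t B j s" "coal t B j s' < coal t B i s'"
 shows False
proof -
 let ?Y = "coal t B"
 have cont: "continuous_on A (?Y k)" for k A
  using continuous_on_subset[OF continuous_coal] B by blast
 have "\<exists>u. min s s' \<le> u \<and> u \<le> max s s' \<and> ?Y i u - ?Y j u = 0"
 proof (cases "s \<le> s'")
  case True
  have "\<exists>u\<ge>s. u \<le> s' \<and> ?Y i u - ?Y j u = 0"
   using True c by (intro IVT' continuous_on_diff cont) auto
  with True show ?thesis by auto
 next
  case False
  have "\<exists>u\<ge>s'. u \<le> s \<and> ?Y i u - ?Y j u = 0"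
   using False c by (intro IVT2' continuous_on_diff cont) auto
  with False show ?thesis by auto
 qed
 then obtain u where u: "min s s' \<le> u" "u \<le> max s s'" "?Y i u = ?Y j u" by auto
 then have "met_by t ?Y i j (max s s')"
  using s by (auto simp: met_by_def intro!: exI[of _ u])
 from coal_met[OF \<open>i < j\<close> this] c show False by (auto simp: max_def split: if_splits)
qed

lemma coal_noncross:
 assumes "\<And>i. continuous_on UNIV (B i)"
  and "t i \<le> s" "t j \<le> s" "t i \<le> s'" "t j \<le> s'"
  and "coal t B i s < coal t B j s"
 shows "coal t B i s' \<le> coal t B j s'"
proof (rule ccontr)
 assume n: "\<not> coal t B i s' \<le> coal t B j s'"
 with assms(6) have "i \<noteq> j" by auto
 then consider "i < j" | "j < i" by linarith
 then show False
 proof cases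
  case 1
  show False by (rule coal_noncross_aux[of B i j t s s']) (use assms n 1 in auto)
 next
  case 2
  show False by (rule coal_noncross_aux[of B j i t s' s]) (use assms n 2 in auto)
 qed
qed

lemma coal_merge:
 assumes "t i \<le> u" "t j \<le> u" "coal t B i u = coal t B j u" "u \<le> s"
 shows "coal t B i s = coal t B j s"
proof -
 consider "i < j" | "j < i" | "i = j" by linarith
 then show ?thesis
 proof cases
  case 1
  moreover have "met_by t (coal t B) i j s" using assms by (auto simp: met_by_def)
  ultimately show ?thesis by (simp add: coal_met)
 next
  case 2
  moreover have "met_by t (coal t B) j i s" using assms by (auto simp: met_by_def)
  ultimately show ?thesis by (simp add: coal_met)
 qed simp
qed

subsection \<open>Measurability of meeting and coalescence\<close>

text \<open>On a compact interval the continuous gap vanishes somewhere iff it becomes smaller than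
  every \<open>1 / Suc n\<close> at rational times: its minimum is attained.\<close>

lemma measurable_meet:
 fixes a b :: "'a \<Rightarrow> real \<Rightarrow> real"
 assumes m [measurable]: "\<And>s. (\<lambda>w. a w s) \<in> borel_measurable M" "\<And>s. (\<lambda>w. b w s) \<in> borel_measurable M"
  and c: "\<And>w. w \<in> space M \<Longrightarrow> continuous_on {T..s} (a w)" "\<And>w. w \<in> space M \<Longrightarrow> continuous_on {T..s} (b w)"
 shows "Measurable.pred M (\<lambda>w. \<exists>u\<in>{T..s}. a w u = b w u)"
proof (cases "T \<le> s")
 case True
 \<comment> \<open>Clipping to the interval lets the quantifier run over all rationals, and both end
   points are reached.\<close>
 define q where "q r = min s (max T (of_rat r))" for r
 have "(\<exists>u\<in>{T..s}. a w u = b w u) \<longleftrightarrow> (\<forall>n::nat. \<exists>r::rat. \<bar>a w (q r) - b w (q r)\<bar> < 1 / Suc n)"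
  if w: "w \<in> space M" for w
 proof -
  let ?g = "\<lambda>u. \<bar>a w u - b w u\<bar>"
  have g: "continuous_on {T..s} ?g"
   using c[OF w] by (intro continuous_intros)
  show ?thesis
  proof safe
   fix u n assume u: "u \<in> {T..s}" "a w u = b w u"
   obtain d where d: "0 < d" "\<And>v. v \<in> {T..s} \<Longrightarrow> dist v u < d \<Longrightarrow> dist (?g v) (?g u) < 1 / Suc n"
    using g u(1) unfolding continuous_on_iff by (metis of_nat_0_less_iff zero_less_Suc zero_less_divide_1_iff)
   obtain r where r: "u - d < of_rat r" "of_rat r < u + d"
    using of_rat_dense[of "u - d" "u + d"] d(1) by auto
   have "q r \<in> {T..s}" "dist (q r) u < d"
    using True u r by (auto simp: q_def dist_real_def min_def max_def abs_less_iff)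
   from d(2)[OF this] u show "\<exists>r. \<bar>a w (q r) - b w (q r)\<bar> < 1 / Suc n"
    by (auto simp: dist_real_def)
  next
   assume *: "\<forall>n::nat. \<exists>r. \<bar>a w (q r) - b w (q r)\<bar> < 1 / Suc n"
   obtain u where u: "u \<in> {T..s}" "\<And>v. v \<in> {T..s} \<Longrightarrow> ?g u \<le> ?g v"
    using continuous_attains_inf[of "{T..s}" ?g] g True by auto
   have "?g u \<le> 0"
   proof (rule ccontr)
    assume "\<not> ?g u \<le> 0"
    then obtain n where n: "1 / Suc n < ?g u"
     using reals_Archimedean[of "?g u"] by (auto simp: inverse_eq_divide)
    from * obtain r where "\<bar>a w (q r) - b w (q r)\<bar> < 1 / Suc n" by blast
    moreover have "q r \<in> {T..s}" using True by (auto simp: q_def)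
    ultimately show False using u(2)[of "q r"] n by linarith
   qed
   with u(1) show "\<exists>u\<in>{T..s}. a w u = b w u" by (intro bexI[of _ u]) auto
  qed
 qed
 then show ?thesis by (simp cong: measurable_cong)
qed simp

lemma measurable_coal:
 fixes B :: "'a \<Rightarrow> paths"
 assumes m: "\<And>j s. (\<lambda>w. B w j s) \<in> borel_measurable M"
  and c: "\<And>w j. w \<in> space M \<Longrightarrow> continuous_on UNIV (B w j)"
 shows "(\<lambda>w. coal t (B w) j s) \<in> borel_measurable M"
proof (induction j arbitrary: s rule: less_induct)
 case (less j)
 have cont: "continuous_on UNIV (coal_part t (B w) j k)" if "w \<in> space M" for w k
  using c[OF that] by (induction k) (auto intro: continuous_glue continuous_coal)
 have "(\<lambda>w. coal_part t (B w) j k s) \<in> borel_measurable M" if "k \<le> j" for k s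
  using that
 proof (induction k arbitrary: s)
  case (Suc k)
  have [measurable]: "(\<lambda>w. coal_part t (B w) j k s) \<in> borel_measurable M" "(\<lambda>w. coal t (B w) k s) \<in> borel_measurable M" for s
   using Suc less by auto
  have [measurable]: "Measurable.pred M (\<lambda>w. \<exists>u\<in>{max (t k) (t j)..s}. coal_part t (B w) j k u = coal t (B w) k u)"
  proof (rule measurable_meet)
   fix w assume w: "w \<in> space M"
   show "continuous_on {max (t k) (t j)..s} (coal_part t (B w) j k)"
    by (rule continuous_on_subset[OF cont[OF w]]) simp
   show "continuous_on {max (t k) (t j)..s} (coal t (B w) k)"
    by (rule continuous_on_subset[OF continuous_coal[OF c[OF w]]]) simp
  qed auto
  show ?case by (simp add: glue_def)
 qed (simp add: m)
 then show ?case by (simp add: coal_eq_part)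
qed

lemma (in prob_space) indep_vars_restrict_space:
 assumes ind: "indep_vars (\<lambda>_. N) X I" and C: "\<And>i w. i \<in> I \<Longrightarrow> w \<in> space M \<Longrightarrow> X i w \<in> C"
 shows "indep_vars (\<lambda>_. restrict_space N C) X I"
 unfolding indep_vars_def
proof (intro conjI ballI)
 show "random_variable (restrict_space N C) (X i)" if "i \<in> I" for i
  using ind C that by (intro measurable_restrict_space2) (auto simp: indep_vars_def)
 have "indep_sets (\<lambda>i. sigma_sets (space M) {X i -` A \<inter> space M |A. A \<in> sets N}) I"
  using ind by (simp add: indep_vars_def)
 then show "indep_sets (\<lambda>i. sigma_sets (space M) {X i -` A \<inter> space M |A. A \<in> sets (restrict_space N C)}) I"
 proof (rule indep_sets_mono_sets)
  fix i assume i: "i \<in> I"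
  show "sigma_sets (space M) {X i -` A \<inter> space M |A. A \<in> sets (restrict_space N C)} \<subseteq>
   sigma_sets (space M) {X i -` A \<inter> space M |A. A \<in> sets N}"
  proof (rule sigma_sets_mono', safe)
   fix A assume "A \<in> sets (restrict_space N C)"
   then obtain A' where A': "A' \<in> sets N" "A = C \<inter> A'" by (auto simp: sets_restrict_space)
   have "X i -` A \<inter> space M = X i -` A' \<inter> space M" using C[OF i] A' by auto
   with A' show "\<exists>A'. X i -` A \<inter> space M = X i -` A' \<inter> space M \<and> A' \<in> sets N" by blast
  qed
 qed
qed

lemma indep_vars_coordinates:
 assumes "prob_space N"
 shows "prob_space.indep_vars (PiM UNIV (\<lambda>_. N)) (\<lambda>_. N) (\<lambda>j w. w j) UNIV"
proof -
 interpret prob_space N by fact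
 interpret P: product_prob_space "\<lambda>_. N" UNIV ..
 show ?thesis
  by (subst P.indep_vars_iff_distr_eq_PiM) (auto simp: P.PiM_component restrict_UNIV distr_id2)
qed

definition paths_space :: "paths measure" where
 "paths_space = PiM UNIV (\<lambda>_. path_space {f. continuous_on UNIV f})"

lemma space_paths_space: "space paths_space = {z. \<forall>j. continuous_on UNIV (z j)}"
 by (auto simp: paths_space_def space_PiM)

lemma measurable_paths_spaceI:
 assumes "\<And>j s. (\<lambda>x. f x j s) \<in> borel_measurable M" "\<And>x j. x \<in> space M \<Longrightarrow> continuous_on UNIV (f x j)"
 shows "f \<in> M \<rightarrow>\<^sub>M paths_space"
 unfolding paths_space_def
 using assms by (intro measurable_abs_UNIV measurable_path_spaceI) auto

lemma measurable_paths_space_eval [measurable]: "(\<lambda>z. z j s) \<in> borel_measurable paths_space"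
 unfolding paths_space_def
 using measurable_compose[OF measurable_component_singleton[of j UNIV "\<lambda>_. path_space {f. continuous_on UNIV f}"] measurable_path_space_eval]
 by simp

definition drive :: "(nat \<Rightarrow> real) \<Rightarrow> (nat \<Rightarrow> real) \<Rightarrow> paths \<Rightarrow> paths" where
 "drive x t w j s = x j + w j (s - t j)"

definition cbm :: "(nat \<Rightarrow> real) \<Rightarrow> (nat \<Rightarrow> real) \<Rightarrow> paths \<Rightarrow> paths" where
 "cbm x t w = coal t (drive x t w)"

lemma measurable_drive [measurable]: "(\<lambda>w. drive x t w j s) \<in> borel_measurable wiener"
 unfolding drive_def by measurable

lemma continuous_drive:
 assumes "w \<in> space wiener"
 shows "continuous_on UNIV (drive x t w j)"
proof -
 have "continuous_on UNIV (\<lambda>s. w j (s - t j))"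
  by (rule continuous_on_compose2[OF wienerD(1)[OF assms, where A = UNIV]]) (auto intro: continuous_intros)
 then show ?thesis
  unfolding drive_def by (rule continuous_on_add[OF continuous_on_const])
qed

lemma measurable_cbm [measurable]: "(\<lambda>w. cbm x t w j s) \<in> borel_measurable wiener"
 unfolding cbm_def by (rule measurable_coal) (auto simp: continuous_drive)

lemma continuous_cbm: "w \<in> space wiener \<Longrightarrow> continuous_on UNIV (cbm x t w j)"
 unfolding cbm_def by (rule continuous_coal) (auto simp: continuous_drive)

lemma cbm_start: "w \<in> space wiener \<Longrightarrow> cbm x t w j (t j) = x j"
 using wienerD(2)[of w 0 j] by (simp add: cbm_def coal_start drive_def)

lemma measurable_cbm_paths [measurable]: "cbm x t \<in> wiener \<rightarrow>\<^sub>M paths_space"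
 by (rule measurable_paths_spaceI) (auto simp: continuous_cbm)

section \<open>Identification of abstract coalescing Brownian motions with the Wiener model\<close>

lemma distr_const_gauss: "prob_space M \<Longrightarrow> distr M borel (\<lambda>_. 0) = gauss 0"
 using prob_space.distr_const[of M "0 :: real" borel] prob_space.distr_const[OF prob_space_stdn, of "0 :: real" borel]
 by (simp add: gauss_def)

lemma brownian_motion_fromD:
 assumes "brownian_motion_from M x t\<^sub>0 B"
 shows "prob_space M"
  "t\<^sub>0 \<le> t \<Longrightarrow> B t \<in> borel_measurable M"
  "w \<in> space M \<Longrightarrow> B t\<^sub>0 w = x"
  "w \<in> space M \<Longrightarrow> continuous_on {t\<^sub>0..} (\<lambda>t. B t w)"
  "t\<^sub>0 \<le> s \<Longrightarrow> s < t \<Longrightarrow> distributed M lborel (\<lambda>w. B t w - B s w) (normal_density 0 (sqrt (t - s)))"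
  "t\<^sub>0 \<le> u 0 \<Longrightarrow> (\<And>i. i < k \<Longrightarrow> u i \<le> u (Suc i)) \<Longrightarrow>
   prob_space.indep_vars M (\<lambda>_. borel) (\<lambda>i w. B (u (Suc i)) w - B (u i) w) {..<k}"
proof -
 note a1 = assms[unfolded brownian_motion_from_def]
 note a2 = conjunct2[OF a1]
 note a3 = conjunct2[OF a2]
 note a4 = conjunct2[OF a3]
 note a5 = conjunct2[OF a4]
 show "prob_space M" by (rule conjunct1[OF a1])
 show "t\<^sub>0 \<le> t \<Longrightarrow> B t \<in> borel_measurable M"
  using conjunct1[OF a2] by blast
 show "w \<in> space M \<Longrightarrow> B t\<^sub>0 w = x" "w \<in> space M \<Longrightarrow> continuous_on {t\<^sub>0..} (\<lambda>t. B t w)"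
  using conjunct1[OF a3] by blast+
 show "t\<^sub>0 \<le> s \<Longrightarrow> s < t \<Longrightarrow> distributed M lborel (\<lambda>w. B t w - B s w) (normal_density 0 (sqrt (t - s)))"
  using conjunct1[OF a4] by blast
 show "t\<^sub>0 \<le> u 0 \<Longrightarrow> (\<And>i. i < k \<Longrightarrow> u i \<le> u (Suc i)) \<Longrightarrow>
   prob_space.indep_vars M (\<lambda>_. borel) (\<lambda>i w. B (u (Suc i)) w - B (u i) w) {..<k}"
  by (rule a5[rule_format]) auto
qed

text \<open>Nothing is known about \<open>B\<close> before \<open>t\<^sub>0\<close>; the clock
  \<open>max r 0\<close> freezes the shifted path there and turns it into an element of the space of
  \<open>wiener1\<close>, whose law \<open>brownian_law_unique\<close> identifies.\<close>

lemma brownian_motion_from_law: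
 assumes "brownian_motion_from M x t\<^sub>0 B"
 shows "(\<lambda>w r. B (t\<^sub>0 + max r 0) w - x) \<in> M \<rightarrow>\<^sub>M wiener1"
  and "distr M wiener1 (\<lambda>w r. B (t\<^sub>0 + max r 0) w - x) = wiener1"
proof -
 interpret prob_space M by (rule brownian_motion_fromD(1)[OF assms])
 let ?X = "\<lambda>w r. B (t\<^sub>0 + max r 0) w - x"
 have B [measurable]: "B t \<in> borel_measurable M" if "t\<^sub>0 \<le> t" for t
  by (rule brownian_motion_fromD(2)[OF assms that])
 show X: "?X \<in> M \<rightarrow>\<^sub>M wiener1"
  unfolding measurable_cong_sets[OF refl sets_wiener1]
 proof (rule measurable_path_spaceI)
  show "(\<lambda>w. B (t\<^sub>0 + max s 0) w - x) \<in> borel_measurable M" for s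
   by (intro borel_measurable_diff B) auto
  fix w assume "w \<in> space M"
  then have "B t\<^sub>0 w = x" "continuous_on {t\<^sub>0..} (\<lambda>t. B t w)"
   using brownian_motion_fromD(3,4)[OF assms] by auto
  moreover have "continuous_on UNIV (\<lambda>r. B (t\<^sub>0 + max r 0) w)"
   by (rule continuous_on_compose2[OF calculation(2)]) (auto intro!: continuous_intros)
  ultimately show "?X w \<in> {f. continuous_on UNIV f \<and> (\<forall>s\<le>0. f s = 0)}"
   by (auto intro!: continuous_on_diff[OF _ continuous_on_const])
 qed
 have gauss: "distr M borel (\<lambda>w. B t w - B s w) = gauss (sqrt (t - s))" if "t\<^sub>0 \<le> s" "s \<le> t" for s t
 proof (cases "s = t")
  case True
  then show ?thesis by (simp add: distr_const_gauss prob_space_axioms)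
 next
  case False
  then have "distributed M lborel (\<lambda>w. B t w - B s w) (normal_density 0 (sqrt (t - s)))"
   using that by (intro brownian_motion_fromD(5)[OF assms]) auto
  with False that show ?thesis by (simp add: distributed_normal_iff_gauss)
 qed
 have "brownian_law (distr M wiener1 ?X)"
  unfolding brownian_law_def
 proof (intro conjI allI impI)
  show "prob_space (distr M wiener1 ?X)" by (rule prob_space_distr[OF X])
  fix u :: "nat \<Rightarrow> real" and k :: nat assume u: "0 \<le> u 0" "\<forall>i<k. u i \<le> u (Suc i)"
  have u_nonneg: "0 \<le> u i" if "i \<le> k" for i
   using that by (induction i) (use u in \<open>auto intro: order_trans\<close>)
  have m: "(\<lambda>f. \<lambda>i\<in>{..<k}. f (u (Suc i)) - f (u i)) \<in> wiener1 \<rightarrow>\<^sub>M PiM {..<k} (\<lambda>_. borel)"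
   by (rule measurable_restrict) measurable
  have "distr (distr M wiener1 ?X) (PiM {..<k} (\<lambda>_. borel)) (\<lambda>f. \<lambda>i\<in>{..<k}. f (u (Suc i)) - f (u i))
   = distr M (PiM {..<k} (\<lambda>_. borel)) (\<lambda>w. \<lambda>i\<in>{..<k}. B (t\<^sub>0 + u (Suc i)) w - B (t\<^sub>0 + u i) w)"
  proof (subst distr_distr[OF m X], rule distr_cong)
   fix w
   have "max (u i) 0 = u i" if "i \<le> k" for i using u_nonneg[OF that] by simp
   then show "((\<lambda>f. \<lambda>i\<in>{..<k}. f (u (Suc i)) - f (u i)) \<circ> ?X) w =
    (\<lambda>i\<in>{..<k}. B (t\<^sub>0 + u (Suc i)) w - B (t\<^sub>0 + u i) w)"
    by (auto simp: fun_eq_iff restrict_def)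
  qed simp_all
  also have "\<dots> = PiM {..<k} (\<lambda>i. distr M borel (\<lambda>w. B (t\<^sub>0 + u (Suc i)) w - B (t\<^sub>0 + u i) w))"
  proof (rule distr_indep_PiM[OF prob_space_axioms])
   have "indep_vars (\<lambda>_. borel) (\<lambda>i w. B ((\<lambda>i. t\<^sub>0 + u i) (Suc i)) w - B ((\<lambda>i. t\<^sub>0 + u i) i) w) {..<k}"
    using u by (intro brownian_motion_fromD(6)[OF assms]) auto
   then show "indep_vars (\<lambda>_. borel) (\<lambda>i w. B (t\<^sub>0 + u (Suc i)) w - B (t\<^sub>0 + u i) w) {..<k}" by simp
  qed simp
  also have "\<dots> = PiM {..<k} (\<lambda>i. gauss (sqrt (u (Suc i) - u i)))"
   by (rule PiM_cong) (use u u_nonneg in \<open>auto simp: gauss\<close>)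
  finally show "distr (distr M wiener1 ?X) (PiM {..<k} (\<lambda>_. borel)) (\<lambda>f. \<lambda>i\<in>{..<k}. f (u (Suc i)) - f (u i))
   = PiM {..<k} (\<lambda>i. gauss (sqrt (u (Suc i) - u i)))" .
 qed simp
 then show "distr M wiener1 ?X = wiener1" by (rule brownian_law_unique)
qed

lemma independent_brownian_motions_law:
 assumes "independent_brownian_motions M n x t B"
 shows "distr M (PiM {..<n} (\<lambda>_. wiener1)) (\<lambda>w. \<lambda>j\<in>{..<n}. \<lambda>r. B j (t j + max r 0) w - x j)
  = PiM {..<n} (\<lambda>_. wiener1)"
proof -
 interpret prob_space M using assms by (simp add: independent_brownian_motions_def)
 have B: "brownian_motion_from M (x j) (t j) (B j)" if "j < n" for j
  using assms that by (simp add: independent_brownian_motions_def)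
 let ?X = "\<lambda>j w r. B j (t j + max r 0) w - x j"
 have "indep_vars (\<lambda>j. PiM {t j..} (\<lambda>_. borel)) (\<lambda>j w. \<lambda>s\<in>{t j..}. B j s w) {..<n}"
  using assms by (simp add: independent_brownian_motions_def)
 then have "indep_vars (\<lambda>_. PiM UNIV (\<lambda>_. borel)) (\<lambda>j w. (\<lambda>f r. f (t j + max r 0) - x j) (\<lambda>s\<in>{t j..}. B j s w)) {..<n}"
  by (rule indep_vars_compose2) (auto intro!: measurable_abs_UNIV borel_measurable_diff measurable_component_singleton)
 then have "indep_vars (\<lambda>_. PiM UNIV (\<lambda>_. borel)) ?X {..<n}"
  by simp
 then have "indep_vars (\<lambda>_. path_space {f. continuous_on UNIV f \<and> (\<forall>s\<le>0. f s = 0)}) ?X {..<n}"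
  unfolding path_space_def
  using measurable_space[OF brownian_motion_from_law(1)[OF B]]
  by (intro indep_vars_restrict_space) (auto simp: space_wiener1)
 then have "indep_vars (\<lambda>_. wiener1) ?X {..<n}"
  by (rule indep_vars_compose2[where Y = "\<lambda>_ x. x"]) (simp add: measurable_cong_sets[OF refl sets_wiener1])
 from distr_indep_PiM[OF prob_space_axioms _ this]
 have "distr M (PiM {..<n} (\<lambda>_. wiener1)) (\<lambda>w. \<lambda>j\<in>{..<n}. ?X j w) = PiM {..<n} (\<lambda>j. distr M wiener1 (?X j))"
  by simp
 also have "\<dots> = PiM {..<n} (\<lambda>_. wiener1)"
  by (rule PiM_cong) (auto simp: brownian_motion_from_law(2)[OF B])
 finally show ?thesis .
qed

text \<open>The motions are frozen before their starts and set to 0 from index \<open>n\<close> on,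
  so that their joint law can be stated on whole sequences of continuous paths on the line.\<close>

lemma independent_brownian_motions_paths:
 assumes ind: "independent_brownian_motions M n x t B"
 defines "B' \<equiv> \<lambda>w j s. if j < n then B j (max s (t j)) w else 0"
 shows "B' \<in> M \<rightarrow>\<^sub>M paths_space"
  and "distr M paths_space B' = distr wiener paths_space (\<lambda>w j s. if j < n then drive x t w j s else 0)"
proof -
 have B: "brownian_motion_from M (x j) (t j) (B j)" if "j < n" for j
  using ind that by (simp add: independent_brownian_motions_def)
 define \<Gamma> where "\<Gamma> f j s = (if j < n then x j + f j (s - t j) else 0)" for f :: "paths" and j s
 have \<Gamma>: "\<Gamma> \<in> PiM {..<n} (\<lambda>_. wiener1) \<rightarrow>\<^sub>M paths_space"
 proof (rule measurable_paths_spaceI)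
  show "(\<lambda>f. \<Gamma> f j s) \<in> borel_measurable (PiM {..<n} (\<lambda>_. wiener1))" for j s
   using measurable_compose[OF measurable_component_singleton[of j "{..<n}" "\<lambda>_. wiener1"] measurable_wiener1_eval]
   by (cases "j < n") (simp_all add: \<Gamma>_def)
  fix f j assume "f \<in> space (PiM {..<n} (\<lambda>_. wiener1))"
  then have fc: "continuous_on UNIV (f j)" if "j < n"
   using that by (auto simp: space_PiM space_wiener1 PiE_iff)
  show "continuous_on UNIV (\<Gamma> f j)"
  proof (cases "j < n")
   case True
   have "continuous_on UNIV (\<lambda>s. f j (s - t j))"
    by (rule continuous_on_compose2[OF fc[OF True]]) (auto intro: continuous_intros)
   with True show ?thesis
    by (auto simp: \<Gamma>_def intro!: continuous_on_add[OF continuous_on_const])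
  qed (simp add: \<Gamma>_def)
 qed
 have X: "(\<lambda>w. \<lambda>j\<in>{..<n}. \<lambda>r. B j (t j + max r 0) w - x j) \<in> M \<rightarrow>\<^sub>M PiM {..<n} (\<lambda>_. wiener1)"
  by (rule measurable_restrict) (auto intro!: brownian_motion_from_law(1) B)
 have B': "B' w = \<Gamma> (\<lambda>j\<in>{..<n}. \<lambda>r. B j (t j + max r 0) w - x j)" for w
 proof -
  have "t + max (s - t) 0 = max s t" for s t :: real by simp
  then show ?thesis by (auto simp: fun_eq_iff B'_def \<Gamma>_def)
 qed
 show "B' \<in> M \<rightarrow>\<^sub>M paths_space"
  unfolding B' by (rule measurable_compose[OF X \<Gamma>])
 interpret prob_space wiener1 by (rule prob_space_wiener1)
 interpret P: product_prob_space "\<lambda>_. wiener1" "UNIV :: nat set" ..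
 have "distr M paths_space B' = distr (distr M (PiM {..<n} (\<lambda>_. wiener1)) (\<lambda>w. \<lambda>j\<in>{..<n}. \<lambda>r. B j (t j + max r 0) w - x j)) paths_space \<Gamma>"
  unfolding ext[of B', OF B'] by (subst distr_distr[OF \<Gamma> X]) (simp add: comp_def)
 also have "\<dots> = distr (PiM {..<n} (\<lambda>_. wiener1)) paths_space \<Gamma>"
  by (simp only: independent_brownian_motions_law[OF ind])
 also have "\<dots> = distr (distr wiener (PiM {..<n} (\<lambda>_. wiener1)) (\<lambda>w. restrict w {..<n})) paths_space \<Gamma>"
  by (subst P.distr_PiM_restrict_finite) auto
 also have "\<dots> = distr wiener paths_space (\<lambda>w j s. if j < n then drive x t w j s else 0)"
  by (subst distr_distr[OF \<Gamma>]) (auto intro!: distr_cong simp: comp_def \<Gamma>_def drive_def fun_eq_iff)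
 finally show "distr M paths_space B' = distr wiener paths_space (\<lambda>w j s. if j < n then drive x t w j s else 0)" .
qed

text \<open>By \<open>coalesces_unique\<close> the paths \<open>Y\<close> are a fixed measurable
  functional of their drivers, and the joint law of the drivers is known. Hence the law of
  \<open>Y\<close> depends on nothing else.\<close>

lemma semipath_law_coalescing:
 assumes "coalescing_brownian_motions M n x t Y"
 shows "semipath_law M n t (\<lambda>j s w. ereal (Y j s w)) = semipath_law wiener n t (\<lambda>j s w. ereal (cbm x t w j s))"
proof -
 from assms obtain B where ind: "independent_brownian_motions M n x t B"
  and Y: "\<And>w. w \<in> space M \<Longrightarrow> \<forall>j<n. Y j (t j) w = x j \<and> continuous_on {t j..} (\<lambda>s. Y j s w)
    \<and> (\<forall>s\<ge>t j. (\<forall>i<j. \<not> met_by t (\<lambda>i u. Y i u w) i j s) \<longrightarrow> Y j s w = B j s w)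
    \<and> (\<forall>i<j. \<forall>s\<ge>t j. met_by t (\<lambda>i u. Y i u w) i j s \<longrightarrow> Y j s w = Y i s w)"
  unfolding coalescing_brownian_motions_def by blast
 have B: "B j (t j) w = x j" "continuous_on {t j..} (\<lambda>s. B j s w)" if "j < n" "w \<in> space M" for j w
  using that brownian_motion_fromD(3,4)[of M "x j" "t j" "B j" w] ind by (auto simp: independent_brownian_motions_def)
 define B' where "B' = (\<lambda>w j s. if j < n then B j (max s (t j)) w else 0)"
 have B': "B' \<in> M \<rightarrow>\<^sub>M paths_space"
  "distr M paths_space B' = distr wiener paths_space (\<lambda>w j s. if j < n then drive x t w j s else 0)"
  using independent_brownian_motions_paths[OF ind] by (auto simp: B'_def)
 define D where "D = (\<lambda>w j s. if j < n then drive x t w j s else 0)"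
 have D: "D \<in> wiener \<rightarrow>\<^sub>M paths_space"
 proof (rule measurable_paths_spaceI)
  fix w j assume "w \<in> space wiener"
  then show "continuous_on UNIV (D w j)"
   using continuous_drive by (cases "j < n") (auto simp: D_def cong: continuous_on_cong)
 next
  show "(\<lambda>w. D w j s) \<in> borel_measurable wiener" for j s
   unfolding D_def by (cases "j < n") simp_all
 qed
 let ?S = "SIGMA j:{..<n}. {t j..}"
 let ?N = "PiM ?S (\<lambda>_. borel) :: (nat \<times> real \<Rightarrow> ereal) measure"
 define \<Xi> where "\<Xi> z = (\<lambda>(j, s)\<in>?S. ereal (coal t z j s))" for z
 have \<Xi>: "\<Xi> \<in> paths_space \<rightarrow>\<^sub>M ?N"
  unfolding \<Xi>_def
 proof (rule measurable_restrict)
  have "(\<lambda>z. coal t z j s) \<in> borel_measurable paths_space" for j s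
   by (rule measurable_coal) (auto simp: space_paths_space)
  then show "(\<lambda>z. case y of (j, s) \<Rightarrow> ereal (coal t z j s)) \<in> borel_measurable paths_space" for y
   by (cases y) auto
 qed
 have "semipath_law M n t (\<lambda>j s w. ereal (Y j s w)) = distr M ?N (\<lambda>w. \<Xi> (B' w))"
  unfolding semipath_law_def
 proof (rule distr_cong)
  fix w assume w: "w \<in> space M"
  have cont: "continuous_on UNIV (B' w j)" for j
   using measurable_space[OF B'(1) w] by (simp add: space_paths_space)
  have "Y j s w = coal t (B' w) j s" if "j < n" "t j \<le> s" for j s
  proof (rule coalesces_unique[where Y = "\<lambda>j s. Y j s w" and B = "\<lambda>j s. B j s w"])
   show "coalesces n t (\<lambda>j s. B j s w) (\<lambda>j s. Y j s w)"
    using Y[OF w] B(1) w by (simp add: coalesces_def)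
   show "coalesces n t (B' w) (coal t (B' w))"
    by (rule coalesces_coal) (rule cont)
   show "continuous_on {t j..} (B' w j)" for j
    using continuous_on_subset[OF cont] by simp
  qed (use that B(2)[OF _ w] in \<open>auto simp: B'_def max_def\<close>)
  then show "(\<lambda>(j, s)\<in>?S. ereal (Y j s w)) = \<Xi> (B' w)"
   by (auto simp: \<Xi>_def fun_eq_iff)
 qed simp_all
 also have "\<dots> = distr (distr wiener paths_space D) ?N \<Xi>"
  unfolding D_def B'(2)[symmetric] by (subst distr_distr[OF \<Xi> B'(1)]) (simp add: comp_def)
 also have "\<dots> = semipath_law wiener n t (\<lambda>j s w. ereal (cbm x t w j s))"
  unfolding semipath_law_def
 proof (subst distr_distr[OF \<Xi> D], rule distr_cong)
  fix w
  have "coal t (D w) j s = cbm x t w j s" if "j < n" for j s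
   unfolding cbm_def using that by (intro coal_causal) (auto simp: D_def)
  then show "(\<Xi> \<circ> D) w = (\<lambda>(j, s)\<in>?S. ereal (cbm x t w j s))"
   by (auto simp: \<Xi>_def fun_eq_iff)
 qed simp_all
 finally show ?thesis .
qed

lemma distr_wiener_component:
 assumes "g \<in> wiener1 \<rightarrow>\<^sub>M N"
 shows "distr wiener N (\<lambda>w. g (w j)) = distr wiener1 N g"
proof -
 have "distr (distr wiener wiener1 (\<lambda>w. w j)) N g = distr wiener N (\<lambda>w. g (w j))"
  by (subst distr_distr[OF assms]) (auto simp: comp_def)
 then show ?thesis
  using distr_PiM_component[of UNIV "\<lambda>_ :: nat. wiener1" j] by (simp add: prob_space_wiener1)
qed

lemma wiener_increment:
 assumes "0 \<le> a" "a \<le> b"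
 shows "distr wiener borel (\<lambda>w. w j b - w j a) = gauss (sqrt (b - a))"
proof -
 define u where "u i = (if i = 0 then a else b)" for i :: nat
 let ?G = "\<lambda>i. gauss (sqrt (u (Suc i) - u i))"
 have "distr wiener borel (\<lambda>w. w j b - w j a) = distr wiener1 borel (\<lambda>f. f b - f a)"
  by (rule distr_wiener_component) measurable
 also have "\<dots> = distr (distr wiener1 (PiM {..<1} (\<lambda>_. borel)) (\<lambda>f. \<lambda>i\<in>{..<1}. f (u (Suc i)) - f (u i))) borel (\<lambda>y. y 0)"
  by (subst distr_distr) (auto simp: comp_def u_def intro!: measurable_restrict measurable_component_singleton)
 also have "\<dots> = distr (PiM {..<1} ?G) borel (\<lambda>y. y 0)"
  by (subst wiener1_increments) (use assms in \<open>auto simp: u_def\<close>)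
 also have "\<dots> = distr (PiM {..<1} ?G) (?G 0) (\<lambda>y. y 0)"
  by (rule distr_cong) auto
 also have "\<dots> = ?G 0"
  by (rule distr_PiM_component) (auto intro: prob_space_gauss)
 finally show ?thesis by (simp add: u_def)
qed

text \<open>Only the part of the motion after clock time \<open>t j - T j\<close> is used. The
  choice \<open>T = t\<close> gives the canonical motions; a common early time \<open>T\<close> lets
  all of them run on one clock, as an interchange at a stopping time requires.\<close>

lemma independent_wiener_clock:
 assumes T: "\<And>j. T j \<le> t j"
 shows "independent_brownian_motions wiener n x t (\<lambda>j s w. x j + (w j (s - T j) - w j (t j - T j)))"
 unfolding independent_brownian_motions_def
proof (intro conjI allI impI)
 show "prob_space wiener" by (rule prob_space_wiener)
 show "prob_space.indep_vars wiener (\<lambda>j. PiM {t j..} (\<lambda>_. borel)) (\<lambda>j w. \<lambda>s\<in>{t j..}. x j + (w j (s - T j) - w j (t j - T j))) {..<n}"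
 proof -
  have "W.indep_vars (\<lambda>_. wiener1) (\<lambda>j w. w j) {..<n}"
   by (rule W.indep_vars_subset[OF indep_vars_coordinates[OF prob_space_wiener1]]) simp
  then have "W.indep_vars (\<lambda>j. PiM {t j..} (\<lambda>_. borel)) (\<lambda>j w. (\<lambda>f. \<lambda>s\<in>{t j..}. x j + (f (s - T j) - f (t j - T j))) (w j)) {..<n}"
   by (rule W.indep_vars_compose2) (rule measurable_restrict, measurable)
  then show ?thesis by simp
 qed
 fix j
 let ?B = "\<lambda>s w. x j + (w j (s - T j) - w j (t j - T j))"
 show "brownian_motion_from wiener (x j) (t j) ?B"
  unfolding brownian_motion_from_def
 proof (intro conjI allI impI ballI)
  show "prob_space wiener" by (rule prob_space_wiener)
  show "?B (t j) w = x j" for w by simp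
  show "continuous_on {t j..} (\<lambda>s. ?B s w)" if "w \<in> space wiener" for w
  proof -
   have "continuous_on {t j..} (\<lambda>s. w j (s - T j))"
    by (rule continuous_on_compose2[OF wienerD(1)[OF that, of UNIV j]]) (auto intro: continuous_intros)
   then show ?thesis
    by (rule continuous_on_add[OF continuous_on_const continuous_on_diff[OF _ continuous_on_const]])
  qed
  show "distributed wiener lborel (\<lambda>w. ?B s' w - ?B s w) (normal_density 0 (sqrt (s' - s)))"
   if "t j \<le> s \<and> s < s'" for s s'
   using that T[of j] wiener_increment[of "s - T j" "s' - T j" j] by (subst distributed_normal_iff_gauss) auto
  fix k :: nat and u :: "nat \<Rightarrow> real" assume u: "t j \<le> u 0 \<and> (\<forall>i<k. u i \<le> u (Suc i))"
  let ?X = "\<lambda>i w. w j (u (Suc i) - T j) - w j (u i - T j)"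
  have u_ge: "t j \<le> u i" if "i \<le> k" for i
   using that by (induction i) (use u in \<open>auto intro: order_trans\<close>)
  have "W.indep_vars (\<lambda>_. borel) ?X {..<k}"
  proof (cases "k = 0")
   case True
   then show ?thesis by (auto simp: W.indep_vars_def W.indep_sets_def)
  next
   case False
   have "distr wiener (PiM {..<k} (\<lambda>_. borel)) (\<lambda>w. \<lambda>i\<in>{..<k}. ?X i w) =
    distr wiener1 (PiM {..<k} (\<lambda>_. borel)) (\<lambda>f. \<lambda>i\<in>{..<k}. f (u (Suc i) - T j) - f (u i - T j))"
    by (rule distr_wiener_component[where g = "\<lambda>f. \<lambda>i\<in>{..<k}. f (u (Suc i) - T j) - f (u i - T j)"])
     (rule measurable_restrict, measurable)
   also have "\<dots> = PiM {..<k} (\<lambda>i. gauss (sqrt ((u (Suc i) - T j) - (u i - T j))))"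
    by (rule wiener1_increments[where u = "\<lambda>i. u i - T j"]) (use u T[of j] in auto)
   also have "\<dots> = PiM {..<k} (\<lambda>i. distr wiener borel (?X i))"
   proof (rule PiM_cong)
    fix i assume "i \<in> {..<k}"
    then have "t j \<le> u i" "u i \<le> u (Suc i)" using u u_ge[of i] by auto
    then show "gauss (sqrt ((u (Suc i) - T j) - (u i - T j))) = distr wiener borel (?X i)"
     using T[of j] by (subst wiener_increment) auto
   qed simp
   finally show ?thesis
    using False by (subst W.indep_vars_iff_distr_eq_PiM') auto
  qed
  then show "W.indep_vars (\<lambda>_. borel) (\<lambda>i w. ?B (u (Suc i)) w - ?B (u i) w) {..<k}"
   by simp
 qed simp
qed

lemma coalescing_wiener:
 "coalescing_brownian_motions wiener n x t (\<lambda>j s w. cbm x t w j s)"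
 unfolding coalescing_brownian_motions_def
proof (intro exI conjI ballI allI impI)
 show "independent_brownian_motions wiener n x t (\<lambda>j s w. x j + (w j (s - t j) - w j (t j - t j)))"
  by (rule independent_wiener_clock) simp
 fix w j assume w: "w \<in> space wiener"
 show "cbm x t w j (t j) = x j" by (rule cbm_start[OF w])
 show "continuous_on {t j..} (cbm x t w j)"
  by (rule continuous_on_subset[OF continuous_cbm[OF w]]) simp
 fix s assume s: "t j \<le> s"
 show "cbm x t w j s = x j + (w j (s - t j) - w j (t j - t j))"
  if "\<forall>i<j. \<not> met_by t (cbm x t w) i j s"
 proof -
  have "cbm x t w j s = drive x t w j s"
   unfolding cbm_def by (rule coal_not_met[where j = j and t = t, OF s]) (use that in \<open>simp add: cbm_def\<close>)
  then show ?thesis using wienerD(2)[OF w, of 0 j] by (simp add: drive_def)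
 qed
next
 fix w i j s assume "i < j" "met_by t (cbm x t w) i j s"
 then show "cbm x t w j s = cbm x t w i s"
  unfolding cbm_def by (rule coal_met)
qed

text \<open>From here on the canonical model \<open>cbm\<close> replaces the quantifier over sample
  spaces.\<close>

lemma is_coalescing_brownian_law_iff:
 "is_coalescing_brownian_law n x t L \<longleftrightarrow> L = semipath_law wiener n t (\<lambda>j s w. ereal (cbm x t w j s))"
 unfolding is_coalescing_brownian_law_def
 using coalescing_wiener[of n x t] semipath_law_coalescing by blast

subsection \<open>Interchanging two Brownian motions at a stopping time\<close>

text \<open>Increments are interchanged rather than positions, so that the paths stay continuous at
  \<open>c\<close>.\<close>

definition swap_at :: "nat \<Rightarrow> nat \<Rightarrow> real \<Rightarrow> paths \<Rightarrow> paths" where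
 "swap_at a b c w j s = (if s \<le> c then w j s
  else w j c + (w (Transposition.transpose a b j) s - w (Transposition.transpose a b j) c))"

lemma swap_at_le: "s \<le> c \<Longrightarrow> swap_at a b c w j s = w j s"
 by (simp add: swap_at_def)

lemma swap_at_ge:
 "c \<le> s \<Longrightarrow> swap_at a b c w j s = w j c + (w (Transposition.transpose a b j) s - w (Transposition.transpose a b j) c)"
 by (cases "s = c") (simp_all add: swap_at_def)

lemma swap_at_space:
 assumes "0 \<le> c" "w \<in> space wiener"
 shows "swap_at a b c w \<in> space wiener"
 unfolding space_wiener
proof (intro CollectI allI conjI impI)
 fix j
 have "continuous_on ({..c} \<union> {c..}) (swap_at a b c w j)"
  unfolding swap_at_def[abs_def]
  by (intro continuous_on_If continuous_on_add continuous_on_diff continuous_on_const wienerD(1)[OF assms(2)]) auto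
 moreover have "{..c} \<union> {c..} = UNIV" by auto
 ultimately show "continuous_on UNIV (swap_at a b c w j)" by simp
 show "swap_at a b c w j s = 0" if "s \<le> 0" for s
  using that assms wienerD(2)[OF assms(2)] by (simp add: swap_at_def)
qed

lemma measurable_swap_at [measurable]: "0 \<le> c \<Longrightarrow> swap_at a b c \<in> wiener \<rightarrow>\<^sub>M wiener"
 by (rule measurable_wienerI) (auto simp: swap_at_space, simp add: swap_at_def)

text \<open>On a grid that contains \<open>c\<close> the map merely permutes the increments of each
  time step among the motions, and these are independent and identically distributed.\<close>

lemma distr_swap_at:
 assumes c: "0 \<le> c"
 shows "distr wiener wiener (swap_at a b c) = wiener"
proof (rule wiener_eqI[OF _ _ c, where n\<^sub>0 = "Suc (max a b)"])
 show "prob_space (distr wiener wiener (swap_at a b c))"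
  using prob_space.prob_space_distr[OF prob_space_wiener measurable_swap_at[OF c]] .
 fix n k l :: nat and u :: "nat \<Rightarrow> real"
 assume n: "Suc (max a b) \<le> n" and u: "0 \<le> u 0" "\<And>i. u i \<le> u (Suc i)" and l: "l \<le> k" "u l = c"
 let ?I = "{..<n} \<times> {..<k}"
 let ?B = "PiM ?I (\<lambda>_. borel) :: (nat \<times> nat \<Rightarrow> real) measure"
 let ?X = "\<lambda>w. \<lambda>(j, i)\<in>?I. w j (u (Suc i)) - w j (u i)"
 let ?G = "\<lambda>(j :: nat, i). gauss (sqrt (u (Suc i) - u i))"
 \<comment> \<open>Identity on the time steps before \<open>c = u l\<close>, transposition of the
   two motions afterwards; an involution that respects the variances.\<close>
 define p where "p = (\<lambda>(j, i). (if i < l then j else Transposition.transpose a b j, i))"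
 have u_mono: "u i \<le> u j" if "i \<le> j" for i j
  using lift_Suc_mono_le[of u, OF u(2) that] .
 have X: "?X \<in> wiener \<rightarrow>\<^sub>M ?B"
  by (rule measurable_restrict) (auto split: prod.splits)
 have tr: "Transposition.transpose a b j < n \<longleftrightarrow> j < n" for j
  using n by (auto simp: Transposition.transpose_def)
 have pI: "p \<in> ?I \<rightarrow> ?I" by (auto simp: p_def tr)
 have pinj: "inj_on p ?I"
  by (rule inj_on_inverseI[where g = p]) (auto simp: p_def)
 have Gp: "?G (p y) = ?G y" for y
  by (cases y) (simp add: p_def)
 have sG: "sets (?G y) = sets borel" for y
  by (cases y) simp
 have swap: "?X (swap_at a b c w) = (\<lambda>y\<in>?I. ?X w (p y))" for w
 proof (rule ext)
  fix y :: "nat \<times> nat"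
  obtain j i where y: "y = (j, i)" by (cases y)
  show "?X (swap_at a b c w) y = (\<lambda>y\<in>?I. ?X w (p y)) y"
  proof (cases "i < l")
   case True
   then have "u (Suc i) \<le> c" "u i \<le> c" using u_mono[of "Suc i" l] u(2)[of i] l by auto
   with True show ?thesis unfolding y by (auto simp: p_def swap_at_le)
  next
   case False
   then have "c \<le> u i" "c \<le> u (Suc i)" using u_mono[of l i] u(2)[of i] l by auto
   with False show ?thesis unfolding y by (auto simp: p_def tr swap_at_ge)
  qed
 qed
 have r: "(\<lambda>v. \<lambda>y\<in>?I. v (p y)) \<in> ?B \<rightarrow>\<^sub>M ?B"
  using pI by (intro measurable_restrict measurable_component_singleton) auto
 have "distr (distr wiener wiener (swap_at a b c)) ?B ?X = distr wiener ?B (\<lambda>w. \<lambda>y\<in>?I. ?X w (p y))"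
  by (subst distr_distr[OF X measurable_swap_at[OF c]]) (simp only: comp_def swap)
 also have "\<dots> = distr (distr wiener ?B ?X) ?B (\<lambda>v. \<lambda>y\<in>?I. v (p y))"
  by (subst distr_distr[OF r X]) (simp only: comp_def)
 also have "distr wiener ?B ?X = PiM ?I ?G"
  by (rule brownian_law_increments[OF brownian_law_wiener1]) (use u in auto)
 also have "distr (PiM ?I ?G) ?B (\<lambda>v. \<lambda>y\<in>?I. v (p y)) = distr (PiM ?I ?G) (PiM ?I (\<lambda>y. ?G (p y))) (\<lambda>v. \<lambda>y\<in>?I. v (p y))"
 proof (rule distr_cong)
  show "sets ?B = sets (PiM ?I (\<lambda>y. ?G (p y)))"
   by (rule sets_PiM_cong) (simp_all only: sG)
 qed simp_all
 also have "\<dots> = PiM ?I (\<lambda>y. ?G (p y))"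
  by (rule distr_PiM_reindex[OF _ pinj pI]) (auto intro: prob_space_gauss)
 also have "\<dots> = PiM ?I ?G"
  by (simp only: Gp)
 finally show "distr (distr wiener wiener (swap_at a b c)) ?B ?X = PiM ?I ?G" .
qed simp

definition swap_hit :: "nat \<Rightarrow> nat \<Rightarrow> (paths \<Rightarrow> real \<Rightarrow> bool) \<Rightarrow> paths \<Rightarrow> paths" where
 "swap_hit a b hit w = (if \<exists>c. hit w c then swap_at a b (Inf {c. hit w c}) w else w)"

text \<open>The stopping time is approximated from the right on a dyadic grid, where it takes only
  countably many values.\<close>

definition swap_grid :: "nat \<Rightarrow> nat \<Rightarrow> (paths \<Rightarrow> real \<Rightarrow> bool) \<Rightarrow> nat \<Rightarrow> paths \<Rightarrow> paths" where
 "swap_grid a b hit m w = (if \<exists>k :: nat. hit w (k / 2 ^ m) then swap_at a b (real (LEAST k :: nat. hit w (real k / 2 ^ m)) / 2 ^ m) w else w)"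

text \<open>The predicate \<open>hit w c\<close> says that a stopping time of \<open>w\<close> is at most \<open>c\<close>.\<close>

locale stopping_hit =
 fixes hit :: "paths \<Rightarrow> real \<Rightarrow> bool"
 assumes hit_mono: "v \<in> space wiener \<Longrightarrow> hit v c \<Longrightarrow> c \<le> c' \<Longrightarrow> hit v c'"
  and hit_pos: "v \<in> space wiener \<Longrightarrow> hit v c \<Longrightarrow> 0 \<le> c"
  and hit_meas [measurable]: "Measurable.pred wiener (\<lambda>v. hit v c)"
  and hit_adapted: "v \<in> space wiener \<Longrightarrow> v' \<in> space wiener \<Longrightarrow> (\<And>j s. s \<le> c \<Longrightarrow> v j s = v' j s) \<Longrightarrow> hit v c = hit v' c"
begin

lemma swap_grid_space: "w \<in> space wiener \<Longrightarrow> swap_grid a b hit m w \<in> space wiener"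
 by (auto simp: swap_grid_def intro!: swap_at_space)

lemma Inf_hit_nonneg: "w \<in> space wiener \<Longrightarrow> hit w c \<Longrightarrow> 0 \<le> Inf {c. hit w c}"
 using hit_pos by (intro cInf_greatest) auto

lemma swap_hit_space: "w \<in> space wiener \<Longrightarrow> swap_hit a b hit w \<in> space wiener"
 by (auto simp: swap_hit_def intro!: swap_at_space Inf_hit_nonneg)

lemma measurable_swap_grid [measurable]: "swap_grid a b hit m \<in> wiener \<rightarrow>\<^sub>M wiener"
proof (rule measurable_wienerI)
 fix j s
 have [measurable]: "(\<lambda>w. LEAST k. hit w (real k / 2 ^ m)) \<in> wiener \<rightarrow>\<^sub>M count_space UNIV"
  by measurable
 have "(\<lambda>w. swap_at a b (real (LEAST k. hit w (real k / 2 ^ m)) / 2 ^ m) w j s) \<in> borel_measurable wiener"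
  by (rule measurable_compose_countable[where f = "\<lambda>k w. swap_at a b (real k / 2 ^ m) w j s"])
   (simp_all add: swap_at_def)
 then have "(\<lambda>w. if \<exists>k. hit w (real k / 2 ^ m) then swap_at a b (real (LEAST k. hit w (real k / 2 ^ m)) / 2 ^ m) w j s else w j s)
   \<in> borel_measurable wiener"
  by measurable
 then show "(\<lambda>w. swap_grid a b hit m w j s) \<in> borel_measurable wiener"
  by (simp add: swap_grid_def if_distrib[of "\<lambda>f. f j s"] cong: if_cong)
qed (rule swap_grid_space)

text \<open>Where the grid stopping time has a given value, the map is an interchange at a
  deterministic time, and adaptedness makes this event invariant under that interchange. Summation
  over the values gives the claim.\<close>

lemma distr_swap_grid: "distr wiener wiener (swap_grid a b hit m) = wiener"
proof (rule measure_eqI)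
 let ?c = "\<lambda>k :: nat. real k / 2 ^ m"
 \<comment> \<open>Index 0 collects the paths that are never hit, index \<open>Suc k\<close> those
   first hit at the grid time \<open>?c k\<close>.\<close>
 define A where "A n = {w \<in> space wiener. case n of 0 \<Rightarrow> \<forall>k. \<not> hit w (?c k) | Suc k \<Rightarrow> hit w (?c k) \<and> (\<forall>i<k. \<not> hit w (?c i))}" for n
 have [measurable]: "A n \<in> sets wiener" for n
  unfolding A_def by (cases n) simp_all
 have disj: "disjoint_family A"
  unfolding disjoint_family_on_def
 proof (intro ballI impI)
  fix n n' :: nat assume "n \<noteq> n'"
  then show "A n \<inter> A n' = {}"
   unfolding A_def by (cases n; cases n') (auto, metis linorder_neqE_nat)
 qed
 have cover: "(\<Union>n. A n) = space wiener"
 proof safe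
  fix w assume w: "w \<in> space wiener"
  show "w \<in> (\<Union>n. A n)"
  proof (cases "\<exists>k. hit w (?c k)")
   case True
   then have "hit w (?c (LEAST k. hit w (?c k)))" "\<forall>i<LEAST k. hit w (?c k). \<not> hit w (?c i)"
    by (auto intro: LeastI_ex dest: not_less_Least)
   with w have "w \<in> A (Suc (LEAST k. hit w (?c k)))" by (simp add: A_def)
   then show ?thesis by blast
  next
   case False
   with w have "w \<in> A 0" by (simp add: A_def)
   then show ?thesis by blast
  qed
 qed (auto simp: A_def)
 have split: "emeasure wiener E = (\<Sum>n. emeasure wiener (E \<inter> A n))" if "E \<in> sets wiener" for E
 proof -
  have "(\<Sum>n. emeasure wiener (E \<inter> A n)) = emeasure wiener (\<Union>n. E \<inter> A n)"
   using that disj by (intro suminf_emeasure) (auto simp: disjoint_family_on_def)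
  also have "(\<Union>n. E \<inter> A n) = E"
   using cover sets.sets_into_space[OF that] by auto
  finally show ?thesis ..
 qed
 fix E assume "E \<in> sets (distr wiener wiener (swap_grid a b hit m))"
 then have E [measurable]: "E \<in> sets wiener" by simp
 have step: "emeasure wiener (swap_grid a b hit m -` E \<inter> space wiener \<inter> A n) = emeasure wiener (E \<inter> A n)" for n
 proof (cases n)
  case 0
  have "swap_grid a b hit m -` E \<inter> space wiener \<inter> A n = E \<inter> A n"
   using 0 by (auto simp: A_def swap_grid_def)
  then show ?thesis by simp
 next
  case (Suc k)
  have K: "(LEAST k. hit w (?c k)) = k" if "w \<in> A n" for w
   using that Suc by (intro Least_equality) (auto simp: A_def not_less[symmetric])
  have sA: "swap_at a b (?c k) w \<in> A n \<longleftrightarrow> w \<in> A n" if "w \<in> space wiener" for w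
  proof -
   have "hit (swap_at a b (?c k) w) (?c i) = hit w (?c i)" if "i \<le> k" for i
   proof (rule hit_adapted)
    fix j s assume "s \<le> ?c i"
    also have "\<dots> \<le> ?c k" using that by (intro divide_right_mono) auto
    finally show "swap_at a b (?c k) w j s = w j s" by (simp add: swap_at_def)
   qed (use \<open>w \<in> space wiener\<close> in \<open>auto intro!: swap_at_space\<close>)
   with that show ?thesis
    unfolding A_def Suc by (auto intro!: swap_at_space)
  qed
  have "swap_grid a b hit m w = swap_at a b (?c k) w" if "w \<in> A n" for w
   using that K[OF that] Suc by (auto simp: swap_grid_def A_def)
  then have "swap_grid a b hit m -` E \<inter> space wiener \<inter> A n = swap_at a b (?c k) -` (E \<inter> A n) \<inter> space wiener"
   using sA by (auto simp: A_def)
  then have "emeasure wiener (swap_grid a b hit m -` E \<inter> space wiener \<inter> A n) = emeasure (distr wiener wiener (swap_at a b (?c k))) (E \<inter> A n)"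
   by (subst emeasure_distr) auto
  then show ?thesis by (simp add: distr_swap_at)
 qed
 have "emeasure (distr wiener wiener (swap_grid a b hit m)) E = emeasure wiener (swap_grid a b hit m -` E \<inter> space wiener)"
  by (subst emeasure_distr) auto
 also have "\<dots> = emeasure wiener E"
  by (subst split) (auto simp: step split[OF E, symmetric])
 finally show "emeasure (distr wiener wiener (swap_grid a b hit m)) E = emeasure wiener E" .
qed simp

text \<open>The grid times are at least the infimum and converge to it, and the paths are continuous
  there.\<close>

lemma swap_grid_limit:
 assumes w: "w \<in> space wiener"
 shows "(\<lambda>m. swap_grid a b hit m w j s) \<longlonglongrightarrow> swap_hit a b hit w j s"
proof (cases "\<exists>c. hit w c")
 case False
 then show ?thesis by (simp add: swap_grid_def swap_hit_def)
next
 case True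
 define T where "T = Inf {c. hit w c}"
 define K where "K m = (LEAST k :: nat. hit w (k / 2 ^ m))" for m
 have T0: "0 \<le> T" using True Inf_hit_nonneg[OF w] by (auto simp: T_def)
 have bdd: "bdd_below {c. hit w c}" using hit_pos[OF w] by (auto intro: bdd_belowI[of _ 0])
 \<comment> \<open>The infimum itself need not satisfy \<open>hit\<close>; only later times are
   guaranteed to.\<close>
 have later: "hit w c" if "T < c" for c
 proof -
  have "{c. hit w c} \<noteq> {}" using True by blast
  from cInf_lessD[OF this, of c] that obtain c' where "hit w c'" "c' < c"
   by (auto simp: T_def)
  then show ?thesis using hit_mono[OF w] by simp
 qed
 have ex: "hit w (real (nat \<lfloor>2 ^ m * T\<rfloor> + 1) / 2 ^ m)" for m
 proof (rule later)
  have "2 ^ m * T < real (nat \<lfloor>2 ^ m * T\<rfloor> + 1)" using T0 by simp linarith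
  then show "T < real (nat \<lfloor>2 ^ m * T\<rfloor> + 1) / 2 ^ m" by (simp add: less_divide_eq mult.commute)
 qed
 have hitK: "hit w (K m / 2 ^ m)" for m
  unfolding K_def using ex by (rule LeastI)
 have K_ge: "T \<le> K m / 2 ^ m" for m
  unfolding T_def using hitK by (intro cInf_lower bdd) simp
 have K_le: "K m / 2 ^ m \<le> real (nat \<lfloor>2 ^ m * T\<rfloor>) / 2 ^ m + (1 / 2) ^ m" for m
 proof -
  have "K m \<le> nat \<lfloor>2 ^ m * T\<rfloor> + 1" unfolding K_def using ex by (rule Least_le)
  then have "real (K m) / 2 ^ m \<le> (real (nat \<lfloor>2 ^ m * T\<rfloor>) + 1) / 2 ^ m"
   by (intro divide_right_mono) simp_all
  then show ?thesis by (simp add: add_divide_distrib power_one_over)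
 qed
 have "(\<lambda>m. real (nat \<lfloor>2 ^ m * T\<rfloor>) / 2 ^ m + (1 / 2) ^ m) \<longlonglongrightarrow> T + 0"
  by (intro tendsto_add dyadic_floor_limit T0 LIMSEQ_realpow_zero) auto
 then have K_lim: "(\<lambda>m. K m / 2 ^ m) \<longlonglongrightarrow> T"
 proof -
  assume "(\<lambda>m. real (nat \<lfloor>2 ^ m * T\<rfloor>) / 2 ^ m + (1 / 2) ^ m) \<longlonglongrightarrow> T + 0"
  then have h: "(\<lambda>m. real (nat \<lfloor>2 ^ m * T\<rfloor>) / 2 ^ m + (1 / 2) ^ m) \<longlonglongrightarrow> T" by simp
  show ?thesis
   by (rule tendsto_sandwich[OF always_eventually always_eventually tendsto_const h]) (use K_ge K_le in blast)+
 qed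
 have grid: "swap_grid a b hit m w = swap_at a b (K m / 2 ^ m) w" for m
  using hitK[of m] by (auto simp: swap_grid_def K_def)
 have hit: "swap_hit a b hit w = swap_at a b T w"
  using True by (simp add: swap_hit_def T_def)
 have cont: "isCont (w i) T" for i
  using wienerD(1)[OF w, of UNIV i] by (simp add: continuous_on_eq_continuous_at)
 show ?thesis
 proof (cases "s \<le> T")
  case True
  then have "swap_grid a b hit m w j s = swap_hit a b hit w j s" for m
   using order_trans[OF True K_ge[of m]] by (simp add: grid hit swap_at_def)
  then show ?thesis by simp
 next
  case False
  then have "\<forall>\<^sub>F m in sequentially. K m / 2 ^ m < s"
   using order_tendstoD(2)[OF K_lim] by simp
  then have "\<forall>\<^sub>F m in sequentially. w j (K m / 2 ^ m) + (w (Transposition.transpose a b j) s - w (Transposition.transpose a b j) (K m / 2 ^ m)) = swap_grid a b hit m w j s"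
   by eventually_elim (simp add: grid swap_at_def)
  moreover have "(\<lambda>m. w j (K m / 2 ^ m) + (w (Transposition.transpose a b j) s - w (Transposition.transpose a b j) (K m / 2 ^ m)))
    \<longlonglongrightarrow> w j T + (w (Transposition.transpose a b j) s - w (Transposition.transpose a b j) T)"
   by (intro tendsto_intros isCont_tendsto_compose[OF cont] K_lim)
  ultimately show ?thesis
   using False by (subst (asm) filterlim_cong[OF refl refl]) (auto simp: hit swap_at_def)
 qed
qed

lemma measurable_swap_hit [measurable]: "swap_hit a b hit \<in> wiener \<rightarrow>\<^sub>M wiener"
proof (rule measurable_wienerI)
 show "(\<lambda>w. swap_hit a b hit w j s) \<in> borel_measurable wiener" for j s
  by (rule borel_measurable_LIMSEQ_real[OF swap_grid_limit])
   (auto intro: measurable_compose[OF measurable_swap_grid measurable_wiener_eval])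
qed (rule swap_hit_space)

theorem distr_swap_hit: "distr wiener wiener (swap_hit a b hit) = wiener"
proof (rule measure_eqI_marginals[where I = UNIV and h = "\<lambda>x w. (case x of (j, s) \<Rightarrow> (w j s :: real))"])
 show "prob_space (distr wiener wiener (swap_hit a b hit))" by (rule W.prob_space_distr) measurable
 show "prob_space wiener" by (rule prob_space_wiener)
 show "sets (distr wiener wiener (swap_hit a b hit)) \<subseteq> sets N"
  if "space N = space (distr wiener wiener (swap_hit a b hit))"
   "\<And>x. x \<in> UNIV \<Longrightarrow> (\<lambda>w. (case x of (j, s) \<Rightarrow> (w j s :: real))) \<in> borel_measurable N" for N :: "paths measure"
  using that(1) that(2)[of "(j, s)" for j s] sets_wiener_le[of N] by simp
 fix J :: "(nat \<times> real) set" assume "finite J"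
 let ?B = "PiM J (\<lambda>_. borel) :: (nat \<times> real \<Rightarrow> real) measure"
 let ?h = "\<lambda>x w. (case x of (j, s) \<Rightarrow> (w j s :: real))"
 have h [measurable]: "?h x \<in> borel_measurable wiener" for x
  by (cases x) simp
 have hJ: "(\<lambda>w. \<lambda>x\<in>J. ?h x w) \<in> wiener \<rightarrow>\<^sub>M ?B"
  by (rule measurable_restrict) simp
 have "distr wiener ?B (\<lambda>w. \<lambda>x\<in>J. ?h x (swap_hit a b hit w)) = distr wiener ?B (\<lambda>w. \<lambda>x\<in>J. ?h x w)"
 proof (rule distr_eq_limit[OF W.prob_space_axioms W.prob_space_axioms])
  show "distr wiener ?B (\<lambda>w. \<lambda>x\<in>J. ?h x (swap_grid a b hit m w)) = distr wiener ?B (\<lambda>w. \<lambda>x\<in>J. ?h x w)" for m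
  proof -
   have "distr (distr wiener wiener (swap_grid a b hit m)) ?B (\<lambda>w. \<lambda>x\<in>J. ?h x w) = distr wiener ?B (\<lambda>w. \<lambda>x\<in>J. ?h x (swap_grid a b hit m w))"
    by (subst distr_distr[OF hJ measurable_swap_grid]) (simp only: comp_def)
   then show ?thesis by (simp only: distr_swap_grid)
  qed
  show "AE w in wiener. (\<lambda>m. ?h x (swap_grid a b hit m w)) \<longlonglongrightarrow> ?h x (swap_hit a b hit w)" for x
   by (cases x) (auto intro!: AE_I2 swap_grid_limit)
 qed (auto intro: measurable_compose[OF measurable_swap_grid h] measurable_compose[OF measurable_swap_hit h])
 moreover have "distr (distr wiener wiener (swap_hit a b hit)) ?B (\<lambda>w. \<lambda>x\<in>J. ?h x w) = distr wiener ?B (\<lambda>w. \<lambda>x\<in>J. ?h x (swap_hit a b hit w))"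
  by (subst distr_distr[OF hJ measurable_swap_hit]) (simp only: comp_def)
 ultimately show "distr (distr wiener wiener (swap_hit a b hit)) ?B (\<lambda>w. \<lambda>x\<in>J. ?h x w) = distr wiener ?B (\<lambda>w. \<lambda>x\<in>J. ?h x w)"
  by simp
qed (auto split: prod.splits)

end

subsection \<open>Independence of the order of priority\<close>

lemma sets_paths_space_le:
 assumes "space N = space paths_space" "\<And>j s. (\<lambda>w. w j s) \<in> borel_measurable N"
 shows "sets paths_space \<subseteq> sets N"
proof
 have m: "(\<lambda>f. f) \<in> N \<rightarrow>\<^sub>M paths_space"
  using assms by (intro measurable_paths_spaceI) (auto simp: space_paths_space)
 fix A assume A: "A \<in> sets paths_space"
 from measurable_sets[OF m this] sets.sets_into_space[OF A] show "A \<in> sets N"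
  by (simp add: assms Int_absorb2)
qed

lemma paths_space_eqI:
 assumes M: "prob_space M" "prob_space N"
  and f: "f \<in> M \<rightarrow>\<^sub>M paths_space" and g: "g \<in> N \<rightarrow>\<^sub>M paths_space"
  and eq: "\<And>J :: (nat \<times> real) set. finite J \<Longrightarrow>
   distr M (PiM J (\<lambda>_. borel)) (\<lambda>x. \<lambda>(j, s)\<in>J. f x j s) = distr N (PiM J (\<lambda>_. borel)) (\<lambda>x. \<lambda>(j, s)\<in>J. g x j s)"
 shows "distr M paths_space f = distr N paths_space g"
proof (rule measure_eqI_marginals[where I = UNIV and h = "\<lambda>x w. (case x of (j, s) \<Rightarrow> (w j s :: real))"])
 show "prob_space (distr M paths_space f)" "prob_space (distr N paths_space g)"
  using M f g by (auto intro: prob_space.prob_space_distr)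
 show "sets (distr M paths_space f) \<subseteq> sets L"
  if "space L = space (distr M paths_space f)"
   "\<And>x. x \<in> UNIV \<Longrightarrow> (\<lambda>w. (case x of (j, s) \<Rightarrow> (w j s :: real))) \<in> borel_measurable L" for L :: "paths measure"
  using that(1) that(2)[of "(j, s)" for j s] sets_paths_space_le[of L] by simp
 fix J :: "(nat \<times> real) set" assume J: "finite J"
 let ?B = "PiM J (\<lambda>_. borel) :: (nat \<times> real \<Rightarrow> real) measure"
 have m: "(\<lambda>w. \<lambda>x\<in>J. (case x of (j, s) \<Rightarrow> (w j s :: real))) \<in> paths_space \<rightarrow>\<^sub>M ?B"
  by (rule measurable_restrict) (auto split: prod.splits)
 show "distr (distr M paths_space f) ?B (\<lambda>w. \<lambda>x\<in>J. (case x of (j, s) \<Rightarrow> (w j s :: real))) =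
  distr (distr N paths_space g) ?B (\<lambda>w. \<lambda>x\<in>J. (case x of (j, s) \<Rightarrow> (w j s :: real)))"
  unfolding distr_distr[OF m f] distr_distr[OF m g] comp_def using eq[OF J] by simp
qed (auto split: prod.splits)

text \<open>A law on infinite sequences is determined by its finite prefixes, so the
  \<open>n\<close>-th comparison pair may be altered freely from index \<open>n\<close> on.\<close>

lemma paths_space_eqI_prefix:
 assumes M: "prob_space M" "prob_space N"
  and f: "f \<in> M \<rightarrow>\<^sub>M paths_space" and g: "g \<in> N \<rightarrow>\<^sub>M paths_space"
  and f': "\<And>n. f' n \<in> M \<rightarrow>\<^sub>M paths_space" and g': "\<And>n. g' n \<in> N \<rightarrow>\<^sub>M paths_space"
  and ff': "\<And>n x j. n\<^sub>0 \<le> n \<Longrightarrow> x \<in> space M \<Longrightarrow> j < n \<Longrightarrow> f x j = f' n x j"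
  and gg': "\<And>n x j. n\<^sub>0 \<le> n \<Longrightarrow> x \<in> space N \<Longrightarrow> j < n \<Longrightarrow> g x j = g' n x j"
  and eq: "\<And>n. n\<^sub>0 \<le> n \<Longrightarrow> distr M paths_space (f' n) = distr N paths_space (g' n)"
 shows "distr M paths_space f = distr N paths_space g"
proof (rule paths_space_eqI[OF M f g])
 fix J :: "(nat \<times> real) set" assume J: "finite J"
 define n where "n = Suc (max n\<^sub>0 (Max (fst ` J)))"
 have n: "n\<^sub>0 \<le> n" by (simp add: n_def)
 have Jn: "j < n" if "(j, s) \<in> J" for j s
  using that J by (auto simp: n_def less_Suc_eq_le le_max_iff_disj intro!: Max_ge rev_image_eqI)
 let ?B = "PiM J (\<lambda>_. borel) :: (nat \<times> real \<Rightarrow> real) measure"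
 let ?h = "\<lambda>w. \<lambda>(j, s)\<in>J. (w j s :: real)"
 have m: "?h \<in> paths_space \<rightarrow>\<^sub>M ?B"
  by (rule measurable_restrict) (auto split: prod.splits)
 have "distr M ?B (\<lambda>x. ?h (f x)) = distr M ?B (\<lambda>x. ?h (f' n x))"
  by (rule distr_cong) (auto simp: ff'[OF n] Jn intro!: restrict_ext)
 also have "\<dots> = distr (distr M paths_space (f' n)) ?B ?h"
  by (simp only: distr_distr[OF m f'] comp_def)
 also have "\<dots> = distr N ?B (\<lambda>x. ?h (g' n x))"
  unfolding eq[OF n] by (simp only: distr_distr[OF m g'] comp_def)
 also have "\<dots> = distr N ?B (\<lambda>x. ?h (g x))"
  by (rule distr_cong) (auto simp: gg'[OF n] Jn intro!: restrict_ext)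
 finally show "distr M ?B (\<lambda>x. ?h (f x)) = distr N ?B (\<lambda>x. ?h (g x))" .
qed

lemma coal_cong:
 assumes "\<And>i. i \<le> j \<Longrightarrow> t i = t' i" "\<And>i. i \<le> j \<Longrightarrow> B i = B' i"
 shows "coal t B j = coal t' B' j"
 using assms
proof (induction j rule: less_induct)
 case (less j)
 have "coal_part t B j k = coal_part t' B' j k" if "k \<le> j" for k
  using that
 proof (induction k)
  case (Suc k)
  then show ?case using less.IH[of k] less.prems by (simp add: less.prems(1))
 qed (simp add: less.prems)
 then show ?case by (simp add: coal_eq_part)
qed

lemma cbm_cong:
 assumes "\<And>i. i \<le> j \<Longrightarrow> x i = x' i" "\<And>i. i \<le> j \<Longrightarrow> t i = t' i"
 shows "cbm x t w j = cbm x' t' w j"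
 unfolding cbm_def
 by (rule coal_cong) (use assms in \<open>auto simp: drive_def fun_eq_iff\<close>)

lemma measurable_coal_paths: "coal t \<in> paths_space \<rightarrow>\<^sub>M paths_space"
proof (rule measurable_paths_spaceI)
 show "(\<lambda>z. coal t z j s) \<in> borel_measurable paths_space" for j s
  by (rule measurable_coal) (auto simp: space_paths_space)
 show "continuous_on UNIV (coal t z j)" if "z \<in> space paths_space" for z j
  using that by (intro continuous_coal) (auto simp: space_paths_space)
qed

lemma measurable_reindex_paths: "(\<lambda>z j. z (p j)) \<in> paths_space \<rightarrow>\<^sub>M paths_space"
 by (rule measurable_paths_spaceI) (auto simp: space_paths_space)

text \<open>Driving Brownian motions read off on a common clock started at time \<open>T\<close>.\<close>

definition drive_from :: "real \<Rightarrow> (nat \<Rightarrow> real) \<Rightarrow> (nat \<Rightarrow> real) \<Rightarrow> paths \<Rightarrow> paths" where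
 "drive_from T x t w j s = x j + (w j (max s (t j) - T) - w j (t j - T))"

lemma continuous_drive_from:
 assumes "w \<in> space wiener"
 shows "continuous_on UNIV (drive_from T x t w j)"
proof -
 have "continuous_on UNIV (\<lambda>s. w j (max s (t j) - T))"
  by (rule continuous_on_compose2[OF wienerD(1)[OF assms, where A = UNIV]]) (auto intro!: continuous_intros)
 then show ?thesis
  unfolding drive_from_def
  by (rule continuous_on_add[OF continuous_on_const continuous_on_diff[OF _ continuous_on_const]])
qed

lemma measurable_drive_from [measurable]: "drive_from T x t \<in> wiener \<rightarrow>\<^sub>M paths_space"
proof (rule measurable_paths_spaceI)
 show "(\<lambda>w. drive_from T x t w j s) \<in> borel_measurable wiener" for j s
  unfolding drive_from_def by measurable
qed (rule continuous_drive_from)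

lemma measurable_drive_paths [measurable]: "drive x t \<in> wiener \<rightarrow>\<^sub>M paths_space"
 by (rule measurable_paths_spaceI) (auto simp: continuous_drive)

lemma distr_drive_from:
 assumes T: "\<And>j. T \<le> t j"
 shows "distr wiener paths_space (drive_from T x t) = distr wiener paths_space (drive x t)"
proof (rule paths_space_eqI_prefix[where n\<^sub>0 = 0])
 show "distr wiener paths_space (\<lambda>w j s. if j < n then x j + (w j (max s (t j) - T) - w j (t j - T)) else 0) =
   distr wiener paths_space (\<lambda>w j s. if j < n then drive x t w j s else 0)" for n
  by (rule independent_brownian_motions_paths(2)[OF independent_wiener_clock[where T = "\<lambda>_. T"]]) (rule T)
 show "(\<lambda>w j s. if j < n then x j + (w j (max s (t j) - T) - w j (t j - T)) else 0) \<in> wiener \<rightarrow>\<^sub>M paths_space" for n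
  by (rule independent_brownian_motions_paths(1)[OF independent_wiener_clock[where T = "\<lambda>_. T"]]) (rule T)
 show "(\<lambda>w j s. if j < n then drive x t w j s else 0) \<in> wiener \<rightarrow>\<^sub>M paths_space" for n
 proof (rule measurable_paths_spaceI)
  fix w j assume "w \<in> space wiener"
  then show "continuous_on UNIV (\<lambda>s. if j < n then drive x t w j s else 0)"
   using continuous_drive by (cases "j < n") (auto cong: continuous_on_cong)
 next
  show "(\<lambda>w. if j < n then drive x t w j s else 0) \<in> borel_measurable wiener" for j s
   by (cases "j < n") simp_all
 qed
qed (auto simp: prob_space_wiener drive_from_def)

lemma distr_wiener_reindex:
 assumes "inj p"
 shows "distr wiener wiener (\<lambda>w j. w (p j)) = wiener"
 using distr_PiM_reindex[of UNIV "\<lambda>_. wiener1" p UNIV] assms prob_space_wiener1 by (simp add: restrict_UNIV)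

text \<open>Raising the priority of the path \<open>Suc a\<close> above that of the path \<open>a\<close> amounts to interchanging
 the two driving Brownian motions at the time when the two paths meet.\<close>

lemma distr_cbm_adjacent_bounded:
 fixes a :: nat
 assumes T: "\<And>j. T \<le> t j"
 defines "q \<equiv> Transposition.transpose a (Suc a)"
 shows "distr wiener paths_space (\<lambda>w j. cbm x t w (q j)) = distr wiener paths_space (cbm (x \<circ> q) (t \<circ> q))"
proof -
 let ?b = "Suc a"
 define t' where "t' = t \<circ> q"
 have qq: "q (q j) = j" for j by (simp add: q_def)
 define D where "D = drive_from T x t"
 \<comment> \<open>Coalescence in which \<open>a\<close> and \<open>Suc a\<close> have exchanged
   their priorities, while every path keeps its own label and driver.\<close>
 define Y where "Y w j = coal t' (\<lambda>i. D w (q i)) (q j)" for w j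
 define hit where "hit w c \<longleftrightarrow> met_by t (Y w) a ?b (c + T)" for w c
 have D_cont: "continuous_on A (D w j)" if "w \<in> space wiener" for w j A
  unfolding D_def by (rule continuous_on_subset[OF continuous_drive_from[OF that]]) simp
 have D_start: "s \<le> t j \<Longrightarrow> D w j s = x j" for w j s
  by (simp add: D_def drive_from_def max_def)
 have D_meas: "(\<lambda>w. D w j s) \<in> borel_measurable wiener" for j s
  unfolding D_def using measurable_compose[OF measurable_drive_from measurable_paths_space_eval] .
 have D_adapted: "D w j s = D w' j s" if "\<And>r. r \<le> c \<Longrightarrow> w j r = w' j r" "s \<le> c + T" for w w' j s c
 proof (cases "s \<le> t j")
  case False
  with that T[of j] show ?thesis by (auto simp: D_def drive_from_def max_def)
 qed (simp add: D_start)
 have Y_cont: "continuous_on A (Y w j)" if "w \<in> space wiener" for w j A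
  unfolding Y_def by (rule continuous_on_subset[OF continuous_coal[OF D_cont[OF that]]]) simp
 have Y_meas: "(\<lambda>w. Y w j s) \<in> borel_measurable wiener" for j s
  unfolding Y_def by (rule measurable_coal) (auto simp: D_meas D_cont)
 have Y_before: "Y w j s = x j" if "s \<le> t j" for w j s
 proof (cases "s = t j")
  case True
  have "Y w j (t' (q j)) = D w (q (q j)) (t' (q j))" unfolding Y_def by (rule coal_start)
  with True that show ?thesis by (simp add: t'_def qq D_start)
 next
  case False
  with that have "s < t' (q j)" by (simp add: t'_def qq)
  then have "Y w j s = D w (q (q j)) s" unfolding Y_def by (rule coal_before)
  with that show ?thesis by (simp add: qq D_start)
 qed
 have Y_merge: "Y w i s = Y w j s" if "t i \<le> u" "t j \<le> u" "Y w i u = Y w j u" "u \<le> s" for w i j u s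
  unfolding Y_def by (rule coal_merge[where u = u]) (use that in \<open>simp_all add: Y_def t'_def qq\<close>)
 have met': "met_by t' (coal t' (\<lambda>i. D w (q i))) i j s \<longleftrightarrow> met_by t (Y w) (q i) (q j) s" for w i j s
  by (simp add: met_by_def t'_def Y_def qq)
 have t'q: "t' (q j) = t j" for j by (simp add: t'_def qq)
 have met_sym: "met_by t y i j s \<longleftrightarrow> met_by t y j i s" for y i j s
  by (auto simp: met_by_def)
 have Y_free: "Y w j s = D w j s" if "t j \<le> s" "\<And>i. i < q j \<Longrightarrow> \<not> met_by t (Y w) (q i) j s" for w j s
 proof -
  have "coal t' (\<lambda>i. D w (q i)) (q j) s = D w (q (q j)) s"
   by (rule coal_not_met) (use that in \<open>auto simp: met' t'q qq\<close>)
  then show ?thesis by (simp add: Y_def qq)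
 qed
 have q_simps: "q a = ?b" "q ?b = a" "j \<noteq> a \<Longrightarrow> j \<noteq> ?b \<Longrightarrow> q j = j" for j
  by (auto simp: q_def Transposition.transpose_def)
 interpret stopping_hit hit
 proof
  fix w c c' assume w: "w \<in> space wiener"
  show "hit w c'" if "hit w c" "c \<le> c'"
   using that by (auto simp: hit_def elim: met_by_mono)
  show "0 \<le> c" if "hit w c"
   using that T[of a] by (auto simp: hit_def met_by_def)
  fix w' assume w': "w' \<in> space wiener" and eq: "\<And>j s. s \<le> c \<Longrightarrow> w j s = w' j s"
  have "Y w j s = Y w' j s" if "s \<le> c + T" for j s
   unfolding Y_def using that by (intro coal_causal D_adapted[where c = c] eq) auto
  then show "hit w c = hit w' c"
   by (auto simp: hit_def met_by_def)
 next
  fix c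
  have "Measurable.pred wiener (\<lambda>w. \<exists>u\<in>{max (t a) (t ?b)..c + T}. Y w a u = Y w ?b u)"
   by (rule measurable_meet) (auto simp: Y_meas Y_cont)
  also have "(\<lambda>w. \<exists>u\<in>{max (t a) (t ?b)..c + T}. Y w a u = Y w ?b u) = (\<lambda>w. hit w c)"
   by (auto simp: hit_def met_by_def fun_eq_iff)
  finally show "Measurable.pred wiener (\<lambda>w. hit w c)" .
 qed
 let ?H = "swap_hit a ?b hit"
 \<comment> \<open>The pathwise core: coalescence in the original order, driven by the interchanged
   motions, reproduces \<open>Y\<close>. It suffices to check the conditions of
   \<open>coalesces\<close> for \<open>Y\<close> and to invoke uniqueness.\<close>
 have main: "coal t (D (?H w)) j s = Y w j s" if w: "w \<in> space wiener" for w j s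
 proof (cases "t j \<le> s")
  case False
  then show ?thesis by (simp add: Y_before D_start coal_before)
 next
  case True
  have H: "?H w \<in> space wiener" by (rule swap_hit_space[OF w])
  have DH_other: "D (?H w) j s = D w j s" if "j \<noteq> a" "j \<noteq> ?b" for j s
  proof -
   have "?H w j = w j"
    using that by (auto simp: swap_hit_def swap_at_def fun_eq_iff)
   then show ?thesis by (simp add: D_def drive_from_def)
  qed
  have DH_before: "D (?H w) j s = D w j s" if no: "\<not> hit w (s - T)" for j s
  proof (rule D_adapted[where c = "s - T"])
   fix r assume r: "r \<le> s - T"
   show "?H w j r = w j r"
   proof (cases "\<exists>c. hit w c")
    case True
    have "s - T \<le> Inf {c. hit w c}"
     using True no hit_mono[OF w] by (intro cInf_greatest) (auto, meson linear)
    with True r show ?thesis by (simp add: swap_hit_def swap_at_le)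
   qed (simp add: swap_hit_def)
  qed simp
  have "coalesces (Suc j) t (D (?H w)) (Y w)"
   unfolding coalesces_def
  proof (intro allI impI conjI)
   fix j
   show "Y w j (t j) = D (?H w) j (t j)" by (simp add: Y_before D_start)
   show "continuous_on {t j..} (Y w j)" by (rule Y_cont[OF w])
   show "Y w j s = Y w i s" if "met_by t (Y w) i j s" for i s
    using that Y_merge[of j _ i w s] by (auto simp: met_by_def)
   fix s assume s: "t j \<le> s" and free: "\<forall>i<j. \<not> met_by t (Y w) i j s"
   have hit_met: "hit w (s - T) \<longleftrightarrow> met_by t (Y w) a ?b s" for s
    by (simp add: hit_def)
   consider "j < a" | "?b < j" | "j = ?b" | "j = a" "\<not> met_by t (Y w) a ?b s" | "j = a" "met_by t (Y w) a ?b s"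
    by linarith
   then show "Y w j s = D (?H w) j s"
   proof cases
    case 1
    have "Y w j s = D w j s"
     by (rule Y_free[OF s]) (use 1 free in \<open>auto simp: q_simps\<close>)
    with 1 show ?thesis by (simp add: DH_other)
   next
    case 2
    have "Y w j s = D w j s"
    proof (rule Y_free[OF s])
     fix i assume "i < q j"
     then have "q i < j" using 2 by (cases "i = a"; cases "i = ?b") (auto simp: q_simps)
     with free show "\<not> met_by t (Y w) (q i) j s" by blast
    qed
    with 2 show ?thesis by (simp add: DH_other)
   next
    case 3
    have "Y w j s = D w j s"
     by (rule Y_free[OF s]) (use 3 free in \<open>auto simp: q_simps\<close>)
    moreover have "\<not> hit w (s - T)" using 3 free by (simp add: hit_met)
    ultimately show ?thesis by (simp add: DH_before)
   next
    case 4
    have "Y w j s = D w j s"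
    proof (rule Y_free[OF s])
     fix i assume "i < q j"
     then show "\<not> met_by t (Y w) (q i) j s"
      using 4 free by (cases "i = a") (auto simp: q_simps met_sym[of "Y w" ?b a s])
    qed
    with 4 show ?thesis by (simp add: DH_before hit_met)
   next
    \<comment> \<open>The only case in which the interchange is felt: after the meeting,
      \<open>Y\<close> follows the driver of \<open>Suc a\<close>, which now has priority, and in
      the original order \<open>a\<close> must be driven by the same increments.\<close>
    case 5
    define S where "S = {u. t a \<le> u \<and> t ?b \<le> u \<and> Y w a u = Y w ?b u}"
    have "closed S"
    proof -
     have "S = {max (t a) (t ?b)..} \<inter> {u. Y w a u = Y w ?b u}" by (auto simp: S_def)
     then show ?thesis using Y_cont[OF w] by (auto intro!: closed_Int closed_Collect_eq)
    qed
    moreover have S: "S \<noteq> {}" "bdd_below S"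
     using 5 by (auto simp: S_def met_by_def intro: bdd_belowI[of _ "t a"])
    ultimately have inS: "Inf S \<in> S" by (rule closed_contains_Inf[rotated 2])
    have hit_iff: "hit w c \<longleftrightarrow> Inf S \<le> c + T" for c
    proof
     assume "hit w c"
     then obtain u where "u \<in> S" "u \<le> c + T" by (auto simp: hit_def met_by_def S_def)
     with cInf_lower[OF this(1) S(2)] show "Inf S \<le> c + T" by simp
    next
     assume "Inf S \<le> c + T"
     with inS show "hit w c" by (auto simp: hit_def met_by_def S_def)
    qed
    define h where "h = Inf S"
    have hith: "{c. hit w c} = {h - T..}"
     unfolding hit_iff h_def by auto
    have h: "t a \<le> h" "t ?b \<le> h" "Y w a h = Y w ?b h"
     using inS by (auto simp: S_def h_def)
    have hs: "h \<le> s" using 5 hit_met[of s] hit_iff[of "s - T"] by (simp add: h_def)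
    have H_eq: "?H w = swap_at a ?b (h - T) w"
    proof -
     have "\<exists>c. hit w c" using hith by auto
     then show ?thesis by (simp add: swap_hit_def hith)
    qed
    have Yb: "Y w ?b u = D w ?b u" if u: "t ?b \<le> u" "u \<le> s" for u
    proof (rule Y_free[OF u(1)])
     fix i assume "i < q ?b"
     then have i: "i < a" by (simp add: q_simps)
     show "\<not> met_by t (Y w) (q i) ?b u"
     proof
      assume "met_by t (Y w) (q i) ?b u"
      then obtain v where v: "t i \<le> v" "t ?b \<le> v" "v \<le> u" "Y w i v = Y w ?b v"
       using i by (auto simp: met_by_def q_simps)
      have "Y w i s = Y w ?b s" "Y w a s = Y w ?b s"
       using Y_merge[of i v ?b w s] Y_merge[of a h ?b w s] v u h hs by auto
      then have "met_by t (Y w) i a s"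
       using v u s 5 by (auto simp: met_by_def intro!: exI[of _ s])
      with free i 5 show False by simp
     qed
    qed
    have cl: "coalesces (Suc ?b) t' (\<lambda>i. D w (q i)) (coal t' (\<lambda>i. D w (q i)))"
     by (rule coalesces_coal) (rule D_cont[OF w])
    have mt: "met_by t' (coal t' (\<lambda>i. D w (q i))) a ?b s"
     using 5 by (simp add: met' q_simps met_sym[of "Y w" ?b a s])
    \<comment> \<open>Position \<open>Suc a\<close> of the reordered family is path
      \<open>a\<close>. Its first meeting must be with path \<open>Suc a\<close>, since a meeting
      with an index below \<open>a\<close> is excluded by \<open>free\<close>; so \<open>a\<close>
      follows its own driver until the time \<open>h\<close>.\<close>
    obtain i u where u: "i < ?b" "t' i \<le> u" "t' ?b \<le> u" "u \<le> s"
      "coal t' (\<lambda>i. D w (q i)) i u = coal t' (\<lambda>i. D w (q i)) ?b u"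
      "\<And>v. t' ?b \<le> v \<Longrightarrow> v \<le> u \<Longrightarrow> coal t' (\<lambda>i. D w (q i)) ?b v = D w (q ?b) v"
     by (rule coalesces_first_meeting[OF cl _ D_cont[OF w] _ mt]) (simp, simp, blast)
    have Ya: "Y w a v = D w a v" if "t a \<le> v" "v \<le> u" for v
     using u(6)[of v] that by (simp add: Y_def q_simps t'_def)
    have "met_by t (Y w) (q i) a s"
     using u by (auto simp: met_by_def Y_def qq q_simps t'_def intro!: exI[of _ u])
    then have "i = a"
     using free 5 u(1) by (cases "i = a") (auto simp: q_simps less_Suc_eq)
    then have "u \<in> S"
     using u by (auto simp: S_def t'_def Y_def q_simps)
    then have "h \<le> u" unfolding h_def by (rule cInf_lower[OF _ S(2)])
    then have Da: "D w a h = Y w a h" using Ya h by simp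
    have Db: "D w ?b h = Y w ?b h" using Yb h hs by simp
    have "Y w a s = Y w ?b s" using Y_merge[of a h ?b w s] h hs by simp
    also have "\<dots> = D w ?b s" using Yb h hs by simp
    also have "\<dots> = D w a h + (D w ?b s - D w ?b h)"
     using Da Db h by simp
    also have "\<dots> = D (?H w) a s"
    proof -
     have "?H w a (s - T) = w a (h - T) + (w ?b (s - T) - w ?b (h - T))"
      using swap_at_ge[of "h - T" "s - T" a ?b w a] hs q_simps(1) by (simp add: H_eq q_def)
     moreover have "?H w a (t a - T) = w a (t a - T)"
      using h(1) by (simp add: H_eq swap_at_le)
     moreover have "max s (t a) = s" "max s (t ?b) = s" "max h (t a) = h" "max h (t ?b) = h"
      using h hs by auto
     ultimately show ?thesis
      by (simp add: D_def drive_from_def)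
    qed
    finally show ?thesis using 5 by simp
   qed
  qed
  moreover have "coalesces (Suc j) t (D (?H w)) (coal t (D (?H w)))"
   by (rule coalesces_coal) (rule D_cont[OF H])
  ultimately show ?thesis
   by (rule coalesces_unique[symmetric]) (use True in \<open>auto intro: D_cont[OF H]\<close>)
 qed
 have mD: "D \<in> wiener \<rightarrow>\<^sub>M paths_space" unfolding D_def by (rule measurable_drive_from)
 have mC: "(\<lambda>z j. coal t z (q j)) \<in> paths_space \<rightarrow>\<^sub>M paths_space"
  using measurable_compose[OF measurable_coal_paths measurable_reindex_paths] .
 have mCD: "(\<lambda>w j. coal t (D w) (q j)) \<in> wiener \<rightarrow>\<^sub>M paths_space"
  using measurable_compose[OF mD mC] .
 have "distr wiener paths_space (\<lambda>w j. cbm x t w (q j)) = distr (distr wiener paths_space (drive x t)) paths_space (\<lambda>z j. coal t z (q j))"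
  by (subst distr_distr[OF mC measurable_drive_paths]) (simp add: cbm_def comp_def)
 also have "\<dots> = distr (distr wiener paths_space D) paths_space (\<lambda>z j. coal t z (q j))"
  unfolding D_def by (simp only: distr_drive_from[OF T])
 also have "\<dots> = distr wiener paths_space (\<lambda>w j. coal t (D w) (q j))"
  by (subst distr_distr[OF mC mD]) (simp add: comp_def)
 also have "\<dots> = distr (distr wiener wiener ?H) paths_space (\<lambda>w j. coal t (D w) (q j))"
  by (simp only: distr_swap_hit)
 also have "\<dots> = distr wiener paths_space (\<lambda>w j. Y w (q j))"
  by (subst distr_distr[OF mCD measurable_swap_hit], rule distr_cong) (auto simp: main fun_eq_iff)
 also have "\<dots> = distr wiener paths_space (\<lambda>w. coal t' (drive_from T (x \<circ> q) t' (\<lambda>j. w (q j))))"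
 proof -
  have e: "(\<lambda>i. D w (q i)) = drive_from T (x \<circ> q) t' (\<lambda>j. w (q j))" for w
   by (simp add: fun_eq_iff D_def drive_from_def t'_def)
  show ?thesis by (simp add: Y_def qq e)
 qed
 also have "\<dots> = distr (distr wiener wiener (\<lambda>w j. w (q j))) paths_space (\<lambda>w. coal t' (drive_from T (x \<circ> q) t' w))"
 proof (subst distr_distr)
  show "(\<lambda>w. coal t' (drive_from T (x \<circ> q) t' w)) \<in> wiener \<rightarrow>\<^sub>M paths_space"
   using measurable_compose[OF measurable_drive_from measurable_coal_paths] .
  show "(\<lambda>w j. w (q j)) \<in> wiener \<rightarrow>\<^sub>M wiener"
   by (rule measurable_wienerI) (auto simp: space_wiener)
 qed (simp add: comp_def)
 also have "distr wiener wiener (\<lambda>w j. w (q j)) = wiener"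
  by (rule distr_wiener_reindex) (simp add: q_def)
 also have "distr wiener paths_space (\<lambda>w. coal t' (drive_from T (x \<circ> q) t' w)) =
   distr (distr wiener paths_space (drive_from T (x \<circ> q) t')) paths_space (coal t')"
  by (subst distr_distr[OF measurable_coal_paths measurable_drive_from]) (simp add: comp_def)
 also have "\<dots> = distr (distr wiener paths_space (drive (x \<circ> q) t')) paths_space (coal t')"
  using T by (subst distr_drive_from) (auto simp: t'_def)
 also have "\<dots> = distr wiener paths_space (cbm (x \<circ> q) (t \<circ> q))"
  by (subst distr_distr[OF measurable_coal_paths measurable_drive_paths]) (simp add: comp_def cbm_def[abs_def] t'_def)
 finally show ?thesis .
qed

text \<open>Infinitely many starting times need not be bounded below, as a common clock requires.
  The bounded case is therefore applied to families whose starting data are 0 from index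
  \<open>n\<close> on.\<close>

lemma distr_cbm_adjacent:
 fixes a :: nat
 defines "r \<equiv> Transposition.transpose a (Suc a)"
 shows "distr wiener paths_space (\<lambda>w j. cbm x t w (r j)) = distr wiener paths_space (cbm (x \<circ> r) (t \<circ> r))"
proof (rule paths_space_eqI_prefix[OF prob_space_wiener prob_space_wiener, where n\<^sub>0 = "Suc (Suc a)"])
 define x' where "x' n i = (if i < n then x i else 0)" for n i
 define t' where "t' n i = (if i < n then t i else 0)" for n i
 let ?f = "\<lambda>n w j. cbm (x' n) (t' n) w (r j)"
 let ?g = "\<lambda>n. cbm (x' n \<circ> r) (t' n \<circ> r)"
 have rn: "r j < n \<longleftrightarrow> j < n" if "Suc (Suc a) \<le> n" for j n
  using that by (auto simp: r_def Transposition.transpose_def)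
 show "(\<lambda>w j. cbm x t w (r j)) \<in> wiener \<rightarrow>\<^sub>M paths_space" "?f n \<in> wiener \<rightarrow>\<^sub>M paths_space" for n
  using measurable_compose[OF measurable_cbm_paths measurable_reindex_paths] by auto
 show "distr wiener paths_space (?f n) = distr wiener paths_space (?g n)" for n
  unfolding r_def
 proof (rule distr_cbm_adjacent_bounded)
  fix j
  have "Min (t' n ` {..n}) \<le> t' n (min j n)" by (intro Min_le) auto
  also have "t' n (min j n) = t' n j" by (auto simp: t'_def)
  finally show "Min (t' n ` {..n}) \<le> t' n j" .
 qed
 fix n w j assume n: "Suc (Suc a) \<le> n" and j: "j < n"
 then show "cbm x t w (r j) = ?f n w j"
  using rn[OF n, of j] by (intro cbm_cong) (auto simp: x'_def t'_def)
 show "cbm (x \<circ> r) (t \<circ> r) w j = ?g n w j"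
  using j rn[OF n] by (intro cbm_cong) (auto simp: x'_def t'_def)
qed auto

definition exchangeable :: "(nat \<Rightarrow> nat) \<Rightarrow> bool" where
 "exchangeable p \<longleftrightarrow> bij p \<and> (\<forall>x t. distr wiener paths_space (\<lambda>w j. cbm x t w (p j)) = distr wiener paths_space (cbm (x \<circ> p) (t \<circ> p)))"

lemma exchangeable_comp:
 assumes "exchangeable p" "exchangeable \<rho>"
 shows "exchangeable (p \<circ> \<rho>)"
 unfolding exchangeable_def
proof (intro conjI allI)
 show "bij (p \<circ> \<rho>)" using assms by (auto simp: exchangeable_def bij_comp)
 fix x t
 have m: "(\<lambda>w j. cbm x t w (p j)) \<in> wiener \<rightarrow>\<^sub>M paths_space"
  using measurable_compose[OF measurable_cbm_paths measurable_reindex_paths] .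
 have "distr wiener paths_space (\<lambda>w j. cbm x t w ((p \<circ> \<rho>) j)) =
   distr (distr wiener paths_space (\<lambda>w j. cbm x t w (p j))) paths_space (\<lambda>z j. z (\<rho> j))"
  by (simp add: distr_distr[OF measurable_reindex_paths m] comp_def)
 also have "\<dots> = distr wiener paths_space (\<lambda>w j. cbm (x \<circ> p) (t \<circ> p) w (\<rho> j))"
  using assms(1) by (simp add: exchangeable_def distr_distr[OF measurable_reindex_paths measurable_cbm_paths] comp_def)
 also have "\<dots> = distr wiener paths_space (cbm (x \<circ> (p \<circ> \<rho>)) (t \<circ> (p \<circ> \<rho>)))"
  using assms(2) by (simp add: exchangeable_def comp_assoc)
 finally show "distr wiener paths_space (\<lambda>w j. cbm x t w ((p \<circ> \<rho>) j)) =
   distr wiener paths_space (cbm (x \<circ> (p \<circ> \<rho>)) (t \<circ> (p \<circ> \<rho>)))" .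
qed

lemma exchangeable_id: "exchangeable id"
 by (simp add: exchangeable_def)

lemma exchangeable_transpose_less:
 assumes "a < b"
 shows "exchangeable (Transposition.transpose a b)"
 using assms
proof (induction b)
 case (Suc b)
 have adj: "exchangeable (Transposition.transpose b (Suc b))"
  using distr_cbm_adjacent[where a = b] by (auto simp: exchangeable_def)
 show ?case
 proof (cases "a = b")
  case False
  with Suc have "exchangeable (Transposition.transpose a b)" by simp
  moreover have "Transposition.transpose a (Suc b) =
    Transposition.transpose b (Suc b) \<circ> (Transposition.transpose a b \<circ> Transposition.transpose b (Suc b))"
   using False Suc.prems by (auto simp: fun_eq_iff Transposition.transpose_def)
  ultimately show ?thesis using adj by (metis exchangeable_comp)
 qed (use adj in simp)
qed simp

lemma exchangeable_transpose: "exchangeable (Transposition.transpose a b)"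
proof -
 consider "a < b" | "b < a" | "a = b" by linarith
 then show ?thesis
 proof cases
  case 2
  then show ?thesis using exchangeable_transpose_less[of b a] by (simp add: transpose_commute)
 qed (auto simp: exchangeable_transpose_less exchangeable_id id_def[symmetric])
qed

text \<open>The values are put in place one at a time; each new value is brought to position
  \<open>k\<close> by one transposition, which leaves the earlier positions alone because
  \<open>e\<close> is injective.\<close>

lemma exchangeable_extend:
 assumes "inj_on e {..<k :: nat}"
 shows "\<exists>q. exchangeable q \<and> (\<forall>i<k. q i = e i)"
 using assms
proof (induction k)
 case 0
 show ?case using exchangeable_id by auto
next
 case (Suc k)
 then obtain q where q: "exchangeable q" "\<And>i. i < k \<Longrightarrow> q i = e i"
  by (metis inj_on_subset lessThan_subset_iff le_SucI order_refl)
 have bij: "bij q" using q(1) by (simp add: exchangeable_def)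
 then obtain p where p: "q p = e k" by (metis bij_pointE)
 have "\<not> p < k"
 proof
  assume "p < k"
  with q(2) p have "e p = e k" by simp
  with Suc.prems \<open>p < k\<close> show False by (auto dest: inj_onD)
 qed
 then have "(q \<circ> Transposition.transpose k p) i = e i" if "i < Suc k" for i
  using that q(2)[of i] p by (cases "i = k") (auto simp: Transposition.transpose_def)
 with exchangeable_comp[OF q(1) exchangeable_transpose[of k p]] show ?case by blast
qed

text \<open>On every finite prefix an injection agrees with an exchangeable permutation, and a
  prefix of \<open>cbm\<close> depends on its own starting points only.\<close>

theorem distr_cbm_subfamily:
 assumes "inj e"
 shows "distr wiener paths_space (\<lambda>w j. cbm x t w (e j)) = distr wiener paths_space (cbm (x \<circ> e) (t \<circ> e))"
proof -
 have "\<exists>p. exchangeable p \<and> (\<forall>i<n. p i = e i)" for n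
  by (rule exchangeable_extend) (use assms in \<open>auto intro: inj_on_subset\<close>)
 then obtain p where p: "\<And>n. exchangeable (p n)" "\<And>n i. i < n \<Longrightarrow> p n i = e i" by metis
 show ?thesis
 proof (rule paths_space_eqI_prefix[OF prob_space_wiener prob_space_wiener, where n\<^sub>0 = 0])
  show "(\<lambda>w j. cbm x t w (e j)) \<in> wiener \<rightarrow>\<^sub>M paths_space" "(\<lambda>w j. cbm x t w (p n j)) \<in> wiener \<rightarrow>\<^sub>M paths_space" for n
   using measurable_compose[OF measurable_cbm_paths measurable_reindex_paths] by auto
  show "distr wiener paths_space (\<lambda>w j. cbm x t w (p n j)) = distr wiener paths_space (cbm (x \<circ> p n) (t \<circ> p n))" for n
   using p(1)[of n] by (simp add: exchangeable_def)
  show "cbm (x \<circ> e) (t \<circ> e) w j = cbm (x \<circ> p n) (t \<circ> p n) w j" if "j < n" for w j n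
   using that p(2)[of _ n] by (intro cbm_cong) auto
 qed (auto simp: p(2))
qed

subsection \<open>Hitting estimates\<close>

lemma gauss_near_zero:
 assumes "0 < s" "0 \<le> a"
 shows "measure (gauss s) {x. \<bar>x\<bar> \<le> a} \<le> a / s"
proof -
 interpret prob_space "gauss s" by (rule prob_space_gauss)
 \<comment> \<open>\<open>2 * s <= sqrt (2 * pi * s ^ 2)\<close> holds because pi is at least 2; the
   interval has length \<open>2 * a\<close>.\<close>
 have d: "normal_density 0 s x \<le> 1 / (2 * s)" for x
 proof -
  have "2 * s = sqrt (4 * s\<^sup>2)" using assms by (simp add: real_sqrt_mult)
  also have "\<dots> \<le> sqrt (2 * pi * s\<^sup>2)"
   using pi_ge_two by (intro real_sqrt_le_mono mult_right_mono) auto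
  finally have le: "2 * s \<le> sqrt (2 * pi * s\<^sup>2)" .
  have "normal_density 0 s x \<le> 1 / sqrt (2 * pi * s\<^sup>2) * 1"
   unfolding normal_density_def by (intro mult_left_mono) (auto simp: divide_nonpos_nonneg)
  also have "\<dots> \<le> 1 / (2 * s)"
   using le assms by (auto intro!: divide_left_mono mult_pos_pos)
  finally show ?thesis .
 qed
 have "emeasure (gauss s) {x. \<bar>x\<bar> \<le> a} = (\<integral>\<^sup>+x. normal_density 0 s x * indicator {-a..a} x \<partial>lborel)"
  using assms by (subst gauss_eq_density) (auto simp: emeasure_density abs_le_iff intro!: nn_integral_cong split: split_indicator)
 also have "\<dots> \<le> (\<integral>\<^sup>+x. ennreal (1 / (2 * s)) * indicator {-a..a} x \<partial>lborel)"
  using d by (intro nn_integral_mono) (auto split: split_indicator intro!: ennreal_leI)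
 also have "\<dots> = ennreal (1 / (2 * s)) * ennreal (2 * a)"
  using assms by (subst nn_integral_cmult_indicator) auto
 also have "\<dots> = ennreal (a / s)"
  using assms by (simp add: ennreal_mult[symmetric])
 finally show ?thesis
  using assms by (simp add: emeasure_eq_measure)
qed

lemma distr_wiener_difference:
 assumes "i \<noteq> k" "0 < h"
 shows "distr wiener borel (\<lambda>w. w i h - w k h) = gauss (sqrt (2 * h))"
proof -
 define c :: "nat \<Rightarrow> real" where "c j = (if j = i then 1 else -1)" for j
 have N: "distributed wiener lborel (\<lambda>w. w j h) (normal_density 0 (sqrt h))" for j
 proof -
  have "distr wiener borel (\<lambda>w. w j h) = distr wiener borel (\<lambda>w. w j h - w j 0)"
   by (rule distr_cong) (auto simp: wienerD(2))
  also have "\<dots> = gauss (sqrt h)" using wiener_increment[of 0 h j] assms by simp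
  finally show ?thesis using assms by (simp add: distributed_normal_iff_gauss)
 qed
 have "W.indep_vars (\<lambda>_. borel) (\<lambda>j w. c j * w j h) {i, k}"
  by (rule W.indep_vars_compose2[OF W.indep_vars_subset[OF indep_vars_coordinates[OF prob_space_wiener1]]]) auto
 moreover have "distributed wiener lborel (\<lambda>w. c j * w j h) (normal_density 0 (sqrt h))" for j
  using W.normal_density_affine[OF N, of "c j" 0 j] assms by (auto simp: c_def)
 ultimately have "distributed wiener lborel (\<lambda>w. \<Sum>j\<in>{i, k}. c j * w j h) (normal_density (\<Sum>j\<in>{i, k}. 0) (sqrt (\<Sum>j\<in>{i, k}. (sqrt h)\<^sup>2)))"
  using assms by (intro W.sum_indep_normal) auto
 then have "distributed wiener lborel (\<lambda>w. w i h - w k h) (normal_density 0 (sqrt (2 * h)))"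
  using assms by (simp add: c_def)
 then show ?thesis using assms by (simp add: distributed_normal_iff_gauss)
qed

text \<open>The reflection principle for the gap between two independent Brownian motions: interchanging them
 when they meet changes the sign of the gap.\<close>

lemma wiener_meeting:
 assumes ik: "i \<noteq> k" and a: "0 < a" and h: "0 < h"
 defines "H \<equiv> {w \<in> space wiener. \<exists>u\<in>{0..h}. w i u = a + w k u}"
 shows "H \<in> sets wiener"
  and "measure wiener (space wiener - H) \<le> a / sqrt h"
  and "measure wiener H \<le> 12 * h\<^sup>2 / a ^ 4"
proof -
 define hit where "hit w c \<longleftrightarrow> (\<exists>u\<in>{0..c}. w i u = a + w k u)" for w :: "paths" and c
 have cont: "continuous_on A (w j)" "continuous_on A (\<lambda>u. a + w j u)" if "w \<in> space wiener" for w j A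
  using wienerD(1)[OF that] by (auto intro: continuous_intros)
 interpret stopping_hit hit
 proof
  show "Measurable.pred wiener (\<lambda>w. hit w c)" for c
   unfolding hit_def by (rule measurable_meet) (auto simp: cont)
 qed (force simp: hit_def)+
 have Hh: "H = {w \<in> space wiener. hit w h}" by (simp add: H_def hit_def)
 show Hs: "H \<in> sets wiener" unfolding Hh by measurable
 \<comment> \<open>The gap at time \<open>h\<close> if motion \<open>k\<close> is started at
   \<open>a\<close> and motion \<open>i\<close> at 0.\<close>
 define g where "g w = a + w k h - w i h" for w :: "paths"
 have [measurable]: "g \<in> borel_measurable wiener" unfolding g_def by measurable
 let ?\<Theta> = "swap_hit i k hit"
 have gap: "\<exists>u\<ge>0. u \<le> v \<and> w i u = a + w k u" if w: "w \<in> space wiener" and v: "0 \<le> v" "a + w k v \<le> w i v" for w v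
 proof -
  have "\<exists>u\<ge>0. u \<le> v \<and> w i u - (a + w k u) = 0"
   using v a wienerD(2)[OF w, of 0] by (intro IVT' continuous_on_diff cont[OF w]) auto
  then show ?thesis by auto
 qed
 have no_hit: "0 < g w" if "w \<in> space wiener" "\<not> hit w h" for w
 proof (rule ccontr)
  assume "\<not> 0 < g w"
  with gap[OF that(1), of h] h obtain u where "0 \<le> u" "u \<le> h" "w i u = a + w k u"
   by (auto simp: g_def)
  with that(2) show False by (auto simp: hit_def)
 qed
 have g\<Theta>_no: "g (?\<Theta> w) = g w" if w: "w \<in> space wiener" "\<not> hit w h" for w
 proof -
  have "?\<Theta> w j h = w j h" for j
  proof (cases "\<exists>c. hit w c")
   case True
   have "h \<le> Inf {c. hit w c}"
    using True w hit_mono[OF w(1)] by (intro cInf_greatest) (auto, meson linear)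
   with True show ?thesis by (simp add: swap_hit_def swap_at_le)
  qed (simp add: swap_hit_def)
  then show ?thesis by (simp add: g_def)
 qed
 have g\<Theta>_hit: "g (?\<Theta> w) = - g w" if w: "w \<in> space wiener" "hit w h" for w
 proof -
  define S where "S = {u. 0 \<le> u \<and> w i u = a + w k u}"
  have "S = {0..} \<inter> {u. w i u = a + w k u}" by (auto simp: S_def)
  then have "closed S" using cont[OF w(1)] by (auto intro!: closed_Int closed_Collect_eq)
  moreover have S: "S \<noteq> {}" "bdd_below S"
   using w by (auto simp: S_def hit_def intro: bdd_belowI[of _ 0])
  ultimately have inS: "Inf S \<in> S" by (rule closed_contains_Inf[rotated 2])
  have "hit w c \<longleftrightarrow> Inf S \<le> c" for c
  proof
   assume "hit w c"
   then obtain u where "u \<in> S" "u \<le> c" by (auto simp: hit_def S_def)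
   with cInf_lower[OF this(1) S(2)] show "Inf S \<le> c" by simp
  next
   assume "Inf S \<le> c"
   with inS show "hit w c" by (auto simp: hit_def S_def)
  qed
  then have "{c. hit w c} = {Inf S..}" "Inf S \<le> h" using w by auto
  then have "?\<Theta> w = swap_at i k (Inf S) w" using w by (auto simp: swap_hit_def)
  with inS \<open>Inf S \<le> h\<close> show ?thesis
   by (simp add: g_def swap_at_ge S_def)
 qed
 define G where "G = {w \<in> space wiener. g w < 0}"
 have [measurable]: "G \<in> sets wiener" unfolding G_def by measurable
 let ?P = "{w \<in> space wiener. 0 < g w}"
 \<comment> \<open>Reflection: a gap that has closed and is positive again at time \<open>h\<close>
   corresponds under the interchange to a negative gap.\<close>
 have "H \<inter> ?P = ?\<Theta> -` G \<inter> space wiener"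
 proof safe
  fix w assume w: "w \<in> space wiener" "?\<Theta> w \<in> G"
  show "w \<in> H" "0 < g w"
   using w no_hit[of w] g\<Theta>_no[of w] g\<Theta>_hit[of w] by (cases "hit w h"; simp add: G_def Hh)+
 qed (auto simp: Hh G_def g\<Theta>_hit swap_hit_space)
 then have HP: "measure wiener (H \<inter> ?P) = measure wiener G"
  using measure_distr[OF measurable_swap_hit[of i k], of G] by (simp add: distr_swap_hit)
 let ?N = "\<lambda>w. w i h - w k h" and ?N' = "\<lambda>w. w k h - w i h"
 have law: "measure wiener (?N -` B \<inter> space wiener) = measure (gauss (sqrt (2 * h))) B"
   "measure wiener (?N' -` B \<inter> space wiener) = measure (gauss (sqrt (2 * h))) B" if "B \<in> sets borel" for B
 proof -
  have [measurable]: "?N \<in> borel_measurable wiener" "?N' \<in> borel_measurable wiener" by measurable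
  show "measure wiener (?N -` B \<inter> space wiener) = measure (gauss (sqrt (2 * h))) B"
   using measure_distr[of ?N wiener borel B] that ik h by (simp add: distr_wiener_difference)
  show "measure wiener (?N' -` B \<inter> space wiener) = measure (gauss (sqrt (2 * h))) B"
   using measure_distr[of ?N' wiener borel B] that ik h by (simp add: distr_wiener_difference)
 qed
 have Ga: "measure wiener G = measure (gauss (sqrt (2 * h))) {x. x < - a}"
 proof -
  have "G = ?N' -` {x. x < - a} \<inter> space wiener" by (auto simp: G_def g_def)
  then show ?thesis by (simp only:) (rule law, simp)
 qed
 have Pa: "measure wiener ?P = measure (gauss (sqrt (2 * h))) {x. x < a}"
 proof -
  have "?P = ?N -` {x. x < a} \<inter> space wiener" by (auto simp: g_def)
  then show ?thesis by (simp only:) (rule law, simp)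
 qed
 interpret G: prob_space "gauss (sqrt (2 * h))" by (rule prob_space_gauss)
 \<comment> \<open>So no meeting has the probability \<open>P(N < a) - P(N < - a)\<close>, where
   \<open>N\<close> is the difference of the two motions at time \<open>h\<close>, of variance
   \<open>2 * h\<close>. The mass of a small interval bounds it from above, and the tails of
   \<open>N\<close> give the third claim.\<close>
 have "space wiener - H = ?P - (H \<inter> ?P)" using no_hit by (auto simp: Hh)
 then have "measure wiener (space wiener - H) = measure wiener ?P - measure wiener (H \<inter> ?P)"
  using Hs by (simp add: W.finite_measure_Diff)
 also have "\<dots> = G.prob {x. x < a} - G.prob {x. x < - a}" by (simp add: HP Ga Pa)
 also have "\<dots> = G.prob ({x. x < a} - {x. x < - a})"
  using a by (intro G.finite_measure_Diff[symmetric]) auto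
 also have "{x. x < a} - {x. x < - a} = {- a..<a}" by auto
 finally have nH: "measure wiener (space wiener - H) = G.prob {- a..<a}" .
 also have "\<dots> \<le> G.prob {x. \<bar>x\<bar> \<le> a}" by (intro G.finite_measure_mono) auto
 also have "\<dots> \<le> a / sqrt (2 * h)" using a h by (intro gauss_near_zero) auto
 also have "\<dots> \<le> a / sqrt h" using a h by (intro divide_left_mono) auto
 finally show "measure wiener (space wiener - H) \<le> a / sqrt h" .
 have "measure wiener H = 1 - measure wiener (space wiener - H)"
  using W.prob_compl[OF Hs] by simp
 also have "\<dots> = G.prob (UNIV - {- a..<a})"
  unfolding nH using G.prob_compl[of "{- a..<a}"] by simp
 also have "\<dots> \<le> G.prob {x. a \<le> \<bar>x\<bar>}" by (intro G.finite_measure_mono) auto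
 also have "\<dots> \<le> 3 * (sqrt (2 * h)) ^ 4 / a ^ 4" by (rule gauss_tail[OF a])
 also have "(sqrt (2 * h)) ^ 4 = 4 * h\<^sup>2"
  using h by (simp add: power4_eq_xxxx power2_eq_square)
 finally show "measure wiener H \<le> 12 * h\<^sup>2 / a ^ 4" by simp
qed

lemma emeasure_wiener_product:
 assumes "i \<noteq> k" "A \<in> sets wiener1" "B \<in> sets wiener1"
 shows "\<P>(w in wiener. w i \<in> A \<and> w k \<in> B) = measure wiener1 A * measure wiener1 B"
proof -
 interpret prob_space wiener1 by (rule prob_space_wiener1)
 interpret P: product_prob_space "\<lambda>_. wiener1" "UNIV :: nat set" ..
 have "{w \<in> space wiener. w i \<in> A \<and> w k \<in> B} = {w \<in> space wiener. \<forall>j\<in>{i, k}. w j \<in> (if j = i then A else B)}"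
  using assms by auto
 moreover have "emeasure wiener {w \<in> space wiener. \<forall>j\<in>{i, k}. w j \<in> (if j = i then A else B)} = emeasure wiener1 A * emeasure wiener1 B"
  using assms by (subst P.emeasure_PiM_Collect) auto
 ultimately show ?thesis by (simp add: measure_def enn2real_mult)
qed

definition levels :: "real \<Rightarrow> real \<Rightarrow> (real \<Rightarrow> real) set" where
 "levels c e = {f \<in> space wiener1. \<exists>u\<in>{0..e}. f u = c}"

lemma sets_levels [measurable]: "levels c e \<in> sets wiener1"
proof -
 have "Measurable.pred wiener1 (\<lambda>f. \<exists>u\<in>{0..e}. f u = c)"
  by (rule measurable_meet) (auto simp: space_wiener1 intro: continuous_on_subset)
 then show ?thesis unfolding levels_def by measurable
qed

lemma levels_reached:
 assumes "f \<in> space wiener1" "0 \<le> u" "u \<le> e" "0 \<le> c \<and> c \<le> f u \<or> c \<le> 0 \<and> f u \<le> c"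
 shows "f \<in> levels c e"
proof -
 have f: "continuous_on {0..u} f" "f 0 = 0"
  using assms(1) by (auto simp: space_wiener1 intro: continuous_on_subset)
 have "\<exists>v\<ge>0. v \<le> u \<and> f v = c"
  using assms(4)
 proof
  assume "0 \<le> c \<and> c \<le> f u"
  then show ?thesis using f assms by (intro IVT') auto
 next
  assume "c \<le> 0 \<and> f u \<le> c"
  then show ?thesis using f assms by (intro IVT2') auto
 qed
 then show ?thesis using assms by (auto simp: levels_def)
qed

text \<open>The events decrease as the time shrinks, and by continuity at 0 no path belongs to all
  of them.\<close>

lemma levels_small:
 assumes "c \<noteq> 0" "0 < p"
 shows "\<exists>e>0. measure wiener1 (levels c e) < p"
proof -
 interpret prob_space wiener1 by (rule prob_space_wiener1)
 have "(\<lambda>n. measure wiener1 (levels c (1 / Suc n))) \<longlonglongrightarrow> measure wiener1 (\<Inter>n. levels c (1 / Suc n))"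
 proof (rule finite_Lim_measure_decseq)
  show "decseq (\<lambda>n. levels c (1 / Suc n))"
  proof (rule decseq_SucI)
   fix n
   have "1 / real (Suc (Suc n)) \<le> 1 / Suc n" by (simp add: frac_le)
   then show "levels c (1 / Suc (Suc n)) \<subseteq> levels c (1 / Suc n)"
    unfolding levels_def by (auto intro: order_trans)
  qed
 qed auto
 also have "(\<Inter>n. levels c (1 / Suc n)) = {}"
 proof safe
  fix f assume f: "f \<in> (\<Inter>n. levels c (1 / Suc n))"
  then have f1: "continuous_on UNIV f" "f 0 = 0" by (auto simp: levels_def space_wiener1)
  then obtain d where d: "0 < d" "\<And>u. dist u 0 < d \<Longrightarrow> dist (f u) (f 0) < \<bar>c\<bar>"
   using assms unfolding continuous_on_iff by (metis UNIV_I zero_less_abs_iff)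
  obtain n where n: "1 / Suc n < d"
   using d(1) reals_Archimedean[of d] by (auto simp: inverse_eq_divide)
  from f have "f \<in> levels c (1 / Suc n)" by blast
  then obtain u where "0 \<le> u" "u \<le> 1 / Suc n" "f u = c" by (auto simp: levels_def)
  with d(2)[of u] n f1 show "f \<in> {}" by (auto simp: dist_real_def)
 qed
 finally have "(\<lambda>n. measure wiener1 (levels c (1 / Suc n))) \<longlonglongrightarrow> 0" by simp
 from order_tendstoD(2)[OF this assms(2)] obtain n where "measure wiener1 (levels c (1 / Suc n)) < p"
  by (auto simp: eventually_sequentially)
 then show ?thesis by (intro exI[of _ "1 / Suc n"]) auto
qed

text \<open>A Brownian motion that reaches level \<open>4 * d\<close> crosses an independent one started from \<open>2 * d\<close>,
 unless the latter rises by \<open>2 * d\<close> as well.\<close>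

lemma levels_bound:
 assumes d: "0 < d"
 shows "\<exists>E\<^sub>0>0. \<forall>E. 0 < E \<longrightarrow> E \<le> E\<^sub>0 \<longrightarrow> measure wiener1 (levels (4 * d) E \<union> levels (- 4 * d) E) \<le> 3 * E\<^sup>2 / d ^ 4"
proof -
 interpret prob_space wiener1 by (rule prob_space_wiener1)
 obtain e1 e2 where e: "0 < e1" "prob (levels (2 * d) e1) < 1 / 2" "0 < e2" "prob (levels (- 2 * d) e2) < 1 / 2"
  using levels_small[of "2 * d" "1 / 2"] levels_small[of "- 2 * d" "1 / 2"] d by auto
 have mono: "levels c E \<subseteq> levels c E'" if "E \<le> E'" for c E E'
  using that by (auto simp: levels_def)
 have half: "1 / 2 \<le> prob (space wiener1 - levels c E)" if "prob (levels c E') < 1 / 2" "E \<le> E'" for c E E'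
  using finite_measure_mono[OF mono[OF that(2)], of c] that(1) by (simp add: prob_compl)
 \<comment> \<open>\<open>wiener_meeting\<close> with distance \<open>2 * d\<close> gives
   \<open>12 * E ^ 2 / (2 * d) ^ 4\<close>; dividing by the probability of \<open>B\<close>, which
   is at least 1/2, doubles it.\<close>
 have bound: "prob A \<le> 3 * E\<^sup>2 / (2 * d ^ 4)"
  if E: "0 < E" and A: "A \<in> sets wiener1" "B \<in> sets wiener1" and B: "1 / 2 \<le> prob B"
   and ik: "i \<noteq> k" "i' \<noteq> k'"
   and meet: "\<And>w. w \<in> space wiener \<Longrightarrow> w i' \<in> A \<Longrightarrow> w k' \<in> B \<Longrightarrow> \<exists>u\<in>{0..E}. w i u = 2 * d + w k u"
  for E A B i k i' k'
 proof -
  have "prob A * (1 / 2) \<le> prob A * prob B" using B by (intro mult_left_mono) auto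
  also have "\<dots> = \<P>(w in wiener. w i' \<in> A \<and> w k' \<in> B)"
   by (rule emeasure_wiener_product[symmetric]) (use ik A in auto)
  also have "\<dots> \<le> \<P>(w in wiener. \<exists>u\<in>{0..E}. w i u = 2 * d + w k u)"
   using meet wiener_meeting(1)[of i k "2 * d" E] ik E d by (intro W.finite_measure_mono) auto
  also have "\<dots> \<le> 12 * E\<^sup>2 / (2 * d) ^ 4"
   using wiener_meeting(3)[of i k "2 * d" E] ik E d by auto
  finally show ?thesis by (simp add: power_mult_distrib)
 qed
 have gap: "\<exists>u\<in>{0..E}. w i u = 2 * d + w k u"
  if w: "w \<in> space wiener" and v: "0 \<le> v" "v \<le> E" "2 * d + w k v \<le> w i v" for w v i k E
 proof -
  have "\<exists>u\<ge>0. u \<le> v \<and> w i u - (2 * d + w k u) = 0"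
   using v d wienerD(2)[OF w, of 0]
   by (intro IVT' continuous_on_diff continuous_on_add continuous_on_const wienerD(1)[OF w]) auto
  with v show ?thesis by auto
 qed
 have comp: "w j \<in> space wiener1" if "w \<in> space wiener" for w j
  using that by (auto simp: space_PiM PiE_iff)
 have "measure wiener1 (levels (4 * d) E \<union> levels (- 4 * d) E) \<le> 3 * E\<^sup>2 / d ^ 4" if E: "0 < E" "E \<le> min e1 e2" for E
 proof -
  have "prob (levels (4 * d) E) \<le> 3 * E\<^sup>2 / (2 * d ^ 4)"
  proof (rule bound[of E _ "space wiener1 - levels (2 * d) E" 0 1 0 1])
   fix w assume w: "w \<in> space wiener" "w 0 \<in> levels (4 * d) E" "w 1 \<in> space wiener1 - levels (2 * d) E"
   then obtain v where v: "0 \<le> v" "v \<le> E" "w 0 v = 4 * d" by (auto simp: levels_def)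
   have "w 1 v < 2 * d"
    using levels_reached[OF comp[OF w(1)] v(1,2), of "2 * d" 1] w(3) d by (cases "2 * d \<le> w 1 v") auto
   with v show "\<exists>u\<in>{0..E}. w 0 u = 2 * d + w 1 u"
    by (intro gap[OF w(1), of v]) auto
  qed (use E half[OF e(2)] in auto)
  moreover have "prob (levels (- 4 * d) E) \<le> 3 * E\<^sup>2 / (2 * d ^ 4)"
  proof (rule bound[of E _ "space wiener1 - levels (- 2 * d) E" 1 0 0 1])
   fix w assume w: "w \<in> space wiener" "w 0 \<in> levels (- 4 * d) E" "w 1 \<in> space wiener1 - levels (- 2 * d) E"
   then obtain v where v: "0 \<le> v" "v \<le> E" "w 0 v = - 4 * d" by (auto simp: levels_def)
   have "- 2 * d < w 1 v"
    using levels_reached[OF comp[OF w(1)] v(1,2), of "- 2 * d" 1] w(3) d by (cases "w 1 v \<le> - 2 * d") auto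
   with v show "\<exists>u\<in>{0..E}. w 1 u = 2 * d + w 0 u"
    by (intro gap[OF w(1), of v]) auto
  qed (use E half[OF e(4)] in auto)
  moreover have "prob (levels (4 * d) E \<union> levels (- 4 * d) E) \<le> prob (levels (4 * d) E) + prob (levels (- 4 * d) E)"
   by (rule measure_Un_le) auto
  moreover have "3 * E\<^sup>2 / (2 * d ^ 4) + 3 * E\<^sup>2 / (2 * d ^ 4) = 3 * E\<^sup>2 / d ^ 4"
   by (simp add: field_simps)
  ultimately show ?thesis by linarith
 qed
 with e show ?thesis by (intro exI[of _ "min e1 e2"]) auto
qed

lemma subfamily_prob:
 assumes "inj e" "E \<in> sets paths_space"
 shows "\<P>(w in wiener. (\<lambda>j. cbm x t w (e j)) \<in> E) = \<P>(w in wiener. cbm (x \<circ> e) (t \<circ> e) w \<in> E)"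
proof -
 have m: "(\<lambda>w j. cbm x t w (e j)) \<in> wiener \<rightarrow>\<^sub>M paths_space"
  using measurable_compose[OF measurable_cbm_paths measurable_reindex_paths] .
 have "measure (distr wiener paths_space (\<lambda>w j. cbm x t w (e j))) E = measure (distr wiener paths_space (cbm (x \<circ> e) (t \<circ> e))) E"
  by (simp only: distr_cbm_subfamily[OF assms(1)])
 then show ?thesis
  by (simp add: measure_distr[OF m assms(2)] measure_distr[OF measurable_cbm_paths assms(2)] vimage_def Int_def conj_commute)
qed

lemma obtain_inj:
 fixes i k q :: nat
 assumes "i \<noteq> k" "i \<noteq> q" "k \<noteq> q"
 obtains e :: "nat \<Rightarrow> nat" where "inj e" "e 0 = i" "e 1 = k" "e 2 = q"
proof -
 define f where "f n = (if n = 0 then i else if n = 1 then k else q)" for n :: nat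
 have "inj_on f {..<3}"
  using assms by (auto simp: inj_on_def f_def less_Suc_eq numeral_3_eq_3)
 from exchangeable_extend[OF this] obtain p where "exchangeable p" "\<forall>n<3. p n = f n" by blast
 then show ?thesis
  by (intro that[of p]) (auto simp: exchangeable_def bij_is_inj f_def)
qed

lemma cbm_0: "cbm x t w 0 = drive x t w 0"
 by (simp add: cbm_def coal_eq_part)

lemma cbm_1_neq:
 assumes "t 0 = t 1" "t 0 \<le> s"
 shows "cbm x t w 0 s \<noteq> cbm x t w 1 s \<longleftrightarrow> \<not> (\<exists>u\<in>{t 0..s}. drive x t w 1 u = drive x t w 0 u)"
proof -
 have "cbm x t w 1 = glue (t 0) (drive x t w 1) (drive x t w 0)"
  using assms by (simp add: cbm_def coal_eq_part One_nat_def)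
 then have *: "cbm x t w 1 s = glue (t 0) (drive x t w 1) (drive x t w 0) s" by simp
 show ?thesis
 proof (cases "\<exists>u\<in>{t 0..s}. drive x t w 1 u = drive x t w 0 u")
  case False
  with assms(2) have "drive x t w 1 s \<noteq> drive x t w 0 s" by auto
  with False show ?thesis unfolding * cbm_0 glue_def by auto
 next
  case True
  then show ?thesis unfolding * cbm_0 glue_def by auto
 qed
qed

text \<open>The inequality may be non-strict: a meeting exactly at time \<open>s\<close> does not
  change the value at \<open>s\<close>.\<close>

lemma coal_early:
 assumes "\<And>i. i < j \<Longrightarrow> s \<le> t i"
 shows "coal t B j s = B j s"
proof -
 have "coal_part t B j k s = B j s" if "k \<le> j" for k
  using that
 proof (induction k)
  case (Suc k)
  then have "s \<le> t k" using assms[of k] by simp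
  then have "glue (max (t k) (t j)) (coal_part t B j k) (coal t B k) s = coal_part t B j k s"
  proof (cases "\<exists>u\<in>{max (t k) (t j)..s}. coal_part t B j k u = coal t B k u")
   case True
   then obtain u where u: "max (t k) (t j) \<le> u" "u \<le> s" "coal_part t B j k u = coal t B k u" by auto
   with \<open>s \<le> t k\<close> have "u = s" by simp
   with u True show ?thesis by (simp add: glue_def)
  qed (simp add: glue_def)
  with Suc show ?case by simp
 qed simp
 then show ?thesis by (simp add: coal_eq_part)
qed

lemma distr_wiener_eval:
 assumes "0 < h"
 shows "distr wiener borel (\<lambda>w. w j h) = gauss (sqrt h)"
proof -
 have "distr wiener borel (\<lambda>w. w j h) = distr wiener borel (\<lambda>w. w j h - w j 0)"
  by (rule distr_cong) (auto simp: wienerD(2))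
 then show ?thesis using wiener_increment[of 0 h j] assms by simp
qed

text \<open>By \<open>subfamily_prob\<close> the path may be moved to index 0, where it equals its
  driver.\<close>

lemma one_time_prob:
 assumes B: "B \<in> sets borel" and "t j < s"
 shows "\<P>(w in wiener. cbm x t w j s \<in> B) = measure (gauss (sqrt (s - t j))) {y. x j + y \<in> B}"
proof -
 define E where "E = {z \<in> space paths_space. z 0 s \<in> B}"
 have [measurable]: "B \<in> sets borel" by fact
 have [measurable]: "{z \<in> space paths_space. z 0 s \<in> B} \<in> sets paths_space" by measurable
 have "\<P>(w in wiener. cbm x t w j s \<in> B) = \<P>(w in wiener. x j + w 0 (s - t j) \<in> B)"
 proof -
  let ?e = "Transposition.transpose 0 j"
  have "\<P>(w in wiener. (\<lambda>i. cbm x t w (?e i)) \<in> E) = \<P>(w in wiener. cbm (x \<circ> ?e) (t \<circ> ?e) w \<in> E)"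
   unfolding E_def by (rule subfamily_prob) auto
  moreover have "{w \<in> space wiener. (\<lambda>i. cbm x t w (?e i)) \<in> E} = {w \<in> space wiener. cbm x t w j s \<in> B}"
   by (auto simp: E_def space_paths_space continuous_cbm)
  moreover have "{w \<in> space wiener. cbm (x \<circ> ?e) (t \<circ> ?e) w \<in> E} = {w \<in> space wiener. x j + w 0 (s - t j) \<in> B}"
   by (auto simp: E_def space_paths_space continuous_cbm cbm_0 drive_def)
  ultimately show ?thesis by simp
 qed
 also have "\<dots> = measure (distr wiener borel (\<lambda>w. w 0 (s - t j))) {y. x j + y \<in> B}"
  by (subst measure_distr) (auto simp: vimage_def Int_def conj_commute)
 finally show ?thesis using assms(2) by (simp add: distr_wiener_eval)
qed

lemma AE_cbm_neq:
 assumes "t j < s"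
 shows "AE w in wiener. cbm x t w j s \<noteq> y"
proof -
 have "\<P>(w in wiener. cbm x t w j s \<in> {y}) = measure (gauss (sqrt (s - t j))) {z. x j + z \<in> {y}}"
  by (rule one_time_prob) (use assms in auto)
 also have "{z. x j + z \<in> {y}} = {y - x j}" by auto
 also have "measure (gauss (sqrt (s - t j))) {y - x j} = 0"
 proof -
  have "{y - x j} \<in> null_sets (density lborel (normal_density 0 (sqrt (s - t j))))"
  proof (subst null_sets_density_iff, simp, intro conjI)
   show "AE z in lborel. z \<in> {y - x j} \<longrightarrow> ennreal (normal_density 0 (sqrt (s - t j)) z) = 0"
    using AE_lborel_singleton[of "y - x j"] by eventually_elim simp
  qed simp
  with assms show ?thesis by (simp add: gauss_eq_density measure_def null_setsD1)
 qed
 finally have "{w \<in> space wiener. cbm x t w j s = y} \<in> null_sets wiener"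
  by (intro null_setsI) (auto simp: W.emeasure_eq_measure)
 from AE_not_in[OF this] AE_space[of wiener] show ?thesis by eventually_elim auto
qed

text \<open>The three paths are moved to the indices 0, 1, 2. The two started at time
  \<open>s\<close> stay distinct iff their drivers do not meet. The older path has lowest priority
  but is still undisturbed at time \<open>s\<close>, so its position depends only on motion 2 and is
  independent of that event.\<close>

lemma cbm_not_coalesced:
 assumes ik: "i \<noteq> k" and t: "t i = s" "t k = s" and h: "0 < h"
 shows "\<P>(w in wiener. cbm x t w i (s + h) \<noteq> cbm x t w k (s + h)) \<le> \<bar>x i - x k\<bar> / sqrt h"
  and "B \<in> sets borel \<Longrightarrow> q \<noteq> i \<Longrightarrow> q \<noteq> k \<Longrightarrow> t q < s \<Longrightarrow>
   \<P>(w in wiener. cbm x t w q s \<in> B \<and> cbm x t w i (s + h) \<noteq> cbm x t w k (s + h))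
    \<le> \<P>(w in wiener. cbm x t w q s \<in> B) * (\<bar>x i - x k\<bar> / sqrt h)"
proof -
 have merge: "cbm x t w i (s + h) = cbm x t w k (s + h)" if "x i = x k" "w \<in> space wiener" for w
  unfolding cbm_def
  using cbm_start[OF that(2), of x t i] cbm_start[OF that(2), of x t k] t h that(1)
  by (rule_tac coal_merge[where u = s]) (auto simp: cbm_def)
 have main: "\<P>(w in wiener. cbm x t w q s \<in> B \<and> cbm x t w i (s + h) \<noteq> cbm x t w k (s + h))
    \<le> \<P>(w in wiener. cbm x t w q s \<in> B) * (\<bar>x i - x k\<bar> / sqrt h)"
  if B: "B \<in> sets borel" and q: "q \<noteq> i" "q \<noteq> k" and tq: "t q < s \<or> B = UNIV" for q B
 proof (cases "x i = x k")
  case True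
  then have "{w \<in> space wiener. cbm x t w q s \<in> B \<and> cbm x t w i (s + h) \<noteq> cbm x t w k (s + h)} = {}"
   using merge by auto
  then show ?thesis using h by (simp only:) simp
 next
  case False
  obtain e :: "nat \<Rightarrow> nat" where e: "inj e" "e 0 = i" "e 1 = k" "e 2 = q"
   by (rule obtain_inj[of i k q]) (use ik q in auto)
  define X where "X = x \<circ> e"
  define T where "T = t \<circ> e"
  have XT: "X 0 = x i" "X 1 = x k" "X 2 = x q" "T 0 = s" "T 1 = s" "T 2 = t q"
   using e t by (auto simp: X_def T_def)
  have [measurable]: "B \<in> sets borel" by fact
  define E where "E = {z \<in> space paths_space. z 2 s \<in> B \<and> z 0 (s + h) \<noteq> z 1 (s + h)}"
  define F where "F = {z \<in> space paths_space. z 2 s \<in> B}"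
  have ev: "(\<lambda>z. z 2 s) \<in> borel_measurable paths_space" "(\<lambda>z. z 0 (s + h)) \<in> borel_measurable paths_space"
   "(\<lambda>z. z 1 (s + h)) \<in> borel_measurable paths_space"
   by (rule measurable_paths_space_eval)+
  have F: "F \<in> sets paths_space" unfolding F_def using ev(1) by measurable
  have "{z \<in> space paths_space. z 0 (s + h) \<noteq> z 1 (s + h)} \<in> sets paths_space"
   by (rule borel_measurable_neq[OF ev(2,3)])
  from sets.Int[OF F this] have E: "E \<in> sets paths_space" by (simp add: E_def F_def Int_def conj_ac cong: conj_cong)
  note [measurable] = E F
  have "\<P>(w in wiener. cbm x t w q s \<in> B \<and> cbm x t w i (s + h) \<noteq> cbm x t w k (s + h)) =
    \<P>(w in wiener. (\<lambda>j. cbm x t w (e j)) \<in> E)"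
   using e by (intro arg_cong[where f = "measure wiener"]) (auto simp: E_def space_paths_space continuous_cbm)
  also have "\<dots> = \<P>(w in wiener. cbm X T w \<in> E)"
   unfolding X_def T_def by (rule subfamily_prob[OF e(1)]) simp
  finally have 1: "\<P>(w in wiener. cbm x t w q s \<in> B \<and> cbm x t w i (s + h) \<noteq> cbm x t w k (s + h)) =
    \<P>(w in wiener. cbm X T w \<in> E)" .
  have "\<P>(w in wiener. cbm x t w q s \<in> B) =
    \<P>(w in wiener. (\<lambda>j. cbm x t w (e j)) \<in> F)"
   using e by (intro arg_cong[where f = "measure wiener"]) (auto simp: F_def space_paths_space continuous_cbm)
  also have "\<dots> = \<P>(w in wiener. cbm X T w \<in> F)"
   unfolding X_def T_def by (rule subfamily_prob[OF e(1)]) simp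
  finally have 2: "\<P>(w in wiener. cbm x t w q s \<in> B) = \<P>(w in wiener. cbm X T w \<in> F)" .
  define a where "a = \<bar>x i - x k\<bar>"
  \<comment> \<open>The two motions are labelled so that the distance to be closed is the positive
    number \<open>a\<close>.\<close>
  define i' :: nat where "i' = (if x i < x k then 0 else 1)"
  define k' :: nat where "k' = (if x i < x k then 1 else 0)"
  define H where "H = {w \<in> space wiener. \<exists>u\<in>{0..h}. w i' u = a + w k' u}"
  have H: "H \<in> sets wiener" "measure wiener (space wiener - H) \<le> a / sqrt h"
   using wiener_meeting[of i' k' a h] False h by (auto simp: H_def a_def i'_def k'_def)
  have E_iff: "cbm X T w \<in> E \<longleftrightarrow> x q + w 2 (s - t q) \<in> B \<and> w \<notin> H" if w: "w \<in> space wiener" for w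
  proof -
   have "cbm X T w 0 (s + h) \<noteq> cbm X T w 1 (s + h) \<longleftrightarrow> \<not> (\<exists>u\<in>{s..s + h}. drive X T w 1 u = drive X T w 0 u)"
    using XT h by (subst cbm_1_neq) auto
   also have "(\<exists>u\<in>{s..s + h}. drive X T w 1 u = drive X T w 0 u) \<longleftrightarrow> w \<in> H"
   proof
    assume "\<exists>u\<in>{s..s + h}. drive X T w 1 u = drive X T w 0 u"
    then obtain u where "u \<in> {s..s + h}" "drive X T w 1 u = drive X T w 0 u" by blast
    with w XT False show "w \<in> H"
     unfolding H_def by (auto simp: drive_def i'_def k'_def a_def intro!: bexI[of _ "u - s"])
   next
    assume "w \<in> H"
    then obtain u where "u \<in> {0..h}" "w i' u = a + w k' u" by (auto simp: H_def)
    with XT False show "\<exists>u\<in>{s..s + h}. drive X T w 1 u = drive X T w 0 u"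
     by (intro bexI[of _ "u + s"]) (auto simp: drive_def i'_def k'_def a_def split: if_splits)
   qed
   finally have neq: "cbm X T w 0 (s + h) \<noteq> cbm X T w 1 (s + h) \<longleftrightarrow> w \<notin> H" .
   have "cbm X T w 2 s = drive X T w 2 s"
    unfolding cbm_def by (rule coal_early) (use XT in \<open>auto simp: less_2_cases_iff\<close>)
   then have "cbm X T w 2 s = x q + w 2 (s - t q)" using XT by (simp add: drive_def)
   with neq show ?thesis by (simp add: E_def w space_paths_space continuous_cbm)
  qed
  have F_iff: "cbm X T w \<in> F \<longleftrightarrow> x q + w 2 (s - t q) \<in> B" if w: "w \<in> space wiener" for w
  proof -
   have "cbm X T w 2 s = drive X T w 2 s"
    unfolding cbm_def by (rule coal_early) (use XT in \<open>auto simp: less_2_cases_iff\<close>)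
   then show ?thesis using XT by (simp add: drive_def F_def w space_paths_space continuous_cbm)
  qed
  have "W.indep_vars (\<lambda>_. wiener1) (\<lambda>j w. w j) UNIV"
   by (rule indep_vars_coordinates[OF prob_space_wiener1])
  from W.indep_var_restrict[OF this, of "{2}" "{0, 1}"]
  have ind: "W.indep_var (PiM {2::nat} (\<lambda>_. wiener1)) (\<lambda>w. restrict w {2}) (PiM {0::nat, 1} (\<lambda>_. wiener1)) (\<lambda>w. restrict w {0, 1})"
   by simp
  define F' where "F' = {f \<in> space (PiM {2::nat} (\<lambda>_. wiener1)). x q + f (2::nat) (s - t q) \<in> B}"
  define H' where "H' = {f \<in> space (PiM {0::nat, 1} (\<lambda>_. wiener1)). \<not> (\<exists>u\<in>{0..h}. f i' u = a + f k' u)}"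
  have ev: "(\<lambda>f. f j s) \<in> borel_measurable (PiM J (\<lambda>_. wiener1))" if "j \<in> J" for j :: nat and J and s :: real
   using measurable_compose[OF measurable_component_singleton[OF that, of "\<lambda>_. wiener1"] measurable_wiener1_eval] .
  have [measurable]: "(\<lambda>f. f (2::nat) (s - t q)) \<in> borel_measurable (PiM {2::nat} (\<lambda>_. wiener1))"
   by (rule ev) simp
  have F': "F' \<in> sets (PiM {2::nat} (\<lambda>_. wiener1))" unfolding F'_def by measurable
  have [measurable]: "Measurable.pred (PiM {0::nat, 1} (\<lambda>_. wiener1)) (\<lambda>f. \<exists>u\<in>{0..h}. f i' u = a + f k' u)"
  proof (rule measurable_meet)
   have ik': "i' \<in> {0, 1}" "k' \<in> {0, 1}" by (auto simp: i'_def k'_def)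
   show "(\<lambda>f. f i' s) \<in> borel_measurable (PiM {0::nat, 1} (\<lambda>_. wiener1))" "(\<lambda>f. a + f k' s) \<in> borel_measurable (PiM {0::nat, 1} (\<lambda>_. wiener1))" for s
    using ev[OF ik'(1), of s] ev[OF ik'(2), of s] by auto
   fix f assume "f \<in> space (PiM {0::nat, 1} (\<lambda>_. wiener1))"
   then have "f i' \<in> space wiener1" "f k' \<in> space wiener1"
    using ik' by (auto simp: space_PiM PiE_iff)
   then show "continuous_on {0..h} (f i')" "continuous_on {0..h} (\<lambda>u. a + f k' u)"
    by (auto simp: space_wiener1 intro: continuous_on_subset continuous_on_add[OF continuous_on_const])
  qed
  have H': "H' \<in> sets (PiM {0::nat, 1} (\<lambda>_. wiener1))" unfolding H'_def by measurable
  have comp: "restrict w J \<in> space (PiM J (\<lambda>_. wiener1))" if "w \<in> space wiener" for w J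
   using that by (auto simp: space_PiM PiE_iff)
  have rF: "(\<lambda>w. restrict w {2}) -` F' \<inter> space wiener = {w \<in> space wiener. x q + w 2 (s - t q) \<in> B}"
   using comp by (auto simp: F'_def)
  have rH: "(\<lambda>w. restrict w {0, 1}) -` H' \<inter> space wiener = space wiener - H"
  proof -
   have "restrict w {0, 1} i' = w i'" "restrict w {0, 1} k' = w k'" for w :: "paths"
    by (auto simp: i'_def k'_def)
   then show ?thesis using comp by (auto simp: H'_def H_def)
  qed
  have EH: "{w \<in> space wiener. cbm X T w \<in> E} = {w \<in> space wiener. x q + w 2 (s - t q) \<in> B} \<inter> (space wiener - H)"
   using E_iff by auto
  have "\<P>(w in wiener. cbm X T w \<in> E) =
    measure wiener ((\<lambda>w. (restrict w {2}, restrict w {0, 1})) -` (F' \<times> H') \<inter> space wiener)"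
   unfolding EH rF[symmetric] rH[symmetric] by (auto intro!: arg_cong[where f = "measure wiener"])
  also have "\<dots> = \<P>(w in wiener. x q + w 2 (s - t q) \<in> B) * measure wiener (space wiener - H)"
   unfolding W.indep_varD[OF ind F' H'] rF rH ..
  also have "\<dots> \<le> \<P>(w in wiener. x q + w 2 (s - t q) \<in> B) * (a / sqrt h)"
   by (intro mult_left_mono H) simp
  also have "{w \<in> space wiener. x q + w 2 (s - t q) \<in> B} = {w \<in> space wiener. cbm X T w \<in> F}"
   using F_iff by auto
  finally show ?thesis unfolding 1 2 a_def .
 qed
 \<comment> \<open>With \<open>B = UNIV\<close> any third path serves, whenever it starts; this is
   why \<open>main\<close> allows \<open>B = UNIV\<close> in place of
   \<open>t q < s\<close>.\<close>
 obtain r where "r \<noteq> i" "r \<noteq> k"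
  by (metis n_not_Suc_n lessI less_SucI less_irrefl max.strict_coboundedI1 max.strict_coboundedI2)
 from main[of UNIV r, OF _ this] show "\<P>(w in wiener. cbm x t w i (s + h) \<noteq> cbm x t w k (s + h)) \<le> \<bar>x i - x k\<bar> / sqrt h"
  using W.prob_space by simp
 show "\<P>(w in wiener. cbm x t w q s \<in> B \<and> cbm x t w i (s + h) \<noteq> cbm x t w k (s + h))
    \<le> \<P>(w in wiener. cbm x t w q s \<in> B) * (\<bar>x i - x k\<bar> / sqrt h)"
  if "B \<in> sets borel" "q \<noteq> i" "q \<noteq> k" "t q < s" for q
  using main[of B q] that by blast
qed

text \<open>An excursion beyond \<open>4 * d\<close> passes one of the two levels, and every single
  path is a Brownian motion after being moved to index 0. Hence the bound is uniform in the starting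
  data.\<close>

lemma cbm_excursion:
 assumes "0 < d"
 shows "\<exists>r\<^sub>0>0. \<forall>r x t j. 0 < r \<longrightarrow> r \<le> r\<^sub>0 \<longrightarrow>
  \<P>(w in wiener. \<not> (\<forall>u\<in>{t j..t j + r}. \<bar>cbm x t w j u - x j\<bar> \<le> 4 * d)) \<le> 3 * r\<^sup>2 / d ^ 4"
proof -
 obtain e0 where e0: "0 < e0" "\<And>r. 0 < r \<Longrightarrow> r \<le> e0 \<Longrightarrow> measure wiener1 (levels (4 * d) r \<union> levels (- 4 * d) r) \<le> 3 * r\<^sup>2 / d ^ 4"
  using levels_bound[OF assms] by blast
 have "\<P>(w in wiener. \<not> (\<forall>u\<in>{t j..t j + r}. \<bar>cbm x t w j u - x j\<bar> \<le> 4 * d)) \<le> 3 * r\<^sup>2 / d ^ 4"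
  if r: "0 < r" "r \<le> e0" for r x t and j :: nat
 proof -
  let ?e = "Transposition.transpose 0 j"
  define E where "E = {z \<in> space paths_space. (\<exists>u\<in>{t j..t j + r}. z 0 u = x j + 4 * d) \<or> (\<exists>u\<in>{t j..t j + r}. z 0 u = x j - 4 * d)}"
  have [measurable]: "Measurable.pred paths_space (\<lambda>z. \<exists>u\<in>{t j..t j + r}. z 0 u = c)" for c
   by (rule measurable_meet) (auto simp: space_paths_space intro: continuous_on_subset)
  have E: "E \<in> sets paths_space" unfolding E_def by measurable
  have sub: "{w \<in> space wiener. \<not> (\<forall>u\<in>{t j..t j + r}. \<bar>cbm x t w j u - x j\<bar> \<le> 4 * d)} \<subseteq> {w \<in> space wiener. (\<lambda>i. cbm x t w (?e i)) \<in> E}"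
  proof safe
   fix w u assume w: "w \<in> space wiener" and u: "u \<in> {t j..t j + r}" "\<not> \<bar>cbm x t w j u - x j\<bar> \<le> 4 * d"
   have c: "continuous_on {t j..u} (cbm x t w j)" by (rule continuous_on_subset[OF continuous_cbm[OF w]]) simp
   have st: "cbm x t w j (t j) = x j" by (rule cbm_start[OF w])
   have "(\<exists>v\<ge>t j. v \<le> u \<and> cbm x t w j v = x j + 4 * d) \<or> (\<exists>v\<ge>t j. v \<le> u \<and> cbm x t w j v = x j - 4 * d)"
   proof (cases "x j + 4 * d \<le> cbm x t w j u")
    case True
    then show ?thesis using u c st assms by (intro disjI1 IVT') auto
   next
    case False
    then have "cbm x t w j u \<le> x j - 4 * d" using u(2) by (auto simp: abs_if split: if_splits)
    then show ?thesis using u c st assms by (intro disjI2 IVT2') auto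
   qed
   then show "(\<lambda>i. cbm x t w (?e i)) \<in> E"
    using w u by (auto simp: E_def space_paths_space continuous_cbm)
  qed
  have EW: "{w \<in> space wiener. (\<lambda>i. cbm x t w (?e i)) \<in> E} \<in> sets wiener"
   using measurable_sets[OF measurable_compose[OF measurable_cbm_paths measurable_reindex_paths] E, of x t ?e]
   by (simp add: vimage_def Int_def conj_commute)
  have "\<P>(w in wiener. \<not> (\<forall>u\<in>{t j..t j + r}. \<bar>cbm x t w j u - x j\<bar> \<le> 4 * d)) \<le> \<P>(w in wiener. (\<lambda>i. cbm x t w (?e i)) \<in> E)"
   by (rule W.finite_measure_mono[OF sub EW])
  also have "\<dots> = \<P>(w in wiener. cbm (x \<circ> ?e) (t \<circ> ?e) w \<in> E)"
   by (rule subfamily_prob[OF _ E]) simp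
  also have "{w \<in> space wiener. cbm (x \<circ> ?e) (t \<circ> ?e) w \<in> E} = (\<lambda>w. w 0) -` (levels (4 * d) r \<union> levels (- 4 * d) r) \<inter> space wiener"
  proof -
   have shift: "(\<exists>u\<in>{t j..t j + r}. f (u - t j) = c) \<longleftrightarrow> (\<exists>u\<in>{0..r}. f u = c)" for f :: "real \<Rightarrow> real" and c
   proof
    assume "\<exists>u\<in>{t j..t j + r}. f (u - t j) = c"
    then obtain u where "u \<in> {t j..t j + r}" "f (u - t j) = c" by blast
    then show "\<exists>u\<in>{0..r}. f u = c" by (intro bexI[of _ "u - t j"]) auto
   next
    assume "\<exists>u\<in>{0..r}. f u = c"
    then obtain u where "u \<in> {0..r}" "f u = c" by blast
    then show "\<exists>u\<in>{t j..t j + r}. f (u - t j) = c" by (intro bexI[of _ "u + t j"]) auto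
   qed
   have "cbm (x \<circ> ?e) (t \<circ> ?e) w \<in> E \<longleftrightarrow> w 0 \<in> levels (4 * d) r \<union> levels (- 4 * d) r" if w: "w \<in> space wiener" for w
   proof -
    have w1: "w 0 \<in> space wiener1" using w by (auto simp: space_PiM PiE_iff)
    have "cbm (x \<circ> ?e) (t \<circ> ?e) w \<in> E \<longleftrightarrow> (\<exists>u\<in>{t j..t j + r}. w 0 (u - t j) = 4 * d) \<or> (\<exists>u\<in>{t j..t j + r}. w 0 (u - t j) = - 4 * d)"
     using w by (auto simp: E_def space_paths_space continuous_cbm cbm_0 drive_def)
    then show ?thesis unfolding shift[of "w 0"] using w1 by (auto simp: levels_def)
   qed
   then show ?thesis by auto
  qed
  also have "measure wiener \<dots> = measure (distr wiener wiener1 (\<lambda>w. w 0)) (levels (4 * d) r \<union> levels (- 4 * d) r)"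
   by (subst measure_distr) auto
  also have "distr wiener wiener1 (\<lambda>w. w 0) = wiener1"
   by (rule distr_PiM_component) (auto intro: prob_space_wiener1)
  also have "measure wiener1 (levels (4 * d) r \<union> levels (- 4 * d) r) \<le> 3 * r\<^sup>2 / d ^ 4"
   by (rule e0(2)[OF r])
  finally show ?thesis .
 qed
 then have "\<forall>r x t j. 0 < r \<longrightarrow> r \<le> e0 \<longrightarrow>
  \<P>(w in wiener. \<not> (\<forall>u\<in>{t j..t j + r}. \<bar>cbm x t w j u - x j\<bar> \<le> 4 * d)) \<le> 3 * r\<^sup>2 / d ^ 4"
  by blast
 with e0(1) show ?thesis by (intro exI[of _ e0] conjI)
qed

declare measurable_path_space_eval [measurable del]

subsection \<open>A countable skeleton of coalescing Brownian motions\<close>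

definition skel :: "nat \<Rightarrow> rat \<times> rat" where
 "skel = from_nat_into UNIV"

definition sx :: "nat \<Rightarrow> real" where "sx i = of_rat (fst (skel i))"
definition st :: "nat \<Rightarrow> real" where "st i = of_rat (snd (skel i))"

definition idx :: "rat \<Rightarrow> rat \<Rightarrow> nat" where
 "idx a b = inv skel (a, b)"

lemma bij_skel: "bij skel"
proof -
 have "infinite (UNIV :: (rat \<times> rat) set)"
  by (simp add: finite_prod infinite_UNIV_char_0)
 from bij_betw_from_nat_into[OF _ this] show ?thesis by (simp add: skel_def)
qed

lemma sx_idx [simp]: "sx (idx a b) = of_rat a" and st_idx [simp]: "st (idx a b) = of_rat b"
 using bij_skel by (simp_all add: sx_def st_def idx_def bij_is_surj surj_f_inv_f)

lemma idx_skel: "idx (fst (skel i)) (snd (skel i)) = i"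
 using bij_skel by (simp add: idx_def bij_is_inj)

lemma idx_eq_iff: "idx a b = idx c d \<longleftrightarrow> a = c \<and> b = d"
 by (metis sx_idx st_idx of_rat_eq_iff)

definition starts :: "paths \<Rightarrow> bool" where
 "starts z \<longleftrightarrow> (\<forall>i. z i (st i) = sx i)"

text \<open>Only rational times are mentioned, which keeps the condition measurable;
  \<open>noncross\<close> recovers real times by continuity.\<close>

definition ordered :: "paths \<Rightarrow> bool" where
 "ordered z \<longleftrightarrow> (\<forall>i k (s :: rat) (s' :: rat).
  st i \<le> of_rat s \<longrightarrow> st k \<le> of_rat s \<longrightarrow> st i \<le> of_rat s' \<longrightarrow> st k \<le> of_rat s' \<longrightarrow>
  z i (of_rat s) < z k (of_rat s) \<longrightarrow> z i (of_rat s') \<le> z k (of_rat s'))"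

text \<open>Skeleton paths from a grid of mesh \<open>1 / (n + 1)\<close> in space and
  \<open>1 / (m + 1)\<close> in time act as fences: over one time cell they move by at most four
  space meshes. Paths that do not cross them inherit a modulus of continuity. The grid covers
  positions and starting times up to \<open>n + 1\<close> in absolute value.\<close>

definition tame_grid :: "nat \<Rightarrow> nat \<Rightarrow> paths \<Rightarrow> bool" where
 "tame_grid n m z \<longleftrightarrow> (\<forall>a\<in>{- int ((n + 1)\<^sup>2)..int ((n + 1)\<^sup>2)}. \<forall>b\<in>{- int ((n + 1) * (m + 1))..int ((n + 1) * (m + 1))}.
  \<forall>u :: rat. of_int b / real (m + 1) \<le> of_rat u \<longrightarrow> of_rat u \<le> (of_int b + 1) / real (m + 1) \<longrightarrow>
   \<bar>z (idx (of_int a / of_nat (n + 1)) (of_int b / of_nat (m + 1))) (of_rat u) - of_int a / real (n + 1)\<bar> \<le> 4 / real (n + 1))"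

definition avoiding :: "paths \<Rightarrow> bool" where
 "avoiding z \<longleftrightarrow> (\<forall>i j. st j < st i \<longrightarrow> z j (st i) \<noteq> sx i)"

text \<open>Finiteness of the set of images at time \<open>t\<close> of the starting points in
  \<open>[-N, N]\<close>, phrased by a bound on the indices of representatives so that only
  countable quantifiers occur.\<close>

definition locally_finite_images :: "paths \<Rightarrow> bool" where
 "locally_finite_images z \<longleftrightarrow> (\<forall>(s :: rat) (t :: rat) N :: nat. s < t \<longrightarrow> (\<exists>m. \<forall>i.
  st i = of_rat s \<longrightarrow> \<bar>sx i\<bar> \<le> real N \<longrightarrow> (\<exists>k\<le>m. st k = of_rat s \<and> z k (of_rat t) = z i (of_rat t))))"

text \<open>An older skeleton path is enclosed between two fresh ones that merge arbitrarily soon. A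
  web path that touches it therefore cannot leave it again (\<open>coincide\<close>).\<close>

definition sandwiched :: "paths \<Rightarrow> bool" where
 "sandwiched z \<longleftrightarrow> (\<forall>i (t :: rat) (u :: rat). st i < of_rat t \<longrightarrow> t < u \<longrightarrow> (\<exists>k l.
  st k = of_rat t \<and> st l = of_rat t \<and> sx k < z i (of_rat t) \<and> z i (of_rat t) < sx l \<and> z k (of_rat u) = z l (of_rat u)))"

text \<open>Prevents web paths from reaching or leaving an infinite position in finite time.\<close>

definition unbounded_images :: "paths \<Rightarrow> bool" where
 "unbounded_images z \<longleftrightarrow> (\<forall>(s :: rat) (t :: rat) N :: nat. s < t \<longrightarrow> (\<exists>k l.
  st k = of_rat s \<and> st l = of_rat s \<and> real N < z k (of_rat t) \<and> z l (of_rat t) < - real N))"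

text \<open>Secures a unique web path through \<open>(x, t)\<close>: the first half fixes its past,
  the second its future. It holds almost surely for each single point but not for all points at
  once, so it is kept apart from \<open>good\<close>.\<close>

definition isolating :: "real \<Rightarrow> real \<Rightarrow> paths \<Rightarrow> bool" where
 "isolating x t z \<longleftrightarrow> (\<forall>i. st i < t \<longrightarrow> z i t \<noteq> x) \<and> (\<forall>v :: rat. t < of_rat v \<longrightarrow> (\<exists>k l.
  st k = st l \<and> st k < t \<and> z k t < x \<and> x < z l t \<and> z k (of_rat v) = z l (of_rat v)))"

definition good :: "paths \<Rightarrow> bool" where
 "good z \<longleftrightarrow> starts z \<and> ordered z \<and> (\<forall>n. \<exists>m. tame_grid n m z) \<and> avoiding z \<and>
  locally_finite_images z \<and> sandwiched z \<and> unbounded_images z"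

lemma pred_paths_space:
 "Measurable.pred paths_space (\<lambda>z. z i s < z k s')"
 "Measurable.pred paths_space (\<lambda>z. z i s \<le> z k s')"
 "Measurable.pred paths_space (\<lambda>z. z i s = z k s')"
 "Measurable.pred paths_space (\<lambda>z. z i s < c)"
 "Measurable.pred paths_space (\<lambda>z. c < z i s)"
 "Measurable.pred paths_space (\<lambda>z. z i s = c)"
 "Measurable.pred paths_space (\<lambda>z. \<bar>z i s - c\<bar> \<le> d)"
 "Measurable.pred paths_space (\<lambda>z. c \<le> \<bar>z i s - d\<bar>)"
 "Measurable.pred paths_space (\<lambda>z. c < d * z i s)"
 "Measurable.pred paths_space (\<lambda>_. b)"
proof -
 have m: "(\<lambda>z. z i s) \<in> borel_measurable paths_space"
  "(\<lambda>z. \<bar>z i s - c\<bar>) \<in> borel_measurable paths_space" "(\<lambda>z. d * z i s) \<in> borel_measurable paths_space" for i s c d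
  by (auto intro!: measurable_paths_space_eval borel_measurable_diff borel_measurable_abs borel_measurable_times)
 show "Measurable.pred paths_space (\<lambda>z. z i s < z k s')"
  "Measurable.pred paths_space (\<lambda>z. z i s \<le> z k s')"
  "Measurable.pred paths_space (\<lambda>z. z i s = z k s')"
  "Measurable.pred paths_space (\<lambda>z. z i s < c)"
  "Measurable.pred paths_space (\<lambda>z. c < z i s)"
  "Measurable.pred paths_space (\<lambda>z. z i s = c)"
  "Measurable.pred paths_space (\<lambda>z. \<bar>z i s - c\<bar> \<le> d)"
  "Measurable.pred paths_space (\<lambda>z. c \<le> \<bar>z i s - d\<bar>)"
  "Measurable.pred paths_space (\<lambda>z. c < d * z i s)"
  "Measurable.pred paths_space (\<lambda>_. b)"
  unfolding pred_def
  using borel_measurable_less[OF m(1) m(1)] borel_measurable_le[OF m(1) m(1)] borel_measurable_eq[OF m(1) m(1)]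
   borel_measurable_less[OF m(1) borel_measurable_const[of c]] borel_measurable_less[OF borel_measurable_const[of c] m(1)]
   borel_measurable_eq[OF m(1) borel_measurable_const[of c]] borel_measurable_le[OF m(2) borel_measurable_const[of d]]
   borel_measurable_le[OF borel_measurable_const[of c] m(2)] borel_measurable_less[OF borel_measurable_const[of c] m(3)]
  by simp_all
qed

lemmas pred_path_intros = pred_intros_countable pred_intros_countable_bounded(3,4) pred_intros_logic(2-5) pred_paths_space

lemma measurable_tame_grid: "Measurable.pred paths_space (tame_grid n m)"
 unfolding tame_grid_def by (intro pred_path_intros)

lemma measurable_good: "Measurable.pred paths_space good"
 unfolding good_def[abs_def] starts_def ordered_def avoiding_def locally_finite_images_def
  sandwiched_def unbounded_images_def by (intro pred_path_intros measurable_tame_grid)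

lemma measurable_isolating: "Measurable.pred paths_space (isolating x t)"
 unfolding isolating_def[abs_def] by (intro pred_path_intros)

lemma rat_dense_interval:
 fixes a b :: real
 assumes "closed S" "a < b" "\<And>u :: rat. a \<le> of_rat u \<Longrightarrow> of_rat u \<le> b \<Longrightarrow> of_rat u \<in> S"
 shows "{a..b} \<subseteq> S"
proof (rule ccontr)
 assume "\<not> ?thesis"
 then obtain u where "u \<in> {a..b}" "u \<notin> S" by blast
 then have u: "a \<le> u" "u \<le> b" "u \<in> - S" by auto
 with assms(1) obtain e where e: "0 < e" "ball u e \<subseteq> - S"
  by (meson open_Compl open_contains_ball)
 have "max a (u - e) < min b (u + e)" using u assms(2) e by auto
 then obtain r where r: "max a (u - e) < of_rat r" "of_rat r < min b (u + e)"
  using of_rat_dense by blast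
 then have "of_rat r \<in> ball u e" by (auto simp: dist_real_def)
 with r e(2) assms(3)[of r] show False by auto
qed

section \<open>Almost sure properties of the skeleton\<close>

text \<open>Indices are chosen with failure probabilities at most \<open>1 / Suc k\<close>; all
  these failures together form a null set.\<close>

lemma (in prob_space) AE_ex_if_small:
 assumes "\<And>e. 0 < e \<Longrightarrow> \<exists>n. {x \<in> space M. \<not> P n x} \<in> events \<and> prob {x \<in> space M. \<not> P n x} \<le> e"
 shows "AE x in M. \<exists>n. P n x"
proof -
 have "\<forall>k. \<exists>n. {x \<in> space M. \<not> P n x} \<in> events \<and> prob {x \<in> space M. \<not> P n x} \<le> 1 / Suc k"
  using assms by simp
 then obtain n where n: "\<And>k. {x \<in> space M. \<not> P (n k) x} \<in> events" "\<And>k. prob {x \<in> space M. \<not> P (n k) x} \<le> 1 / Suc k"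
  by metis
 define B where "B = (\<Inter>k. {x \<in> space M. \<not> P (n k) x})"
 have B: "B \<in> events" unfolding B_def by (intro sets.countable_INT) (use n in auto)
 have "prob B \<le> 1 / Suc k" for k
  using finite_measure_mono[of B "{x \<in> space M. \<not> P (n k) x}"] n[of k] by (fastforce simp: B_def)
 then have "prob B \<le> 0"
  by (intro LIMSEQ_le_const[OF LIMSEQ_inverse_real_of_nat]) (auto simp: divide_inverse)
 then have "prob B = 0" by (simp add: measure_le_0_iff)
 then have "B \<in> null_sets M" using B by (auto simp: emeasure_eq_measure)
 then have "AE x in M. x \<notin> B" by (rule AE_not_in)
 with AE_space show ?thesis by eventually_elim (auto simp: B_def)
qed

lemma event_cbm: "Measurable.pred paths_space P \<Longrightarrow> {w \<in> space wiener. P (cbm x t w)} \<in> sets wiener"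
 using measurable_compose[OF measurable_cbm_paths, of P "count_space UNIV"] by (simp add: pred_def)

lemma cbm_tail:
 assumes "t j < s" "0 < c"
 shows "\<P>(w in wiener. c \<le> \<bar>cbm x t w j s - x j\<bar>) \<le> 3 * (s - t j)\<^sup>2 / c ^ 4"
proof -
 have "\<P>(w in wiener. cbm x t w j s \<in> {y. c \<le> \<bar>y - x j\<bar>}) = measure (gauss (sqrt (s - t j))) {y. x j + y \<in> {y. c \<le> \<bar>y - x j\<bar>}}"
  using assms by (intro one_time_prob) auto
 also have "\<dots> \<le> 3 * sqrt (s - t j) ^ 4 / c ^ 4"
  using gauss_tail[OF assms(2), of "sqrt (s - t j)"] by simp
 also have "sqrt (s - t j) ^ 4 = (s - t j)\<^sup>2"
  using assms(1) by (simp add: power4_eq_xxxx power2_eq_square)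
 finally show ?thesis by simp
qed

lemma AE_starts_ordered: "AE w in wiener. starts (cbm sx st w) \<and> ordered (cbm sx st w)"
proof (rule AE_I2, intro conjI)
 fix w assume w: "w \<in> space wiener"
 show "starts (cbm sx st w)" by (simp add: starts_def cbm_start[OF w])
 show "ordered (cbm sx st w)"
  unfolding ordered_def cbm_def using continuous_drive[OF w] by (intro allI impI coal_noncross)
qed

lemma AE_avoiding: "AE w in wiener. avoiding (cbm sx st w)"
 unfolding avoiding_def by (simp add: AE_all_countable AE_cbm_neq AE_impI)

text \<open>For fixed \<open>n\<close> the number of grid points grows linearly in \<open>m\<close>,
  while each fails with probability of order \<open>1 / m ^ 2\<close>; so the union bound tends to
  0.\<close>

lemma AE_tame: "AE w in wiener. \<forall>n. \<exists>m. tame_grid n m (cbm sx st w)"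
 unfolding AE_all_countable
proof
 fix n :: nat
 show "AE w in wiener. \<exists>m. tame_grid n m (cbm sx st w)"
 proof (rule W.AE_ex_if_small)
  fix e :: real assume "0 < e"
  define d where "d = 1 / real (n + 1)"
  have d: "0 < d" by (simp add: d_def)
  from cbm_excursion[OF d] obtain e0 where e0: "0 < e0"
   "\<And>E x t j. 0 < E \<Longrightarrow> E \<le> e0 \<Longrightarrow> \<P>(w in wiener. \<not> (\<forall>u\<in>{t j..t j + E}. \<bar>cbm x t w j u - x j\<bar> \<le> 4 * d)) \<le> 3 * E\<^sup>2 / d ^ 4"
   by blast
  define c where "c = (2 * real (n + 1)^2 + 1) * (2 * real (n + 1) + 1) * (3 / d ^ 4)"
  have "(\<lambda>m. 1 / real (m + 1)) \<longlonglongrightarrow> 0" using LIMSEQ_inverse_real_of_nat by (simp add: inverse_eq_divide)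
  then have ev1: "\<forall>\<^sub>F m in sequentially. 1 / real (m + 1) < e0" using e0(1) by (rule order_tendstoD)
  have "(\<lambda>m. c * (1 / real (m + 1))) \<longlonglongrightarrow> c * 0" by (intro tendsto_intros) fact
  then have "\<forall>\<^sub>F m in sequentially. c * (1 / real (m + 1)) < e" using \<open>0 < e\<close> by (intro order_tendstoD(2)) auto
  with ev1 have "\<forall>\<^sub>F m in sequentially. 1 / real (m + 1) < e0 \<and> c * (1 / real (m + 1)) < e" by eventually_elim simp
  then obtain m where m: "1 / real (m + 1) < e0" "c * (1 / real (m + 1)) < e"
   by (auto simp: eventually_sequentially)
  define E where "E = 1 / real (m + 1)"
  have E: "0 < E" "E \<le> e0" "E \<le> 1" using m by (auto simp: E_def)
  define I where "I = {- int ((n + 1)\<^sup>2)..int ((n + 1)\<^sup>2)} \<times> {- int ((n + 1) * (m + 1))..int ((n + 1) * (m + 1))}"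
  define J where "J = (\<lambda>(a, b). idx (of_int a / of_nat (n + 1)) (of_int b / of_nat (m + 1)))"
  define F where "F j = {w \<in> space wiener. \<not> (\<forall>u\<in>{st j..st j + E}. \<bar>cbm sx st w j u - sx j\<bar> \<le> 4 * d)}" for j
  \<comment> \<open>By continuity rational times suffice, which makes the failure an event and gives
    it the form used in \<open>tame_grid\<close>.\<close>
  have Fr: "F j = {w \<in> space wiener. \<not> (\<forall>u :: rat. st j \<le> of_rat u \<longrightarrow> of_rat u \<le> st j + E \<longrightarrow> \<bar>cbm sx st w j (of_rat u) - sx j\<bar> \<le> 4 * d)}" for j
  proof -
   have "(\<forall>u\<in>{st j..st j + E}. \<bar>cbm sx st w j u - sx j\<bar> \<le> 4 * d) \<longleftrightarrow>
     (\<forall>u :: rat. st j \<le> of_rat u \<longrightarrow> of_rat u \<le> st j + E \<longrightarrow> \<bar>cbm sx st w j (of_rat u) - sx j\<bar> \<le> 4 * d)"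
    if w: "w \<in> space wiener" for w
   proof
    assume *: "\<forall>u :: rat. st j \<le> of_rat u \<longrightarrow> of_rat u \<le> st j + E \<longrightarrow> \<bar>cbm sx st w j (of_rat u) - sx j\<bar> \<le> 4 * d"
    have "closed {u. \<bar>cbm sx st w j u - sx j\<bar> \<le> 4 * d}"
     by (intro closed_Collect_le continuous_on_rabs continuous_on_diff continuous_cbm[OF w] continuous_on_const)
    from rat_dense_interval[OF this, of "st j" "st j + E"] * E(1)
    show "\<forall>u\<in>{st j..st j + E}. \<bar>cbm sx st w j u - sx j\<bar> \<le> 4 * d" by auto
   qed simp
   then show ?thesis by (auto simp: F_def)
  qed
  have F: "F j \<in> W.events" for j
  proof -
   have "Measurable.pred paths_space (\<lambda>z. \<not> (\<forall>u :: rat. st j \<le> of_rat u \<longrightarrow> of_rat u \<le> st j + E \<longrightarrow> \<bar>z j (of_rat u) - sx j\<bar> \<le> 4 * d))"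
    by (intro pred_path_intros)
   from event_cbm[OF this] show ?thesis unfolding Fr .
  qed
  have "{w \<in> space wiener. \<not> tame_grid n m (cbm sx st w)} = (\<Union>p\<in>I. F (J p))"
  proof -
   have J: "sx (J (a, b)) = of_int a / real (n + 1)" "st (J (a, b)) = of_int b / real (m + 1)" for a b
    by (simp_all add: J_def of_rat_divide of_rat_add)
   have "st (J (a, b)) + E = (of_int b + 1) / real (m + 1)" "4 * d = 4 / real (n + 1)" for a b
    by (simp_all add: J E_def d_def add_divide_distrib)
   then have "tame_grid n m (cbm sx st w) \<longleftrightarrow> (\<forall>p\<in>I. w \<notin> F (J p))" if "w \<in> space wiener" for w
    using that unfolding tame_grid_def Fr I_def by (auto simp: J) (auto simp: J_def)
   moreover have "F j \<subseteq> space wiener" for j unfolding Fr by blast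
   ultimately show ?thesis by blast
  qed
  moreover have "W.prob (\<Union>p\<in>I. F (J p)) \<le> (\<Sum>p\<in>I. W.prob (F (J p)))"
   by (rule W.finite_measure_subadditive_finite) (auto simp: I_def F)
  moreover have "(\<Sum>p\<in>I. W.prob (F (J p))) \<le> of_nat (card I) * (3 * E\<^sup>2 / d ^ 4)"
   by (rule sum_bounded_above) (unfold F_def, rule e0(2)[OF E(1,2)])
  moreover have "of_nat (card I) * (3 * E\<^sup>2 / d ^ 4) \<le> c * E"
  proof -
   have "real (card I) = (2 * real (n + 1)^2 + 1) * (2 * real (n + 1) * real (m + 1) + 1)"
   proof -
    have "card {- int k..int k} = 2 * k + 1" for k by auto
    then show ?thesis by (simp only: I_def card_cartesian_product) (simp add: algebra_simps)
   qed
   then have "real (card I) * E = (2 * real (n + 1)^2 + 1) * (2 * real (n + 1) + E)"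
    by (simp add: E_def field_simps)
   also have "\<dots> \<le> (2 * real (n + 1)^2 + 1) * (2 * real (n + 1) + 1)"
    using E(3) by (intro mult_left_mono) auto
   finally have "real (card I) * E * (3 / d ^ 4 * E) \<le> (2 * real (n + 1)^2 + 1) * (2 * real (n + 1) + 1) * (3 / d ^ 4 * E)"
    using d E by (intro mult_right_mono) auto
   then show ?thesis by (simp add: c_def power2_eq_square mult_ac)
  qed
  moreover have "c * E \<le> e" using m(2) by (simp add: E_def)
  moreover have "(\<Union>p\<in>I. F (J p)) \<in> W.events" by (intro sets.finite_UN F) (auto simp: I_def)
  ultimately show "\<exists>m. {w \<in> space wiener. \<not> tame_grid n m (cbm sx st w)} \<in> W.events \<and>
    W.prob {w \<in> space wiener. \<not> tame_grid n m (cbm sx st w)} \<le> e"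
   by (intro exI[of _ m]) auto
 qed
qed

lemma AE_unbounded: "AE w in wiener. unbounded_images (cbm sx st w)"
proof -
 \<comment> \<open>\<open>q = 1\<close> and \<open>q = - 1\<close> treat both directions at once: a
   path started at distance \<open>n\<close> must move by more than \<open>n0\<close> to miss the
   target, which is unlikely for large \<open>n0\<close>.\<close>
 have *: "AE w in wiener. \<exists>n :: nat. real N < r * cbm sx st w (idx (q * of_nat n) s) (of_rat t)"
  if st: "s < t" and r: "r = of_rat q" "q * q = 1" for s t q r and N :: nat
 proof (rule W.AE_ex_if_small)
  fix e :: real assume e: "0 < e"
  define h :: real where "h = of_rat t - of_rat s"
  have h: "0 < h" using st by (simp add: h_def of_rat_less)
  obtain n0 :: nat where n0: "3 * h\<^sup>2 / e < n0" using reals_Archimedean2 by blast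
  define n where "n = N + n0 + 1"
  let ?j = "idx (q * of_nat n) s"
  have r2: "r * r = 1" using r by (simp flip: of_rat_mult)
  then have ar: "\<bar>r\<bar> = 1" by (metis abs_mult_self_eq abs_of_nonneg abs_one power2_abs power2_eq_square real_sqrt_abs real_sqrt_one)
  have sj: "sx ?j = r * real n" unfolding r(1) sx_idx by (simp add: of_rat_mult)
  have sub: "{w \<in> space wiener. \<not> real N < r * cbm sx st w ?j (of_rat t)} \<subseteq> {w \<in> space wiener. real n0 + 1 \<le> \<bar>cbm sx st w ?j (of_rat t) - sx ?j\<bar>}"
  proof safe
   fix w assume a: "\<not> real N < r * cbm sx st w ?j (of_rat t)"
   have "real n0 + 1 \<le> real n - r * cbm sx st w ?j (of_rat t)" using a by (simp add: n_def)
   also have "real n - r * cbm sx st w ?j (of_rat t) = - r * (cbm sx st w ?j (of_rat t) - sx ?j)"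
    using r2 unfolding sj by (simp add: algebra_simps)
   also have "\<dots> \<le> \<bar>- r * (cbm sx st w ?j (of_rat t) - sx ?j)\<bar>" by (rule abs_ge_self)
   also have "\<dots> = \<bar>cbm sx st w ?j (of_rat t) - sx ?j\<bar>" by (simp add: abs_mult ar)
   finally show "real n0 + 1 \<le> \<bar>cbm sx st w ?j (of_rat t) - sx ?j\<bar>" .
  qed
  have "W.prob {w \<in> space wiener. \<not> real N < r * cbm sx st w ?j (of_rat t)} \<le> W.prob {w \<in> space wiener. real n0 + 1 \<le> \<bar>cbm sx st w ?j (of_rat t) - sx ?j\<bar>}"
   by (rule W.finite_measure_mono[OF sub]) (intro event_cbm pred_path_intros)
  also have "\<dots> \<le> 3 * h\<^sup>2 / (real n0 + 1) ^ 4"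
   using cbm_tail[of st ?j "of_rat t" "real n0 + 1" sx] st by (simp add: h_def of_rat_less)
  also have "\<dots> \<le> 3 * h\<^sup>2 / (real n0 + 1)"
   by (intro divide_left_mono) (auto intro: self_le_power)
  also have "\<dots> \<le> e" using n0 e by (simp add: field_simps)
  finally have "W.prob {w \<in> space wiener. \<not> real N < r * cbm sx st w ?j (of_rat t)} \<le> e" .
  moreover have "{w \<in> space wiener. \<not> real N < r * cbm sx st w ?j (of_rat t)} \<in> W.events"
   by (intro event_cbm pred_path_intros)
  ultimately show "\<exists>n. {w \<in> space wiener. \<not> real N < r * cbm sx st w (idx (q * of_nat n) s) (of_rat t)} \<in> W.events \<and>
   W.prob {w \<in> space wiener. \<not> real N < r * cbm sx st w (idx (q * of_nat n) s) (of_rat t)} \<le> e" by blast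
 qed
 have "AE w in wiener. \<exists>k l. st k = of_rat s \<and> st l = of_rat s \<and> real N < cbm sx st w k (of_rat t) \<and> cbm sx st w l (of_rat t) < - real N"
  if "s < t" for s t and N :: nat
 proof -
  have "AE w in wiener. \<exists>n :: nat. real N < 1 * cbm sx st w (idx (1 * of_nat n) s) (of_rat t)"
   "AE w in wiener. \<exists>n :: nat. real N < - 1 * cbm sx st w (idx (- 1 * of_nat n) s) (of_rat t)"
   by (rule *[OF that]; simp)+
  then show ?thesis
 proof eventually_elim
  case (elim w)
  then obtain n m :: nat where "real N < cbm sx st w (idx (of_nat n) s) (of_rat t)" "real N < - cbm sx st w (idx (- of_nat m) s) (of_rat t)" by auto
  then show ?case by (intro exI[of _ "idx (of_nat n) s"] exI[of _ "idx (- of_nat m) s"]) auto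
 qed
 qed
 then show ?thesis unfolding unbounded_images_def by (simp add: AE_all_countable AE_impI)
qed

lemma AE_isolating: "AE z in wiener. isolating x t (cbm sx st z)"
proof -
 have *: "AE z in wiener. \<exists>k l. st k = st l \<and> st k < t \<and> cbm sx st z k t < x \<and> x < cbm sx st z l t \<and>
   cbm sx st z k (of_rat v) = cbm sx st z l (of_rat v)" if v: "t < of_rat v" for v
 proof -
  define Q where "Q p z \<longleftrightarrow> st (fst p) = st (snd p) \<and> st (fst p) < t \<and> cbm sx st z (fst p) t < x \<and> x < cbm sx st z (snd p) t \<and>
   cbm sx st z (fst p) (of_rat v) = cbm sx st z (snd p) (of_rat v)" for p z
  have "AE z in wiener. \<exists>p. Q p z"
 proof (rule W.AE_ex_if_small)
  fix e :: real assume e: "0 < e"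
  define \<rho> where "\<rho> = of_rat v - t"
  have \<rho>: "0 < \<rho>" using v by (simp add: \<rho>_def)
  \<comment> \<open>Each of the two older paths moves by \<open>a\<close> or more with probability
    at most \<open>3 * a\<close>; at distance below \<open>4 * a\<close> they fail to merge within
    time \<open>\<rho>\<close> with probability at most \<open>4 * a / sqrt \<rho>\<close>. The
    constant makes the sum at most \<open>e\<close>.\<close>
  define a where "a = min 1 (e / (6 + 4 / sqrt \<rho>))"
  have pos: "0 < 6 + 4 / sqrt \<rho>" using \<rho> by (intro add_pos_pos) auto
  have a: "0 < a" "a \<le> 1" "(6 + 4 / sqrt \<rho>) * a \<le> e"
  proof -
   show "0 < a" "a \<le> 1" using e pos by (auto simp: a_def)
   have "a \<le> e / (6 + 4 / sqrt \<rho>)" by (simp add: a_def)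
   then show "(6 + 4 / sqrt \<rho>) * a \<le> e" using pos by (simp add: pos_le_divide_eq mult.commute)
  qed
  \<comment> \<open>A head start shorter than \<open>a ^ 3\<close> has fourth moment bound
    \<open>3 * (a ^ 3) ^ 2 / a ^ 4 = 3 * a ^ 2\<close>, so the paths, started at distances between
    \<open>a\<close> and \<open>2 * a\<close> from \<open>x\<close>, probably remain on their
    sides.\<close>
  obtain T where T: "t - a ^ 3 < of_rat T" "of_rat T < t" using of_rat_dense[of "t - a ^ 3" t] a by auto
  obtain y where y: "x - 2 * a < of_rat y" "of_rat y < x - a" using of_rat_dense[of "x - 2 * a" "x - a"] a by auto
  obtain w where w: "x + a < of_rat w" "of_rat w < x + 2 * a" using of_rat_dense[of "x + a" "x + 2 * a"] a by auto
  define k where "k = idx y T"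
  define l where "l = idx w T"
  have kl: "sx k = of_rat y" "sx l = of_rat w" "st k = of_rat T" "st l = of_rat T" by (simp_all add: k_def l_def)
  have "real_of_rat y < of_rat w" using y w a by linarith
  then have kneq: "k \<noteq> l" by (auto simp: k_def l_def idx_eq_iff of_rat_less)
  let ?bad = "{z \<in> space wiener. \<not> (st k = st l \<and> st k < t \<and> cbm sx st z k t < x \<and> x < cbm sx st z l t \<and>
   cbm sx st z k (of_rat v) = cbm sx st z l (of_rat v))}"
  let ?A = "\<lambda>j. {z \<in> space wiener. a \<le> \<bar>cbm sx st z j t - sx j\<bar>}"
  let ?h = "t + \<rho> - of_rat T"
  let ?C = "{z \<in> space wiener. cbm sx st z k (of_rat T + ?h) \<noteq> cbm sx st z l (of_rat T + ?h)}"
  have sub: "?bad \<subseteq> ?A k \<union> ?A l \<union> ?C"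
   using T y w by (auto simp: kl \<rho>_def)
  have A: "W.prob (?A j) \<le> 3 * a" if "st j = of_rat T" for j
  proof -
   have "W.prob (?A j) \<le> 3 * (t - of_rat T)\<^sup>2 / a ^ 4"
    using cbm_tail[of st j t a sx] that T a by simp
   also have "\<dots> \<le> 3 * (a ^ 3)\<^sup>2 / a ^ 4"
    using T a by (intro divide_right_mono mult_left_mono power_mono) auto
   also have "\<dots> = 3 * (a * a)" using a by (simp add: field_simps eval_nat_numeral)
   also have "\<dots> \<le> 3 * (a * 1)" using a by (intro mult_left_mono) auto
   finally show ?thesis by simp
  qed
  have "W.prob ?C \<le> \<bar>sx k - sx l\<bar> / sqrt ?h"
   by (rule cbm_not_coalesced(1)) (use kneq kl T \<rho> in auto)
  also have "\<dots> \<le> (4 * a) / sqrt \<rho>"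
   using kl y w T \<rho> by (intro frac_le) auto
  finally have C: "W.prob ?C \<le> 4 / sqrt \<rho> * a" by simp
  have ev: "?bad \<in> W.events" "?A j \<in> W.events" "?C \<in> W.events" for j
   by (intro event_cbm pred_path_intros)+
  have "W.prob ?bad \<le> W.prob (?A k \<union> ?A l \<union> ?C)"
   by (rule W.finite_measure_mono[OF sub]) (intro sets.Un ev)
  also have "\<dots> \<le> W.prob (?A k \<union> ?A l) + W.prob ?C" by (intro measure_Un_le sets.Un ev)
  also have "W.prob (?A k \<union> ?A l) \<le> W.prob (?A k) + W.prob (?A l)" by (intro measure_Un_le ev)
  finally have "W.prob ?bad \<le> 3 * a + 3 * a + 4 / sqrt \<rho> * a"
   using A[of k] A[of l] C kl by linarith
  also have "\<dots> = (6 + 4 / sqrt \<rho>) * a" by (simp add: algebra_simps)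
  finally have "W.prob ?bad \<le> e" using a(3) by linarith
  with ev(1) have "?bad \<in> W.events \<and> W.prob ?bad \<le> e" by blast
  then show "\<exists>p. {z \<in> space wiener. \<not> Q p z} \<in> W.events \<and> W.prob {z \<in> space wiener. \<not> Q p z} \<le> e"
   unfolding Q_def by (intro exI[of _ "(k, l)"]) (unfold fst_conv snd_conv)
 qed
  then show ?thesis by eventually_elim (auto simp: Q_def)
 qed
 then show ?thesis
  unfolding isolating_def by (simp add: AE_all_countable AE_conj_iff AE_impI AE_cbm_neq)
qed

text \<open>The line is cut into cells of length \<open>1 / Suc n\<close>. Given that the older path
  lies in a cell, the two fresh paths from its ends fail to merge with probability at most
  \<open>c\<close>, by independence. Weighted with the probabilities of the cells, these bounds add
  up to at most \<open>c\<close>, although there are infinitely many cells.\<close>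

lemma AE_sandwiched: "AE w in wiener. sandwiched (cbm sx st w)"
proof -
 have "AE w in wiener. \<exists>k l. st k = of_rat t \<and> st l = of_rat t \<and> sx k < cbm sx st w i (of_rat t) \<and>
   cbm sx st w i (of_rat t) < sx l \<and> cbm sx st w k (of_rat u) = cbm sx st w l (of_rat u)"
  if t: "st i < of_rat t" "t < u" for i t u
 proof -
  define h :: real where "h = of_rat u - of_rat t"
  have h: "0 < h" "of_rat u = of_rat t + h" using t by (auto simp: h_def of_rat_less)
  define Z where "Z w = cbm sx st w i (of_rat t)" for w
  define p where "p n j = idx (of_int j / of_nat (Suc n)) t" for n j
  have p: "sx (p n j) = of_int j / real (Suc n)" "st (p n j) = of_rat t" for n j
   by (simp_all add: p_def of_rat_divide del: of_nat_Suc)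
  \<comment> \<open>Hitting a cell boundary counts as success for the moment, so that the cells
    cover the line; this alternative is removed below, as it is almost surely void.\<close>
  define P where "P n w \<longleftrightarrow> (\<exists>j. Z w = sx (p n j) \<or> sx (p n j) < Z w \<and> Z w < sx (p n (j + 1)) \<and>
    cbm sx st w (p n j) (of_rat u) = cbm sx st w (p n (j + 1)) (of_rat u))" for n w
  have "AE w in wiener. \<exists>n. P n w"
  proof (rule W.AE_ex_if_small)
   fix e :: real assume e: "0 < e"
   obtain n :: nat where n: "1 / (e * sqrt h) < n" using reals_Archimedean2 by blast
   define c where "c = 1 / real (Suc n) / sqrt h"
   have c: "0 \<le> c" "c \<le> e"
   proof -
    show "0 \<le> c" using h by (simp add: c_def)
    have "1 / (e * sqrt h) < real (Suc n)" using n by simp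
    then show "c \<le> e" using e h by (simp add: c_def field_simps del: of_nat_Suc)
   qed
   define F where "F j = {w \<in> space wiener. Z w \<in> {sx (p n j)<..<sx (p n (j + 1))}}" for j
   define E where "E j = {w \<in> space wiener. Z w \<in> {sx (p n j)<..<sx (p n (j + 1))} \<and>
    cbm sx st w (p n j) (of_rat t + h) \<noteq> cbm sx st w (p n (j + 1)) (of_rat t + h)}" for j
   have F: "F j \<in> W.events" for j
    unfolding F_def Z_def greaterThanLessThan_iff by (intro event_cbm pred_path_intros)
   have E: "E j \<in> W.events" for j
    unfolding E_def Z_def greaterThanLessThan_iff by (intro event_cbm pred_path_intros)
   have EF: "W.prob (E j) \<le> W.prob (F j) * c" for j
   proof -
    have "p n j \<noteq> p n (j + 1)" "i \<noteq> p n j" "i \<noteq> p n (j + 1)"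
    proof -
     have "sx (p n j) < sx (p n (j + 1))" unfolding p(1) by (intro divide_strict_right_mono) auto
     then show "p n j \<noteq> p n (j + 1)" by auto
     show "i \<noteq> p n j" "i \<noteq> p n (j + 1)" using t(1) p(2)[of n] by auto
    qed
    note this = cbm_not_coalesced(2)[OF this(1) p(2) p(2) h(1) _ this(2,3) t(1), of "{sx (p n j)<..<sx (p n (j + 1))}" sx]
    moreover have "\<bar>sx (p n j) - sx (p n (j + 1))\<bar> = 1 / real (Suc n)"
     unfolding p(1) by (simp add: field_simps abs_divide del: of_nat_Suc)
    ultimately show ?thesis by (simp add: E_def F_def c_def Z_def)
   qed
   have cover: "\<exists>j. y = sx (p n j) \<or> sx (p n j) < y \<and> y < sx (p n (j + 1))" for y
   proof -
    have "of_int \<lfloor>y * real (Suc n)\<rfloor> \<le> y * real (Suc n)" "y * real (Suc n) < of_int (\<lfloor>y * real (Suc n)\<rfloor> + 1)"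
     by linarith+
    then have "sx (p n \<lfloor>y * real (Suc n)\<rfloor>) \<le> y" "y < sx (p n (\<lfloor>y * real (Suc n)\<rfloor> + 1))"
     unfolding p(1) by (simp_all add: pos_divide_le_eq pos_less_divide_eq del: of_nat_Suc)
    then show ?thesis by (metis order_le_less)
   qed
   have sub: "{w \<in> space wiener. \<not> P n w} \<subseteq> (\<Union>m. E (int_decode m))"
   proof
    fix w assume w: "w \<in> {w \<in> space wiener. \<not> P n w}"
    obtain j where j: "Z w = sx (p n j) \<or> sx (p n j) < Z w \<and> Z w < sx (p n (j + 1))" using cover by blast
    with w have "w \<in> E j" by (auto simp: P_def E_def h(2)[symmetric])
    then have "w \<in> E (int_decode (int_encode j))" by simp
    then show "w \<in> (\<Union>m. E (int_decode m))" by blast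
   qed
   have disj: "disjoint_family (\<lambda>m. F (int_decode m))"
   proof -
    have "False" if "Z w \<in> {sx (p n j)<..<sx (p n (j + 1))}" "Z w \<in> {sx (p n j')<..<sx (p n (j' + 1))}" "j < j'" for j j' w
    proof -
     have "sx (p n (j + 1)) \<le> sx (p n j')" unfolding p(1) using that(3) by (intro divide_right_mono) auto
     with that show False by auto
    qed
    then have "F j \<inter> F j' = {}" if "j \<noteq> j'" for j j' using that by (fastforce simp: F_def neq_iff)
    then show ?thesis using int_decode_eq unfolding disjoint_family_on_def by blast
   qed
   have "emeasure wiener (\<Union>m. E (int_decode m)) \<le> (\<Sum>m. emeasure wiener (E (int_decode m)))"
    by (rule emeasure_subadditive_countably) (use E in auto)
   also have "\<dots> \<le> (\<Sum>m. ennreal c * emeasure wiener (F (int_decode m)))"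
    using EF c by (intro suminf_le) (auto simp: W.emeasure_eq_measure ennreal_mult[symmetric] mult.commute intro!: ennreal_leI)
   also have "\<dots> = ennreal c * emeasure wiener (\<Union>m. F (int_decode m))"
    using F disj by (subst ennreal_suminf_cmult, subst suminf_emeasure) auto
   also have "\<dots> \<le> ennreal c * 1"
    by (intro mult_left_mono W.emeasure_le_1) auto
   finally have "W.prob (\<Union>m. E (int_decode m)) \<le> c"
    using c by (simp add: W.emeasure_eq_measure)
   moreover have "W.prob {w \<in> space wiener. \<not> P n w} \<le> W.prob (\<Union>m. E (int_decode m))"
    by (rule W.finite_measure_mono[OF sub]) (use E in auto)
   moreover have "{w \<in> space wiener. \<not> P n w} \<in> W.events"
    unfolding P_def Z_def by (intro event_cbm pred_path_intros)
   ultimately show "\<exists>n. {w \<in> space wiener. \<not> P n w} \<in> W.events \<and> W.prob {w \<in> space wiener. \<not> P n w} \<le> e"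
    using c(2) by (intro exI[of _ n]) auto
  qed
  moreover have "AE w in wiener. \<forall>n j. Z w \<noteq> sx (p n j)"
   unfolding AE_all_countable Z_def using AE_cbm_neq[of st i] t(1) by blast
  ultimately show ?thesis
  proof eventually_elim
   case (elim w)
   then obtain n j where "sx (p n j) < Z w" "Z w < sx (p n (j + 1))"
    "cbm sx st w (p n j) (of_rat u) = cbm sx st w (p n (j + 1)) (of_rat u)" unfolding P_def by blast
   then show ?case by (intro exI[of _ "p n j"] exI[of _ "p n (j + 1)"]) (simp add: p(2) Z_def)
  qed
 qed
 then show ?thesis unfolding sandwiched_def by (simp add: AE_all_countable AE_impI)
qed

fun changes :: "('a \<Rightarrow> 'b) \<Rightarrow> 'a list \<Rightarrow> nat" where
 "changes Z (x # y # ys) = (if Z x = Z y then 0 else 1) + changes Z (y # ys)"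
| "changes Z _ = 0"

lemma card_image_changes: "card (Z ` set ys) \<le> Suc (changes Z ys)"
proof (induction Z ys rule: changes.induct)
 case (1 Z x y ys)
 then show ?case by (auto simp: card_insert_if insert_absorb intro: order_trans)
qed auto

text \<open>Neighbours at distance \<open>y - x\<close> are still distinct with probability at most
  \<open>(y - x) / sqrt h\<close>, where \<open>h\<close> is the elapsed time. These bounds
  telescope, so the expectation is bounded by the total length, however many points there
  are.\<close>

lemma integral_changes_cbm:
 assumes "s < t" "ys \<noteq> []" "sorted_wrt (<) ys"
 shows "integrable wiener (\<lambda>w. real (changes (\<lambda>y. cbm sx st w (idx y s) (of_rat t)) ys))"
  and "(\<integral>w. real (changes (\<lambda>y. cbm sx st w (idx y s) (of_rat t)) ys) \<partial>wiener)
   \<le> (of_rat (last ys) - of_rat (hd ys)) / sqrt (of_rat t - of_rat s)"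
proof -
 let ?Z = "\<lambda>w y. cbm sx st w (idx y s) (of_rat t)"
 let ?V = "\<lambda>ys w. real (changes (?Z w) ys)"
 let ?h = "real_of_rat t - of_rat s"
 have h: "0 < ?h" using assms(1) by (simp add: of_rat_less)
 have "integrable wiener (?V ys) \<and> (\<integral>w. ?V ys w \<partial>wiener) \<le> (of_rat (last ys) - of_rat (hd ys)) / sqrt ?h"
  using assms(2,3)
 proof (induction ys rule: induct_list012)
  case (3 x y ys)
  let ?A = "{w \<in> space wiener. ?Z w x \<noteq> ?Z w y}"
  have A: "?A \<in> W.events" by (intro event_cbm pred_path_intros)
  have IH: "integrable wiener (?V (y # ys))" "(\<integral>w. ?V (y # ys) w \<partial>wiener) \<le> (of_rat (last (y # ys)) - of_rat y) / sqrt ?h"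
   using 3 by auto
  have xy: "x < y" using 3 by simp
  have eq: "?V (x # y # ys) w = indicat_real ?A w + ?V (y # ys) w" if "w \<in> space wiener" for w
   using that by (simp add: indicator_def)
  have iA: "integrable wiener (indicat_real ?A)" using A by (simp add: W.emeasure_eq_measure)
  have int: "integrable wiener (\<lambda>w. indicat_real ?A w + ?V (y # ys) w)" by (rule Bochner_Integration.integrable_add[OF iA IH(1)])
  have "W.prob ?A = W.prob {w \<in> space wiener. cbm sx st w (idx x s) (of_rat s + ?h) \<noteq> cbm sx st w (idx y s) (of_rat s + ?h)}"
   by simp
  also have "\<dots> \<le> \<bar>sx (idx x s) - sx (idx y s)\<bar> / sqrt ?h"
   by (rule cbm_not_coalesced(1)) (use xy h in \<open>auto simp: idx_eq_iff\<close>)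
  also have "\<dots> = (of_rat y - of_rat x) / sqrt ?h" using xy by (simp add: of_rat_less abs_if)
  finally have pA: "W.prob ?A \<le> (of_rat y - of_rat x) / sqrt ?h" .
  have "(\<integral>w. ?V (x # y # ys) w \<partial>wiener) = (\<integral>w. indicat_real ?A w + ?V (y # ys) w \<partial>wiener)"
   by (rule Bochner_Integration.integral_cong[OF refl eq])
  also have "\<dots> = W.prob ?A + (\<integral>w. ?V (y # ys) w \<partial>wiener)"
   using Bochner_Integration.integral_add[OF iA IH(1)] A by (simp add: W.emeasure_eq_measure)
  also have "\<dots> \<le> (of_rat y - of_rat x) / sqrt ?h + (of_rat (last (y # ys)) - of_rat y) / sqrt ?h"
   by (rule add_mono[OF pA IH(2)])
  also have "\<dots> = (of_rat (last (x # y # ys)) - of_rat (hd (x # y # ys))) / sqrt ?h"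
   by (simp add: add_divide_distrib[symmetric])
  finally have "(\<integral>w. ?V (x # y # ys) w \<partial>wiener) \<le> (of_rat (last (x # y # ys)) - of_rat (hd (x # y # ys))) / sqrt ?h" .
  moreover have "integrable wiener (?V (x # y # ys))"
   using int eq by (subst Bochner_Integration.integrable_cong[OF refl eq]) auto
  ultimately show ?case by blast
 qed auto
 then show "integrable wiener (?V ys)" "(\<integral>w. ?V ys w \<partial>wiener) \<le> (of_rat (last ys) - of_rat (hd ys)) / sqrt ?h"
  by auto
qed

text \<open>The expected number of changes along any finite set of starting points in
  \<open>[-N, N]\<close> is at most \<open>c\<close>. By Markov's inequality and monotone passage to
  all of them, the number of distinct images is almost surely finite.\<close>

lemma AE_locally_finite: "AE w in wiener. locally_finite_images (cbm sx st w)"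
proof -
 have "AE w in wiener. \<exists>m. \<forall>i. st i = of_rat s \<longrightarrow> \<bar>sx i\<bar> \<le> real N \<longrightarrow>
   (\<exists>k\<le>m. st k = of_rat s \<and> cbm sx st w k (of_rat t) = cbm sx st w i (of_rat t))"
  if st: "s < t" for s t and N :: nat
 proof -
  define A where "A = {k. st k = of_rat s \<and> \<bar>sx k\<bar> \<le> real N}"
  define F where "F n = {k. k \<le> n \<and> k \<in> A}" for n
  have F: "finite (F n)" for n unfolding F_def by simp
  \<comment> \<open>The index \<open>k\<close> is the first in \<open>A\<close> with its image, so
    images are counted by their first representatives.\<close>
  define new where "new k z \<longleftrightarrow> (\<forall>j\<in>{j. j < k \<and> j \<in> A}. z j (of_rat t) \<noteq> z k (of_rat t))" for k and z :: "paths"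
  have new: "Measurable.pred paths_space (new k)" for k
   unfolding new_def by (intro pred_path_intros)
  \<comment> \<open>More than \<open>L + 1\<close> distinct images force at least
    \<open>L + 1\<close> changes between neighbours, by \<open>card_image_changes\<close>.\<close>
  define B where "B L n z \<longleftrightarrow> (\<exists>S\<in>{S. S \<subseteq> F n \<and> L + 1 < card S}. \<forall>k\<in>S. new k z)" for L n and z
  have Bm: "Measurable.pred paths_space (B L n)" for L n
  proof -
   have "finite {S. S \<subseteq> F n \<and> L + 1 < card S}" by (rule finite_subset[OF _ finite_Pow_iff[THEN iffD2, OF F[of n]]]) auto
   moreover have "finite S" if "S \<in> {S. S \<subseteq> F n \<and> L + 1 < card S}" for S using that finite_subset[OF _ F] by blast
   ultimately show ?thesis unfolding B_def by (rule pred_intros_finite(4)[OF _ pred_intros_finite(3)[OF _ new]])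
  qed
  define h where "h = real_of_rat t - of_rat s"
  have h: "0 < h" using st by (simp add: h_def of_rat_less)
  define c where "c = 2 * real N / sqrt h"
  have c: "0 \<le> c" using h by (simp add: c_def)
  let ?Y = "cbm sx st"
  have PB: "W.prob {w \<in> space wiener. B L n (?Y w)} \<le> c / real (L + 1)" for L n
  proof (cases "F n = {}")
   case True
   then have "\<not> B L n z" for z by (auto simp: B_def)
   then show ?thesis using c by simp
  next
   case False
   define ys where "ys = sorted_list_of_set ((fst \<circ> skel) ` F n)"
   have ys: "set ys = (fst \<circ> skel) ` F n" "sorted_wrt (<) ys" "ys \<noteq> []"
    using F[of n] False by (auto simp: ys_def)
   have bd: "\<bar>real_of_rat y\<bar> \<le> real N" if "y \<in> set ys" for y
    using that unfolding ys(1) by (auto simp: F_def A_def sx_def)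
   have "real_of_rat (last ys) - of_rat (hd ys) \<le> 2 * real N"
    using bd[OF last_in_set[OF ys(3)]] bd[OF hd_in_set[OF ys(3)]] by linarith
   then have "(of_rat (last ys) - of_rat (hd ys)) / sqrt h \<le> c" using h unfolding c_def by (intro divide_right_mono) auto
   note V = integral_changes_cbm[OF st ys(3,2)]
   let ?V = "\<lambda>w. real (changes (\<lambda>y. ?Y w (idx y s) (of_rat t)) ys)"
   have sub: "{w \<in> space wiener. B L n (?Y w)} \<subseteq> {w \<in> space wiener. real (L + 1) \<le> ?V w}"
   proof safe
    fix w assume "B L n (?Y w)"
    then obtain S where S: "S \<subseteq> F n" "L + 1 < card S" "\<And>k. k \<in> S \<Longrightarrow> new k (?Y w)" by (auto simp: B_def)
    let ?z = "\<lambda>k. ?Y w k (of_rat t)"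
    have "inj_on ?z S"
    proof (rule linorder_inj_onI')
     fix j k assume "j \<in> S" "k \<in> S" "j < k"
     with S show "?z j \<noteq> ?z k" by (auto simp: new_def F_def)
    qed
    then have "card S = card (?z ` S)" by (simp add: card_image)
    also have "\<dots> \<le> card ((\<lambda>y. ?Y w (idx y s) (of_rat t)) ` set ys)"
    proof (rule card_mono)
     show "?z ` S \<subseteq> (\<lambda>y. ?Y w (idx y s) (of_rat t)) ` set ys"
     proof
      fix v assume "v \<in> ?z ` S"
      then obtain k where k: "k \<in> S" "v = ?z k" by blast
      then have "real_of_rat (snd (skel k)) = of_rat s" "k \<in> F n" using S(1) by (auto simp: F_def A_def st_def)
      then have "idx (fst (skel k)) s = k" using idx_skel[of k] by simp
      with k \<open>k \<in> F n\<close> show "v \<in> (\<lambda>y. ?Y w (idx y s) (of_rat t)) ` set ys"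
       unfolding ys(1) image_image by (intro image_eqI[of _ _ k]) auto
     qed
    qed simp
    also have "\<dots> \<le> Suc (changes (\<lambda>y. ?Y w (idx y s) (of_rat t)) ys)" by (rule card_image_changes)
    finally show "real (L + 1) \<le> ?V w" using S(2) by linarith
   qed
   have "W.prob {w \<in> space wiener. B L n (?Y w)} \<le> W.prob {w \<in> space wiener. real (L + 1) \<le> ?V w}"
    by (rule W.finite_measure_mono[OF sub])
     (rule borel_measurable_le[OF borel_measurable_const borel_measurable_integrable[OF V(1)]])
   also have "\<dots> \<le> (\<integral>w. ?V w \<partial>wiener) / real (L + 1)"
    by (rule integral_Markov_inequality_measure[OF V(1), of "{}"]) auto
   also have "\<dots> \<le> c / real (L + 1)"
    using V(2) \<open>(of_rat (last ys) - of_rat (hd ys)) / sqrt h \<le> c\<close> by (intro divide_right_mono) (auto simp: h_def)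
   finally show ?thesis .
  qed
  have "AE w in wiener. \<exists>L. \<forall>n. \<not> B L n (?Y w)"
  proof (rule W.AE_ex_if_small)
   fix e :: real assume e: "0 < e"
   obtain L :: nat where L: "c / e < L" using reals_Archimedean2 by blast
   define E where "E n = {w \<in> space wiener. B L n (?Y w)}" for n
   have E: "E n \<in> W.events" for n unfolding E_def by (rule event_cbm[OF Bm])
   have "B L n z \<longrightarrow> B L m z" if "n \<le> m" for n m z
   proof -
    have "F n \<subseteq> F m" using that by (auto simp: F_def)
    then show ?thesis unfolding B_def by blast
   qed
   then have "incseq E" by (auto simp: incseq_def E_def)
   then have "(\<lambda>n. W.prob (E n)) \<longlonglongrightarrow> W.prob (\<Union>n. E n)"
    by (intro W.finite_Lim_measure_incseq) (use E in auto)
   then have "W.prob (\<Union>n. E n) \<le> c / real (L + 1)"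
    using PB by (intro LIMSEQ_le_const2) (auto simp: E_def)
   also have "\<dots> \<le> e" using L e by (simp add: field_simps)
   finally have "W.prob (\<Union>n. E n) \<le> e" .
   moreover have "{w \<in> space wiener. \<not> (\<forall>n. \<not> B L n (?Y w))} = (\<Union>n. E n)" by (auto simp: E_def)
   moreover have "(\<Union>n. E n) \<in> W.events" using E by auto
   ultimately show "\<exists>L. {w \<in> space wiener. \<not> (\<forall>n. \<not> B L n (?Y w))} \<in> W.events \<and>
     W.prob {w \<in> space wiener. \<not> (\<forall>n. \<not> B L n (?Y w))} \<le> e" by (intro exI[of _ L]) simp
  qed
  then show ?thesis
  proof eventually_elim
   case (elim w)
   then obtain L where L: "\<And>n. \<not> B L n (?Y w)" by blast
   let ?z = "\<lambda>k. ?Y w k (of_rat t)"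
   have "finite {k \<in> A. new k (?Y w)}"
   proof (rule ccontr)
    assume "infinite {k \<in> A. new k (?Y w)}"
    then obtain S where S: "finite S" "card S = L + 2" "S \<subseteq> {k \<in> A. new k (?Y w)}"
     using infinite_arbitrarily_large by blast
    then have "S \<subseteq> F (Max S)" by (auto simp: F_def)
    with S have "B L (Max S) (?Y w)" unfolding B_def by (intro bexI[of _ S]) auto
    with L show False by blast
   qed
   then obtain m where m: "\<And>k. k \<in> A \<Longrightarrow> new k (?Y w) \<Longrightarrow> k \<le> m"
    unfolding finite_nat_set_iff_bounded_le by blast
   show ?case
   proof (rule exI[of _ m], intro allI impI)
    fix i assume "st i = of_rat s" "\<bar>sx i\<bar> \<le> real N"
    then have i: "i \<in> A \<and> ?z i = ?z i" by (simp add: A_def)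
    define k where "k = (LEAST k. k \<in> A \<and> ?z k = ?z i)"
    have k: "k \<in> A" "?z k = ?z i" using LeastI[of "\<lambda>k. k \<in> A \<and> ?z k = ?z i", OF i] by (simp_all add: k_def)
    have "?z j \<noteq> ?z k" if "j < k" "j \<in> A" for j
     using not_less_Least[OF that(1)[unfolded k_def]] that(2) k(2) by simp
    then have "new k (?Y w)" by (simp add: new_def)
    from m[OF k(1) this] k show "\<exists>k\<le>m. st k = of_rat s \<and> ?z k = ?z i" by (auto simp: A_def)
   qed
  qed
 qed
 then show ?thesis unfolding locally_finite_images_def by (simp add: AE_all_countable AE_impI)
qed

theorem AE_good: "AE w in wiener. good (cbm sx st w)"
 using AE_starts_ordered AE_tame AE_avoiding AE_locally_finite AE_sandwiched AE_unbounded
 by eventually_elim (auto simp: good_def)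

subsection \<open>Compactness in the path space\<close>

lemma tanh_ereal_le_iff [simp]: "tanh_ereal x \<le> tanh_ereal y \<longleftrightarrow> x \<le> y"
proof -
 have "\<not> 1 \<le> tanh r" "- 1 \<le> tanh r" "tanh r \<le> 1" "\<not> tanh r \<le> - 1" for r :: real
  using tanh_real_lt_1[of r] tanh_real_gt_neg1[of r] by auto
 then show ?thesis by (cases x; cases y) auto
qed

lemma tanh_ereal_less_iff [simp]: "tanh_ereal x < tanh_ereal y \<longleftrightarrow> x < y"
 by (simp add: not_le[symmetric])

definition artanh_ereal :: "real \<Rightarrow> ereal" where
 "artanh_ereal y = (if 1 \<le> y then \<infinity> else if y \<le> - 1 then - \<infinity> else ereal (artanh y))"

lemma tanh_artanh_ereal:
 assumes "\<bar>y\<bar> \<le> 1"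
 shows "tanh_ereal (artanh_ereal y) = y"
proof (cases "\<bar>y\<bar> = 1")
 case False
 then have y: "- 1 < y" "y < 1" using assms by auto
 have "exp (- 2 * artanh y) = (1 - y) / (1 + y)"
  using y by (simp add: artanh_def exp_minus)
 then have "tanh (artanh y) = (1 - (1 - y) / (1 + y)) / (1 + (1 - y) / (1 + y))"
  unfolding tanh_real_altdef by simp
 also have "\<dots> = y" using y by (simp add: divide_simps)
 finally have "tanh (artanh y) = y" .
 then show ?thesis using y by (simp add: artanh_ereal_def)
qed (use assms in \<open>auto simp: artanh_ereal_def abs_if split: if_splits\<close>)

lemma tanh_lipschitz: "\<bar>tanh x - tanh y\<bar> \<le> \<bar>x - y\<bar>" for x y :: real
proof -
 have "tanh y - tanh x \<le> y - x" if "x \<le> y" for x y :: real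
 proof -
  have "x - tanh x \<le> y - tanh y"
  proof (rule DERIV_nonneg_imp_nondecreasing[OF that])
   fix u :: real
   have "((\<lambda>u. u - tanh u) has_real_derivative 1 - (1 - tanh u ^ 2) * 1) (at u)"
    by (auto intro!: derivative_eq_intros)
   then show "\<exists>D. ((\<lambda>u. u - tanh u) has_real_derivative D) (at u) \<and> 0 \<le> D"
    by (intro exI[of _ "tanh u ^ 2"]) simp
  qed
  then show ?thesis by simp
 qed
 from this[of x y] this[of y x] show ?thesis by (cases "x \<le> y") auto
qed

definition tanh_at :: "fpath \<Rightarrow> real \<Rightarrow> real" where
 "tanh_at f t = tanh_ereal (at_time f t)"

lemma tanh_at_le_iff [simp]: "tanh_at f s \<le> tanh_at g t \<longleftrightarrow> at_time f s \<le> at_time g t"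
 and tanh_at_less_iff [simp]: "tanh_at f s < tanh_at g t \<longleftrightarrow> at_time f s < at_time g t"
 and tanh_at_eq_iff: "tanh_at f s = tanh_at g t \<longleftrightarrow> at_time f s = at_time g t"
 by (simp_all add: tanh_at_def tanh_ereal_inject)

lemma tanh_at_le_tanh_iff: "tanh_at f s \<le> tanh x \<longleftrightarrow> at_time f s \<le> ereal x"
 and tanh_le_tanh_at_iff: "tanh x \<le> tanh_at f s \<longleftrightarrow> ereal x \<le> at_time f s"
 and tanh_at_eq_tanh_iff: "tanh_at f s = tanh x \<longleftrightarrow> at_time f s = ereal x"
 unfolding tanh_at_def tanh_ereal_simps(1)[symmetric] by (simp_all only: tanh_ereal_inject tanh_ereal_le_iff)

lemma abs_tanh_at_le: "\<bar>tanh_at f t\<bar> \<le> 1"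
 by (simp add: tanh_at_def abs_tanh_ereal_le)

text \<open>Continuity at the two infinite times is automatic, because the denominator in
  \<open>\<Phi>\<close> tends to infinity while \<open>tanh_ereal\<close> is bounded.\<close>

lemma is_path_iff: "is_path f \<longleftrightarrow> continuous_on UNIV (\<lambda>t :: real. tanh_ereal (f (ereal t)))"
proof
 assume "is_path f"
 then have c: "continuous_on UNIV (\<lambda>t. \<Phi> (f t) t)" by (simp add: is_path_def)
 have "continuous_on UNIV (\<lambda>s. \<Phi> (f (ereal s)) (ereal s) * (1 + \<bar>s\<bar>))"
  by (intro continuous_on_mult continuous_on_compose2[OF c continuous_on_ereal[OF continuous_on_id]] continuous_on_add continuous_on_rabs continuous_on_const continuous_on_id) auto
 moreover have "\<Phi> (f (ereal s)) (ereal s) * (1 + \<bar>s\<bar>) = tanh_ereal (f (ereal s))" for s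
 proof -
  have "1 + \<bar>s\<bar> \<noteq> 0" by linarith
  then show ?thesis by simp
 qed
 ultimately show "continuous_on UNIV (\<lambda>t. tanh_ereal (f (ereal t)))" by simp
next
 assume c: "continuous_on UNIV (\<lambda>t :: real. tanh_ereal (f (ereal t)))"
 let ?g = "\<lambda>t. \<Phi> (f t) t"
 have small: "\<bar>?g t\<bar> < e" if "0 < e" "ereal (1 / e) < \<bar>t\<bar>" for t e
 proof (cases t)
  case (real r)
  then have "1 / e < \<bar>r\<bar>" using that by simp
  then have r: "1 < e * (1 + \<bar>r\<bar>)" using that(1) by (simp add: field_simps)
  have "\<bar>?g t\<bar> \<le> 1 / (1 + \<bar>r\<bar>)"
   using abs_tanh_ereal_le[of "f t"] by (simp add: real abs_divide divide_right_mono)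
  also have "\<dots> < e" using r by (subst pos_divide_less_eq) (auto simp: add_pos_nonneg)
  finally show ?thesis .
 qed (use that in auto)
 have "(?g \<longlongrightarrow> ?g t) (nhds t)" for t
 proof (cases "\<bar>t\<bar> \<noteq> \<infinity>")
  case True
  then obtain r where real: "t = ereal r" by auto
  have "continuous_on UNIV (\<lambda>s. tanh_ereal (f (ereal s)) / (1 + \<bar>s\<bar>))"
   using c by (intro continuous_on_divide continuous_on_add continuous_on_rabs continuous_on_const continuous_on_id) (auto simp: add_nonneg_eq_0_iff)
  then have "isCont (\<lambda>s. tanh_ereal (f (ereal s)) / (1 + \<bar>s\<bar>)) r"
   by (simp add: continuous_on_eq_continuous_at)
  then have "((\<lambda>s. tanh_ereal (f (ereal s)) / (1 + \<bar>s\<bar>)) \<longlongrightarrow> tanh_ereal (f (ereal r)) / (1 + \<bar>r\<bar>)) (nhds r)"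
   unfolding isCont_def by (rule tendsto_at_iff_tendsto_nhds[THEN iffD1])
  then show ?thesis unfolding real nhds_ereal filterlim_filtermap by simp
 next
  case False
  have "?g t = 0" using False by (cases t) auto
  show ?thesis
  proof (rule tendstoI)
   fix e :: real assume "0 < e"
   have "\<forall>\<^sub>F u in nhds t. u \<in> - {ereal (- 1 / e)..ereal (1 / e)}"
    using False by (intro eventually_nhds_in_open open_Compl closed_atLeastAtMost) auto
   then show "\<forall>\<^sub>F u in nhds t. dist (?g u) (?g t) < e"
   proof eventually_elim
    case (elim u)
    then have "ereal (1 / e) < \<bar>u\<bar>" by (cases u) (auto simp: abs_real_def)
    from small[OF \<open>0 < e\<close> this] show ?case by (simp add: dist_real_def \<open>?g t = 0\<close>)
   qed
  qed
 qed
 then show "is_path f"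
  unfolding is_path_def continuous_on_eq_continuous_at[OF open_UNIV] isCont_def
  by (intro ballI tendsto_at_iff_tendsto_nhds[THEN iffD2])
qed

lemma continuous_tanh_at: "continuous_on UNIV (tanh_at f)"
 unfolding tanh_at_def by transfer (simp add: path_eq_def is_path_iff)

definition path_of :: "(real \<Rightarrow> ereal) \<Rightarrow> fpath" where
 "path_of h = abs_fpath (\<lambda>t. h (real_of_ereal t))"

lemma at_time_path_of:
 assumes "continuous_on UNIV (\<lambda>t. tanh_ereal (h t))"
 shows "at_time (path_of h) = h"
proof
 fix t
 have "path_eq (\<lambda>t. h (real_of_ereal t)) (\<lambda>t. h (real_of_ereal t))"
  using assms by (simp add: path_eq_def is_path_iff)
 from at_time.abs_eq[OF this] show "at_time (path_of h) t = h t" by (simp add: path_of_def)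
qed

lemma fpath_eqI: "(\<And>t. at_time f t = at_time g t) \<Longrightarrow> f = g"
proof transfer
 fix f g assume "path_eq f f" "path_eq g g" "\<And>t. f (ereal t) = g (ereal t)"
 then show "path_eq f g" unfolding path_eq_def by (auto simp: not_infty_ereal)

qed

lemma dist_fpath_leI:
 assumes "\<And>t. \<bar>tanh_at f t - tanh_at g t\<bar> \<le> r * (1 + \<bar>t\<bar>)"
 shows "dist f g \<le> r"
 using assms unfolding tanh_at_def
proof transfer
 fix f g r assume p: "path_eq f f" "path_eq g g"
  and *: "\<And>t. \<bar>tanh_ereal (f (ereal t)) - tanh_ereal (g (ereal t))\<bar> \<le> r * (1 + \<bar>t\<bar>)"
 have "0 \<le> r" using *[of 0] by simp
 show "(SUP t. \<bar>\<Phi> (f t) t - \<Phi> (g t) t\<bar>) \<le> r"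
 proof (rule cSUP_least, simp)
  fix t
  show "\<bar>\<Phi> (f t) t - \<Phi> (g t) t\<bar> \<le> r"
  proof (cases t)
   case (real s)
   have pos: "0 < 1 + \<bar>s\<bar>" by linarith
   have "\<bar>\<Phi> (f t) t - \<Phi> (g t) t\<bar> = \<bar>tanh_ereal (f (ereal s)) - tanh_ereal (g (ereal s))\<bar> / (1 + \<bar>s\<bar>)"
    using pos by (simp add: real diff_divide_distrib[symmetric] abs_divide)
   also have "\<dots> \<le> r" using *[of s] pos by (simp add: pos_divide_le_eq)
   finally show ?thesis .
  qed (use \<open>0 \<le> r\<close> in auto)
 qed
qed

lemma tanh_at_dist: "\<bar>tanh_at f t - tanh_at g t\<bar> \<le> dist f g * (1 + \<bar>t\<bar>)"
 unfolding tanh_at_def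
proof transfer
 fix f g and t :: real assume p: "path_eq f f" "path_eq g g"
 have pos: "0 < 1 + \<bar>t\<bar>" by linarith
 have "\<bar>\<Phi> (f (ereal t)) (ereal t) - \<Phi> (g (ereal t)) (ereal t)\<bar> \<le> (SUP t. \<bar>\<Phi> (f t) t - \<Phi> (g t) t\<bar>)"
  by (rule cSUP_upper[OF UNIV_I bdd_above_\<Phi>_diff])
 moreover have "\<bar>\<Phi> (f (ereal t)) (ereal t) - \<Phi> (g (ereal t)) (ereal t)\<bar> = \<bar>tanh_ereal (f (ereal t)) - tanh_ereal (g (ereal t))\<bar> / (1 + \<bar>t\<bar>)"
  using pos by (simp add: diff_divide_distrib[symmetric] abs_divide)
 ultimately show "\<bar>tanh_ereal (f (ereal t)) - tanh_ereal (g (ereal t))\<bar> \<le> (SUP t. \<bar>\<Phi> (f t) t - \<Phi> (g t) t\<bar>) * (1 + \<bar>t\<bar>)"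
  using pos by (simp add: pos_divide_le_eq)
qed

lemma continuous_tanh_at_at: "continuous_on UNIV (\<lambda>f. tanh_at f t)"
proof (rule continuous_on_subset[OF lipschitz_on_continuous_on])
 show "(1 + \<bar>t\<bar>)-lipschitz_on UNIV (\<lambda>f. tanh_at f t)"
  using tanh_at_dist[of _ t] by (intro lipschitz_onI) (auto simp: dist_real_def mult.commute)
qed simp

lemma closed_tanh_at:
 "closed {f. tanh_at f t \<le> c}" "closed {f. c \<le> tanh_at f t}" "closed {f. tanh_at f t = c}"
 by (intro closed_Collect_le closed_Collect_eq continuous_tanh_at_at continuous_on_const)+

lemma closed_at_time:
 "closed {f. at_time f t \<le> ereal x}" "closed {f. ereal x \<le> at_time f t}" "closed {f. at_time f t = ereal x}"
 using closed_tanh_at(1)[of t "tanh x"] closed_tanh_at(2)[of "tanh x" t] closed_tanh_at(3)[of t "tanh x"] by (simp_all add: tanh_at_le_tanh_iff tanh_le_tanh_at_iff tanh_at_eq_tanh_iff)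

lemma open_at_time_less:
 "open {t. at_time f t < at_time g t}"
 "continuous_on UNIV z \<Longrightarrow> open {t. at_time f t < ereal (z t)}"
 "continuous_on UNIV z \<Longrightarrow> open {t. ereal (z t) < at_time f t}"
proof -
 have "open {t. tanh_at f t < tanh_at g t}"
  by (intro open_Collect_less continuous_tanh_at)
 then show "open {t. at_time f t < at_time g t}" by simp
 assume z: "continuous_on UNIV z"
 have c: "continuous_on UNIV (\<lambda>t. tanh (z t))"
  by (intro continuous_on_tanh z) (use cosh_real_nonzero in blast)
 have "open {t. tanh_at f t < tanh (z t)}" "open {t. tanh (z t) < tanh_at f t}"
  by (intro open_Collect_less continuous_tanh_at c)+
 then show "open {t. at_time f t < ereal (z t)}" "open {t. ereal (z t) < at_time f t}"
  using tanh_at_le_tanh_iff tanh_le_tanh_at_iff by (simp_all add: not_le[symmetric])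
qed

lemma rat_near:
 fixes t :: real
 assumes "open U" "t \<in> U" "0 < e"
 shows "\<exists>r :: rat. t < of_rat r \<and> of_rat r < t + e \<and> {t..of_rat r} \<subseteq> U"
  and "\<exists>r :: rat. of_rat r < t \<and> t - e < of_rat r \<and> {of_rat r..t} \<subseteq> U"
proof -
 obtain d where d: "0 < d" "ball t d \<subseteq> U" using assms by (meson open_contains_ball)
 have "t < t + min d e" using d assms by simp
 then obtain r where r: "t < of_rat r" "of_rat r < t + min d e" using of_rat_dense by blast
 then have "{t..of_rat r} \<subseteq> ball t d" by (auto simp: dist_real_def)
 with r d(2) show "\<exists>r :: rat. t < of_rat r \<and> of_rat r < t + e \<and> {t..of_rat r} \<subseteq> U" by (intro exI[of _ r]) auto
 have "t - min d e < t" using d assms by simp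
 then obtain r where r: "t - min d e < of_rat r" "of_rat r < t" using of_rat_dense by blast
 then have "{of_rat r..t} \<subseteq> ball t d" by (auto simp: dist_real_def)
 with r d(2) show "\<exists>r :: rat. of_rat r < t \<and> t - e < of_rat r \<and> {of_rat r..t} \<subseteq> U" by (intro exI[of _ r]) auto
qed

text \<open>The time axis is compactified; division by zero makes the function vanish at \<open>s = \<plusminus>1\<close>.\<close>

definition compressed :: "fpath \<Rightarrow> real \<Rightarrow> real" where
 "compressed f s = (1 - \<bar>s\<bar>) * tanh_at f (s / (1 - \<bar>s\<bar>))"

lemma abs_compressed_le: "s \<in> {-1..1} \<Longrightarrow> \<bar>compressed f s\<bar> \<le> 1 - \<bar>s\<bar>"
 using abs_tanh_at_le[of f] by (auto simp: compressed_def abs_mult intro!: mult_left_le)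

lemma compressed_at: "compressed f (t / (1 + \<bar>t\<bar>)) = tanh_at f t / (1 + \<bar>t\<bar>)"
 and compressed_time: "t / (1 + \<bar>t\<bar>) \<in> {-1..1}" for t :: real
proof -
 define s where "s = t / (1 + \<bar>t\<bar>)"
 have pos: "0 < 1 + \<bar>t\<bar>" by linarith
 have 1: "1 - \<bar>s\<bar> = 1 / (1 + \<bar>t\<bar>)" using pos by (simp add: s_def abs_divide field_simps)
 moreover have "0 < 1 / (1 + \<bar>t\<bar>)" using pos by simp
 ultimately have "\<bar>s\<bar> \<le> 1" by linarith
 then show "t / (1 + \<bar>t\<bar>) \<in> {-1..1}" unfolding s_def[symmetric] by auto
 have "s / (1 - \<bar>s\<bar>) = t" unfolding 1 using pos by (simp add: s_def)
 then show "compressed f (t / (1 + \<bar>t\<bar>)) = tanh_at f t / (1 + \<bar>t\<bar>)" unfolding s_def[symmetric] by (simp add: compressed_def 1)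
qed

lemma dist_fpath_le_compressed:
 assumes "\<And>s. s \<in> {-1..1} \<Longrightarrow> \<bar>compressed f s - compressed g s\<bar> \<le> r"
 shows "dist f g \<le> r"
proof (rule dist_fpath_leI)
 fix t :: real
 have pos: "0 < 1 + \<bar>t\<bar>" by linarith
 have "\<bar>tanh_at f t - tanh_at g t\<bar> / (1 + \<bar>t\<bar>) \<le> r"
  using assms[OF compressed_time, of t] pos by (simp add: compressed_at diff_divide_distrib[symmetric] abs_divide)
 then show "\<bar>tanh_at f t - tanh_at g t\<bar> \<le> r * (1 + \<bar>t\<bar>)" using pos by (simp add: pos_divide_le_eq)
qed

text \<open>At the ends of the interval all compressed paths are uniformly small. In the interior,
  the change is split into a change of the factor \<open>1 - \<bar>s\<bar>\<close> and a change of
  the path.\<close>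

lemma equicontinuous_compressed:
 assumes equi: "\<And>t e. 0 < e \<Longrightarrow> \<exists>d>0. \<forall>f\<in>K. \<forall>s. \<bar>s - t\<bar> < d \<longrightarrow> \<bar>tanh_at f s - tanh_at f t\<bar> \<le> e"
  and s: "s \<in> {-1..1}" and e: "0 < e"
 shows "\<exists>d>0. \<forall>f\<in>K. \<forall>y\<in>{-1..1}. \<bar>y - s\<bar> < d \<longrightarrow> \<bar>compressed f y - compressed f s\<bar> < e"
proof (cases "\<bar>s\<bar> < 1")
 case True
 let ?T = "\<lambda>s :: real. s / (1 - \<bar>s\<bar>)"
 from equi[of "e / 4" "?T s"] e obtain d where d: "0 < d"
  "\<And>f u. f \<in> K \<Longrightarrow> \<bar>u - ?T s\<bar> < d \<Longrightarrow> \<bar>tanh_at f u - tanh_at f (?T s)\<bar> \<le> e / 4"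
  by auto
 have "continuous_on {-1<..<1} ?T"
  by (intro continuous_intros) auto
 then have "isCont ?T s" using True by (auto simp: continuous_on_eq_continuous_at abs_less_iff)
 then obtain d' where d': "0 < d'" "\<And>y. dist y s < d' \<Longrightarrow> dist (?T y) (?T s) < d"
  using d(1) unfolding continuous_at_eps_delta dist_real_def by meson
 show ?thesis
 proof (intro exI[of _ "min d' (e / 4)"] conjI ballI impI)
  show "0 < min d' (e / 4)" using d' e by simp
  fix f y assume f: "f \<in> K" and y: "y \<in> {-1..1}" "\<bar>y - s\<bar> < min d' (e / 4)"
  then have 1: "\<bar>tanh_at f (?T y) - tanh_at f (?T s)\<bar> \<le> e / 4"
   using d(2)[of f "?T y"] d'(2)[of y] by (auto simp: dist_real_def)
  have "compressed f y - compressed f s = (1 - \<bar>s\<bar>) * (tanh_at f (?T y) - tanh_at f (?T s)) - (\<bar>y\<bar> - \<bar>s\<bar>) * tanh_at f (?T y)"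
   by (simp add: compressed_def algebra_simps)
  also have "\<bar>\<dots>\<bar> \<le> \<bar>1 - \<bar>s\<bar>\<bar> * \<bar>tanh_at f (?T y) - tanh_at f (?T s)\<bar> + \<bar>\<bar>y\<bar> - \<bar>s\<bar>\<bar> * \<bar>tanh_at f (?T y)\<bar>"
   by (simp only: abs_mult[symmetric]) (rule abs_triangle_ineq4)
  also have "\<dots> \<le> 1 * (e / 4) + (e / 4) * 1"
  proof (intro add_mono mult_mono)
   have "\<bar>\<bar>y\<bar> - \<bar>s\<bar>\<bar> \<le> \<bar>y - s\<bar>" by (rule abs_triangle_ineq3)
   then show "\<bar>\<bar>y\<bar> - \<bar>s\<bar>\<bar> \<le> e / 4" using y by simp
  qed (use s e 1 abs_tanh_at_le in auto)
  also have "\<dots> < e" using e by simp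
  finally show "\<bar>compressed f y - compressed f s\<bar> < e" .
 qed
next
 case False
 then have s1: "\<bar>s\<bar> = 1" using s by auto
 have "\<bar>compressed f y\<bar> < e" if "y \<in> {-1..1}" "\<bar>y - s\<bar> < e" for f y
  using abs_compressed_le[OF that(1), of f] that(2) s1 by linarith
 moreover have "compressed f s = 0" for f using s1 by (simp add: compressed_def)
 ultimately show ?thesis using e by (intro exI[of _ e]) simp
qed

lemma continuous_compressed: "continuous_on {-1..1} (compressed f)"
 unfolding continuous_on_iff
proof (intro ballI allI impI)
 fix s e :: real assume s: "s \<in> {-1..1}" and e: "0 < e"
 have "\<exists>d>0. \<forall>h\<in>{f}. \<forall>s. \<bar>s - t\<bar> < d \<longrightarrow> \<bar>tanh_at h s - tanh_at h t\<bar> \<le> e" if "0 < e" for t e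
  using continuous_tanh_at[of f] that unfolding continuous_on_iff dist_real_def by (simp, meson less_imp_le UNIV_I)
 from equicontinuous_compressed[of "{f}", OF this s e]
 show "\<exists>d>0. \<forall>y\<in>{-1..1}. dist y s < d \<longrightarrow> dist (compressed f y) (compressed f s) < e"
  by (auto simp: dist_real_def)
qed

text \<open>Arzela-Ascoli for the compressed paths. The limit stays in \<open>[-1, 1]\<close>, and
  \<open>artanh_ereal\<close> turns it back into a path, possibly with infinite values.\<close>

theorem compact_fpathsI:
 assumes "closed K"
  and equi: "\<And>t e. 0 < e \<Longrightarrow> \<exists>d>0. \<forall>f\<in>K. \<forall>s. \<bar>s - t\<bar> < d \<longrightarrow> \<bar>tanh_at f s - tanh_at f t\<bar> \<le> e"
 shows "compact K"
 unfolding compact_eq_seq_compact_metric seq_compact_def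
proof (intro allI impI)
 fix F :: "nat \<Rightarrow> fpath" assume FK: "\<forall>n. F n \<in> K"
 obtain g k where g: "continuous_on {-1..1} g" "strict_mono (k :: nat \<Rightarrow> nat)"
  "\<And>e. 0 < e \<Longrightarrow> \<exists>N. \<forall>n x. n \<ge> N \<and> x \<in> {-1..1} \<longrightarrow> norm (compressed (F (k n)) x - g x) < e"
 proof (rule Arzela_Ascoli[of "{-1..1 :: real}" "\<lambda>n. compressed (F n)" 1])
  show "norm (compressed (F n) s) \<le> 1" if "s \<in> {-1..1}" for n s using abs_compressed_le[OF that, of "F n"] by simp
  show "\<exists>d>0. \<forall>n y. y \<in> {-1..1} \<and> norm (s - y) < d \<longrightarrow> norm (compressed (F n) s - compressed (F n) y) < e"
   if se: "s \<in> {-1..1}" "0 < e" for s e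
  proof -
   obtain d where "0 < d" "\<And>f y. f \<in> K \<Longrightarrow> y \<in> {-1..1} \<Longrightarrow> \<bar>y - s\<bar> < d \<Longrightarrow> \<bar>compressed f y - compressed f s\<bar> < e"
    using equicontinuous_compressed[OF equi se] by blast
   then show ?thesis using FK by (intro exI[of _ d]) (simp add: abs_minus_commute)
  qed
 qed auto
 define c where "c t = g (t / (1 + \<bar>t\<bar>)) * (1 + \<bar>t\<bar>)" for t
 have pos: "0 < 1 + \<bar>t\<bar>" for t :: real by linarith
 have lim: "(\<lambda>n. tanh_at (F (k n)) t) \<longlonglongrightarrow> c t" for t
 proof -
  have "(\<lambda>n. compressed (F (k n)) (t / (1 + \<bar>t\<bar>))) \<longlonglongrightarrow> g (t / (1 + \<bar>t\<bar>))"
   unfolding LIMSEQ_iff using g(3) compressed_time by meson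
  then have "(\<lambda>n. compressed (F (k n)) (t / (1 + \<bar>t\<bar>)) * (1 + \<bar>t\<bar>)) \<longlonglongrightarrow> c t" unfolding c_def by (intro tendsto_intros)
  then show ?thesis using pos[of t] by (simp add: compressed_at)
 qed
 have c1: "\<bar>c t\<bar> \<le> 1" for t
  by (rule LIMSEQ_le_const2[OF tendsto_rabs[OF lim]]) (auto simp: abs_tanh_at_le)
 have cc: "continuous_on UNIV c"
  unfolding c_def
  by (intro continuous_on_mult continuous_on_compose2[OF g(1)] continuous_intros)
   (use compressed_time in \<open>auto simp: add_nonneg_eq_0_iff\<close>)
 define h where "h = path_of (\<lambda>t. artanh_ereal (c t))"
 have hc: "tanh_at h t = c t" for t
  unfolding tanh_at_def h_def using c1 cc by (subst at_time_path_of) (auto simp: tanh_artanh_ereal)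
 have "(\<lambda>n. F (k n)) \<longlonglongrightarrow> h"
 proof (rule metric_LIMSEQ_I)
  fix e :: real assume e: "0 < e"
  then obtain N where N: "\<And>n x. n \<ge> N \<Longrightarrow> x \<in> {-1..1} \<Longrightarrow> \<bar>compressed (F (k n)) x - g x\<bar> < e / 2"
   using g(3)[of "e / 2"] by auto
  have "dist (F (k n)) h \<le> e / 2" if "n \<ge> N" for n
  proof (rule dist_fpath_leI)
   fix t
   have "tanh_at (F (k n)) t - tanh_at h t = (compressed (F (k n)) (t / (1 + \<bar>t\<bar>)) - g (t / (1 + \<bar>t\<bar>))) * (1 + \<bar>t\<bar>)"
    using pos[of t] by (simp add: hc c_def compressed_at left_diff_distrib)
   then show "\<bar>tanh_at (F (k n)) t - tanh_at h t\<bar> \<le> e / 2 * (1 + \<bar>t\<bar>)"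
    using N[OF that compressed_time, of t] pos[of t] by (simp add: abs_mult)
  qed
  moreover have "e / 2 < e" using e by simp
  ultimately show "\<exists>N. \<forall>n\<ge>N. dist (F (k n)) h < e" by (meson le_less_trans)
 qed
 moreover have "h \<in> K"
  by (rule closed_sequentially[OF assms(1)]) (use FK calculation in auto)
 ultimately show "\<exists>l\<in>K. \<exists>r. strict_mono r \<and> (F \<circ> r) \<longlonglongrightarrow> l"
  using g(2) by (auto simp: o_def intro!: bexI[of _ h] exI[of _ k])
qed

subsection \<open>The web of a good skeleton\<close>

text \<open>Not crossing any skeleton path after its start. It is stated for plain functions because
  \<open>two_sided\<close> has to satisfy it before its continuity, which is derived from it, is
  known.\<close>

definition obeys :: "paths \<Rightarrow> (real \<Rightarrow> ereal) \<Rightarrow> bool" where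
 "obeys z h \<longleftrightarrow> (\<forall>i. (\<forall>s\<ge>st i. h s \<le> ereal (z i s)) \<or> (\<forall>s\<ge>st i. ereal (z i s) \<le> h s))"

definition full_web :: "paths \<Rightarrow> fpath set" where
 "full_web z = {f. obeys z (at_time f)}"

text \<open>Before its start the path is the upper envelope of the older skeleton paths that pass to
  the left of the starting point. By \<open>avoiding\<close>, all other older paths pass to the
  right.\<close>

definition two_sided :: "paths \<Rightarrow> nat \<Rightarrow> real \<Rightarrow> ereal" where
 "two_sided z i s = (if st i \<le> s then ereal (z i s) else SUP q\<in>{q. st q \<le> s \<and> z q (st i) < sx i}. ereal (z q s))"

definition web_path :: "paths \<Rightarrow> nat \<Rightarrow> fpath" where
 "web_path z i = path_of (two_sided z i)"

definition skeleton_web :: "paths \<Rightarrow> fpath set" where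
 "skeleton_web z = closure (range (web_path z))"

lemma closed_full_web: "closed (full_web z)"
proof -
 have "full_web z = (\<Inter>i. (\<Inter>s\<in>{st i..}. {f. at_time f s \<le> ereal (z i s)}) \<union> (\<Inter>s\<in>{st i..}. {f. ereal (z i s) \<le> at_time f s}))"
  unfolding full_web_def obeys_def by auto
 also have "closed \<dots>"
  by (intro closed_INT closed_Un ballI closed_at_time)
 finally show ?thesis .
qed

lemma obeys_less:
 assumes "obeys z h" "st i \<le> s" "h s < ereal (z i s)" "st i \<le> u"
 shows "h u \<le> ereal (z i u)"
 using assms unfolding obeys_def by (meson not_le)

lemma obeys_greater:
 assumes "obeys z h" "st i \<le> s" "ereal (z i s) < h s" "st i \<le> u"
 shows "ereal (z i u) \<le> h u"
 using assms unfolding obeys_def by (meson not_le)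

locale web =
 fixes z :: "paths"
 assumes good: "good z" and cont: "\<And>i. continuous_on UNIV (z i)"
begin

lemma start [simp]: "z i (st i) = sx i"
 using good by (simp add: good_def starts_def)

text \<open>A strict inequality persists at rational times shortly to the right, where both paths
  have already started; so \<open>ordered\<close> applies.\<close>

lemma noncross:
 assumes "st i \<le> s" "st k \<le> s" "st i \<le> u" "st k \<le> u" "z i s < z k s"
 shows "z i u \<le> z k u"
proof (rule ccontr)
 assume "\<not> ?thesis"
 then have u: "z k u < z i u" by simp
 have open_less: "open {t. z a t < z b t}" for a b
  by (intro open_Collect_less cont)
 obtain s' :: rat where s': "s < of_rat s'" "{s..of_rat s'} \<subseteq> {t. z i t < z k t}"
  using rat_near(1)[OF open_less, of s i k 1] assms by auto
 obtain u' :: rat where u': "u < of_rat u'" "{u..of_rat u'} \<subseteq> {t. z k t < z i t}"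
  using rat_near(1)[OF open_less, of u k i 1] u by auto
 have "z i (of_rat s') < z k (of_rat s')" "z k (of_rat u') < z i (of_rat u')"
  using subsetD[OF s'(2), of "of_rat s'"] subsetD[OF u'(2), of "of_rat u'"] s'(1) u'(1) by simp_all
 moreover have "st i \<le> of_rat s'" "st k \<le> of_rat s'" "st i \<le> of_rat u'" "st k \<le> of_rat u'"
  using assms s' u' by auto
 ultimately have "z i (of_rat u') \<le> z k (of_rat u')"
  using good unfolding good_def ordered_def by blast
 with \<open>z k (of_rat u') < z i (of_rat u')\<close> show False by simp
qed

lemma avoid: "st j < st i \<Longrightarrow> z j (st i) \<noteq> sx i"
 using good by (simp add: good_def avoiding_def)

text \<open>Within one time cell a path is confined by the fence paths started next to its position.
  Beyond the spatial range of the grid the fences keep it far out, where \<open>tanh\<close> is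
  almost constant.\<close>

lemma modulus_cell:
 assumes "0 < e"
 shows "\<exists>n m. N \<le> n \<and> (\<forall>h (b :: int) u. obeys z h \<longrightarrow> \<bar>b\<bar> \<le> int ((n + 1) * (m + 1)) \<longrightarrow>
  of_int b / real (m + 1) \<le> u \<longrightarrow> u \<le> (of_int b + 1) / real (m + 1) \<longrightarrow>
  \<bar>tanh_ereal (h u) - tanh_ereal (h (of_int b / real (m + 1)))\<bar> \<le> e)"
proof -
 \<comment> \<open>\<open>n\<close> must be so large that positions beyond \<open>n - 4\<close>, the
   range that the outermost fences secure, have \<open>tanh\<close> within \<open>e\<close> of 1,
   and that six meshes are less than \<open>e\<close>.\<close>
 have ev1: "\<forall>\<^sub>F n :: nat in sequentially. 1 - e < tanh (real n - 4)"
 proof -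
  have "filterlim (\<lambda>n. real n - 4) at_top sequentially"
   using filterlim_tendsto_add_at_top[OF tendsto_const filterlim_real_sequentially, of "- 4"] by (simp add: add.commute)
  from filterlim_compose[OF tanh_real_at_top this] show ?thesis
   using assms by (intro order_tendstoD) auto
 qed
 have ev2: "\<forall>\<^sub>F n :: nat in sequentially. 6 / real (n + 1) < e"
 proof -
  have "(\<lambda>n. 6 * inverse (real (Suc n))) \<longlonglongrightarrow> 6 * 0" by (intro tendsto_intros LIMSEQ_inverse_real_of_nat)
  then show ?thesis using assms by (intro order_tendstoD) (auto simp: divide_inverse)
 qed
 from eventually_conj[OF ev1 ev2] eventually_ge_at_top[of N]
 obtain n where n: "1 - e < tanh (real n - 4)" "6 / real (n + 1) < e" "N \<le> n"
  by (metis (mono_tags, lifting) eventually_conj eventually_sequentially order_refl)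
 obtain m where m: "tame_grid n m z" using good unfolding good_def by blast
 define d where "d = 1 / real (n + 1)"
 have d: "0 < d" "d \<le> 1" "real (n + 1) * d = 1" by (simp_all add: d_def)
 define K where "K = int ((n + 1)\<^sup>2)"
 have K: "1 \<le> K" "of_int K * d = real (n + 1)"
 proof -
  have "real_of_int K = real (n + 1) * real (n + 1)" by (simp only: K_def power2_eq_square of_int_of_nat_eq of_nat_mult of_int_mult)
  then show "of_int K * d = real (n + 1)" using d(3) by (simp only: mult.assoc mult_1_right)
 qed (simp add: K_def)
 have main: "\<bar>tanh_ereal (h u) - tanh_ereal (h t)\<bar> \<le> e"
  if h: "obeys z h" and b: "\<bar>b\<bar> \<le> int ((n + 1) * (m + 1))"
   and t: "t = of_int b / real (m + 1)" and u: "t \<le> u" "u \<le> (of_int b + 1) / real (m + 1)" for h b t u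
 proof -
  define p where "p a = idx (of_int a / of_nat (n + 1)) (of_int b / of_nat (m + 1))" for a
  have p: "sx (p a) = of_int a * d" "st (p a) = t" for a
   by (simp_all add: p_def of_rat_divide of_rat_add t d_def)
  have stay: "\<bar>z (p a) u - of_int a * d\<bar> \<le> 4 * d" if "\<bar>a\<bar> \<le> K" for a
  proof -
   have "closed {u. \<bar>z (p a) u - of_int a * d\<bar> \<le> 4 * d}"
    by (intro closed_Collect_le continuous_on_rabs continuous_on_diff cont continuous_on_const)
   moreover have "t < (of_int b + 1) / real (m + 1)" unfolding t by (intro divide_strict_right_mono) auto
   moreover have "of_rat v \<in> {u. \<bar>z (p a) u - of_int a * d\<bar> \<le> 4 * d}" if "t \<le> of_rat v" "of_rat v \<le> (of_int b + 1) / real (m + 1)" for v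
    using m that \<open>\<bar>a\<bar> \<le> K\<close> b unfolding tame_grid_def p_def t d_def K_def by (auto simp: abs_le_iff)
   ultimately have "{t..(of_int b + 1) / real (m + 1)} \<subseteq> {u. \<bar>z (p a) u - of_int a * d\<bar> \<le> 4 * d}"
    by (rule rat_dense_interval)
   then show ?thesis using u by auto
  qed
  have up: "h u \<le> ereal ((of_int a + 4) * d)" if "\<bar>a\<bar> \<le> K" "h t < ereal (of_int a * d)" for a
  proof -
   have "h u \<le> ereal (z (p a) u)" by (rule obeys_less[OF h, of _ t]) (use p that u start[of "p a"] in auto)
   also have "\<dots> \<le> ereal ((of_int a + 4) * d)" using stay[OF that(1)] unfolding distrib_right by simp
   finally show ?thesis .
  qed
  have dn: "ereal ((of_int a - 4) * d) \<le> h u" if "\<bar>a\<bar> \<le> K" "ereal (of_int a * d) < h t" for a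
  proof -
   have "ereal ((of_int a - 4) * d) \<le> ereal (z (p a) u)" using stay[OF that(1)] unfolding left_diff_distrib by simp
   also have "\<dots> \<le> h u" by (rule obeys_greater[OF h, of _ t]) (use p that u start[of "p a"] in auto)
   finally show ?thesis .
  qed
  have bd: "\<bar>tanh_ereal y\<bar> \<le> 1" for y by (rule abs_tanh_ereal_le)
  have K1: "real n - 4 \<le> of_int (K - 1) * d - 4 * d" "real n - 4 \<le> of_int (K - 1) * d"
   using K(2) d by (simp_all add: left_diff_distrib)
  consider "ereal (of_int (K - 1) * d) < h t" | "h t < ereal (of_int (- (K - 1)) * d)"
   | "ereal (of_int (- (K - 1)) * d) \<le> h t" "h t \<le> ereal (of_int (K - 1) * d)" by fastforce
  then show ?thesis
  proof cases
   case 1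
   have "ereal (real n - 4) \<le> ereal ((of_int (K - 1) - 4) * d)" using K1(1) by (simp add: left_diff_distrib)
   also have "\<dots> \<le> h u" using 1 K by (intro dn) auto
   finally have "tanh (real n - 4) \<le> tanh_ereal (h u)" by (metis tanh_ereal_le_iff tanh_ereal_simps(1))
   moreover have "ereal (real n - 4) \<le> h t" using 1 K1(2) by (meson ereal_less_eq(3) le_less_trans less_imp_le)
   then have "tanh (real n - 4) \<le> tanh_ereal (h t)" by (metis tanh_ereal_le_iff tanh_ereal_simps(1))
   ultimately show ?thesis using bd[of "h u"] bd[of "h t"] n(1) by (auto simp: abs_le_iff)
  next
   case 2
   have "h u \<le> ereal ((of_int (- (K - 1)) + 4) * d)" using 2 K by (intro up) auto
   also have "\<dots> \<le> ereal (- (real n - 4))" using K1(1) by (simp add: algebra_simps)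
   finally have "tanh_ereal (h u) \<le> tanh (- (real n - 4))" by (metis tanh_ereal_le_iff tanh_ereal_simps(1))
   moreover have "h t \<le> ereal (- (real n - 4))"
   proof -
    have "of_int (- (K - 1)) * d \<le> - (real n - 4)" using K1(2) by (simp add: algebra_simps)
    with 2 show ?thesis by (meson ereal_less_eq(3) le_less_trans less_imp_le order_trans)
   qed
   then have "tanh_ereal (h t) \<le> tanh (- (real n - 4))" by (metis tanh_ereal_le_iff tanh_ereal_simps(1))
   ultimately show ?thesis using bd[of "h u"] bd[of "h t"] n(1) unfolding tanh_minus by linarith
  next
   case 3
   then obtain y where y: "h t = ereal y" by (cases "h t") auto
   define a where "a = \<lfloor>y / d\<rfloor>"
   have "of_int a \<le> y / d" "y / d < of_int a + 1" unfolding a_def by linarith+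
   then have a: "of_int a * d \<le> y" "y < (of_int a + 1) * d"
    by (simp_all add: pos_le_divide_eq[OF d(1)] pos_divide_less_eq[OF d(1)])
   have aK: "- (K - 1) \<le> a" "a \<le> K - 1"
   proof -
    have "of_int (- (K - 1)) \<le> y / d" using 3(1) unfolding pos_le_divide_eq[OF d(1)] y by simp
    then show "- (K - 1) \<le> a" unfolding a_def by linarith
    have "y / d \<le> of_int (K - 1)" using 3(2) unfolding pos_divide_le_eq[OF d(1)] y by simp
    then show "a \<le> K - 1" unfolding a_def by linarith
   qed
   \<comment> \<open>The fences start at \<open>(a + 1) * d\<close> and \<open>(a - 1) * d\<close>,
     strictly on either side of \<open>y\<close>, since \<open>y\<close> may equal
     \<open>a * d\<close>. They move by at most \<open>4 * d\<close>, and together with the position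
     of \<open>y\<close> within its mesh this yields \<open>6 * d\<close>.\<close>
   have "h u \<le> ereal ((of_int (a + 1) + 4) * d)" using a aK by (intro up) (auto simp: y)
   moreover have "ereal ((of_int (a - 1) - 4) * d) \<le> h u"
    using a aK d(1) by (intro dn) (auto simp: y left_diff_distrib)
   ultimately obtain w where w: "h u = ereal w" "w \<le> (of_int (a + 1) + 4) * d" "(of_int (a - 1) - 4) * d \<le> w"
    by (cases "h u") auto
   have "\<bar>w - y\<bar> \<le> 6 * d" using w(2,3) a d(1) unfolding abs_le_iff by (simp add: algebra_simps)
   then have "\<bar>tanh w - tanh y\<bar> \<le> 6 * d" using tanh_lipschitz[of w y] by linarith
   then show ?thesis using n(2) by (simp add: w y d_def)
  qed
 qed
 show ?thesis
  by (intro exI[of _ n] exI[of _ m] conjI n(3) allI impI main) auto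
qed

lemma modulus:
 assumes "0 < e"
 shows "\<exists>d>0. \<forall>h. obeys z h \<longrightarrow> (\<forall>s t. \<bar>s\<bar> \<le> N \<longrightarrow> \<bar>t\<bar> \<le> N \<longrightarrow> \<bar>s - t\<bar> \<le> d \<longrightarrow> \<bar>tanh_ereal (h s) - tanh_ereal (h t)\<bar> \<le> e)"
proof -
 \<comment> \<open>Two times at most one cell width apart lie in the same or in adjacent time cells,
   so at most three comparisons with cell boundaries are needed.\<close>
 have "0 < e / 3" using assms by simp
 from modulus_cell[OF this, of "nat \<lceil>N\<rceil>"] obtain n m where n: "N \<le> real n"
  and cell: "\<And>h b u. obeys z h \<Longrightarrow> \<bar>b\<bar> \<le> int ((n + 1) * (m + 1)) \<Longrightarrow>
   of_int b / real (m + 1) \<le> u \<Longrightarrow> u \<le> (of_int b + 1) / real (m + 1) \<Longrightarrow>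
   \<bar>tanh_ereal (h u) - tanh_ereal (h (of_int b / real (m + 1)))\<bar> \<le> e / 3"
  by (metis nat_ceiling_le_eq)
 let ?d = "1 / real (m + 1)"
 have *: "\<bar>tanh_ereal (h s) - tanh_ereal (h t)\<bar> \<le> e"
  if h: "obeys z h" and st: "\<bar>s\<bar> \<le> N" "\<bar>t\<bar> \<le> N" "s \<le> t" "t - s \<le> ?d" for h s t
 proof -
  define b where "b = \<lfloor>s * real (m + 1)\<rfloor>"
  let ?p = "of_int b / real (m + 1)" and ?q = "of_int (b + 1) / real (m + 1)"
  have pos: "0 < real (m + 1)" by simp
  have b: "of_int b \<le> s * real (m + 1)" "s * real (m + 1) < of_int b + 1"
   by (auto simp: b_def)
  have s: "?p \<le> s" "s \<le> ?q" using b pos by (simp_all add: pos_divide_le_eq pos_le_divide_eq)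
  have t: "t \<le> (of_int (b + 1) + 1) / real (m + 1)"
  proof -
   have "t \<le> ?q + ?d" using st s by linarith
   then show ?thesis by (simp add: add_divide_distrib)
  qed
  have bb: "\<bar>b\<bar> \<le> int ((n + 1) * (m + 1))" "\<bar>b + 1\<bar> \<le> int ((n + 1) * (m + 1))"
  proof -
   have "\<bar>s\<bar> \<le> real n" using st n by simp
   then have "\<bar>s * real (m + 1)\<bar> \<le> real n * real (m + 1)" unfolding abs_mult by (intro mult_mono) auto
   then have "real_of_int (- (int n * int (m + 1))) - 1 < of_int b" "of_int b \<le> real_of_int (int n * int (m + 1))"
   proof -
    have "- (real n * real (m + 1)) \<le> s * real (m + 1)" "s * real (m + 1) \<le> real n * real (m + 1)"
     using \<open>\<bar>s * real (m + 1)\<bar> \<le> real n * real (m + 1)\<close> by linarith+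
    with b have "- (real n * real (m + 1)) - 1 < of_int b" "of_int b \<le> real n * real (m + 1)" by linarith+
    then show "real_of_int (- (int n * int (m + 1))) - 1 < of_int b" "of_int b \<le> real_of_int (int n * int (m + 1))"
     by (simp_all only: of_int_minus of_int_mult of_int_of_nat_eq)
   qed
   then have "- (int n * int (m + 1)) \<le> b" "b \<le> int n * int (m + 1)" by linarith+
   then show "\<bar>b\<bar> \<le> int ((n + 1) * (m + 1))" "\<bar>b + 1\<bar> \<le> int ((n + 1) * (m + 1))"
    by (auto simp: abs_le_iff algebra_simps)
  qed
  have 1: "\<bar>tanh_ereal (h s) - tanh_ereal (h ?p)\<bar> \<le> e / 3"
   by (rule cell[OF h bb(1)]) (use s in auto)
  show ?thesis
  proof (cases "t \<le> ?q")
   case True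
   have "\<bar>tanh_ereal (h t) - tanh_ereal (h ?p)\<bar> \<le> e / 3"
    by (rule cell[OF h bb(1)]) (use s st True in auto)
   then show ?thesis using 1 assms by linarith
  next
   case False
   have "\<bar>tanh_ereal (h ?q) - tanh_ereal (h ?p)\<bar> \<le> e / 3"
    by (rule cell[OF h bb(1)]) (auto intro!: divide_right_mono)
   moreover have "\<bar>tanh_ereal (h t) - tanh_ereal (h ?q)\<bar> \<le> e / 3"
    by (rule cell[OF h bb(2) _ t]) (use False in auto)
   ultimately show ?thesis using 1 by linarith
  qed
 qed
 have "\<bar>tanh_ereal (h s) - tanh_ereal (h t)\<bar> \<le> e"
  if "obeys z h" "\<bar>s\<bar> \<le> N" "\<bar>t\<bar> \<le> N" "\<bar>s - t\<bar> \<le> ?d" for h s t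
  using *[OF that(1,2,3)] *[OF that(1,3,2)] that(4) by (cases "s \<le> t") (auto simp: abs_minus_commute)
 then show ?thesis by (intro exI[of _ ?d]) auto
qed

lemma equicontinuous:
 assumes "0 < e"
 shows "\<exists>d>0. \<forall>h. obeys z h \<longrightarrow> (\<forall>s. \<bar>s - t\<bar> < d \<longrightarrow> \<bar>tanh_ereal (h s) - tanh_ereal (h t)\<bar> \<le> e)"
proof -
 obtain d where d: "0 < d" "\<And>h s u. obeys z h \<Longrightarrow> \<bar>s\<bar> \<le> \<bar>t\<bar> + 1 \<Longrightarrow> \<bar>u\<bar> \<le> \<bar>t\<bar> + 1 \<Longrightarrow> \<bar>s - u\<bar> \<le> d \<Longrightarrow> \<bar>tanh_ereal (h s) - tanh_ereal (h u)\<bar> \<le> e"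
  using modulus[OF assms, of "\<bar>t\<bar> + 1"] by blast
 show ?thesis
 proof (intro exI[of _ "min d 1"] conjI allI impI)
  fix h s assume "obeys z h" "\<bar>s - t\<bar> < min d 1"
  then show "\<bar>tanh_ereal (h s) - tanh_ereal (h t)\<bar> \<le> e" by (intro d(2)) auto
 qed (use d in auto)
qed

lemma continuous_obeys:
 assumes "obeys z h"
 shows "continuous_on UNIV (\<lambda>t. tanh_ereal (h t))"
 unfolding continuous_on_iff
proof (intro ballI allI impI)
 fix t e :: real assume "0 < e"
 then have "0 < e / 2" by simp
 from equicontinuous[OF this] assms obtain d where "0 < d" "\<And>s. \<bar>s - t\<bar> < d \<Longrightarrow> \<bar>tanh_ereal (h s) - tanh_ereal (h t)\<bar> \<le> e / 2"
  by blast
 with \<open>0 < e\<close> show "\<exists>d>0. \<forall>s\<in>UNIV. dist s t < d \<longrightarrow> dist (tanh_ereal (h s)) (tanh_ereal (h t)) < e"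
  by (intro exI[of _ d]) (force simp: dist_real_def)
qed

lemma compact_full_web: "compact (full_web z)"
proof (rule compact_fpathsI[OF closed_full_web])
 fix t e :: real assume "0 < e"
 from equicontinuous[OF this, of t] show "\<exists>d>0. \<forall>f\<in>full_web z. \<forall>s. \<bar>s - t\<bar> < d \<longrightarrow> \<bar>tanh_at f s - tanh_at f t\<bar> \<le> e"
  by (auto simp: full_web_def tanh_at_def)
qed

text \<open>Later skeleton paths are handled by \<open>noncross\<close> alone. An earlier one passes
  strictly left or strictly right of the starting point, by \<open>avoid\<close>, and then bounds
  the envelope from below or from above.\<close>

lemma obeys_two_sided: "obeys z (two_sided z i)"
 unfolding obeys_def
proof
 fix k
 let ?h = "two_sided z i"
 consider "st i \<le> st k" | "st k < st i" "z k (st i) < sx i" | "st k < st i" "sx i < z k (st i)"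
  using avoid[of k i] by fastforce
 then show "(\<forall>s\<ge>st k. ?h s \<le> ereal (z k s)) \<or> (\<forall>s\<ge>st k. ereal (z k s) \<le> ?h s)"
 proof cases
  case 1
  then have h: "?h s = ereal (z i s)" if "st k \<le> s" for s using that by (simp add: two_sided_def)
  show ?thesis
  proof (cases "\<exists>s\<ge>st k. z k s < z i s")
   case True
   then obtain s where "st k \<le> s" "z k s < z i s" by blast
   then have "z k u \<le> z i u" if "st k \<le> u" for u using noncross[of k s i u] 1 that by auto
   then show ?thesis using h by auto
  qed (use h in \<open>auto simp: not_less\<close>)
 next
  case 2
  have "ereal (z k s) \<le> ?h s" if "st k \<le> s" for s
  proof (cases "st i \<le> s")
   case True
   then show ?thesis using noncross[of k "st i" i s] 2 that by (simp add: two_sided_def)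
  next
   case False
   then show ?thesis using 2 that by (auto simp: two_sided_def intro: SUP_upper)
  qed
  then show ?thesis by blast
 next
  case 3
  have "?h s \<le> ereal (z k s)" if "st k \<le> s" for s
  proof (cases "st i \<le> s")
   case True
   then show ?thesis using noncross[of i "st i" k s] 3 that by (simp add: two_sided_def)
  next
   case False
   have "z q s \<le> z k s" if "st q \<le> s" "z q (st i) < sx i" for q
    using noncross[of q "st i" k s] 3 that False \<open>st k \<le> s\<close> by auto
   then show ?thesis using False by (auto simp: two_sided_def intro!: SUP_least)
  qed
  then show ?thesis by blast
 qed
qed

lemma at_time_web_path: "at_time (web_path z i) = two_sided z i"
 unfolding web_path_def by (rule at_time_path_of[OF continuous_obeys[OF obeys_two_sided]])

lemma web_path_forward: "st i \<le> s \<Longrightarrow> at_time (web_path z i) s = ereal (z i s)"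
 by (simp add: at_time_web_path two_sided_def)

lemma web_path_in_full_web: "web_path z i \<in> full_web z"
 by (simp add: full_web_def at_time_web_path obeys_two_sided)

lemma skeleton_web_subset: "skeleton_web z \<subseteq> full_web z"
 unfolding skeleton_web_def by (rule closure_minimal) (auto simp: web_path_in_full_web closed_full_web)

lemma compact_skeleton_web: "compact (skeleton_web z)"
 using compact_Int_closed[OF compact_full_web, of "skeleton_web z"] skeleton_web_subset
 by (simp add: skeleton_web_def Int_absorb1)

lemma web_path_in_skeleton_web: "web_path z i \<in> skeleton_web z"
 unfolding skeleton_web_def by (simp add: closure_subset[THEN subsetD])

lemma full_webD:
 assumes "f \<in> full_web z" "st i \<le> s" "st i \<le> u"
 shows "at_time f s < ereal (z i s) \<Longrightarrow> at_time f u \<le> ereal (z i u)"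
  "ereal (z i s) < at_time f s \<Longrightarrow> ereal (z i u) \<le> at_time f u"
 using assms obeys_less obeys_greater unfolding full_web_def by blast+

text \<open>A strict inequality holds at a slightly earlier rational time, and there a rational
  point fits strictly between the two paths. The skeleton path from it keeps them apart for ever
  after.\<close>

lemma separate:
 assumes "f \<in> full_web z" "g \<in> full_web z" "at_time f s < at_time g s" "0 < e"
 obtains i where "st i < s" "s - e < st i" "at_time f (st i) < ereal (sx i)" "ereal (sx i) < at_time g (st i)"
  "\<And>u. st i \<le> u \<Longrightarrow> at_time f u \<le> ereal (z i u) \<and> ereal (z i u) \<le> at_time g u"
proof -
 obtain r :: rat where r: "of_rat r < s" "s - e < of_rat r" "{of_rat r..s} \<subseteq> {t. at_time f t < at_time g t}"
  using rat_near(2)[OF open_at_time_less(1), of s f g e] assms by auto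
 then have "at_time f (of_rat r) < at_time g (of_rat r)" using subsetD[OF r(3), of "of_rat r"] by simp
 then obtain x :: rat where x: "at_time f (of_rat r) < ereal (of_rat x)" "ereal (of_rat x) < at_time g (of_rat r)"
  using ereal_dense3 by blast
 show ?thesis
 proof (rule that[of "idx x r"])
  fix u assume "st (idx x r) \<le> u"
  then show "at_time f u \<le> ereal (z (idx x r) u) \<and> ereal (z (idx x r) u) \<le> at_time g u"
   using full_webD[OF assms(1), of "idx x r" "st (idx x r)" u] full_webD[OF assms(2), of "idx x r" "st (idx x r)" u] x
   unfolding start by auto
 qed (use r x in auto)
qed

lemma full_web_forward:
 assumes "f \<in> full_web z" "g \<in> full_web z" "at_time f s < at_time g s" "s \<le> u"
 shows "at_time f u \<le> at_time g u"
proof -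
 obtain i where "st i < s" "\<And>u. st i \<le> u \<Longrightarrow> at_time f u \<le> ereal (z i u) \<and> ereal (z i u) \<le> at_time g u"
  using separate[OF assms(1,2,3), of 1] by (metis zero_less_one)
 with assms(4) have "at_time f u \<le> ereal (z i u)" "ereal (z i u) \<le> at_time g u" by auto
 then show ?thesis by (rule order_trans)
qed

lemma noncrossing_full_web: "noncrossing (full_web z)"
 unfolding noncrossing_def cross_def
proof (intro ballI notI)
 fix f g assume fg: "f \<in> full_web z" "g \<in> full_web z" and "\<exists>s t. at_time g s < at_time f s \<and> at_time f t < at_time g t"
 then obtain s t where s: "at_time g s < at_time f s" and t: "at_time f t < at_time g t" by blast
 show False
  using full_web_forward[OF fg(2,1) s, of t] full_web_forward[OF fg t, of s] s t by (cases "s \<le> t") auto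
qed

text \<open>Two different pasts would be separated by an older skeleton path, which would be
  squeezed into the starting point of \<open>i\<close>, contrary to \<open>avoid\<close>.\<close>

lemma web_path_unique_past:
 assumes f: "f \<in> full_web z" and "at_time f (st i) = ereal (sx i)" "s \<le> st i"
 shows "at_time f s = at_time (web_path z i) s"
proof (rule ccontr)
 let ?g = "web_path z i"
 assume ne: "at_time f s \<noteq> at_time ?g s"
 have g: "at_time ?g (st i) = ereal (sx i)" by (simp add: web_path_forward)
 have contr: False if fg: "f' \<in> full_web z" "g' \<in> full_web z" "at_time f' s < at_time g' s"
  "at_time f' (st i) = ereal (sx i)" "at_time g' (st i) = ereal (sx i)" for f' g'
 proof -
  obtain k where k: "st k < s" "\<And>u. st k \<le> u \<Longrightarrow> at_time f' u \<le> ereal (z k u) \<and> ereal (z k u) \<le> at_time g' u"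
   using separate[OF fg(1,2,3), of 1] by (metis zero_less_one)
  have "z k (st i) = sx i" using k(2)[of "st i"] k(1) assms(3) fg(4,5) by auto
  with avoid[of k i] k(1) assms(3) show False by auto
 qed
 with contr ne f g assms(2) web_path_in_full_web[of i] show False by (metis neq_iff)
qed

text \<open>Web paths through rational points near \<open>(x, t)\<close> are equicontinuous at
  \<open>t\<close>, so every limit of a subsequence passes through the point itself.\<close>

lemma skeleton_web_through: "\<exists>g\<in>skeleton_web z. at_time g t = ereal x"
proof -
 have "\<exists>a b :: rat. \<bar>of_rat a - x\<bar> < 1 / Suc n \<and> \<bar>of_rat b - t\<bar> < 1 / Suc n" for n
 proof -
  obtain a where "x < of_rat a" "of_rat a < x + 1 / Suc n" using of_rat_dense[of x "x + 1 / Suc n"] by auto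
  moreover obtain b where "t < of_rat b" "of_rat b < t + 1 / Suc n" using of_rat_dense[of t "t + 1 / Suc n"] by auto
  ultimately show ?thesis by (intro exI[of _ a] exI[of _ b]) auto
 qed
 then obtain a b :: "nat \<Rightarrow> rat" where ab: "\<And>n. \<bar>of_rat (a n) - x\<bar> < 1 / Suc n" "\<And>n. \<bar>of_rat (b n) - t\<bar> < 1 / Suc n"
  by metis
 define F where "F n = web_path z (idx (a n) (b n))" for n
 have F: "F n \<in> skeleton_web z" "F n \<in> full_web z" "at_time (F n) (of_rat (b n)) = ereal (of_rat (a n))" for n
  by (simp_all add: F_def web_path_in_skeleton_web web_path_in_full_web web_path_forward start[of "idx (a n) (b n)", simplified])
 have lim0: "(\<lambda>n. 1 / real (Suc n)) \<longlonglongrightarrow> 0" using LIMSEQ_inverse_real_of_nat by (simp add: inverse_eq_divide)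
 have blim: "(\<lambda>n. \<bar>of_rat (b n) - t\<bar>) \<longlonglongrightarrow> 0"
  by (rule tendsto_sandwich[OF _ _ tendsto_const lim0]) (use ab(2) in \<open>auto intro!: always_eventually less_imp_le\<close>)
 have alim: "(\<lambda>n. \<bar>of_rat (a n) - x\<bar>) \<longlonglongrightarrow> 0"
  by (rule tendsto_sandwich[OF _ _ tendsto_const lim0]) (use ab(1) in \<open>auto intro!: always_eventually less_imp_le\<close>)
 have d0: "(\<lambda>n. \<bar>tanh_at (F n) t - tanh_at (F n) (of_rat (b n))\<bar>) \<longlonglongrightarrow> 0"
 proof (rule LIMSEQ_I)
  fix e :: real assume "0 < e"
  then have "0 < e / 2" by simp
  from equicontinuous[OF this, of t] obtain d where d: "0 < d"
   "\<And>h s. obeys z h \<Longrightarrow> \<bar>s - t\<bar> < d \<Longrightarrow> \<bar>tanh_ereal (h s) - tanh_ereal (h t)\<bar> \<le> e / 2" by blast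
  obtain n0 where n0: "\<And>n. n0 \<le> n \<Longrightarrow> \<bar>of_rat (b n) - t\<bar> < d"
   using order_tendstoD(2)[OF blim d(1)] by (auto simp: eventually_sequentially)
  have "\<bar>tanh_at (F n) t - tanh_at (F n) (of_rat (b n))\<bar> \<le> e / 2" if "n0 \<le> n" for n
   using d(2)[OF _ n0[OF that], of "at_time (F n)"] F(2)[of n] by (auto simp: full_web_def tanh_at_def abs_minus_commute)
  then show "\<exists>n0. \<forall>n\<ge>n0. norm (\<bar>tanh_at (F n) t - tanh_at (F n) (of_rat (b n))\<bar> - 0) < e"
   using \<open>0 < e\<close> by (intro exI[of _ n0]) force
 qed
 have "(\<lambda>n. tanh_at (F n) t) \<longlonglongrightarrow> tanh x"
 proof (rule Lim_null_comparison[where f = "\<lambda>n. tanh_at (F n) t - tanh x", THEN LIM_zero_cancel])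
  show "(\<lambda>n. \<bar>tanh_at (F n) t - tanh_at (F n) (of_rat (b n))\<bar> + \<bar>of_rat (a n) - x\<bar>) \<longlonglongrightarrow> 0"
   using tendsto_add[OF d0 alim] by simp
  have "\<bar>tanh_at (F n) t - tanh x\<bar> \<le> \<bar>tanh_at (F n) t - tanh_at (F n) (of_rat (b n))\<bar> + \<bar>of_rat (a n) - x\<bar>" for n
   using tanh_lipschitz[of "of_rat (a n)" x] F(3)[of n] by (simp add: tanh_at_def)
  then show "\<forall>\<^sub>F n in sequentially. norm (tanh_at (F n) t - tanh x) \<le> \<bar>tanh_at (F n) t - tanh_at (F n) (of_rat (b n))\<bar> + \<bar>of_rat (a n) - x\<bar>"
   by (simp add: always_eventually)
 qed
 moreover obtain l k where l: "l \<in> skeleton_web z" "strict_mono (k :: nat \<Rightarrow> nat)" "(F \<circ> k) \<longlonglongrightarrow> l"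
  using compact_skeleton_web F(1) unfolding compact_eq_seq_compact_metric seq_compact_def by meson
 moreover have "(\<lambda>n. tanh_at (F (k n)) t) \<longlonglongrightarrow> tanh_at l t"
  using continuous_on_tendsto_compose[OF continuous_tanh_at_at l(3)[unfolded o_def]] by simp
 ultimately have "tanh_at l t = tanh x"
  using LIMSEQ_subseq_LIMSEQ[of "\<lambda>n. tanh_at (F n) t" "tanh x" k] LIMSEQ_unique by (auto simp: o_def)
 with l(1) show ?thesis by (auto simp: tanh_at_eq_tanh_iff)
qed

lemma sandwich_at:
 assumes "f \<in> full_web z" "st k \<le> t" "st l \<le> t" "t \<le> u"
  and "ereal (z k t) < at_time f t" "at_time f t < ereal (z l t)" "z k u = z l u"
 shows "at_time f u = ereal (z k u)"
 using full_webD(2)[OF assms(1,2), of u] full_webD(1)[OF assms(1,3), of u] assms by auto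

text \<open>A difference in the past yields a skeleton path through \<open>(x, t)\<close>. A
  difference in the future is impossible because both paths run between older skeleton paths that
  have merged earlier.\<close>

lemma isolating_unique:
 assumes iso: "isolating x t z" and f: "f \<in> full_web z" "at_time f t = ereal x"
  and g: "g \<in> full_web z" "at_time g t = ereal x"
 shows "f = g"
proof -
 have past: "False" if fg: "f' \<in> full_web z" "g' \<in> full_web z" "at_time f' s < at_time g' s" "s \<le> t"
  "at_time f' t = ereal x" "at_time g' t = ereal x" for f' g' s
 proof -
  obtain k where k: "st k < s" "\<And>u. st k \<le> u \<Longrightarrow> at_time f' u \<le> ereal (z k u) \<and> ereal (z k u) \<le> at_time g' u"
   using separate[OF fg(1,2,3), of 1] by (metis zero_less_one)
  have "z k t = x" using k(2)[of t] k(1) fg(4-) by auto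
  with iso k(1) fg(4) show False by (auto simp: isolating_def)
 qed
 have fut: "False" if fg: "f' \<in> full_web z" "g' \<in> full_web z" "at_time f' s < at_time g' s" "t < s"
  "at_time f' t = ereal x" "at_time g' t = ereal x" for f' g' s
 proof -
  obtain v :: rat where v: "of_rat v < s" "s - (s - t) < of_rat v" "{of_rat v..s} \<subseteq> {t. at_time f' t < at_time g' t}"
   using rat_near(2)[OF open_at_time_less(1), of s f' g' "s - t"] fg by auto
  then have "t < of_rat v" by simp
  with iso obtain k l where kl: "st k = st l" "st k < t" "z k t < x" "x < z l t" "z k (of_rat v) = z l (of_rat v)"
   unfolding isolating_def by blast
  have "at_time h (of_rat v) = ereal (z k (of_rat v))" if "h \<in> full_web z" "at_time h t = ereal x" for h
   by (rule sandwich_at[OF that(1), of _ t]) (use kl that \<open>t < of_rat v\<close> in auto)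
  with fg subsetD[OF v(3), of "of_rat v"] v(1) show False by auto
 qed
 show "f = g"
 proof (rule fpath_eqI, rule ccontr)
  fix s assume "at_time f s \<noteq> at_time g s"
  with f g past[of f g s] past[of g f s] fut[of f g s] fut[of g f s] show False by (cases "s \<le> t") (auto simp: neq_iff)
 qed
qed

lemma isolating_ex1:
 assumes "isolating x t z"
 shows "\<exists>!f. f \<in> skeleton_web z \<and> passes f x t"
proof -
 obtain f where "f \<in> skeleton_web z" "at_time f t = ereal x" using skeleton_web_through by blast
 with isolating_unique[OF assms] skeleton_web_subset show ?thesis
  unfolding passes_def by (intro ex1I[of _ f]) blast+
qed

end

section \<open>Equality of the full web and the skeleton web\<close>

context web
begin

lemma sandwich:
 assumes "st i < of_rat t" "t < u"
 obtains k l where "st k = of_rat t" "st l = of_rat t" "z k (of_rat t) < z i (of_rat t)"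
  "z i (of_rat t) < z l (of_rat t)" "z k (of_rat u) = z l (of_rat u)"
 using good assms start unfolding good_def sandwiched_def by metis

lemma closed_agree: "closed {t. at_time f t = ereal (z i t)}"
proof -
 have "- {t. at_time f t = ereal (z i t)} = {t. at_time f t < ereal (z i t)} \<union> {t. ereal (z i t) < at_time f t}"
  by auto
 then show ?thesis
  unfolding closed_def using open_Un[OF open_at_time_less(2)[OF cont] open_at_time_less(3)[OF cont]] by simp
qed

text \<open>Both paths pass between the two fresh paths supplied by \<open>sandwich\<close>, and
  these merge before any prescribed later rational time. Continuity covers the remaining
  times.\<close>

lemma coincide:
 assumes f: "f \<in> full_web z" and i: "st i < of_rat t" "at_time f (of_rat t) = ereal (z i (of_rat t))"
  and u: "of_rat t \<le> u"
 shows "at_time f u = ereal (z i u)"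
proof -
 have rat: "at_time f (of_rat v) = ereal (z i (of_rat v))" if tv: "t < v" for v
 proof -
  obtain k l where kl: "st k = of_rat t" "st l = of_rat t" "z k (of_rat t) < z i (of_rat t)"
   "z i (of_rat t) < z l (of_rat t)" "z k (of_rat v) = z l (of_rat v)"
   using sandwich[OF i(1) tv] by blast
  have "real_of_rat t \<le> of_rat v" using tv by (simp add: of_rat_less_eq)
  then have "at_time h (of_rat v) = ereal (z k (of_rat v))"
   if "h \<in> full_web z" "at_time h (of_rat t) = ereal (z i (of_rat t))" for h
   by (intro sandwich_at[OF that(1), of _ "of_rat t" l]) (use kl that(2) in auto)
  from this[OF f i(2)] this[OF web_path_in_full_web, of i] show ?thesis
   using i(1) \<open>real_of_rat t \<le> of_rat v\<close> by (simp add: web_path_forward)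
 qed
 have "{of_rat t..u + 1} \<subseteq> {v. at_time f v = ereal (z i v)}"
 proof (rule rat_dense_interval[OF closed_agree])
  fix v :: rat assume "real_of_rat t \<le> of_rat v"
  then show "of_rat v \<in> {v. at_time f v = ereal (z i v)}"
   using rat[of v] i(2) by (cases "v = t") (auto simp: of_rat_less_eq)
 qed (use u in simp)
 from subsetD[OF this, of u] show ?thesis using u by simp
qed

text \<open>Reduces the images of older paths to those of paths started exactly at time
  \<open>s\<close>, to which \<open>locally_finite_images\<close> refers.\<close>

lemma older_image:
 assumes "st q \<le> of_rat s" "s < t"
 obtains k where "st k = of_rat s" "z k (of_rat t) = z q (of_rat t)"
proof (cases "st q = of_rat s")
 case False
 then have q: "st q < of_rat s" using assms by simp
 then obtain k l where kl: "st k = of_rat s" "st l = of_rat s" "z k (of_rat s) < z q (of_rat s)"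
   "z q (of_rat s) < z l (of_rat s)" "z k (of_rat t) = z l (of_rat t)"
  using sandwich assms(2) by blast
 have st: "real_of_rat s \<le> of_rat t" using assms(2) by (simp add: of_rat_less_eq)
 have "at_time (web_path z q) (of_rat t) = ereal (z k (of_rat t))"
  by (rule sandwich_at[OF web_path_in_full_web, of _ "of_rat s" l]) (use kl st q in \<open>auto simp: web_path_forward\<close>)
 then have "z k (of_rat t) = z q (of_rat t)" using q st by (simp add: web_path_forward)
 with kl(1) show ?thesis by (rule that)
qed (use that in blast)

lemma far_images:
 assumes "s < t"
 obtains k l where "st k = of_rat s" "st l = of_rat s" "y < z k (of_rat t)" "z l (of_rat t) < y"
proof -
 obtain N :: nat where "\<bar>y\<bar> < N" using reals_Archimedean2 by blast
 moreover obtain k l where "st k = of_rat s" "st l = of_rat s" "real N < z k (of_rat t)" "z l (of_rat t) < - real N"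
  using good assms unfolding good_def unbounded_images_def by metis
 ultimately show ?thesis by (intro that[of k l]) auto
qed

text \<open>When \<open>a\<close> lies left of \<open>b\<close>, an interval of positions at time
  \<open>t\<close> that contains no image of a path started at time \<open>s\<close>.\<close>

definition gap :: "rat \<Rightarrow> rat \<Rightarrow> nat \<Rightarrow> nat \<Rightarrow> bool" where
 "gap s t a b \<longleftrightarrow> st a = of_rat s \<and> st b = of_rat s \<and>
  (\<forall>k. st k = of_rat s \<longrightarrow> z k (of_rat t) \<le> z a (of_rat t) \<or> z b (of_rat t) \<le> z k (of_rat t))"

lemma gap_exists:
 assumes st: "s < t" and y: "\<And>k. st k = of_rat s \<Longrightarrow> z k (of_rat t) \<noteq> y"
 obtains a b where "gap s t a b" "z a (of_rat t) < y" "y < z b (of_rat t)"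
proof -
 let ?v = "\<lambda>k. z k (of_rat t)"
 obtain k0 l0 where kl: "st k0 = of_rat s" "st l0 = of_rat s" "y < ?v k0" "?v l0 < y"
  using far_images[OF st] by blast
 obtain N :: nat where N: "\<bar>sx k0\<bar> + \<bar>sx l0\<bar> \<le> real N" using real_arch_simple by blast
 obtain m where m: "\<And>i. st i = of_rat s \<Longrightarrow> \<bar>sx i\<bar> \<le> real N \<Longrightarrow> \<exists>k\<le>m. st k = of_rat s \<and> ?v k = ?v i"
  using good st unfolding good_def locally_finite_images_def by metis
 define V where "V = insert (?v k0) (insert (?v l0) (?v ` {k. k \<le> m \<and> st k = of_rat s}))"
 have V: "finite V" unfolding V_def by simp
 have repr: "\<exists>k. st k = of_rat s \<and> ?v k = v" if "v \<in> V" for v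
  using that kl by (auto simp: V_def)
 \<comment> \<open>An image between those of \<open>l0\<close> and \<open>k0\<close> comes from a
   starting point between theirs, since skeleton paths do not cross; the local finiteness bound
   \<open>m\<close> covers these.\<close>
 have VI: "?v k \<in> V \<or> ?v k < ?v l0 \<or> ?v k0 < ?v k" if k: "st k = of_rat s" for k
 proof (rule ccontr)
  assume neg: "\<not> ?thesis"
  have ts: "real_of_rat s \<le> of_rat t" using st by (simp add: of_rat_less_eq)
  have s0: "z i (of_rat s) = sx i" if "st i = of_rat s" for i using start[of i] that by simp
  have "?v l0 \<noteq> ?v k" "?v k0 \<noteq> ?v k" using neg by (auto simp: V_def)
  with neg have lt: "?v l0 < ?v k" "?v k < ?v k0" by auto
  have "sx l0 \<le> sx k"
   using noncross[of k "of_rat s" l0 "of_rat t"] lt(1) kl(2) k ts by (auto simp: s0 not_le[symmetric])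
  moreover have "sx k \<le> sx k0"
   using noncross[of k0 "of_rat s" k "of_rat t"] lt(2) kl(1) k ts by (auto simp: s0 not_le[symmetric])
  ultimately have "\<bar>sx k\<bar> \<le> real N" using N by linarith
  from m[OF k this] obtain j where "j \<le> m" "st j = of_rat s" "?v j = ?v k" by blast
  then have "?v k \<in> V" unfolding V_def by (intro insertI2 image_eqI[of _ _ j]) auto
  with neg show False by blast
 qed
 have l0: "{v \<in> V. v < y} \<noteq> {}" "finite {v \<in> V. v < y}" "?v l0 \<in> {v \<in> V. v < y}"
  and k0: "{v \<in> V. y < v} \<noteq> {}" "finite {v \<in> V. y < v}" "?v k0 \<in> {v \<in> V. y < v}"
  using kl V by (auto simp: V_def)
 obtain a where a: "st a = of_rat s" "?v a = Max {v \<in> V. v < y}"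
  using repr Max_in[OF l0(2,1)] by blast
 obtain b where b: "st b = of_rat s" "?v b = Min {v \<in> V. y < v}"
  using repr Min_in[OF k0(2,1)] by blast
 have "?v k \<le> ?v a \<or> ?v b \<le> ?v k" if k: "st k = of_rat s" for k
 proof (cases "?v k \<in> V")
  case True
  then show ?thesis unfolding a b using y[OF k] Max_ge[OF l0(2), of "?v k"] Min_le[OF k0(2), of "?v k"] by force
 next
  case False
  then show ?thesis using VI[OF k] Max_ge[OF l0(2,3)] Min_le[OF k0(2,3)] unfolding a b by auto
 qed
 moreover have "?v a < y" "y < ?v b"
  unfolding a b using Max_in[OF l0(2,1)] Min_in[OF k0(2,1)] by auto
 ultimately show ?thesis using that a(1) b(1) by (auto simp: gap_def)
qed

text \<open>If the pasts differed, a skeleton path older than \<open>s\<close> would separate the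
  two paths and hence run through the gap at time \<open>t\<close>; its image there is also the
  image of a path started at \<open>s\<close>.\<close>

lemma gap_past:
 assumes "s < t" and gap: "gap s t a b" and r: "r \<le> of_rat s"
  and f: "f \<in> full_web z" "ereal (z a (of_rat t)) < at_time f (of_rat t)" "at_time f (of_rat t) < ereal (z b (of_rat t))"
  and g: "g \<in> full_web z" "ereal (z a (of_rat t)) < at_time g (of_rat t)" "at_time g (of_rat t) < ereal (z b (of_rat t))"
 shows "at_time f r = at_time g r"
proof -
 have contr: False
  if fg: "f' \<in> full_web z" "g' \<in> full_web z" "at_time f' r < at_time g' r"
   and ab: "ereal (z a (of_rat t)) < at_time f' (of_rat t)" "at_time g' (of_rat t) < ereal (z b (of_rat t))" for f' g'
 proof -
  obtain q where q: "st q < r" "\<And>u. st q \<le> u \<Longrightarrow> at_time f' u \<le> ereal (z q u) \<and> ereal (z q u) \<le> at_time g' u"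
   using separate[OF fg, of 1] by (metis zero_less_one)
  have "st q \<le> of_rat s" "st q \<le> of_rat t"
   using q(1) r assms(1) of_rat_less[of s t, where 'a = real] by auto
  from older_image[OF this(1) assms(1)] obtain k where k: "st k = of_rat s" "z k (of_rat t) = z q (of_rat t)" by blast
  with gap have "z q (of_rat t) \<le> z a (of_rat t) \<or> z b (of_rat t) \<le> z q (of_rat t)" by (metis gap_def)
  moreover have "ereal (z a (of_rat t)) < ereal (z q (of_rat t))" "ereal (z q (of_rat t)) < ereal (z b (of_rat t))"
   using q(2)[OF \<open>st q \<le> of_rat t\<close>] ab by (meson less_le_trans le_less_trans)+
  ultimately show False by auto
 qed
 from contr[OF f(1) g(1)] contr[OF g(1) f(1)] f g show ?thesis by (metis neq_iff)
qed

lemma at_time_constant: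
 assumes "\<And>v :: rat. at_time f (of_rat v) = c"
 shows "at_time f u = c"
proof -
 have "closed {v. tanh_at f v = tanh_ereal c}" by (intro closed_Collect_eq continuous_on_const continuous_tanh_at)
 then have "{u - 1..u + 1} \<subseteq> {v. tanh_at f v = tanh_ereal c}"
  by (rule rat_dense_interval) (use assms in \<open>auto simp: tanh_at_def\<close>)
 from subsetD[OF this, of u] show ?thesis by (simp add: tanh_at_def tanh_ereal_inject)
qed

text \<open>Backwards: from a finite position the path would lie below a skeleton path, and this
  bounds it later. Forwards: if it came down to a finite position, a skeleton path with a larger
  image would have to lie above it already at an earlier time, when it was infinite.\<close>

lemma infinite_everywhere:
 assumes f: "f \<in> full_web z" and inf: "at_time f t = \<infinity>"
 shows "at_time f u = \<infinity>"
proof -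
 have past: "at_time f (of_rat s) = \<infinity>" if "of_rat s \<le> t" for s
 proof (rule ccontr)
  assume "at_time f (of_rat s) \<noteq> \<infinity>"
  then obtain x :: rat where x: "at_time f (of_rat s) < ereal (of_rat x)" "ereal (of_rat x) < \<infinity>"
   using ereal_dense3[of "at_time f (of_rat s)" \<infinity>] by auto
  have "ereal (z (idx x s) (of_rat s)) \<le> at_time f (of_rat s)"
   by (rule full_webD(2)[OF f, of _ t]) (use that inf in auto)
  then show False using x start[of "idx x s"] by simp
 qed
 have rat: "at_time f (of_rat v) = \<infinity>" for v
 proof (rule ccontr)
  assume neq: "at_time f (of_rat v) \<noteq> \<infinity>"
  obtain s where s: "min t (of_rat v) - 1 < of_rat s" "of_rat s < min t (of_rat v)"
   using of_rat_dense[of "min t (of_rat v) - 1" "min t (of_rat v)"] by (auto simp del: min_less_iff_conj)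
  then have sv: "s < v" by (simp add: of_rat_less)
  obtain y :: rat where y: "at_time f (of_rat v) < ereal (of_rat y)" using neq ereal_dense3[of "at_time f (of_rat v)" \<infinity>] by auto
  obtain k where k: "st k = of_rat s" "of_rat y < z k (of_rat v)" using far_images[OF sv, of "of_rat y"] by metis
  have "at_time f (of_rat s) \<le> ereal (z k (of_rat s))"
   by (rule full_webD(1)[OF f, of _ "of_rat v"]) (use k y s in \<open>auto intro: less_trans\<close>)
  with past[of s] s show False by simp
 qed
 show ?thesis using at_time_constant[of f \<infinity> u] rat by blast
qed

lemma minus_infinite_everywhere:
 assumes f: "f \<in> full_web z" and inf: "at_time f t = - \<infinity>"
 shows "at_time f u = - \<infinity>"
proof -
 have past: "at_time f (of_rat s) = - \<infinity>" if "of_rat s \<le> t" for s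
 proof (rule ccontr)
  assume "at_time f (of_rat s) \<noteq> - \<infinity>"
  then obtain x :: rat where x: "ereal (of_rat x) < at_time f (of_rat s)"
   using ereal_dense3[of "- \<infinity>" "at_time f (of_rat s)"] by auto
  have "at_time f (of_rat s) \<le> ereal (z (idx x s) (of_rat s))"
   by (rule full_webD(1)[OF f, of _ t]) (use that inf in auto)
  then show False using x start[of "idx x s"] by simp
 qed
 have rat: "at_time f (of_rat v) = - \<infinity>" for v
 proof (rule ccontr)
  assume neq: "at_time f (of_rat v) \<noteq> - \<infinity>"
  obtain s where s: "min t (of_rat v) - 1 < of_rat s" "of_rat s < min t (of_rat v)"
   using of_rat_dense[of "min t (of_rat v) - 1" "min t (of_rat v)"] by (auto simp del: min_less_iff_conj)
  then have sv: "s < v" by (simp add: of_rat_less)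
  obtain y :: rat where y: "ereal (of_rat y) < at_time f (of_rat v)" using neq ereal_dense3[of "- \<infinity>" "at_time f (of_rat v)"] by auto
  obtain k where k: "st k = of_rat s" "z k (of_rat v) < of_rat y" using far_images[OF sv, of "of_rat y"] by metis
  have "ereal (z k (of_rat v)) < at_time f (of_rat v)" using k(2) y by (meson ereal_less(2) less_ereal.simps(1) less_trans)
  then have "ereal (z k (of_rat s)) \<le> at_time f (of_rat s)"
   by (rule full_webD(2)[OF f, rotated 2]) (use k s in auto)
  with past[of s] s show False by simp
 qed
 show ?thesis using at_time_constant[of f "- \<infinity>" u] rat by blast
qed

lemma skeleton_web_subseq:
 assumes "\<And>n :: nat. F n \<in> skeleton_web z"
 obtains l k where "l \<in> skeleton_web z" "strict_mono (k :: nat \<Rightarrow> nat)" "\<And>t. (\<lambda>n. tanh_at (F (k n)) t) \<longlonglongrightarrow> tanh_at l t"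
proof -
 obtain l k where l: "l \<in> skeleton_web z" "strict_mono (k :: nat \<Rightarrow> nat)" "(F \<circ> k) \<longlonglongrightarrow> l"
  using compact_skeleton_web assms unfolding compact_eq_seq_compact_metric seq_compact_def by meson
 have "(\<lambda>n. tanh_at (F (k n)) t) \<longlonglongrightarrow> tanh_at l t" for t
  using continuous_on_tendsto_compose[OF continuous_tanh_at_at l(3)[unfolded o_def]] by simp
 with l(1,2) show ?thesis by (rule that)
qed

text \<open>The skeleton web is compact, and a subsequential limit agrees with \<open>f\<close> off
  the single time \<open>T\<close>, hence everywhere by continuity.\<close>

lemma skeleton_web_limit:
 assumes F: "\<And>n :: nat. F n \<in> skeleton_web z"
  and ev: "\<And>t. t \<noteq> T \<Longrightarrow> \<forall>\<^sub>F n in sequentially. at_time (F n) t = at_time f t"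
 shows "f \<in> skeleton_web z"
proof -
 obtain l k where l: "l \<in> skeleton_web z" "strict_mono (k :: nat \<Rightarrow> nat)" "\<And>t. (\<lambda>n. tanh_at (F (k n)) t) \<longlonglongrightarrow> tanh_at l t"
  using skeleton_web_subseq[of F] F by blast
 have "tanh_at l t = tanh_at f t" if "t \<noteq> T" for t
 proof (rule LIMSEQ_unique[OF l(3)])
  have "\<forall>\<^sub>F n in sequentially. at_time (F (k n)) t = at_time f t"
   using ev[OF that] l(2) by (rule eventually_subseq[rotated])
  then show "(\<lambda>n. tanh_at (F (k n)) t) \<longlonglongrightarrow> tanh_at f t"
   by (intro tendsto_eventually) (auto simp: tanh_at_def elim: eventually_mono)
 qed
 then have "- {T} \<subseteq> {t. tanh_at l t = tanh_at f t}" by auto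
 moreover have "closed {t. tanh_at l t = tanh_at f t}" by (intro closed_Collect_eq continuous_tanh_at)
 ultimately have "closure (- {T}) \<subseteq> {t. tanh_at l t = tanh_at f t}" by (rule closure_minimal)
 then have "tanh_at l t = tanh_at f t" for t by (auto simp: closure_complement)
 then have "l = f" by (intro fpath_eqI) (simp add: tanh_at_eq_iff)
 with l(1) show ?thesis by simp
qed

text \<open>The infinite path is approached by web paths started at time 0 from positions tending to
  infinity; a limit is infinite at time 0, hence at all times.\<close>

lemma infinite_in_skeleton_web:
 assumes f: "f \<in> full_web z" and "at_time f 0 = c" "c = \<infinity> \<or> c = - \<infinity>"
 shows "f \<in> skeleton_web z"
proof -
 define q :: rat where "q = (if c = \<infinity> then 1 else - 1)"
 define F where "F n = web_path z (idx (q * of_nat n) 0)" for n :: nat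
 have F0: "at_time (F n) 0 = ereal (of_rat q * real n)" for n
  using web_path_forward[of "idx (q * of_nat n) 0" 0] start[of "idx (q * of_nat n) 0"] by (simp add: F_def of_rat_mult)
 obtain l k where l: "l \<in> skeleton_web z" "strict_mono (k :: nat \<Rightarrow> nat)" "\<And>t. (\<lambda>n. tanh_at (F (k n)) t) \<longlonglongrightarrow> tanh_at l t"
  using skeleton_web_subseq[of F] web_path_in_skeleton_web unfolding F_def by blast
 have top: "filterlim (\<lambda>n. real (k n)) at_top sequentially"
  using filterlim_compose[OF filterlim_real_sequentially filterlim_subseq[OF l(2)]] .
 have t1: "(\<lambda>n. tanh (real (k n))) \<longlonglongrightarrow> 1" by (rule filterlim_compose[OF tanh_real_at_top top])
 have "at_time l 0 = c"
 proof (cases "c = \<infinity>")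
  case True
  then have "tanh_at l 0 = 1" using LIMSEQ_unique[OF l(3)[of 0]] t1 by (simp add: tanh_at_def F0 q_def)
  then have "tanh_ereal (at_time l 0) = tanh_ereal \<infinity>" by (simp add: tanh_at_def)
  then show ?thesis using True by (simp only: tanh_ereal_inject)
 next
  case False
  then have "tanh_at l 0 = - 1" using LIMSEQ_unique[OF l(3)[of 0]] tendsto_minus[OF t1] by (simp add: tanh_at_def F0 q_def)
  then have "tanh_ereal (at_time l 0) = tanh_ereal (- \<infinity>)" by (simp add: tanh_at_def)
  then show ?thesis using False assms(3) by (simp only: tanh_ereal_inject) simp
 qed
 moreover have "l \<in> full_web z" using l(1) skeleton_web_subset by blast
 ultimately have "at_time l t = at_time f t" for t
  using assms infinite_everywhere[of l 0 t] infinite_everywhere[of f 0 t]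
   minus_infinite_everywhere[of l 0 t] minus_infinite_everywhere[of f 0 t] by auto
 then have "l = f" by (rule fpath_eqI)
 with l(1) show ?thesis by simp
qed

text \<open>A hit fixes the future, by \<open>coincide\<close>; as long as there is none, the recent
  past is fixed through a gap, by \<open>gap_past\<close>.\<close>

definition hit :: "fpath \<Rightarrow> rat \<Rightarrow> bool" where
 "hit f t \<longleftrightarrow> (\<exists>i. st i < of_rat t \<and> at_time f (of_rat t) = ereal (z i (of_rat t)))"

lemma hit_mono: "f \<in> full_web z \<Longrightarrow> hit f t \<Longrightarrow> t \<le> u \<Longrightarrow> hit f u"
 unfolding hit_def using coincide by (metis le_less_trans less_le_trans of_rat_less_eq)

text \<open>Any path of the skeleton web through the same point of the gap shares the whole past up
  to \<open>s\<close> with \<open>f\<close>.\<close>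

lemma skeleton_web_past:
 assumes f: "f \<in> full_web z" and y: "at_time f (of_rat t) = ereal y" and "s < t"
  and free: "\<And>k. st k = of_rat s \<Longrightarrow> z k (of_rat t) \<noteq> y"
 obtains g where "g \<in> skeleton_web z" "at_time g (of_rat t) = ereal y" "\<And>r. r \<le> of_rat s \<Longrightarrow> at_time g r = at_time f r"
proof -
 obtain a b where ab: "gap s t a b" "z a (of_rat t) < y" "y < z b (of_rat t)"
  using gap_exists[OF assms(3) free] by blast
 obtain g where g: "g \<in> skeleton_web z" "at_time g (of_rat t) = ereal y"
  using skeleton_web_through by blast
 have "at_time g r = at_time f r" if "r \<le> of_rat s" for r
  by (rule gap_past[OF assms(3) ab(1) that]) (use g f y ab skeleton_web_subset in auto)
 with g show ?thesis by (rule that)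
qed

text \<open>The cases are that \<open>f\<close> never runs on the skeleton, that it does so at
  arbitrarily early times, or that it starts to do so at a finite time \<open>T\<close>. In the
  first case its past up to any time, in the second its future from any time is reproduced exactly.
  In the third, paths of the skeleton web are found that differ from \<open>f\<close> only near
  \<open>T\<close>.\<close>

lemma finite_in_skeleton_web:
 assumes f: "f \<in> full_web z" and fin: "\<And>t. at_time f t = ereal (y t)"
 shows "f \<in> skeleton_web z"
proof -
 consider "\<And>t. \<not> hit f t" | "\<And>n :: nat. hit f (- of_nat n)" | t0 t1 where "\<not> hit f t0" "hit f t1"
  by blast
 then show ?thesis
 proof cases
  case 1
  have "\<exists>g. g \<in> skeleton_web z \<and> (\<forall>r\<le>real n. at_time g r = at_time f r)" for n :: nat
  proof -
   have "\<not> hit f (of_nat n + 1)" by (rule 1)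
   then have free: "z k (of_rat (of_nat n + 1)) \<noteq> y (of_rat (of_nat n + 1))" if "st k = of_rat (of_nat n)" for k
    using that fin[of "of_rat (of_nat n + 1)"] by (auto simp: hit_def of_rat_add dest!: spec[of _ k])
   obtain g where "g \<in> skeleton_web z" "\<And>r. r \<le> of_rat (of_nat n) \<Longrightarrow> at_time g r = at_time f r"
    using skeleton_web_past[OF f fin _ free] by (metis less_add_one)
   then show ?thesis by auto
  qed
  then obtain F where F: "\<And>n. F n \<in> skeleton_web z" "\<And>n r. r \<le> real n \<Longrightarrow> at_time (F n) r = at_time f r" by metis
  show ?thesis
  proof (rule skeleton_web_limit[of F 0, OF F(1)])
   fix t :: real
   obtain n0 :: nat where "t \<le> n0" using real_arch_simple by blast
   then show "\<forall>\<^sub>F n in sequentially. at_time (F n) t = at_time f t"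
    unfolding eventually_sequentially by (intro exI[of _ n0]) (auto intro!: F(2))
  qed
 next
  case 2
  then obtain i where i: "\<And>n. st (i n) < of_rat (- of_nat n)" "\<And>n. at_time f (of_rat (- of_nat n)) = ereal (z (i n) (of_rat (- of_nat n)))"
   unfolding hit_def by metis
  have F: "at_time (web_path z (i n)) r = at_time f r" if "- real n \<le> r" for n r
  proof -
   have "at_time f r = ereal (z (i n) r)" by (rule coincide[OF f i]) (use that in \<open>simp add: of_rat_minus\<close>)
   moreover have "st (i n) \<le> r" using i(1)[of n] that by (simp add: of_rat_minus)
   ultimately show ?thesis by (simp add: web_path_forward)
  qed
  show ?thesis
  proof (rule skeleton_web_limit[of "\<lambda>n. web_path z (i n)" 0, OF web_path_in_skeleton_web])
   fix t :: real
   obtain n0 :: nat where "- t \<le> n0" using real_arch_simple by blast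
   then show "\<forall>\<^sub>F n in sequentially. at_time (web_path z (i n)) t = at_time f t"
    unfolding eventually_sequentially by (intro exI[of _ n0]) (auto intro!: F)
  qed
 next
  case 3
  define S where "S = {real_of_rat t | t. hit f t}"
  define T where "T = Inf S"
  have Sb: "of_rat t0 \<le> v" if "v \<in> S" for v
   using that hit_mono[OF f, of _ t0] 3(1) by (auto simp: S_def of_rat_less_eq) (metis linear)
  then have bdd: "bdd_below S" by (rule bdd_belowI)
  have ne: "S \<noteq> {}" using 3(2) by (auto simp: S_def)
  have below: "\<not> hit f r" if "of_rat r < T" for r
   using that cInf_lower[OF _ bdd, of "of_rat r"] by (auto simp: S_def T_def)
  have above: "hit f r" if Tr: "T < of_rat r" for r
  proof -
   obtain t where "hit f t" "real_of_rat t < of_rat r"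
    using Tr cInf_less_iff[OF ne bdd] by (auto simp: S_def T_def)
   then show ?thesis using hit_mono[OF f, of t r] by (simp add: of_rat_less)
  qed
  have free: "z k (of_rat r) \<noteq> y (of_rat r)" if "of_rat r < T" "st k < of_rat r" for r k
   using below[OF that(1)] that(2) fin[of "of_rat r"] by (auto simp: hit_def)
  have "\<exists>g. g \<in> skeleton_web z \<and> (\<forall>u. e \<le> \<bar>u - T\<bar> \<longrightarrow> at_time g u = at_time f u)" if e: "0 < e" for e
  proof (cases "\<exists>k. st k < T \<and> (\<forall>u\<ge>T. at_time f u = ereal (z k u))")
   \<comment> \<open>A web path is started just before \<open>T\<close> at a point strictly between
     \<open>f\<close> and the skeleton path \<open>k\<close>, inside the gap that contains
     \<open>f\<close>. The gap gives it the past of \<open>f\<close>; after \<open>T\<close> it is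
     caught between \<open>f\<close> and \<open>k\<close>, which coincide there.\<close>
   case True
   then obtain k where k: "st k < T" "\<And>u. T \<le> u \<Longrightarrow> at_time f u = ereal (z k u)" by blast
   obtain s where s: "T - e < of_rat s" "of_rat s < T" using of_rat_dense[of "T - e" T] e by auto
   have "max (of_rat s) (st k) < T" using s k by simp
   then obtain r where r: "max (of_rat s) (st k) < of_rat r" "of_rat r < T"
    using of_rat_dense by blast
   then have sr: "s < r" by (simp add: of_rat_less)
   let ?y = "y (of_rat r)"
   obtain a b where ab: "gap s r a b" "z a (of_rat r) < ?y" "?y < z b (of_rat r)"
    using gap_exists[OF sr, of ?y] free[OF r(2)] r(1) by auto
   have "z k (of_rat r) \<noteq> ?y" using free[OF r(2)] r(1) by simp
   then consider "?y < z k (of_rat r)" | "z k (of_rat r) < ?y" by linarith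
   then have "\<exists>x. z a (of_rat r) < of_rat x \<and> of_rat x < z b (of_rat r) \<and> (\<forall>u\<ge>T. z (idx x r) u = z k u)"
   proof cases
    case 1
    then have "?y < min (z b (of_rat r)) (z k (of_rat r))" using ab by simp
    then obtain x where x: "?y < of_rat x" "of_rat x < min (z b (of_rat r)) (z k (of_rat r))"
     using of_rat_dense by blast
    let ?w = "idx x r"
    have w: "z ?w (of_rat r) = of_rat x" using start[of ?w] by simp
    have "z ?w u = z k u" if "T \<le> u" for u
    proof (rule antisym)
     show "z ?w u \<le> z k u" by (rule noncross[of _ "of_rat r"]) (use that r x w in auto)
     have "at_time f u \<le> ereal (z ?w u)" by (rule full_webD(1)[OF f, of _ "of_rat r"]) (use that r x w fin in auto)
     then show "z k u \<le> z ?w u" using k(2)[OF that] by simp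
    qed
    then show ?thesis using x ab by (intro exI[of _ x]) auto
   next
    case 2
    then have "max (z a (of_rat r)) (z k (of_rat r)) < ?y" using ab by simp
    then obtain x where x: "max (z a (of_rat r)) (z k (of_rat r)) < of_rat x" "of_rat x < ?y"
     using of_rat_dense by blast
    let ?w = "idx x r"
    have w: "z ?w (of_rat r) = of_rat x" using start[of ?w] by simp
    have "z ?w u = z k u" if "T \<le> u" for u
    proof (rule antisym)
     show "z k u \<le> z ?w u" by (rule noncross[of _ "of_rat r"]) (use that r x w in auto)
     have "ereal (z ?w u) \<le> at_time f u" by (rule full_webD(2)[OF f, of _ "of_rat r"]) (use that r x w fin in auto)
     then show "z ?w u \<le> z k u" using k(2)[OF that] by simp
    qed
    then show ?thesis using x ab by (intro exI[of _ x]) auto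
   qed
   then obtain x where x: "z a (of_rat r) < of_rat x" "of_rat x < z b (of_rat r)" "\<And>u. T \<le> u \<Longrightarrow> z (idx x r) u = z k u" by blast
   let ?g = "web_path z (idx x r)"
   have gr: "at_time ?g (of_rat r) = ereal (of_rat x)"
    using web_path_forward[of "idx x r" "of_rat r"] start[of "idx x r"] by simp
   have past: "at_time ?g u = at_time f u" if "u \<le> of_rat s" for u
    by (rule gap_past[OF sr ab(1) that]) (use gr x ab fin f web_path_in_full_web in auto)
   have fut: "at_time ?g u = at_time f u" if "T \<le> u" for u
    using web_path_forward[of "idx x r" u] x(3)[OF that] k(2)[OF that] that r by simp
   show ?thesis
   proof (intro exI[of _ ?g] conjI allI impI web_path_in_skeleton_web)
    fix u assume "e \<le> \<bar>u - T\<bar>"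
    then have "u \<le> of_rat s \<or> T \<le> u" using s e by linarith
    then show "at_time ?g u = at_time f u" using past fut by blast
   qed
  next
   \<comment> \<open>Here no skeleton path older than \<open>T\<close> carries \<open>f\<close> from
     \<open>T\<close> on. One looks for a time \<open>r\<close> shortly after \<open>T\<close> at
     which \<open>f\<close> is off the images of the paths started at \<open>s\<close>; then the
     past is fixed by a gap at \<open>r\<close> and the future by a hit at \<open>r\<close>.\<close>
   case False
   obtain s where s: "T - e < of_rat s" "of_rat s < T" using of_rat_dense[of "T - e" T] e by auto
   obtain s' where s': "of_rat s < (of_rat s' :: real)" "of_rat s' < T" using of_rat_dense[OF s(2)] by blast
   then have ss: "s < s'" by (simp add: of_rat_less)
   \<comment> \<open>If \<open>f\<close> met a fixed skeleton path \<open>c\<close> at times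
     accumulating at \<open>T\<close> from the right, it would coincide with \<open>c\<close> from
     \<open>T\<close> on, contrary to the case assumption.\<close>
   have accum: False if c: "st c < T" "\<And>\<eta>. 0 < \<eta> \<Longrightarrow> \<exists>r. T < of_rat r \<and> of_rat r < T + \<eta> \<and> at_time f (of_rat r) = ereal (z c (of_rat r))" for c
   proof -
    have gt: "at_time f u = ereal (z c u)" if Tu: "T < u" for u
    proof -
     have "0 < u - T" using Tu by simp
     from c(2)[OF this] obtain r where r: "T < of_rat r" "of_rat r < T + (u - T)" "at_time f (of_rat r) = ereal (z c (of_rat r))"
      by blast
     show ?thesis by (rule coincide[OF f _ r(3)]) (use r c in auto)
    qed
    have "closure {T<..} \<subseteq> {t. at_time f t = ereal (z c t)}"
     by (rule closure_minimal[OF _ closed_agree]) (use gt in auto)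
    then have "at_time f u = ereal (z c u)" if "T \<le> u" for u using that by auto
    with False c(1) show False by blast
   qed
   \<comment> \<open>Otherwise \<open>f\<close> would lie on images of paths started at
     \<open>s\<close> at all rational times shortly after \<open>T\<close>. Being enclosed by the
     neighbours \<open>a\<close> and \<open>b\<close> of a gap before \<open>T\<close>, it could
     only lie on those of \<open>a\<close> or \<open>b\<close>, so one of the two would accumulate
     at \<open>T\<close>.\<close>
   have "\<exists>r. T < of_rat r \<and> of_rat r < T + e \<and> (\<forall>k. st k = of_rat s \<longrightarrow> z k (of_rat r) \<noteq> y (of_rat r))"
   proof (rule ccontr)
    assume neg: "\<not> ?thesis"
    obtain a b where ab: "gap s s' a b" "z a (of_rat s') < y (of_rat s')" "y (of_rat s') < z b (of_rat s')"
     using gap_exists[OF ss, of "y (of_rat s')"] free[OF s'(2)] s'(1) by auto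
    have stab: "st a = of_rat s" "st b = of_rat s" using ab(1) by (auto simp: gap_def)
    have alt: "at_time f (of_rat r) = ereal (z a (of_rat r)) \<or> at_time f (of_rat r) = ereal (z b (of_rat r))"
     if r: "T < of_rat r" "of_rat r < T + e" for r
    proof -
     obtain k where k: "st k = of_rat s" "z k (of_rat r) = y (of_rat r)" using neg r by blast
     have s'r: "real_of_rat s' \<le> of_rat r" using s' r by linarith
     have fa: "ereal (z a (of_rat r)) \<le> at_time f (of_rat r)"
      by (rule full_webD(2)[OF f, of _ "of_rat s'"]) (use ab fin s'r s' stab in auto)
     have fb: "at_time f (of_rat r) \<le> ereal (z b (of_rat r))"
      by (rule full_webD(1)[OF f, of _ "of_rat s'"]) (use ab fin s'r s' stab in auto)
     have same: "z k (of_rat r) = z c (of_rat r)" if "st c = of_rat s" "z k (of_rat s') = z c (of_rat s')" for c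
     proof -
      have "at_time (web_path z k) (of_rat r) = ereal (z c (of_rat r))"
       by (rule coincide[OF web_path_in_full_web, of _ s']) (use that k s' s'r in \<open>auto simp: web_path_forward\<close>)
      then show ?thesis using k s' s'r by (simp add: web_path_forward)
     qed
     have "z k (of_rat s') \<le> z a (of_rat s') \<or> z b (of_rat s') \<le> z k (of_rat s')"
      using ab(1) k(1) by (auto simp: gap_def)
     then consider "z k (of_rat s') < z a (of_rat s')" | "z k (of_rat s') = z a (of_rat s')"
      | "z b (of_rat s') < z k (of_rat s')" | "z k (of_rat s') = z b (of_rat s')" by linarith
     then show ?thesis
     proof cases
      case 1
      have "z k (of_rat r) \<le> z a (of_rat r)"
       by (rule noncross[OF _ _ _ _ 1]) (use k stab s' s'r in auto)
      then show ?thesis using fa k(2) fin[of "of_rat r"] by simp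
     next
      case 2
      then show ?thesis using same[of a] stab k(2) fin[of "of_rat r"] by simp
     next
      case 3
      have "z b (of_rat r) \<le> z k (of_rat r)"
       by (rule noncross[OF _ _ _ _ 3]) (use k stab s' s'r in auto)
      then show ?thesis using fb k(2) fin[of "of_rat r"] by simp
     next
      case 4
      then show ?thesis using same[of b] stab k(2) fin[of "of_rat r"] by simp
     qed
    qed
    have "st b < T" "st a < T" using stab s(2) by auto
    from accum[OF this(1)] obtain \<eta> where \<eta>: "0 < \<eta>"
     "\<And>r. T < of_rat r \<Longrightarrow> of_rat r < T + \<eta> \<Longrightarrow> at_time f (of_rat r) \<noteq> ereal (z b (of_rat r))" by blast
    have "\<exists>r. T < of_rat r \<and> of_rat r < T + \<eta>' \<and> at_time f (of_rat r) = ereal (z a (of_rat r))" if \<eta>': "0 < \<eta>'" for \<eta>'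
    proof -
     have "T < T + min \<eta>' (min \<eta> e)" using \<eta>' \<eta>(1) e by simp
     then obtain r where r: "T < of_rat r" "of_rat r < T + min \<eta>' (min \<eta> e)"
      using of_rat_dense by blast
     then show ?thesis using alt[of r] \<eta>(2)[of r] by (intro exI[of _ r]) auto
    qed
    with accum[OF \<open>st a < T\<close>] show False by blast
   qed
   then obtain r where r: "T < of_rat r" "of_rat r < T + e" "\<And>k. st k = of_rat s \<Longrightarrow> z k (of_rat r) \<noteq> y (of_rat r)" by blast
   have "real_of_rat s < of_rat r" using s r by linarith
   then have sr: "s < r" by (simp add: of_rat_less)
   obtain g where g: "g \<in> skeleton_web z" "at_time g (of_rat r) = ereal (y (of_rat r))" "\<And>u. u \<le> of_rat s \<Longrightarrow> at_time g u = at_time f u"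
    using skeleton_web_past[OF f fin sr r(3)] by blast
   obtain i where i: "st i < of_rat r" "at_time f (of_rat r) = ereal (z i (of_rat r))" using above[OF r(1)] by (auto simp: hit_def)
   have fut: "at_time g u = at_time f u" if "of_rat r \<le> u" for u
    using coincide[OF f i that] coincide[of g i r u] i g(1,2) fin[of "of_rat r"] skeleton_web_subset that by auto
   show ?thesis
   proof (intro exI[of _ g] conjI allI impI g(1))
    fix u assume "e \<le> \<bar>u - T\<bar>"
    then have "u \<le> of_rat s \<or> of_rat r \<le> u" using s r e by linarith
    then show "at_time g u = at_time f u" using g(3) fut by blast
   qed
  qed
  then have "\<forall>n. \<exists>g. g \<in> skeleton_web z \<and> (\<forall>u. 1 / Suc n \<le> \<bar>u - T\<bar> \<longrightarrow> at_time g u = at_time f u)" by simp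
  then obtain F where F: "\<And>n. F n \<in> skeleton_web z" "\<And>n u. 1 / Suc n \<le> \<bar>u - T\<bar> \<Longrightarrow> at_time (F n) u = at_time f u" by metis
  show ?thesis
  proof (rule skeleton_web_limit[of F T, OF F(1)])
   fix t assume "t \<noteq> T"
   then have "\<forall>\<^sub>F n in sequentially. inverse (real (Suc n)) < \<bar>t - T\<bar>"
    by (intro order_tendstoD(2)[OF LIMSEQ_inverse_real_of_nat]) simp
   then show "\<forall>\<^sub>F n in sequentially. at_time (F n) t = at_time f t"
    by eventually_elim (rule F(2), simp add: inverse_eq_divide)
  qed
 qed
qed

theorem full_web_eq_skeleton_web: "full_web z = skeleton_web z"
proof
 show "full_web z \<subseteq> skeleton_web z"
 proof
  fix f assume f: "f \<in> full_web z"
  show "f \<in> skeleton_web z"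
  proof (cases "at_time f 0")
   case (real r)
   then have "\<exists>y. at_time f t = ereal y" for t
    using infinite_everywhere[OF f, of t 0] minus_infinite_everywhere[OF f, of t 0] by (cases "at_time f t") auto
   then obtain y where "\<And>t. at_time f t = ereal (y t)" by metis
   then show ?thesis by (rule finite_in_skeleton_web[OF f])
  qed (use infinite_in_skeleton_web[OF f] in auto)
 qed
qed (rule skeleton_web_subset)

text \<open>A compact noncrossing family with the given forward paths lies between the two descriptions
 of the web.\<close>

theorem web_unique:
 assumes K: "closed K" "noncrossing K"
  and p: "\<And>i. p i \<in> K" "\<And>i s. st i \<le> s \<Longrightarrow> at_time (p i) s = ereal (z i s)"
 shows "K = skeleton_web z"
proof
 have Kf: "K \<subseteq> full_web z"
 proof
  fix f assume f: "f \<in> K"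
  have "(\<forall>s\<ge>st i. at_time f s \<le> ereal (z i s)) \<or> (\<forall>s\<ge>st i. ereal (z i s) \<le> at_time f s)" for i
  proof (rule ccontr)
   assume "\<not> ?thesis"
   then obtain s u where su: "st i \<le> s" "ereal (z i s) < at_time f s" "st i \<le> u" "at_time f u < ereal (z i u)"
    by (auto simp: not_le)
   then have "cross f (p i)" unfolding cross_def by (intro exI[of _ s] exI[of _ u]) (simp add: p(2))
   with K(2) f p(1) show False by (auto simp: noncrossing_def)
  qed
  then show "f \<in> full_web z" by (simp add: full_web_def obeys_def)
 qed
 then show "K \<subseteq> skeleton_web z" by (simp add: full_web_eq_skeleton_web)
 have "web_path z i = p i" for i
 proof (rule fpath_eqI)
  fix s
  show "at_time (web_path z i) s = at_time (p i) s"
  proof (cases "st i \<le> s")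
   case True
   then show ?thesis by (simp add: web_path_forward p(2))
  next
   case False
   then show ?thesis using web_path_unique_past[of "p i" i s] subsetD[OF Kf p(1)[of i]] p(2)[of i "st i"] by simp
  qed
 qed
 then have "range (web_path z) \<subseteq> K" using p(1) by auto
 then show "skeleton_web z \<subseteq> K"
  unfolding skeleton_web_def by (rule closure_minimal[OF _ K(1)])
qed

end

subsection \<open>Measurability of the web\<close>

lemma tanh_ereal_measurable [measurable]: "tanh_ereal \<in> borel_measurable borel"
proof (rule borel_measurableI_le)
 fix c
 show "{x \<in> space borel. tanh_ereal x \<le> c} \<in> sets borel"
 proof (cases "\<bar>c\<bar> \<le> 1")
  case True
  then have "tanh_ereal x \<le> c \<longleftrightarrow> x \<le> artanh_ereal c" for x
   using tanh_ereal_le_iff[of x "artanh_ereal c"] by (simp add: tanh_artanh_ereal)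
  then show ?thesis by simp
 next
  case False
  have "- 1 \<le> tanh_ereal x" "tanh_ereal x \<le> 1" for x using abs_tanh_ereal_le[of x] by (auto simp: abs_le_iff)
  have "{x \<in> space borel. tanh_ereal x \<le> c} = (if 1 < c then UNIV else {})"
  proof (cases "1 < c")
   case True
   then have "tanh_ereal x \<le> c" for x using \<open>\<And>x. tanh_ereal x \<le> 1\<close>[of x] by linarith
   then show ?thesis using True by simp
  next
   case c: False
   then have "c < - 1" using False by linarith
   then have "\<not> tanh_ereal x \<le> c" for x using \<open>\<And>x. - 1 \<le> tanh_ereal x\<close>[of x] by linarith
   then show ?thesis using c by simp
  qed
  then show ?thesis by simp
 qed
qed

text \<open>Paths are classified by a modulus of continuity and rounded values on a finite grid; two
 paths of the same class are close, and there are only countably many classes.\<close>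

lemma countable_dense_fpath:
 obtains D :: "fpath set" where "countable D" "\<And>f e. 0 < e \<Longrightarrow> \<exists>d\<in>D. dist f d < e"
proof -
 define C :: "nat \<Rightarrow> nat \<Rightarrow> int list \<Rightarrow> fpath set" where
  "C n m c = {f. (\<forall>s\<in>{-1..1}. \<forall>u\<in>{-1..1}. \<bar>s - u\<bar> \<le> 1 / Suc m \<longrightarrow> \<bar>compressed f s - compressed f u\<bar> \<le> 1 / Suc n) \<and>
   map (\<lambda>k. \<lfloor>real (Suc n) * compressed f (of_int k / Suc m)\<rfloor>) [- int (Suc m)..int (Suc m)] = c}" for n m c
 define D where "D = (\<lambda>(n, m, c). SOME f. f \<in> C n m c) ` UNIV"
 have "countable D" unfolding D_def by (intro countable_image) simp
 moreover have "\<exists>d\<in>D. dist f d < e" if e: "0 < e" for f e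
 proof -
  obtain n :: nat where n: "3 / e < n" using reals_Archimedean2 by blast
  have n3: "3 / real (Suc n) < e"
  proof -
   have "3 / e < real (Suc n)" using n by simp
   then show ?thesis using e by (simp add: field_simps del: of_nat_Suc)
  qed
  have "uniformly_continuous_on {-1..1} (compressed f)"
   by (rule compact_uniformly_continuous[OF continuous_compressed]) simp
  then obtain d where d: "0 < d" "\<And>s u. s \<in> {-1..1} \<Longrightarrow> u \<in> {-1..1} \<Longrightarrow> dist u s < d \<Longrightarrow> dist (compressed f u) (compressed f s) < 1 / Suc n"
   unfolding uniformly_continuous_on_def by (metis of_nat_0_less_iff zero_less_Suc zero_less_divide_1_iff)
  obtain m where m: "1 / real (Suc m) < d" using d(1) by (metis nat_approx_posE)
  define c where "c = map (\<lambda>k. \<lfloor>real (Suc n) * compressed f (of_int k / Suc m)\<rfloor>) [- int (Suc m)..int (Suc m)]"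
  have f: "f \<in> C n m c"
   using d(2) m unfolding C_def c_def by (force simp: dist_real_def)
  define g where "g = (SOME f. f \<in> C n m c)"
  have g: "g \<in> C n m c" unfolding g_def by (rule someI[of "\<lambda>f. f \<in> C n m c", OF f])
  have "g \<in> D" unfolding D_def g_def by (rule image_eqI[of _ _ "(n, m, c)"]) auto
  \<comment> \<open>Three errors of size \<open>1 / Suc n\<close>: the moduli of both paths and the
    rounding at the grid point.\<close>
  moreover have "dist f g \<le> 3 / real (Suc n)"
  proof (rule dist_fpath_le_compressed)
   fix s :: real assume s: "s \<in> {-1..1}"
   define k where "k = \<lfloor>s * real (Suc m)\<rfloor>"
   let ?p = "of_int k / real (Suc m)"
   have k: "of_int k \<le> s * real (Suc m)" "s * real (Suc m) < of_int k + 1" unfolding k_def by linarith+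
   have sm: "- real (Suc m) \<le> s * real (Suc m)" "s * real (Suc m) \<le> real (Suc m)"
   proof -
    have "- 1 * real (Suc m) \<le> s * real (Suc m)" "s * real (Suc m) \<le> 1 * real (Suc m)"
     by (rule mult_right_mono; use s in simp)+
    then show "- real (Suc m) \<le> s * real (Suc m)" "s * real (Suc m) \<le> real (Suc m)" by (simp_all only: mult_minus_left mult_1)
   qed
   have "real_of_int (- int (Suc m)) - 1 < of_int k" "real_of_int k \<le> real_of_int (int (Suc m))"
    using k sm by (simp_all only: of_int_minus of_int_of_nat_eq)
   then have kr: "- int (Suc m) \<le> k" "k \<le> int (Suc m)" by linarith+
   then have "real_of_int (- int (Suc m)) \<le> of_int k" "real_of_int k \<le> real_of_int (int (Suc m))"
    by (simp_all only: of_int_le_iff)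
   then have pr: "?p \<in> {-1..1}" by (simp add: pos_le_divide_eq pos_divide_le_eq del: of_nat_Suc)
   have pos: "0 < real (Suc m)" by simp
   have sp: "\<bar>s - ?p\<bar> \<le> 1 / Suc m"
   proof -
    have "?p \<le> s" "s < (of_int k + 1) / real (Suc m)"
     using k by (simp_all add: pos_divide_le_eq[OF pos] pos_less_divide_eq[OF pos] del: of_nat_Suc)
    then show ?thesis by (simp add: add_divide_distrib del: of_nat_Suc)
   qed
   have c1: "\<bar>compressed h s - compressed h ?p\<bar> \<le> 1 / Suc n" if "h \<in> C n m c" for h
    using that s pr sp by (auto simp: C_def)
   have "\<lfloor>real (Suc n) * compressed f ?p\<rfloor> = \<lfloor>real (Suc n) * compressed g ?p\<rfloor>"
   proof -
    have "map (\<lambda>k. \<lfloor>real (Suc n) * compressed f (of_int k / Suc m)\<rfloor>) [- int (Suc m)..int (Suc m)] =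
     map (\<lambda>k. \<lfloor>real (Suc n) * compressed g (of_int k / Suc m)\<rfloor>) [- int (Suc m)..int (Suc m)]"
     using f g by (simp only: C_def mem_Collect_eq)
    then show ?thesis using kr unfolding map_eq_conv by (simp only: set_upto atLeastAtMost_iff)
   qed
   then have "\<bar>real (Suc n) * compressed f ?p - real (Suc n) * compressed g ?p\<bar> \<le> 1" by linarith
   then have "real (Suc n) * \<bar>compressed f ?p - compressed g ?p\<bar> \<le> 1"
    by (simp only: right_diff_distrib[symmetric] abs_mult abs_of_nat)
   then have "\<bar>compressed f ?p - compressed g ?p\<bar> \<le> 1 / Suc n"
    by (simp add: field_simps del: of_nat_Suc)
   with c1[OF f] c1[OF g] show "\<bar>compressed f s - compressed g s\<bar> \<le> 3 / real (Suc n)" by linarith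
  qed
  ultimately show ?thesis using n3 by (meson le_less_trans)
 qed
 ultimately show ?thesis by (rule that)
qed

text \<open>A finite net with mesh \<open>e / 4\<close> is moved by less than \<open>e / 4\<close>
  into the dense set. Finiteness of the approximating sets turns infima over them into minima in
  \<open>measurable_web_of\<close>.\<close>

lemma countable_dense_compact_paths:
 obtains E :: "compact_paths set" where "countable E" "\<And>K. K \<in> E \<Longrightarrow> finite (paths_of K)"
  "\<And>K e. 0 < e \<Longrightarrow> \<exists>d\<in>E. dist K d < e"
proof -
 obtain D :: "fpath set" where D: "countable D" "\<And>f e. 0 < e \<Longrightarrow> \<exists>d\<in>D. dist f d < e"
  using countable_dense_fpath by blast
 define E where "E = Abs_compact_paths ` {F. finite F \<and> F \<subseteq> D}"
 have abs: "paths_of (Abs_compact_paths F) = F" if "finite F" for F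
  using that by (simp add: Abs_compact_paths_inverse finite_imp_compact)
 have "countable E" unfolding E_def by (intro countable_image countable_Collect_finite_subset D(1))
 moreover have "finite (paths_of K)" if "K \<in> E" for K using that by (auto simp: E_def abs)
 moreover have "\<exists>d\<in>E. dist K d < e" if e: "0 < e" for K e
 proof (cases "paths_of K = {}")
  case True
  then have "K = Abs_compact_paths {}" by (metis paths_of_inverse)
  then show ?thesis using e by (intro bexI[of _ K]) (auto simp: E_def)
 next
  case False
  have "compact (paths_of K)" using paths_of by simp
  then obtain F0 where F0: "F0 \<subseteq> paths_of K" "finite F0" "paths_of K \<subseteq> (\<Union>x\<in>F0. ball x (e / 4))"
   by (rule compactE_image[of _ "paths_of K" "\<lambda>x. ball x (e / 4)"]) (use e in auto)
  have "0 < e / 4" using e by simp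
  then have "\<forall>f. \<exists>d\<in>D. dist f d < e / 4" using D(2) by blast
  then obtain h where h: "\<And>f. h f \<in> D" "\<And>f. dist f (h f) < e / 4" by metis
  define d where "d = Abs_compact_paths (h ` F0)"
  have d: "paths_of d = h ` F0" "d \<in> E"
   using F0(2) h(1) by (auto simp: d_def abs E_def intro!: imageI)
  have ne: "h ` F0 \<noteq> {}" using False F0(3) by auto
  have "hausdorff_dist (paths_of K) (h ` F0) \<le> e / 2"
   unfolding hausdorff_dist_le_iff[OF False ne]
  proof (intro conjI ballI)
   fix f assume "f \<in> paths_of K"
   then obtain x where x: "x \<in> F0" "dist x f < e / 4" using F0(3) by auto
   have "infdist f (h ` F0) \<le> dist f (h x)" using x(1) by (intro infdist_le) auto
   also have "\<dots> \<le> dist f x + dist x (h x)" by (rule dist_triangle)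
   also have "\<dots> \<le> e / 2" using x(2) h(2)[of x] by (simp add: dist_commute)
   finally show "infdist f (h ` F0) \<le> e / 2" .
  next
   fix g assume "g \<in> h ` F0"
   then obtain x where x: "x \<in> F0" "g = h x" by blast
   have "infdist g (paths_of K) \<le> dist g x" using x(1) F0(1) by (intro infdist_le) auto
   also have "\<dots> \<le> e / 2" using h(2)[of x] x(2) e by (simp add: dist_commute)
   finally show "infdist g (paths_of K) \<le> e / 2" .
  qed
  then have "dist K d \<le> e / 2" by (simp add: dist_compact_paths.rep_eq d)
  then show ?thesis using d(2) e by (intro bexI[of _ d]) auto
 qed
 ultimately show ?thesis by (rule that)
qed

text \<open>An open set is a countable union of balls with centres in \<open>E\<close> and radii
  \<open>1 / Suc n\<close>.\<close>

lemma borel_measurable_separable: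
 fixes F :: "'a \<Rightarrow> 'b :: metric_space"
 assumes E: "countable E" "\<And>x e. 0 < e \<Longrightarrow> \<exists>d\<in>E. dist x d < e"
  and m: "\<And>d. d \<in> E \<Longrightarrow> (\<lambda>w. dist (F w) d) \<in> borel_measurable M"
 shows "F \<in> borel_measurable M"
proof (rule borel_measurableI)
 fix S :: "'b set" assume S: "open S"
 define I where "I = {(d, n :: nat). d \<in> E \<and> ball d (1 / Suc n) \<subseteq> S}"
 have I: "countable I" by (rule countable_subset[of _ "E \<times> UNIV"]) (auto simp: I_def E(1))
 have "F -` S \<inter> space M = (\<Union>(d, n)\<in>I. {w \<in> space M. dist (F w) d < 1 / Suc n})"
 proof (intro set_eqI iffI)
  fix w assume w: "w \<in> F -` S \<inter> space M"
  then obtain e where e: "0 < e" "ball (F w) e \<subseteq> S" using S open_contains_ball by blast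
  obtain n where n: "1 / real (Suc n) < e / 2" using nat_approx_posE[of "e / 2"] e(1) by auto
  obtain d where d: "d \<in> E" "dist (F w) d < 1 / Suc n" using E(2)[of "1 / Suc n" "F w"] by auto
  have "ball d (1 / Suc n) \<subseteq> ball (F w) e"
  proof
   fix y assume "y \<in> ball d (1 / Suc n)"
   then show "y \<in> ball (F w) e" using d(2) n dist_triangle[of "F w" y d] by (simp del: of_nat_Suc)
  qed
  then have "(d, n) \<in> I" using d(1) e(2) by (auto simp: I_def)
  with d(2) w show "w \<in> (\<Union>(d, n)\<in>I. {w \<in> space M. dist (F w) d < 1 / Suc n})" by blast
 next
  fix w assume "w \<in> (\<Union>(d, n)\<in>I. {w \<in> space M. dist (F w) d < 1 / Suc n})"
  then obtain d n where "(d, n) \<in> I" "dist (F w) d < 1 / Suc n" "w \<in> space M" by blast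
  then show "w \<in> F -` S \<inter> space M" unfolding I_def by (auto simp: dist_commute)
 qed
 also have "\<dots> \<in> sets M"
 proof (rule sets.countable_UN''[OF I])
  fix p assume "p \<in> I"
  then show "(case p of (d, n) \<Rightarrow> {w \<in> space M. dist (F w) d < 1 / Suc n}) \<in> sets M"
   using m by (auto simp: I_def intro!: borel_measurable_less)
 qed
 finally show "F -` S \<inter> space M \<in> sets M" .
qed

text \<open>The skeleton web is used rather than the equal full web, because distances to the
  closure of a sequence are determined by countably many evaluations.\<close>

definition web_of :: "paths \<Rightarrow> compact_paths" where
 "web_of z = (if good z then Abs_compact_paths (skeleton_web z) else Abs_compact_paths {})"

lemma webI: "good z \<Longrightarrow> z \<in> space paths_space \<Longrightarrow> web z"
 by (simp add: web_def space_paths_space)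

lemma paths_of_web_of:
 assumes "good z" "z \<in> space paths_space"
 shows "paths_of (web_of z) = skeleton_web z"
 using web.compact_skeleton_web[OF webI[OF assms]] assms by (simp add: web_of_def Abs_compact_paths_inverse)

lemma measurable_two_sided: "(\<lambda>z. two_sided z i s) \<in> borel_measurable paths_space"
proof (cases "st i \<le> s")
 case True
 then show ?thesis unfolding two_sided_def by (simp add: measurable_paths_space_eval)
next
 case False
 \<comment> \<open>The index set of the supremum depends on \<open>z\<close>; the default value
   minus infinity replaces it by a fixed countable one.\<close>
 have "(\<lambda>z. two_sided z i s) = (\<lambda>z. SUP q. if st q \<le> s \<and> z q (st i) < sx i then ereal (z q s) else - \<infinity>)"
 proof
  fix z
  show "two_sided z i s = (SUP q. if st q \<le> s \<and> z q (st i) < sx i then ereal (z q s) else - \<infinity>)" (is "_ = ?R")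
  proof (rule antisym)
   show "two_sided z i s \<le> ?R"
   proof -
    have "ereal (z q s) \<le> ?R" if "st q \<le> s" "z q (st i) < sx i" for q
     using SUP_upper[OF UNIV_I, of "\<lambda>q. if st q \<le> s \<and> z q (st i) < sx i then ereal (z q s) else - \<infinity>" q] that by simp
    then show ?thesis using False unfolding two_sided_def by (auto intro!: SUP_least)
   qed
   show "?R \<le> two_sided z i s"
   proof (rule SUP_least)
    fix q
    have "ereal (z q s) \<le> two_sided z i s" if "st q \<le> s" "z q (st i) < sx i"
     using that False unfolding two_sided_def by (auto intro: SUP_upper)
    then show "(if st q \<le> s \<and> z q (st i) < sx i then ereal (z q s) else - \<infinity>) \<le> two_sided z i s" by simp
   qed
  qed
 qed
 moreover have "(\<lambda>z. if st q \<le> s \<and> z q (st i) < sx i then ereal (z q s) else - \<infinity>) \<in> borel_measurable paths_space" for q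
  by (intro measurable_If borel_measurable_ereal measurable_paths_space_eval borel_measurable_const)
   (use pred_path_intros in \<open>auto simp: pred_def\<close>)
 ultimately show ?thesis by (simp only: borel_measurable_SUP[OF countableI_type])
qed

lemma dist_fpath_le_iff:
 "dist f g \<le> r \<longleftrightarrow> (\<forall>t :: rat. \<bar>tanh_at f (of_rat t) - tanh_at g (of_rat t)\<bar> \<le> r * (1 + \<bar>of_rat t\<bar>))"
proof
 assume "dist f g \<le> r"
 then show "\<forall>t :: rat. \<bar>tanh_at f (of_rat t) - tanh_at g (of_rat t)\<bar> \<le> r * (1 + \<bar>of_rat t\<bar>)"
  using tanh_at_dist[of f _ g] by (meson abs_ge_zero add_nonneg_nonneg mult_right_mono order_trans zero_le_one)
next
 assume r: "\<forall>t :: rat. \<bar>tanh_at f (of_rat t) - tanh_at g (of_rat t)\<bar> \<le> r * (1 + \<bar>of_rat t\<bar>)"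
 show "dist f g \<le> r"
 proof (rule dist_fpath_leI)
  fix t
  have "closed {t. \<bar>tanh_at f t - tanh_at g t\<bar> \<le> r * (1 + \<bar>t\<bar>)}"
   by (intro closed_Collect_le continuous_on_rabs continuous_on_diff continuous_tanh_at continuous_on_mult continuous_on_add continuous_on_const continuous_on_id)
  then have "{t - 1..t + 1} \<subseteq> {t. \<bar>tanh_at f t - tanh_at g t\<bar> \<le> r * (1 + \<bar>t\<bar>)}"
   by (rule rat_dense_interval) (use r in auto)
  from subsetD[OF this, of t] show "\<bar>tanh_at f t - tanh_at g t\<bar> \<le> r * (1 + \<bar>t\<bar>)" by simp
 qed
qed

lemma infdist_closure_le_iff:
 fixes x :: "'a :: metric_space"
 assumes "S \<noteq> {}"
 shows "infdist x (closure S) \<le> r \<longleftrightarrow> (\<forall>n. \<exists>s\<in>S. dist s x \<le> r + 1 / Suc n)"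
proof -
 have infdist_closure: "infdist x (closure S) = infdist x S"
  by (simp add: infdist_eq_setdist)
 show ?thesis
proof
 assume le: "infdist x (closure S) \<le> r"
 show "\<forall>n. \<exists>s\<in>S. dist s x \<le> r + 1 / Suc n"
 proof
  fix n
  have "infdist x S \<le> r" "0 < 1 / real (Suc n)" using le by (simp_all add: infdist_closure)
  then have "infdist x S < r + 1 / Suc n" by linarith
  then obtain s where "s \<in> S" "dist x s < r + 1 / Suc n"
   unfolding infdist_notempty[OF assms] by (subst (asm) cINF_less_iff) (auto simp: assms intro: bdd_belowI2[of _ 0])
  then show "\<exists>s\<in>S. dist s x \<le> r + 1 / Suc n" by (auto simp: dist_commute intro!: bexI[of _ s])
 qed
next
 assume *: "\<forall>n. \<exists>s\<in>S. dist s x \<le> r + 1 / Suc n"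
 have "infdist x S \<le> r + inverse (real (Suc n))" for n
  using * infdist_le2 by (metis dist_commute inverse_eq_divide)
 then have "infdist x S \<le> r + 0"
  by (intro LIMSEQ_le_const[OF tendsto_add[OF tendsto_const LIMSEQ_inverse_real_of_nat]]) auto
 then show "infdist x (closure S) \<le> r" by (simp add: infdist_closure)
qed
qed

text \<open>It suffices to treat distances to finite sets of paths. By density of the web paths and
  of the rational times, \<open>dist (web_of z) d <= r\<close> becomes a countable combination of
  conditions on the values \<open>two_sided z i t\<close>.\<close>

theorem measurable_web_of: "web_of \<in> borel_measurable paths_space"
proof -
 obtain E :: "compact_paths set" where E: "countable E" "\<And>K. K \<in> E \<Longrightarrow> finite (paths_of K)"
  "\<And>K e. 0 < e \<Longrightarrow> \<exists>d\<in>E. dist K d < e"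
  using countable_dense_compact_paths by blast
 show ?thesis
 proof (rule borel_measurable_separable[OF E(1,3)])
  fix d assume d: "d \<in> E"
  define B where "B r i g z \<longleftrightarrow> (\<forall>t :: rat. \<bar>tanh_ereal (two_sided z i (of_rat t)) - tanh_at g (of_rat t)\<bar> \<le> r * (1 + \<bar>of_rat t\<bar>))" for r i g z
  have B: "Measurable.pred paths_space (B r i g)" for r i g
  proof -
   have "(\<lambda>z. \<bar>tanh_ereal (two_sided z i s) - c\<bar>) \<in> borel_measurable paths_space" for s c
    by (intro borel_measurable_abs borel_measurable_diff borel_measurable_const measurable_compose[OF measurable_two_sided tanh_ereal_measurable])
   from borel_measurable_le[OF this borel_measurable_const] show ?thesis
    unfolding B_def by (intro pred_intros_countable) (simp add: pred_def)
  qed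
  have Biff: "B r i g z \<longleftrightarrow> dist (web_path z i) g \<le> r" if "web z" for r i g z
   by (simp add: B_def dist_fpath_le_iff tanh_at_def web.at_time_web_path[OF that])
  have empty: "paths_of (Abs_compact_paths {}) = {}" by (simp add: Abs_compact_paths_inverse)
  have ne: "skeleton_web z \<noteq> {}" for z by (simp add: skeleton_web_def)
  have good_dist: "dist (web_of z) d \<le> r \<longleftrightarrow> (if paths_of d = {} then 2 \<le> r else
    (\<forall>i. \<exists>g\<in>paths_of d. B r i g z) \<and> (\<forall>g\<in>paths_of d. \<forall>n. \<exists>i. B (r + 1 / Suc n) i g z))"
   if z: "good z" "z \<in> space paths_space" for z r
  proof (cases "paths_of d = {}")
   case True
   then show ?thesis by (simp add: dist_compact_paths.rep_eq paths_of_web_of[OF z] hausdorff_dist_def ne)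
  next
   case False
   note W = webI[OF z]
   have cl: "closed {f. infdist f (paths_of d) \<le> r}"
    by (intro closed_Collect_le continuous_on_infdist continuous_on_id continuous_on_const)
   have "(\<forall>f\<in>skeleton_web z. infdist f (paths_of d) \<le> r) \<longleftrightarrow> (\<forall>i. infdist (web_path z i) (paths_of d) \<le> r)"
   proof
    assume "\<forall>i. infdist (web_path z i) (paths_of d) \<le> r"
    then have "skeleton_web z \<subseteq> {f. infdist f (paths_of d) \<le> r}"
     unfolding skeleton_web_def by (intro closure_minimal[OF _ cl]) auto
    then show "\<forall>f\<in>skeleton_web z. infdist f (paths_of d) \<le> r" by blast
   qed (use web.web_path_in_skeleton_web[OF W] in blast)
   moreover have "infdist f (paths_of d) \<le> r \<longleftrightarrow> (\<exists>g\<in>paths_of d. dist f g \<le> r)" for f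
   proof
    assume "infdist f (paths_of d) \<le> r"
    moreover obtain g where "g \<in> paths_of d" "infdist f (paths_of d) = dist f g"
    proof -
     have "infdist f (paths_of d) = Min (dist f ` paths_of d)"
      using E(2)[OF d] False by (simp add: infdist_notempty cInf_eq_Min)
     moreover have "Min (dist f ` paths_of d) \<in> dist f ` paths_of d"
      using E(2)[OF d] False by (intro Min_in) auto
     ultimately show ?thesis using that by auto
    qed
    ultimately show "\<exists>g\<in>paths_of d. dist f g \<le> r" by auto
   qed (auto intro: infdist_le2)
   moreover have "infdist g (skeleton_web z) \<le> r \<longleftrightarrow> (\<forall>n. \<exists>i. dist (web_path z i) g \<le> r + 1 / Suc n)" for g
    unfolding skeleton_web_def by (subst infdist_closure_le_iff) auto
   ultimately show ?thesis
    using False by (simp add: dist_compact_paths.rep_eq paths_of_web_of[OF z] hausdorff_dist_le_iff[OF ne False] Biff[OF W])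
  qed
  show "(\<lambda>z. dist (web_of z) d) \<in> borel_measurable paths_space"
  proof (rule borel_measurableI_le)
   fix r
   let ?G = "{z \<in> space paths_space. good z}"
   let ?A = "if paths_of d = {} then {z \<in> space paths_space. 2 \<le> r} else {z \<in> space paths_space.
    (\<forall>i. \<exists>g\<in>paths_of d. B r i g z) \<and> (\<forall>g\<in>paths_of d. \<forall>n. \<exists>i. B (r + 1 / Suc n) i g z)}"
   have "{z \<in> space paths_space. dist (web_of z) d \<le> r} = (?G \<inter> ?A) \<union>
     ((space paths_space - ?G) \<inter> (if dist (Abs_compact_paths {}) d \<le> r then space paths_space else {}))"
   proof (rule set_eqI)
    fix z
    show "z \<in> {z \<in> space paths_space. dist (web_of z) d \<le> r} \<longleftrightarrow> z \<in> (?G \<inter> ?A) \<union>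
     ((space paths_space - ?G) \<inter> (if dist (Abs_compact_paths {}) d \<le> r then space paths_space else {}))"
    proof (cases "z \<in> space paths_space \<and> good z")
     case True
     then show ?thesis using good_dist[of z r] by (cases "paths_of d = {}") simp_all
    next
     case False
     then show ?thesis by (cases "z \<in> space paths_space") (simp_all add: web_of_def)
    qed
   qed
   moreover have "?G \<in> sets paths_space" using measurable_good by (simp add: pred_def)
   moreover have "Measurable.pred paths_space (\<lambda>z. (\<forall>i. \<exists>g\<in>paths_of d. B r i g z) \<and> (\<forall>g\<in>paths_of d. \<forall>n. \<exists>i. B (r + 1 / Suc n) i g z))"
    by (intro pred_intros_logic(3) pred_intros_countable pred_intros_finite(3,4) B E(2)[OF d])
   then have "?A \<in> sets paths_space" by (simp add: pred_def)
   ultimately show "{z \<in> space paths_space. dist (web_of z) d \<le> r} \<in> sets paths_space"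
    by auto
  qed
 qed
qed

subsection \<open>The law of the web\<close>

text \<open>If some preimage were not measurable, then neither would be that of the complement, and both
 would get measure zero.\<close>

lemma measurable_if_prob_space_distr:
 assumes "prob_space M" "f \<in> space M \<rightarrow> space N" "prob_space (distr M N f)"
 shows "f \<in> M \<rightarrow>\<^sub>M N"
proof -
 interpret D: prob_space "distr M N f" by fact
 let ?\<mu> = "\<lambda>A. emeasure M (f -` A \<inter> space M)"
 have ms: "measure_space (space N) (sets N) ?\<mu>"
 proof (rule ccontr)
  assume "\<not> ?thesis"
  then have "emeasure (distr M N f) (space N) = 0"
   by (simp add: distr_def emeasure_measure_of_conv sets.sigma_sets_eq)
  then show False using D.emeasure_space_1 by simp
 qed
 have em: "emeasure (distr M N f) A = ?\<mu> A" if "A \<in> sets N" for A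
  using that ms by (simp add: distr_def emeasure_measure_of_conv sets.sigma_sets_eq)
 show ?thesis
 proof (rule measurableI)
  fix A assume A: "A \<in> sets N"
  show "f -` A \<inter> space M \<in> sets M"
  proof (rule ccontr)
   assume n: "f -` A \<inter> space M \<notin> sets M"
   have "f -` A \<inter> space M = space M - (f -` (space N - A) \<inter> space M)" using assms(2) by auto
   with n have "f -` (space N - A) \<inter> space M \<notin> sets M" by (metis sets.compl_sets)
   then have "emeasure (distr M N f) A = 0" "emeasure (distr M N f) (space N - A) = 0"
    using n A by (simp_all add: em emeasure_notin_sets)
   moreover have "emeasure (distr M N f) A + emeasure (distr M N f) (space N - A) = emeasure (distr M N f) (space N)"
    using A sets.sets_into_space[OF A] by (subst plus_emeasure) (auto simp: Un_absorb1)
   ultimately show False using D.emeasure_space_1 by simp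
  qed
 qed (use assms(2) in auto)
qed

lemma path_through_ex1:
 assumes "\<exists>!f. f \<in> K \<and> passes f x t"
 shows "path_through K x t \<in> K" "at_time (path_through K x t) t = ereal x"
 using theI'[OF assms] assms by (auto simp: path_through_def passes_def)

lemma measurable_semipaths:
 "(\<lambda>w. \<lambda>(j, s)\<in>S. ereal (cbm x t w j s)) \<in> wiener \<rightarrow>\<^sub>M PiM S (\<lambda>_. borel)"
 by (rule measurable_restrict) (auto intro!: borel_measurable_ereal measurable_cbm split: prod.splits)

lemma abs_tanh_le_tanh: "\<bar>y\<bar> \<le> ereal L \<Longrightarrow> \<bar>tanh_ereal y\<bar> \<le> tanh L"
proof (cases y)
 case (real r)
 assume "\<bar>y\<bar> \<le> ereal L"
 then have "- L \<le> r" "r \<le> L" using real by auto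
 then have "tanh (- L) \<le> tanh r" "tanh r \<le> tanh L" by (simp_all only: tanh_real_le_iff)
 then show ?thesis using real by (simp add: abs_le_iff tanh_minus)
qed auto

text \<open>The semipaths through the rational points are turned into a skeleton \<open>Z\<close>
  whose law is that of \<open>cbm sx st\<close>. Then \<open>Z\<close> is almost surely good, and
  \<open>web_unique\<close> identifies \<open>W\<close> with \<open>web_of Z\<close> path by
  path.\<close>

theorem full_brownian_web_law:
 assumes web: "full_brownian_web M W"
 shows "distr M borel W = distr (distr wiener paths_space (cbm sx st)) borel web_of"
proof -
 interpret M: prob_space M using web by (simp add: full_brownian_web_def)
 have Wm: "W \<in> borel_measurable M" using web by (simp add: full_brownian_web_def)
 define P where "P i w = path_through (paths_of (W w)) (sx i) (st i)" for i w
 define S where "S n = (SIGMA j:{..<n}. {st j..})" for n :: nat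
 define B where "B n = (PiM (S n) (\<lambda>_. borel) :: (nat \<times> real \<Rightarrow> ereal) measure)" for n
 define V where "V n w = (\<lambda>(j, s)\<in>S n. at_time (P j w) s)" for n w
 define V' where "V' n w = (\<lambda>(j, s)\<in>S n. ereal (cbm sx st w j s))" for n w
 have law: "distr M (B n) (V n) = distr wiener (B n) (V' n)" for n
 proof -
  have "is_coalescing_brownian_law n sx st (semipath_law M n st (\<lambda>j s w. at_time (P j w) s))"
  proof -
   from web have "\<forall>n x t. is_coalescing_brownian_law n x t
     (semipath_law M n t (\<lambda>j s w. at_time (path_through (paths_of (W w)) (x j) (t j)) s))"
    unfolding full_brownian_web_def by (elim conjE)
   from this[rule_format, of n sx st] show ?thesis unfolding P_def .
  qed
  then show ?thesis
   unfolding is_coalescing_brownian_law_iff semipath_law_def by (simp only: V_def[abs_def] V'_def[abs_def] B_def S_def)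
 qed
 have V': "V' n \<in> wiener \<rightarrow>\<^sub>M B n" for n
  unfolding V'_def B_def by (rule measurable_semipaths)
 have V: "V n \<in> M \<rightarrow>\<^sub>M B n" for n
 proof (rule measurable_if_prob_space_distr[OF M.prob_space_axioms])
  show "V n \<in> space M \<rightarrow> space (B n)" by (auto simp: V_def B_def space_PiM)
  show "prob_space (distr M (B n) (V n))" unfolding law by (rule W.prob_space_distr[OF V'])
 qed
 have Vi: "V (Suc i) w (i, s) = at_time (P i w) s" if "st i \<le> s" for i w s
  using that by (simp add: V_def S_def)
 have comp: "(\<lambda>v. v (i, s)) \<in> borel_measurable (B (Suc i))" if "st i \<le> s" for i s
  unfolding B_def by (rule measurable_component_singleton) (use that in \<open>simp add: S_def\<close>)
 have ev: "(\<lambda>w. at_time (P i w) s) \<in> borel_measurable M" if "st i \<le> s" for i s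
  using measurable_compose[OF V comp[OF that]] that by (simp add: Vi)
 \<comment> \<open>The semipaths have values in \<open>ereal\<close>. Their finiteness is expressed
   by bounds at rational times, so that it is an event and can be transferred from the Wiener
   model.\<close>
 define bd where "bd i N v \<longleftrightarrow> (\<exists>L :: nat. \<forall>s :: rat. st i \<le> of_rat s \<longrightarrow> of_rat s \<le> st i + real N \<longrightarrow> \<bar>v (i, of_rat s)\<bar> \<le> ereal (real L))"
  for i N and v :: "nat \<times> real \<Rightarrow> ereal"
 have bdm: "Measurable.pred (B (Suc i)) (bd i N)" for i N
 proof -
  have "Measurable.pred (B (Suc i)) (\<lambda>v. st i \<le> of_rat s \<longrightarrow> of_rat s \<le> st i + real N \<longrightarrow> \<bar>v (i, of_rat s)\<bar> \<le> ereal (real L))" for s L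
  proof (cases "st i \<le> of_rat s")
   case True
   have "Measurable.pred (B (Suc i)) (\<lambda>v. \<bar>v (i, of_rat s)\<bar> \<le> ereal (real L))"
    unfolding pred_def by (rule borel_measurable_le[OF borel_measurable_ereal_abs[OF comp[OF True]] borel_measurable_const])
   then show ?thesis by simp
  qed simp
  then show ?thesis unfolding bd_def by (intro pred_intros_countable)
 qed
 have bdV': "bd i N (V' (Suc i) w)" if w: "w \<in> space wiener" for i N w
 proof -
  have "compact (cbm sx st w i ` {st i..st i + real N})"
   by (rule compact_continuous_image[OF continuous_on_subset[OF continuous_cbm[OF w]]]) auto
  from compact_imp_bounded[OF this] obtain b where b: "\<And>s. s \<in> {st i..st i + real N} \<Longrightarrow> \<bar>cbm sx st w i s\<bar> \<le> b"
   unfolding bounded_iff real_norm_def by (meson image_eqI)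
  obtain L :: nat where "b \<le> real L" using real_arch_simple by blast
  then show ?thesis
   unfolding bd_def using b by (intro exI[of _ L]) (force simp: V'_def S_def)
 qed
 define G where "G w \<longleftrightarrow> (\<forall>i N. bd i N (V (Suc i) w))" for w
 have Gm: "Measurable.pred M G"
  unfolding G_def by (intro pred_intros_countable measurable_compose[OF V bdm])
 have "AE w in M. bd i N (V (Suc i) w)" for i N
 proof -
  have "AE v in distr wiener (B (Suc i)) (V' (Suc i)). bd i N v"
   using bdm by (subst AE_distr_iff[OF V']) (auto simp: pred_def bdV' intro!: AE_I2)
  then show ?thesis unfolding law[symmetric] using bdm by (subst (asm) AE_distr_iff[OF V]) (auto simp: pred_def)
 qed
 then have AEG: "AE w in M. G w" unfolding G_def by (simp add: AE_all_countable)
 have fin: "\<exists>r. at_time (P i w) s = ereal r" if w: "G w" and s: "st i \<le> s" for i w s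
 proof -
  obtain N :: nat where N: "s - st i + 1 \<le> real N" using real_arch_simple by blast
  from w obtain L :: nat where L: "\<And>u. st i \<le> of_rat u \<Longrightarrow> of_rat u \<le> st i + real N \<Longrightarrow> \<bar>V (Suc i) w (i, of_rat u)\<bar> \<le> ereal (real L)"
   unfolding G_def bd_def by blast
  have "closed {u. \<bar>tanh_at (P i w) u\<bar> \<le> tanh (real L)}"
   by (intro closed_Collect_le continuous_on_rabs continuous_tanh_at continuous_on_const)
  then have "{st i..st i + real N} \<subseteq> {u. \<bar>tanh_at (P i w) u\<bar> \<le> tanh (real L)}"
  proof (rule rat_dense_interval)
   show "st i < st i + real N" using N s by simp
   show "of_rat u \<in> {u. \<bar>tanh_at (P i w) u\<bar> \<le> tanh (real L)}" if "st i \<le> of_rat u" "of_rat u \<le> st i + real N" for u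
    using abs_tanh_le_tanh[OF L[OF that]] that(1) by (simp add: Vi tanh_at_def)
  qed
  from subsetD[OF this, of s] have "\<bar>tanh_ereal (at_time (P i w) s)\<bar> \<le> tanh (real L)"
   using s N by (simp add: tanh_at_def)
  then show ?thesis using tanh_real_lt_1[of "real L"] by (cases "at_time (P i w) s") auto
 qed
 \<comment> \<open>Frozen before the start and 0 off the event \<open>G\<close>, so that every
   sample gives a continuous real path on the whole line.\<close>
 define Z where "Z w i s = (if G w then real_of_ereal (at_time (P i w) (max s (st i))) else 0)" for w i s
 have ZG: "ereal (Z w i s) = at_time (P i w) s" if "G w" "st i \<le> s" for w i s
  using fin[OF that] that by (auto simp: Z_def)
 have Z: "Z \<in> M \<rightarrow>\<^sub>M paths_space"
 proof (rule measurable_paths_spaceI)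
  show "(\<lambda>w. Z w i s) \<in> borel_measurable M" for i s
   unfolding Z_def using Gm
   by (intro measurable_If borel_measurable_real_of_ereal ev borel_measurable_const) (auto simp: pred_def)
  fix w i
  show "continuous_on UNIV (Z w i)"
  proof (cases "G w")
   case True
   have "Z w i = (\<lambda>s. artanh (tanh_at (P i w) (max s (st i))))"
   proof
    fix s
    obtain r where "at_time (P i w) (max s (st i)) = ereal r" using fin[OF True, of i "max s (st i)"] by auto
    then show "Z w i s = artanh (tanh_at (P i w) (max s (st i)))"
     using True by (simp add: Z_def tanh_at_def artanh_tanh_real)
   qed
   moreover have "continuous_on UNIV (\<lambda>s. artanh (tanh_at (P i w) (max s (st i))))"
   proof (rule continuous_on_artanh')
    show "continuous_on UNIV (\<lambda>s. tanh_at (P i w) (max s (st i)))"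
     by (rule continuous_on_compose2[OF continuous_tanh_at, of UNIV "\<lambda>s. max s (st i)"])
      (intro continuous_on_max continuous_on_id continuous_on_const, simp)
    fix s
    obtain r where "at_time (P i w) (max s (st i)) = ereal r" using fin[OF True, of i "max s (st i)"] by auto
    then show "tanh_at (P i w) (max s (st i)) \<in> {-1<..<1}"
     using tanh_real_lt_1[of r] tanh_real_gt_neg1[of r] by (simp add: tanh_at_def)
   qed
   ultimately show ?thesis by simp
  qed (simp add: Z_def[abs_def])
 qed
 have lawZ: "distr M paths_space Z = distr wiener paths_space (cbm sx st)"
 proof (rule paths_space_eqI[OF M.prob_space_axioms W.prob_space_axioms Z measurable_cbm_paths])
  fix J :: "(nat \<times> real) set" assume J: "finite J"
  define n where "n = Suc (Max (fst ` J))"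
  have Jn: "j < n" if "(j, s) \<in> J" for j s
   using that J by (auto simp: n_def less_Suc_eq_le intro!: Max_ge rev_image_eqI)
  let ?B = "PiM J (\<lambda>_. borel) :: (nat \<times> real \<Rightarrow> real) measure"
  define h where "h v = (\<lambda>(j, s)\<in>J. real_of_ereal (v (j, max s (st j))))" for v :: "nat \<times> real \<Rightarrow> ereal"
  have h: "h \<in> B n \<rightarrow>\<^sub>M ?B"
   unfolding h_def B_def
  proof (rule measurable_restrict)
   fix p assume "p \<in> J"
   then obtain j s where p: "p = (j, s)" "(j, max s (st j)) \<in> S n" using Jn by (cases p) (auto simp: S_def)
   from borel_measurable_real_of_ereal[OF measurable_component_singleton[OF p(2)]]
   show "(\<lambda>v. case p of (j, s) \<Rightarrow> real_of_ereal (v (j, max s (st j)))) \<in> borel_measurable (PiM (S n) (\<lambda>_. borel))"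
    by (simp add: p(1))
  qed
  have "distr M ?B (\<lambda>w. \<lambda>(j, s)\<in>J. Z w j s) = distr M ?B (\<lambda>w. h (V n w))"
  proof (rule distr_cong_AE)
   show "(\<lambda>w. \<lambda>(j, s)\<in>J. Z w j s) \<in> M \<rightarrow>\<^sub>M ?B"
    by (rule measurable_restrict) (auto intro: measurable_compose[OF Z measurable_paths_space_eval] split: prod.splits)
   show "(\<lambda>w. h (V n w)) \<in> M \<rightarrow>\<^sub>M ?B" by (rule measurable_compose[OF V h])
   show "AE w in M. (\<lambda>(j, s)\<in>J. Z w j s) = h (V n w)"
    using AEG by eventually_elim (auto simp: h_def V_def S_def Z_def fun_eq_iff restrict_def dest: Jn)
  qed auto
  also have "\<dots> = distr (distr M (B n) (V n)) ?B h"
   by (subst distr_distr[OF h V]) (simp add: comp_def)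
  also have "\<dots> = distr wiener ?B (\<lambda>w. h (V' n w))"
   unfolding law by (subst distr_distr[OF h V']) (simp add: comp_def)
  also have "\<dots> = distr wiener ?B (\<lambda>w. \<lambda>(j, s)\<in>J. cbm sx st w j s)"
  proof (rule distr_cong[OF refl refl])
   fix w assume w: "w \<in> space wiener"
   have "cbm sx st w j (max s (st j)) = cbm sx st w j s" for j s
   proof (cases "s < st j")
    case True
    then have "cbm sx st w j s = sx j"
     using wienerD(2)[OF w, of "s - st j" j] by (simp add: cbm_def coal_before drive_def)
    then show ?thesis using True by (simp add: max_def cbm_start[OF w])
   qed (simp add: max_def)
   then show "h (V' n w) = (\<lambda>(j, s)\<in>J. cbm sx st w j s)"
    by (auto simp: h_def V'_def S_def fun_eq_iff restrict_def dest: Jn)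
  qed
  finally show "distr M ?B (\<lambda>w. \<lambda>(j, s)\<in>J. Z w j s) = distr wiener ?B (\<lambda>w. \<lambda>(j, s)\<in>J. cbm sx st w j s)" .
 qed
 have "AE z in distr wiener paths_space (cbm sx st). good z"
  using AE_good measurable_good by (subst AE_distr_iff[OF measurable_cbm_paths]) (simp_all add: pred_def)
 then have AEgood: "AE w in M. good (Z w)"
  unfolding lawZ[symmetric] using measurable_good by (subst (asm) AE_distr_iff[OF Z]) (simp_all add: pred_def)
 have "AE w in M. \<forall>i. \<exists>!f. f \<in> paths_of (W w) \<and> passes f (sx i) (st i)"
  using web by (simp add: full_brownian_web_def AE_all_countable)
 moreover have "AE w in M. noncrossing (paths_of (W w))"
  using web by (simp add: full_brownian_web_def)
 ultimately have "AE w in M. W w = web_of (Z w)"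
  using AEgood AEG AE_space
 proof eventually_elim
  case (elim w)
  have Zs: "Z w \<in> space paths_space" using measurable_space[OF Z elim(5)] .
  interpret web "Z w" by (rule webI[OF elim(3) Zs])
  have "paths_of (W w) = skeleton_web (Z w)"
  proof (rule web_unique[where p = "\<lambda>i. P i w"])
   show "closed (paths_of (W w))" using paths_of[of "W w"] by (simp add: compact_imp_closed)
   show "P i w \<in> paths_of (W w)" for i unfolding P_def by (rule path_through_ex1(1)) (use elim(1) in blast)
  qed (use elim(2) ZG[OF elim(4)] in auto)
  then show ?case using paths_of_web_of[OF elim(3) Zs] by (metis paths_of_inject)
 qed
 then have "distr M borel W = distr M borel (\<lambda>w. web_of (Z w))"
  by (intro distr_cong_AE Wm measurable_compose[OF Z measurable_web_of]) auto
 also have "\<dots> = distr (distr M paths_space Z) borel web_of"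
  by (subst distr_distr[OF measurable_web_of Z]) (simp add: comp_def)
 finally show ?thesis unfolding lawZ .
qed

text \<open>At an isolating point the future of the web path is the supremum of the skeleton paths
 passing to the left of the point.\<close>

definition future :: "real \<Rightarrow> real \<Rightarrow> paths \<Rightarrow> real \<Rightarrow> ereal" where
 "future x t z s = (if s = t then ereal x else SUP k. if st k < t \<and> z k t < x then ereal (z k s) else - \<infinity>)"

lemma measurable_future: "(\<lambda>z. future x t z s) \<in> borel_measurable paths_space"
proof (cases "s = t")
 case False
 have *: "(\<lambda>z. if st k < t \<and> z k t < x then ereal (z k s) else - \<infinity>) \<in> borel_measurable paths_space" for k
  by (intro measurable_If borel_measurable_ereal measurable_paths_space_eval borel_measurable_const)
   (use pred_path_intros in \<open>auto simp: pred_def\<close>)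
 show ?thesis
  unfolding future_def if_not_P[OF False] by (rule borel_measurable_SUP[OF countableI_type *])
qed (simp add: future_def)

text \<open>Shortly after \<open>t\<close> an older path from the left and one from the right have
  merged. From then on the left one realises the supremum and, by \<open>eq\<close>, the value
  \<open>y\<close>.\<close>

lemma future_eqI:
 assumes iso: "isolating x t z" and "t < s"
  and le: "\<And>k. st k < t \<Longrightarrow> z k t < x \<Longrightarrow> ereal (z k s) \<le> y"
  and eq: "\<And>k l v. st k < t \<Longrightarrow> st l < t \<Longrightarrow> z k t < x \<Longrightarrow> x < z l t \<Longrightarrow> t < of_rat v \<Longrightarrow> of_rat v < s \<Longrightarrow>
   z k (of_rat v) = z l (of_rat v) \<Longrightarrow> y = ereal (z k s)"
 shows "future x t z s = y"
proof -
 obtain v where v: "t < of_rat v" "of_rat v < s" using of_rat_dense[OF assms(2)] by blast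
 obtain k l where kl: "st k = st l" "st k < t" "z k t < x" "x < z l t" "z k (of_rat v) = z l (of_rat v)"
  using iso v(1) unfolding isolating_def by blast
 let ?g = "\<lambda>k. if st k < t \<and> z k t < x then ereal (z k s) else - \<infinity>"
 have "(SUP k. ?g k) = y"
 proof (rule antisym)
  show "(SUP k. ?g k) \<le> y" by (rule SUP_least) (use le in auto)
  have "y = ?g k" using eq[of k l v] kl v by simp
  also have "\<dots> \<le> (SUP k. ?g k)" by (rule SUP_upper) simp
  finally show "y \<le> (SUP k. ?g k)" .
 qed
 then show ?thesis using assms(2) by (simp add: future_def)
qed

text \<open>The web path through the point lies right of all older skeleton paths that pass left of
  it, and it coincides with one of them once that path has merged with one from the right.\<close>

lemma (in web) future_path_through:
 assumes iso: "isolating x t z" and "t \<le> s"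
 shows "at_time (path_through (skeleton_web z) x t) s = future x t z s"
proof -
 let ?f = "path_through (skeleton_web z) x t"
 have f: "?f \<in> full_web z" "at_time ?f t = ereal x"
  using path_through_ex1[OF isolating_ex1[OF iso]] skeleton_web_subset by auto
 show ?thesis
 proof (cases "s = t")
  case False
  then have ts: "t < s" using assms(2) by simp
  show ?thesis
  proof (rule future_eqI[OF iso ts, symmetric])
   show "ereal (z k s) \<le> at_time ?f s" if "st k < t" "z k t < x" for k
    by (rule full_webD(2)[OF f(1), of _ t]) (use that f(2) ts in auto)
   fix k l v assume kl: "st k < t" "st l < t" "z k t < x" "x < z l t" "z k (of_rat v) = z l (of_rat v)" and v: "t < of_rat v" "of_rat v < s"
   have "at_time ?f (of_rat v) = ereal (z k (of_rat v))"
    by (rule sandwich_at[OF f(1), of _ t l]) (use kl v f(2) in auto)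
   then show "at_time ?f s = ereal (z k s)"
    by (rule coincide[OF f(1), rotated]) (use kl v in auto)
  qed
 qed (simp add: f(2) future_def)
qed

lemma AE_isolating_law: "AE z in distr wiener paths_space (cbm sx st). isolating x t z"
 using AE_isolating measurable_isolating by (subst AE_distr_iff[OF measurable_cbm_paths]) (simp_all add: pred_def)

text \<open>The given points are put in front of the skeleton; dropping them again does not change the law
 of the skeleton.\<close>

lemma future_law:
 "distr (distr wiener paths_space (cbm sx st)) (PiM (SIGMA j:{..<n}. {t j..}) (\<lambda>_. borel))
   (\<lambda>z. \<lambda>(j, s)\<in>(SIGMA j:{..<n}. {t j..}). future (x j) (t j) z s) =
  semipath_law wiener n t (\<lambda>j s w. ereal (cbm x t w j s))"
proof -
 let ?S = "SIGMA j:{..<n}. {t j..}"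
 let ?B = "PiM ?S (\<lambda>_. borel) :: (nat \<times> real \<Rightarrow> ereal) measure"
 let ?F = "\<lambda>z. \<lambda>(j, s)\<in>?S. future (x j) (t j) z s"
 \<comment> \<open>The given points come first; the original skeleton occupies the indices from
   \<open>n\<close> on, with lower priority, and is recovered by the injection \<open>i\<close> to
   \<open>n + i\<close>.\<close>
 define x' where "x' i = (if i < n then x i else sx (i - n))" for i
 define t' where "t' i = (if i < n then t i else st (i - n))" for i
 define tail where "tail w i = cbm x' t' w (n + i)" for w i
 have F: "?F \<in> paths_space \<rightarrow>\<^sub>M ?B"
  by (rule measurable_restrict) (auto intro!: measurable_future split: prod.splits)
 have tail: "tail \<in> wiener \<rightarrow>\<^sub>M paths_space"
  unfolding tail_def using measurable_compose[OF measurable_cbm_paths measurable_reindex_paths, of x' t' "\<lambda>i. n + i"] .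
 have law: "distr wiener paths_space (cbm sx st) = distr wiener paths_space tail"
 proof -
  have "inj (\<lambda>i. n + i)" by (simp add: inj_def)
  from distr_cbm_subfamily[OF this, of x' t']
  show ?thesis by (simp add: tail_def[abs_def] comp_def x'_def[abs_def] t'_def[abs_def])
 qed
 have "distr (distr wiener paths_space (cbm sx st)) ?B ?F = distr wiener ?B (\<lambda>w. ?F (tail w))"
  unfolding law by (subst distr_distr[OF F tail]) (simp add: comp_def)
 also have "\<dots> = distr wiener ?B (\<lambda>w. \<lambda>(j, s)\<in>?S. ereal (cbm x t w j s))"
 proof (rule distr_cong_AE)
  show "(\<lambda>w. ?F (tail w)) \<in> wiener \<rightarrow>\<^sub>M ?B" by (rule measurable_compose[OF tail F])
  have "AE w in wiener. isolating x0 t0 (tail w)" for x0 t0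
   using AE_isolating_law[of x0 t0] measurable_isolating unfolding law
   by (subst (asm) AE_distr_iff[OF tail]) (simp_all add: pred_def)
  then have "AE w in wiener. \<forall>j. isolating (x j) (t j) (tail w)" by (simp add: AE_all_countable)
  with AE_space show "AE w in wiener. ?F (tail w) = (\<lambda>(j, s)\<in>?S. ereal (cbm x t w j s))"
  proof eventually_elim
   case (elim w)
   have "future (x j) (t j) (tail w) s = ereal (cbm x t w j s)" if j: "j < n" and s: "t j \<le> s" for j s
   proof -
    have xj: "cbm x t w j = cbm x' t' w j"
     by (rule cbm_cong) (use j in \<open>auto simp: x'_def t'_def\<close>)
    have tj: "t' j = t j" "\<And>k. t' (n + k) = st k" using j by (simp_all add: t'_def)
    have start: "cbm x' t' w j (t j) = x j"
     using cbm_start[OF elim(1), of x' t' j] j by (simp add: x'_def t'_def)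
    show ?thesis
    proof (cases "s = t j")
     case False
     then have ts: "t j < s" using s by simp
     have ord: "cbm x' t' w a u' \<le> cbm x' t' w b u'"
      if "cbm x' t' w a u < cbm x' t' w b u" "t' a \<le> u" "t' b \<le> u" "u \<le> u'" for a b u u'
      using that unfolding cbm_def by (intro coal_noncross[OF continuous_drive[OF elim(1)], of t' a u b]) auto
     show ?thesis
     proof (rule future_eqI[OF _ ts])
      show "isolating (x j) (t j) (tail w)" using elim(2) by blast
      show "ereal (tail w k s) \<le> ereal (cbm x t w j s)" if "st k < t j" "tail w k (t j) < x j" for k
       using ord[of "n + k" "t j" j s] that ts tj start by (simp add: tail_def xj)
      fix k l v assume kl: "st k < t j" "st l < t j" "tail w k (t j) < x j" "x j < tail w l (t j)"
       "tail w k (of_rat v) = tail w l (of_rat v)" and v: "t j < of_rat v" "of_rat v < s"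
      have "tail w k (of_rat v) \<le> cbm x t w j (of_rat v)" "cbm x t w j (of_rat v) \<le> tail w l (of_rat v)"
       using ord[of "n + k" "t j" j "of_rat v"] ord[of j "t j" "n + l" "of_rat v"] kl v tj start by (simp_all add: tail_def xj)
      then have "cbm x' t' w j (of_rat v) = cbm x' t' w (n + k) (of_rat v)" using kl(5) by (simp add: tail_def xj)
      then have "cbm x' t' w j s = cbm x' t' w (n + k) s"
       unfolding cbm_def by (rule coal_merge[rotated 2]) (use kl v tj in auto)
      then show "ereal (cbm x t w j s) = ereal (tail w k s)" by (simp add: tail_def xj)
     qed
    qed (simp add: future_def xj start)
   qed
   then show ?case by (auto simp: fun_eq_iff restrict_def)
  qed
  show "(\<lambda>w. \<lambda>(j, s)\<in>?S. ereal (cbm x t w j s)) \<in> wiener \<rightarrow>\<^sub>M ?B" by (rule measurable_semipaths)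
 qed (rule refl)+
 finally show ?thesis unfolding semipath_law_def .
qed

text \<open>On the final \<open>\<sigma>\<close>-algebra of the completed Wiener space no measurability has to be checked
 for events and evaluations that are almost surely of a known form.\<close>

theorem full_brownian_web_exists: "\<exists>(M :: compact_paths measure) W. full_brownian_web M W"
proof -
 let ?C = "completion wiener"
 define Y where "Y w = web_of (cbm sx st w)" for w
 \<comment> \<open>The largest sigma-algebra on \<open>compact_paths\<close> that makes
   \<open>Y\<close> measurable. A function out of it is measurable as soon as its composition with
   \<open>Y\<close> is.\<close>
 define F where "F = {A. Y -` A \<inter> space ?C \<in> sets ?C}"
 define N where "N = sigma (UNIV :: compact_paths set) F"
 have "sigma_algebra UNIV F"
  unfolding sigma_algebra_iff2
 proof (intro conjI ballI allI impI)
  show "UNIV - A \<in> F" if "A \<in> F" for A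
  proof -
   have "Y -` (UNIV - A) \<inter> space ?C = space ?C - (Y -` A \<inter> space ?C)" by auto
   then show ?thesis using that by (simp only: F_def mem_Collect_eq sets.compl_sets)
  qed
  show "(\<Union>i. A i) \<in> F" if "range A \<subseteq> F" for A :: "nat \<Rightarrow> _"
  proof -
   have "Y -` (\<Union>i. A i) \<inter> space ?C = (\<Union>i. Y -` A i \<inter> space ?C)" by auto
   also have "\<dots> \<in> sets ?C" by (rule sets.countable_UN) (use that in \<open>auto simp: F_def\<close>)
   finally show ?thesis by (simp add: F_def)
  qed
 qed (auto simp: F_def)
 then have setsN: "sets N = F" and spaceN: "space N = UNIV"
  by (simp_all add: N_def sigma_algebra.sigma_sets_eq)
 have Ym: "Y \<in> ?C \<rightarrow>\<^sub>M N"
  by (rule measurableI) (auto simp: spaceN setsN F_def)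
 have final: "g \<in> N \<rightarrow>\<^sub>M L" if "(\<lambda>w. g (Y w)) \<in> ?C \<rightarrow>\<^sub>M L" "\<And>K. g K \<in> space L" for g :: "compact_paths \<Rightarrow> 'c" and L
 proof (rule measurableI)
  fix A assume "A \<in> sets L"
  from measurable_sets[OF that(1) this] show "g -` A \<inter> space N \<in> sets N"
   by (simp add: spaceN setsN F_def vimage_def)
 qed (rule that(2))
 define M where "M = distr ?C N Y"
 \<comment> \<open>The predicate \<open>P\<close> is arbitrary: on the completed space, a statement
   that holds almost surely defines an event, so its preimage is measurable automatically.\<close>
 have AEM: "AE K in M. P K" if "AE w in wiener. P (Y w)" for P
 proof -
  have "AE w in wiener. \<not> \<not> P (Y w)" using that by simp
  from pred_intros_logic(2)[OF sets_completion_AE[OF this]] have "Measurable.pred ?C (\<lambda>w. P (Y w))" by simp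
  then have "{K \<in> space N. P K} \<in> sets N"
   by (simp add: spaceN setsN F_def pred_def vimage_def Int_def conj_commute)
  then show ?thesis
   unfolding M_def using that by (subst AE_distr_iff[OF Ym]) (auto simp: AE_completion_iff)
 qed
 have Yb: "Y \<in> borel_measurable ?C"
  unfolding Y_def using measurable_completion[OF measurable_compose[OF measurable_cbm_paths measurable_web_of]] .
 have good: "AE w in wiener. good (cbm sx st w) \<and> cbm sx st w \<in> space paths_space"
  using AE_good AE_space by eventually_elim (auto simp: space_paths_space continuous_cbm)
 have "full_brownian_web M (\<lambda>K. K)"
  unfolding full_brownian_web_def
 proof (intro conjI allI)
  show "prob_space M" unfolding M_def by (rule prob_space.prob_space_distr[OF W.prob_space_completion Ym])
  show "(\<lambda>K. K) \<in> borel_measurable M"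
   unfolding M_def measurable_distr_eq1 by (rule final) (use Yb in auto)
  show "AE K in M. noncrossing (paths_of K)"
  proof (rule AEM)
   show "AE w in wiener. noncrossing (paths_of (Y w))"
    using good
   proof eventually_elim
    case (elim w)
    then interpret web "cbm sx st w" by (intro webI) auto
    show ?case using noncrossing_full_web skeleton_web_subset elim
     by (auto simp: Y_def paths_of_web_of noncrossing_def)
   qed
  qed
  have iso: "AE w in wiener. isolating x t (cbm sx st w) \<and> paths_of (Y w) = skeleton_web (cbm sx st w) \<and> web (cbm sx st w)" for x t
   using AE_isolating[of x t] good by eventually_elim (auto simp: Y_def paths_of_web_of webI)
  show "AE K in M. \<exists>!f. f \<in> paths_of K \<and> passes f x t" for x t
  proof (rule AEM)
   show "AE w in wiener. \<exists>!f. f \<in> paths_of (Y w) \<and> passes f x t"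
    using iso[of x t] by eventually_elim (simp add: web.isolating_ex1)
  qed
  fix n and x t :: "nat \<Rightarrow> real"
  let ?S = "SIGMA j:{..<n}. {t j..}"
  let ?B = "PiM ?S (\<lambda>_. borel) :: (nat \<times> real \<Rightarrow> ereal) measure"
  let ?R = "\<lambda>K. \<lambda>(j, s)\<in>?S. at_time (path_through (paths_of K) (x j) (t j)) s"
  let ?F = "\<lambda>z. \<lambda>(j, s)\<in>?S. future (x j) (t j) z s"
  have Fm: "?F \<in> paths_space \<rightarrow>\<^sub>M ?B"
   by (rule measurable_restrict) (auto intro!: measurable_future split: prod.splits)
  note Fc = measurable_completion[OF measurable_compose[OF measurable_cbm_paths[of sx st] Fm]]
  have "AE w in wiener. \<forall>j. isolating (x j) (t j) (cbm sx st w) \<and> paths_of (Y w) = skeleton_web (cbm sx st w) \<and> web (cbm sx st w)"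
   unfolding AE_all_countable using iso by blast
  then have "AE w in wiener. ?R (Y w) = ?F (cbm sx st w)"
   by eventually_elim (auto simp: fun_eq_iff restrict_def web.future_path_through)
  then have RF: "AE w in ?C. ?R (Y w) = ?F (cbm sx st w)" by (rule AE_completion)
  \<comment> \<open>The semipath map agrees almost surely with a measurable function of the
    skeleton, which is enough in the completion.\<close>
  have RY: "(\<lambda>w. ?R (Y w)) \<in> ?C \<rightarrow>\<^sub>M ?B"
  proof (rule measurableI)
   fix A assume A: "A \<in> sets ?B"
   show "(\<lambda>w. ?R (Y w)) -` A \<inter> space ?C \<in> sets ?C"
   proof (rule completion.in_sets_AE)
    show "(\<lambda>w. ?F (cbm sx st w)) -` A \<inter> space ?C \<in> sets ?C" by (rule measurable_sets[OF Fc A])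
    show "AE w in ?C. (w \<in> (\<lambda>w. ?F (cbm sx st w)) -` A \<inter> space ?C) = (w \<in> (\<lambda>w. ?R (Y w)) -` A \<inter> space ?C)"
     using RF by eventually_elim simp
   qed auto
  qed (auto simp: space_PiM)
  have R: "?R \<in> N \<rightarrow>\<^sub>M ?B" by (rule final[of ?R ?B, OF RY]) (auto simp: space_PiM)
  have "semipath_law M n t (\<lambda>j s K. at_time (path_through (paths_of K) (x j) (t j)) s) = distr M ?B ?R"
   unfolding semipath_law_def ..
  also have "\<dots> = distr ?C ?B (\<lambda>w. ?R (Y w))"
   unfolding M_def by (subst distr_distr[OF R Ym]) (simp add: comp_def)
  also have "\<dots> = distr ?C ?B (\<lambda>w. ?F (cbm sx st w))"
   by (rule distr_cong_AE[OF refl refl RF RY Fc])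
  also have "\<dots> = distr wiener ?B (\<lambda>w. ?F (cbm sx st w))"
   by (rule distr_completion[OF measurable_compose[OF measurable_cbm_paths Fm]])
  also have "\<dots> = distr (distr wiener paths_space (cbm sx st)) ?B ?F"
   by (subst distr_distr[OF Fm measurable_cbm_paths]) (simp add: comp_def)
  finally show "is_coalescing_brownian_law n x t (semipath_law M n t (\<lambda>j s K. at_time (path_through (paths_of K) (x j) (t j)) s))"
   unfolding is_coalescing_brownian_law_iff future_law .
 qed
 then show ?thesis by blast
qed

theorem theorem3p2:
 shows "(\<exists>(M :: compact_paths measure) W. full_brownian_web M W) \<and>
  (\<forall>(M\<^sub>1 :: 'a measure) W\<^sub>1 (M\<^sub>2 :: 'b measure) W\<^sub>2.
   full_brownian_web M\<^sub>1 W\<^sub>1 \<longrightarrow> full_brownian_web M\<^sub>2 W\<^sub>2 \<longrightarrow>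
   distr M\<^sub>1 borel W\<^sub>1 = distr M\<^sub>2 borel W\<^sub>2)"
 using full_brownian_web_exists full_brownian_web_law by metis

end
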